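(* Let $S=(S_n)_{n\ge0}$ be a random walk with non-degenerate i.i.d. real steps and $S_0=0$, let $\sigma\ge0$, let $R_n^\sigma$ be its number of weak $\sigma$-records during the first $n$ steps, and let $V$ be the renewal function of its weak ladder heights. Assume $\sigma$ is a continuity point of $V$. For $0\le\rho\le 1$ and $0\le y<1$ write $C_\rho(y)=\exp\big[\sum_{k=1}^\infty\frac{y^k}{k}(\mathrm{P}(S_k\ge0)-\rho)\big]$. (i) If $\mathrm{P}(S_n\ge0)\to\rho$ with $0<\rho<1$, then $$\frac{V(\sigma)R_n^\sigma}{C_\rho(1-1/n)\,n^\rho}\xrightarrow{d}g_\rho,$$ and the process $R^\sigma=(R^\sigma_n)_{n\ge0}$ has a functional limit which is the inverse process of the stable subordinator with index $\rho$; that is, $\big(V(\sigma)R^\sigma_{\lfloor nt\rfloor}/(C_\rho(1-1/n)n^\rho)\big)_{t\ge0}$ converges weakly in the Skorokhod space $D[0,\infty)$ to this inverse process. (ii) If $\mathrm{P}(S_n\ge0)\to0$ and $\sum_{k=1}^\infty\frac{\mathrm{P}(S_k\ge0)}{k}=\infty$, then $$\frac{V(\sigma)R_n^\sigma}{C_0(1-1/n)}\xrightarrow{d}g_0 .$$ If $\mathrm{P}(S_n\ge0)\to1$, then $R_n^\sigma$ has a degenerate weak limit under the normalization $\frac{V(\sigma)}{nC_1(1-1/n)}$, namely $\frac{V(\sigma)R_n^\sigma}{nC_1(1-1/n)}\xrightarrow{d}1$. (iii) If $S$ drifts to $-\infty$ (i.e. $S_n\to-\infty$ a.s.), then $R_\infty^\sigma=\lim_{n\to\infty}R_n^\sigma$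 has the geometric distribution on $\{1,2,\dots\}$ with parameter $V(\sigma)\exp\big\{-\sum_{k=1}^\infty\frac{\mathrm{P}(S_k\ge0)}{k}\big\}$.
   Context: $X_1,X_2,\dots$ are i.i.d. non-degenerate real random variables, $S_0=0$, $S_n=\sum_{i=1}^nX_i$. Weak $\sigma$-records: $S_0$ is the first weak $\sigma$-record; if $S_k$ is a weak $\sigma$-record, the next weak $\sigma$-record is $S_j$, where $j$ is the smallest index $j>k$ with $S_j-S_k\ge\sigma$ (if there is one). $R_n^\sigma$ is the number of weak $\sigma$-records among steps $0,1,\dots,n$, so $R_0^\sigma=1$. Weak ladder heights: a weak record occurs at step $n$ if $S_n=\max_{0\le k\le n}S_k$. Let $H_0=0$ and let $H_n$ be the value of the walk at its $n$-th weak record after time $0$, with $H_n=+\infty$ if there are fewer than $n$ such records. Define $V(x)=\sum_{n=0}^\infty\mathrm{P}(H_n\le x)$ for $x\in\mathbb{R}$ (so $V(x)=0$ for $x<0$). $g_\rho$ denotes the Mittag-Leffler distribution with parameter $\rho\in[0,1]$, i.e. the distribution on $[0,\infty)$ with $m$-th moments $m!/\Gamma(1+m\rho)$; $g_0$ is exponential with mean $1$, $g_1$ is the unit mass at $1$. The stable subordinator with index $\rho\in(0,1)$ is the subordinator $(D_v)_{v\ge0}$ with $\mathrm{E}e^{-sD_v}=e^{-vs^\rho}$, $s\ge0$, and its inverse process is $Z_t=\inf\{v\ge0:D_v>t\}$. *)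

theory Defs
  imports "HOL-Probability.Probability"
begin

section \<open>Random walks, weak sigma-records and weak ladder heights\<close>

text \<open>The steps are indexed from \<open>0\<close>: the \<open>i\<close>-th step of the walk is \<open>X (i - 1)\<close>.\<close>

definition walk :: "(nat \<Rightarrow> 'a \<Rightarrow> real) \<Rightarrow> nat \<Rightarrow> 'a \<Rightarrow> real" where
  "walk X n \<omega> = (\<Sum>i<n. X i \<omega>)"

inductive weak_sigma_record :: "real \<Rightarrow> (nat \<Rightarrow> real) \<Rightarrow> nat \<Rightarrow> bool"
  for \<sigma> :: real and s :: "nat \<Rightarrow> real" where
  first: "weak_sigma_record \<sigma> s 0"
| next_record: "weak_sigma_record \<sigma> s j"
    if "weak_sigma_record \<sigma> s k" "k < j" "s j - s k \<ge> \<sigma>"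
       "\<And>i. k < i \<Longrightarrow> i < j \<Longrightarrow> s i - s k < \<sigma>"

definition sigma_record_count :: "real \<Rightarrow> (nat \<Rightarrow> 'a \<Rightarrow> real) \<Rightarrow> nat \<Rightarrow> 'a \<Rightarrow> nat" where
  "sigma_record_count \<sigma> X n \<omega> = card {k. k \<le> n \<and> weak_sigma_record \<sigma> (\<lambda>i. walk X i \<omega>) k}"

definition total_sigma_record_count :: "real \<Rightarrow> (nat \<Rightarrow> 'a \<Rightarrow> real) \<Rightarrow> 'a \<Rightarrow> enat" where
  "total_sigma_record_count \<sigma> X \<omega> = lim (\<lambda>n. enat (sigma_record_count \<sigma> X n \<omega>))"

definition weak_record_times :: "(nat \<Rightarrow> real) \<Rightarrow> nat set" where
  "weak_record_times s = {n. n \<ge> 1 \<and> s n = Max (s ` {0..n})}"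

text \<open>\<open>enumerate W\<close> counts from \<open>0\<close>, so the \<open>n\<close>-th weak record after time \<open>0\<close> occurs at
  \<open>enumerate W (n - 1)\<close>.\<close>

definition weak_ladder_height :: "(nat \<Rightarrow> real) \<Rightarrow> nat \<Rightarrow> ereal" where
  "weak_ladder_height s n =
     (let W = weak_record_times s in
      if n = 0 then 0
      else if finite W \<and> card W < n then \<infinity>
      else ereal (s (enumerate W (n - 1))))"

definition ladder_renewal :: "'a measure \<Rightarrow> (nat \<Rightarrow> 'a \<Rightarrow> real) \<Rightarrow> real \<Rightarrow> real" where
  "ladder_renewal M X x =
     (\<Sum>n. \<P>(\<omega> in M. weak_ladder_height (\<lambda>i. walk X i \<omega>) n \<le> ereal x))"

definition pos_prob :: "'a measure \<Rightarrow> (nat \<Rightarrow> 'a \<Rightarrow> real) \<Rightarrow> nat \<Rightarrow> real" where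
  "pos_prob M X n = \<P>(\<omega> in M. walk X n \<omega> \<ge> 0)"

definition spitzer_C :: "'a measure \<Rightarrow> (nat \<Rightarrow> 'a \<Rightarrow> real) \<Rightarrow> real \<Rightarrow> real \<Rightarrow> real" where
  "spitzer_C M X \<rho> y =
     exp (\<Sum>k. y ^ Suc k / real (Suc k) * (pos_prob M X (Suc k) - \<rho>))"


section \<open>Mittag-Leffler distributions\<close>

text \<open>For \<open>0 \<le> \<rho> \<le> 1\<close> these moments determine the distribution uniquely.\<close>

definition mittag_leffler :: "real \<Rightarrow> real measure" where
  "mittag_leffler \<rho> = (THE \<mu>. real_distribution \<mu> \<and> measure \<mu> {..<0} = 0 \<and>
     (\<forall>m::nat. integrable \<mu> (\<lambda>x. x ^ m) \<and>
        (\<integral>x. x ^ m \<partial>\<mu>) = fact m / Gamma (1 + real m * \<rho>)))"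


section \<open>The stable subordinator and its inverse process\<close>

definition subordinator :: "'b measure \<Rightarrow> (real \<Rightarrow> 'b \<Rightarrow> real) \<Rightarrow> bool" where
  "subordinator N D \<longleftrightarrow>
     prob_space N \<and>
     (\<forall>v\<ge>0. D v \<in> borel_measurable N) \<and>
     (AE \<omega> in N. D 0 \<omega> = 0 \<and> mono_on {0..} (\<lambda>v. D v \<omega>) \<and>
        (\<forall>v\<ge>0. ((\<lambda>u. D u \<omega>) \<longlongrightarrow> D v \<omega>) (at_right v))) \<and>
     (\<forall>t::nat \<Rightarrow> real. mono t \<and> t 0 \<ge> 0 \<longrightarrow>
        prob_space.indep_vars N (\<lambda>_. borel) (\<lambda>i \<omega>. D (t (Suc i)) \<omega> - D (t i) \<omega>) UNIV) \<and>
     (\<forall>u v. 0 \<le> u \<and> u \<le> v \<longrightarrow>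
        distr N borel (\<lambda>\<omega>. D v \<omega> - D u \<omega>) = distr N borel (D (v - u)))"

definition stable_subordinator :: "real \<Rightarrow> 'b measure \<Rightarrow> (real \<Rightarrow> 'b \<Rightarrow> real) \<Rightarrow> bool" where
  "stable_subordinator \<rho> N D \<longleftrightarrow>
     subordinator N D \<and>
     (\<forall>v\<ge>0. \<forall>s\<ge>0. (\<integral>\<omega>. exp (- s * D v \<omega>) \<partial>N) = exp (- v * s powr \<rho>))"

definition inverse_process :: "(real \<Rightarrow> 'b \<Rightarrow> real) \<Rightarrow> 'b \<Rightarrow> real \<Rightarrow> real" where
  "inverse_process D \<omega> = (\<lambda>t\<in>{0..}. Inf {v. v \<ge> 0 \<and> D v \<omega> > t})"


section \<open>The Skorokhod space of cadlag functions on the half-line\<close>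

definition skorokhod_D :: "(real \<Rightarrow> real) set" where
  "skorokhod_D = {x \<in> extensional {0..}.
     (\<forall>t\<ge>0. (x \<longlongrightarrow> x t) (at_right t)) \<and>
     (\<forall>t>0. \<exists>l. (x \<longlongrightarrow> l) (at_left t))}"

definition time_change :: "(real \<Rightarrow> real) \<Rightarrow> bool" where
  "time_change \<tau> \<longleftrightarrow> strict_mono_on {0..} \<tau> \<and> bij_betw \<tau> {0..} {0..}"

text \<open>Skorokhod's J1 topology is given by its neighbourhood bases: \<open>x\<^sub>n\<close> converges to \<open>x\<close>
  iff for every \<open>T\<close> there are time changes \<open>\<tau>\<^sub>n\<close> such that \<open>\<tau>\<^sub>n t - t\<close> and
  \<open>x\<^sub>n t - x (\<tau>\<^sub>n t)\<close> tend to \<open>0\<close> uniformly in \<open>t \<in> [0, T]\<close>.\<close>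

definition skorokhod_nbhd :: "(real \<Rightarrow> real) \<Rightarrow> real \<Rightarrow> real \<Rightarrow> (real \<Rightarrow> real) set" where
  "skorokhod_nbhd x T \<epsilon> = {y \<in> skorokhod_D. \<exists>\<tau>. time_change \<tau> \<and>
     (\<forall>t\<in>{0..T}. \<bar>\<tau> t - t\<bar> < \<epsilon> \<and> \<bar>y t - x (\<tau> t)\<bar> < \<epsilon>)}"

definition skorokhod_topology :: "(real \<Rightarrow> real) topology" where
  "skorokhod_topology = topology (\<lambda>U. U \<subseteq> skorokhod_D \<and>
     (\<forall>x\<in>U. \<exists>T>0. \<exists>\<epsilon>>0. skorokhod_nbhd x T \<epsilon> \<subseteq> U))"

lemma skorokhod_nbhd_antimono:
  "T \<le> T' \<Longrightarrow> \<epsilon>' \<le> \<epsilon> \<Longrightarrow> skorokhod_nbhd x T' \<epsilon>' \<subseteq> skorokhod_nbhd x T \<epsilon>"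
  unfolding skorokhod_nbhd_def
  by (intro subsetI CollectI, elim CollectE conjE exE)
    (intro conjI exI ballI, assumption+, auto intro: less_le_trans)

lemma openin_skorokhod_topology:
  "openin skorokhod_topology U \<longleftrightarrow> U \<subseteq> skorokhod_D \<and>
     (\<forall>x\<in>U. \<exists>T>0. \<exists>\<epsilon>>0. skorokhod_nbhd x T \<epsilon> \<subseteq> U)"
proof -
  let ?L = "\<lambda>U. U \<subseteq> skorokhod_D \<and> (\<forall>x\<in>U. \<exists>T>0. \<exists>\<epsilon>>0. skorokhod_nbhd x T \<epsilon> \<subseteq> U)"
  have "istopology ?L"
    unfolding istopology_def
  proof (intro conjI allI impI)
    fix S U assume S: "?L S" and U: "?L U"
    show "S \<inter> U \<subseteq> skorokhod_D" using S by blast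
    show "\<forall>x\<in>S \<inter> U. \<exists>T>0. \<exists>\<epsilon>>0. skorokhod_nbhd x T \<epsilon> \<subseteq> S \<inter> U"
    proof
      fix x assume x: "x \<in> S \<inter> U"
      obtain T \<epsilon> where 1: "T > 0" "\<epsilon> > 0" "skorokhod_nbhd x T \<epsilon> \<subseteq> S" using x S by blast
      obtain T' \<epsilon>' where 2: "T' > 0" "\<epsilon>' > 0" "skorokhod_nbhd x T' \<epsilon>' \<subseteq> U" using x U by blast
      have "skorokhod_nbhd x (max T T') (min \<epsilon> \<epsilon>') \<subseteq> skorokhod_nbhd x T \<epsilon>"
        "skorokhod_nbhd x (max T T') (min \<epsilon> \<epsilon>') \<subseteq> skorokhod_nbhd x T' \<epsilon>'"
        by (rule skorokhod_nbhd_antimono; simp)+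
      with 1 2 have "max T T' > 0 \<and> min \<epsilon> \<epsilon>' > 0 \<and>
          skorokhod_nbhd x (max T T') (min \<epsilon> \<epsilon>') \<subseteq> S \<inter> U"
        by auto
      then show "\<exists>T>0. \<exists>\<epsilon>>0. skorokhod_nbhd x T \<epsilon> \<subseteq> S \<inter> U" by blast
    qed
  next
    fix K assume K: "\<forall>S\<in>K. ?L S"
    show "\<Union> K \<subseteq> skorokhod_D" using K by blast
    show "\<forall>x\<in>\<Union> K. \<exists>T>0. \<exists>\<epsilon>>0. skorokhod_nbhd x T \<epsilon> \<subseteq> \<Union> K"
    proof
      fix x assume "x \<in> \<Union> K"
      then obtain S where S: "S \<in> K" "x \<in> S" by blast
      then obtain T \<epsilon> where "T > 0" "\<epsilon> > 0" "skorokhod_nbhd x T \<epsilon> \<subseteq> S" using K by blast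
      with S(1) show "\<exists>T>0. \<exists>\<epsilon>>0. skorokhod_nbhd x T \<epsilon> \<subseteq> \<Union> K" by blast
    qed
  qed
  then show ?thesis
    unfolding skorokhod_topology_def by (simp add: topology_inverse')
qed

lemma topspace_skorokhod_topology: "topspace skorokhod_topology = skorokhod_D"
proof -
  have "openin skorokhod_topology skorokhod_D"
    unfolding openin_skorokhod_topology
    by (auto simp: skorokhod_nbhd_def intro!: exI[of _ "1::real"])
  then show ?thesis
    by (meson openin_skorokhod_topology openin_subset openin_topspace subset_antisym)
qed

text \<open>Weak convergence of the laws of processes whose paths lie almost surely in the Skorokhod
  space. The completions are used because the paths may be arbitrary on a null set; for instance
  the inverse of a subordinator has a path in \<open>skorokhod_D\<close> only almost surely. As the topology is
  metrizable, integrability of all \<open>f (Y \<omega>)\<close> amounts to Borel measurability of the process.\<close>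

definition weak_conv_skorokhod ::
  "'a measure \<Rightarrow> (nat \<Rightarrow> 'a \<Rightarrow> real \<Rightarrow> real) \<Rightarrow> 'b measure \<Rightarrow> ('b \<Rightarrow> real \<Rightarrow> real) \<Rightarrow> bool" where
  "weak_conv_skorokhod M Y N Z \<longleftrightarrow>
     (\<forall>n. AE \<omega> in M. Y n \<omega> \<in> skorokhod_D) \<and> (AE \<omega> in N. Z \<omega> \<in> skorokhod_D) \<and>
     (\<forall>f :: (real \<Rightarrow> real) \<Rightarrow> real.
        continuous_map skorokhod_topology euclideanreal f \<and> bounded (f ` skorokhod_D) \<longrightarrow>
        (\<forall>n. integrable (completion M) (\<lambda>\<omega>. f (Y n \<omega>))) \<and>
        integrable (completion N) (\<lambda>\<omega>. f (Z \<omega>)) \<and>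
        (\<lambda>n. \<integral>\<omega>. f (Y n \<omega>) \<partial>completion M) \<longlonglongrightarrow> (\<integral>\<omega>. f (Z \<omega>) \<partial>completion N))"

end

theory Submission imports Defs begin

text \<open>The times of the \<open>\<sigma>\<close>-records form a renewal process whose increments are distributed as the
  first time \<open>T\<^sup>\<sigma> \<ge> 1\<close> at which the walk is \<open>\<ge> \<sigma>\<close>. Splitting a path that stays below \<open>\<sigma>\<close> at its last
  maximum gives \<open>1 - E y^T\<^sup>\<sigma> = V\<^sub>y(\<sigma>) (1 - E y^T\<^sup>0)\<close>, where \<open>V\<^sub>y\<close> tends to \<open>V\<close> as \<open>y \<rightarrow> 1\<close>;
  counting the cyclic rotations of a path at its weak records gives Sparre Andersen's identity
  \<open>1 - E y^T\<^sup>0 = exp (- (\<Sum>k\<ge>1. y^k / k * P(S\<^sub>k \<ge> 0)))\<close>. Since \<open>C\<^sub>\<rho>(1 - 1/n) n^\<rho>\<close> equals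
  \<open>exp (\<Sum>k\<ge>1. (1 - 1/n)^k / k * P(S\<^sub>k \<ge> 0))\<close> for every \<open>\<rho>\<close>, the Laplace transform at \<open>\<lambda>\<close> of the
  time of the \<open>v\<close>-th record, both suitably scaled, tends to \<open>exp (- v \<lambda>^\<rho>)\<close>.

  These Laplace transforms are moments of the variables \<open>exp (- T / n)\<close> in \<open>[0, 1]\<close>, so the scaled
  increments converge jointly in law by Bernstein approximation. The one-dimensional limits are
  identified through their moments. For the functional limit, a bounded continuous
  function on the Skorokhod space is approximated from below by functions that are Lipschitz
  for the uniform distance; as the paths are monotone and the limit is continuous, these are controlled by
  the hitting times of finitely many levels.\<close>

section \<open>First passage and weak record times\<close>

definition psum :: "(nat \<Rightarrow> real) \<Rightarrow> nat \<Rightarrow> real" where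
  "psum x n = (\<Sum>i<n. x i)"

definition dropn :: "nat \<Rightarrow> (nat \<Rightarrow> real) \<Rightarrow> nat \<Rightarrow> real" where
  "dropn k x i = x (i + k)"

definition weak_rec :: "(nat \<Rightarrow> real) \<Rightarrow> nat \<Rightarrow> bool" where
  "weak_rec x n \<longleftrightarrow> (\<forall>j\<le>n. psum x j \<le> psum x n)"

definition below :: "real \<Rightarrow> (nat \<Rightarrow> real) \<Rightarrow> nat \<Rightarrow> bool" where
  "below c x n \<longleftrightarrow> (\<forall>i\<in>{1..n}. psum x i < c)"

definition hits_at :: "real \<Rightarrow> (nat \<Rightarrow> real) \<Rightarrow> nat \<Rightarrow> bool" where
  "hits_at c x n \<longleftrightarrow> n \<ge> 1 \<and> below c x (n - 1) \<and> psum x n \<ge> c"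

lemma psum_0 [simp]: "psum x 0 = 0"
  by (simp add: psum_def)

lemma psum_Suc: "psum x (Suc n) = psum x n + x n"
  by (simp add: psum_def)

lemma walk_eq_psum: "walk X n \<omega> = psum (\<lambda>i. X i \<omega>) n"
  by (simp add: walk_def psum_def)

lemma psum_dropn: "psum (dropn k x) n = psum x (k + n) - psum x k"
  by (induction n) (simp_all add: psum_Suc dropn_def add.commute)

lemma psum_cong: "(\<And>i. i < n \<Longrightarrow> x i = y i) \<Longrightarrow> psum x n = psum y n"
  by (simp add: psum_def)

lemma weak_rec_cong: "(\<And>i. i < n \<Longrightarrow> x i = y i) \<Longrightarrow> weak_rec x n = weak_rec y n"
proof -
  assume "\<And>i. i < n \<Longrightarrow> x i = y i"
  then have "psum x j = psum y j" if "j \<le> n" for j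
    using that by (intro psum_cong) auto
  then show ?thesis by (auto simp: weak_rec_def)
qed

lemma below_cong: "(\<And>i. i < n \<Longrightarrow> x i = y i) \<Longrightarrow> below c x n = below c y n"
proof -
  assume "\<And>i. i < n \<Longrightarrow> x i = y i"
  then have "psum x j = psum y j" if "j \<le> n" for j
    using that by (intro psum_cong) auto
  then show ?thesis by (auto simp: below_def)
qed

lemma hits_at_cong: "(\<And>i. i < n \<Longrightarrow> x i = y i) \<Longrightarrow> hits_at c x n = hits_at c y n"
proof -
  assume *: "\<And>i. i < n \<Longrightarrow> x i = y i"
  then have "below c x (n - 1) = below c y (n - 1)" by (intro below_cong) auto
  moreover have "psum x n = psum y n" using * by (rule psum_cong)
  ultimately show ?thesis by (simp add: hits_at_def)
qed

lemma below_Suc: "below c x (Suc n) \<longleftrightarrow> below c x n \<and> psum x (Suc n) < c"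
  by (auto simp: below_def le_Suc_eq)

lemma below_antimono: "m \<le> n \<Longrightarrow> below c x n \<Longrightarrow> below c x m"
  by (auto simp: below_def)

lemma hits_at_Suc: "hits_at c x (Suc n) \<longleftrightarrow> below c x n \<and> \<not> below c x (Suc n)"
  by (auto simp: hits_at_def below_Suc)

lemma hits_at_unique:
  assumes "hits_at c x m" "hits_at c x n" shows "m = n"
proof -
  have "\<not> a < b" if "hits_at c x a" "hits_at c x b" for a b
  proof
    assume "a < b"
    then have "a \<in> {1..b - 1}" using that(1) by (auto simp: hits_at_def)
    then show False using that by (force simp: hits_at_def below_def)
  qed
  then show ?thesis using assms by (meson linorder_cases)
qed

lemma borel_measurable_pred_le [measurable (raw)]:
  fixes f g :: "'a \<Rightarrow> real"
  shows "f \<in> borel_measurable M \<Longrightarrow> g \<in> borel_measurable M \<Longrightarrow> Measurable.pred M (\<lambda>x. f x \<le> g x)"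
  unfolding pred_def by measurable

locale iid_steps = sequence_space M for M :: "real measure" +
  assumes sets_M [simp]: "sets M = sets borel"
begin

lemma space_M [simp]: "space M = UNIV"
  using sets_eq_imp_space_eq[OF sets_M] by simp

lemma space_S [simp]: "space S = UNIV"
  by (simp add: space_PiM)

lemma measurable_coord: "(\<lambda>x. x i) \<in> borel_measurable S"
  using measurable_component_singleton[of i UNIV "\<lambda>_. M"] measurable_cong_sets[OF refl sets_M] by blast

lemma measurable_psum [measurable]: "(\<lambda>x. psum x n) \<in> borel_measurable S"
  unfolding psum_def by (intro borel_measurable_sum measurable_coord)

lemma measurable_dropn [measurable]: "dropn k \<in> measurable S S"
proof (rule measurable_PiM_single')
  show "\<And>i. i \<in> UNIV \<Longrightarrow> (\<lambda>x. dropn k x i) \<in> measurable S M"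
    unfolding dropn_def by (simp add: measurable_component_singleton)
qed auto

lemma pred_weak_rec [measurable]: "Measurable.pred S (\<lambda>x. weak_rec x n)"
  unfolding weak_rec_def by measurable

lemma pred_below [measurable]: "Measurable.pred S (\<lambda>x. below c x n)"
  unfolding below_def by measurable

lemma pred_hits_at [measurable]: "Measurable.pred S (\<lambda>x. hits_at c x n)"
  unfolding hits_at_def by measurable

lemma nn_integral_split:
  assumes [measurable]: "g \<in> borel_measurable S" "h \<in> borel_measurable S"
    and g: "\<And>x y. (\<And>i. i < k \<Longrightarrow> x i = y i) \<Longrightarrow> g x = g y"
  shows "(\<integral>\<^sup>+x. g x * h (dropn k x) \<partial>S) = (\<integral>\<^sup>+x. g x \<partial>S) * (\<integral>\<^sup>+x. h x \<partial>S)"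
proof -
  have "(\<integral>\<^sup>+x. g x * h (dropn k x) \<partial>S)
     = (\<integral>\<^sup>+x. g x * h (dropn k x) \<partial>distr (S \<Otimes>\<^sub>M S) S (\<lambda>(x, y). comb_seq k x y))"
    by (subst PiM_comb_seq) simp
  also have "\<dots> = (\<integral>\<^sup>+z. g (comb_seq k (fst z) (snd z)) * h (dropn k (comb_seq k (fst z) (snd z))) \<partial>(S \<Otimes>\<^sub>M S))"
    by (subst nn_integral_distr) (auto simp: case_prod_beta')
  also have "\<dots> = (\<integral>\<^sup>+z. g (fst z) * h (snd z) \<partial>(S \<Otimes>\<^sub>M S))"
  proof (rule nn_integral_cong)
    fix z
    have "dropn k (comb_seq k (fst z) (snd z)) = snd z"
      by (auto simp: dropn_def comb_seq_def)
    moreover have "g (comb_seq k (fst z) (snd z)) = g (fst z)"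
      by (rule g) (auto simp: comb_seq_def)
    ultimately show "g (comb_seq k (fst z) (snd z)) * h (dropn k (comb_seq k (fst z) (snd z)))
        = g (fst z) * h (snd z)" by simp
  qed
  also have "\<dots> = (\<integral>\<^sup>+x. \<integral>\<^sup>+y. g x * h y \<partial>S \<partial>S)"
    by (subst P.nn_integral_fst[symmetric]) auto
  also have "\<dots> = (\<integral>\<^sup>+x. g x \<partial>S) * (\<integral>\<^sup>+x. h x \<partial>S)"
    by (simp add: nn_integral_cmult nn_integral_multc)
  finally show ?thesis .
qed

lemma prob_split:
  assumes [measurable]: "Measurable.pred S P" "Measurable.pred S Q"
    and P: "\<And>x y. (\<And>i. i < k \<Longrightarrow> x i = y i) \<Longrightarrow> P x = P y"
  shows "P.prob {x. P x \<and> Q (dropn k x)} = P.prob {x. P x} * P.prob {x. Q x}"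
proof -
  have "{x\<in>space S. P x} \<in> sets S" "{x\<in>space S. Q x} \<in> sets S"
    "{x\<in>space S. P x \<and> Q (dropn k x)} \<in> sets S"
    by measurable
  then have [measurable]: "{x. P x} \<in> sets S" "{x. Q x} \<in> sets S" "{x. P x \<and> Q (dropn k x)} \<in> sets S"
    by simp_all
  have "emeasure S {x. P x \<and> Q (dropn k x)} = (\<integral>\<^sup>+x. indicator {x. P x \<and> Q (dropn k x)} x \<partial>S)"
    by (rule nn_integral_indicator[symmetric]) measurable
  also have "\<dots> = (\<integral>\<^sup>+x. indicator {x. P x} x * indicator {x. Q x} (dropn k x) \<partial>S)"
    by (intro nn_integral_cong) (auto split: split_indicator)
  also have "\<dots> = emeasure S {x. P x} * emeasure S {x. Q x}"
  proof (subst nn_integral_split)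
    show "indicator {x. P x} x = (indicator {x. P x} y :: ennreal)" if "\<And>i. i < k \<Longrightarrow> x i = y i" for x y
      using P[OF that] by (simp add: indicator_def)
  qed (simp_all add: nn_integral_indicator)
  finally show ?thesis
    by (simp add: measure_def enn2real_mult)
qed

lemma prob_reindex:
  assumes [measurable]: "Measurable.pred S P" and "inj e"
  shows "P.prob {x. P (\<lambda>i. x (e i))} = P.prob {x. P x}"
proof -
  have [measurable]: "{x. P x} \<in> sets S"
    using assms(1) by (auto simp: pred_def)
  have e [measurable]: "(\<lambda>x i. x (e i)) \<in> measurable S S"
  proof (rule measurable_PiM_single')
    show "\<And>i. i \<in> UNIV \<Longrightarrow> (\<lambda>x. x (e i)) \<in> measurable S M"
      by (simp add: measurable_component_singleton)
  qed auto
  have "distr S S (\<lambda>x i. x (e i)) = S"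
    using distr_PiM_reindex[of UNIV "\<lambda>_. M" e UNIV] assms(2) M.prob_space_axioms
    by (simp add: restrict_def)
  then have "P.prob {x. P x} = measure (distr S S (\<lambda>x i. x (e i))) {x. P x}"
    by simp
  also have "\<dots> = P.prob {x. P (\<lambda>i. x (e i))}"
    by (subst measure_distr) (auto simp: vimage_def)
  finally show ?thesis by simp
qed

end

lemma ex_last_maximum:
  fixes s :: "nat \<Rightarrow> real"
  obtains k where "k \<le> n" "\<And>j. j \<le> n \<Longrightarrow> s j \<le> s k" "\<And>j. k < j \<Longrightarrow> j \<le> n \<Longrightarrow> s j < s k"
proof -
  define A where "A = {i. i \<le> n \<and> (\<forall>j\<le>n. s j \<le> s i)}"
  have fin: "finite A" by (simp add: A_def)
  have "Max (s ` {..n}) \<in> s ` {..n}" by (intro Max_in) auto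
  then obtain i where i: "i \<le> n" "Max (s ` {..n}) = s i"
    by (metis imageE atMost_iff)
  have "s j \<le> s i" if "j \<le> n" for j
    unfolding i(2)[symmetric] using that by (intro Max_ge) auto
  then have "i \<in> A" using i by (simp add: A_def)
  then have k: "Max A \<in> A" "\<And>i. i \<in> A \<Longrightarrow> i \<le> Max A" using fin by (auto intro: Max_in Max_ge)
  show ?thesis
  proof (rule that)
    show "Max A \<le> n" "\<And>j. j \<le> n \<Longrightarrow> s j \<le> s (Max A)" using k(1) by (simp_all add: A_def)
    show "s j < s (Max A)" if "Max A < j" "j \<le> n" for j
    proof (rule ccontr)
      assume "\<not> s j < s (Max A)"
      then have "j \<in> A" using that k(1) unfolding A_def by (auto intro: order_trans)
      then show False using k(2) that by force
    qed
  qed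
qed

lemma last_maximum_unique:
  assumes "weak_rec x k" "k \<le> n" "below 0 (dropn k x) (n - k)"
    and "weak_rec x l" "l \<le> n" "below 0 (dropn l x) (n - l)"
  shows "k = l"
proof -
  have "\<not> a < b" if "below 0 (dropn a x) (n - a)" "weak_rec x b" "b \<le> n" for a b
  proof
    assume "a < b"
    then have "b - a \<in> {1..n - a}" using that by auto
    then have "psum (dropn a x) (b - a) < 0" using that by (auto simp: below_def)
    moreover have "psum x a \<le> psum x b" using that \<open>a < b\<close> by (simp add: weak_rec_def)
    ultimately show False using \<open>a < b\<close> by (simp add: psum_dropn)
  qed
  then show ?thesis using assms by (meson linorder_cases)
qed

lemma last_maximum_iff:
  assumes Q: "\<And>a b. a \<le> b \<Longrightarrow> Q b \<Longrightarrow> Q a"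
  shows "(\<forall>i\<le>n. Q (psum x i)) \<longleftrightarrow>
    (\<exists>k\<le>n. weak_rec x k \<and> Q (psum x k) \<and> below 0 (dropn k x) (n - k))"
proof
  assume *: "\<forall>i\<le>n. Q (psum x i)"
  obtain k where k: "k \<le> n" "\<And>j. j \<le> n \<Longrightarrow> psum x j \<le> psum x k"
    "\<And>j. k < j \<Longrightarrow> j \<le> n \<Longrightarrow> psum x j < psum x k"
    using ex_last_maximum[of n "psum x"] by blast
  have "below 0 (dropn k x) (n - k)"
    unfolding below_def
  proof
    fix i assume "i \<in> {1..n - k}"
    then have "psum x (k + i) < psum x k" using k(1) by (intro k(3)) auto
    then show "psum (dropn k x) i < 0" by (simp add: psum_dropn)
  qed
  then show "\<exists>k\<le>n. weak_rec x k \<and> Q (psum x k) \<and> below 0 (dropn k x) (n - k)"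
    using * k by (intro exI[of _ k]) (auto simp: weak_rec_def)
next
  assume "\<exists>k\<le>n. weak_rec x k \<and> Q (psum x k) \<and> below 0 (dropn k x) (n - k)"
  then obtain k where k: "k \<le> n" "weak_rec x k" "Q (psum x k)" "below 0 (dropn k x) (n - k)" by blast
  show "\<forall>i\<le>n. Q (psum x i)"
  proof (intro allI impI)
    fix i assume "i \<le> n"
    have "psum x i \<le> psum x k"
    proof (cases "i \<le> k")
      case True then show ?thesis using k by (simp add: weak_rec_def)
    next
      case False
      then have "i - k \<in> {1..n - k}" using \<open>i \<le> n\<close> by auto
      then have "psum (dropn k x) (i - k) < 0" using k by (simp add: below_def)
      then show ?thesis using False by (simp add: psum_dropn)
    qed
    then show "Q (psum x i)" using Q k by blast
  qed
qed

lemma psum_periodic: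
  "psum (\<lambda>i. x (i mod n)) (m + n) = psum (\<lambda>i. x (i mod n)) m + psum x n"
proof (induction m)
  case 0
  show ?case by (auto intro: psum_cong)
next
  case (Suc m)
  then show ?case by (simp add: psum_Suc)
qed

lemma cyclic_decomposition:
  fixes x :: "nat \<Rightarrow> real"
  assumes "n \<ge> 1"
  defines "p \<equiv> (\<lambda>i. x (i mod n))"
  defines "E \<equiv> (\<lambda>j k. hits_at 0 (dropn (2 * n - j) p) k \<and> weak_rec (dropn (2 * n - j) p) n)"
  shows "psum x n \<ge> 0 \<longleftrightarrow> (\<exists>k j. j < k \<and> k \<le> n \<and> E j k)"
    and "E j k \<Longrightarrow> E j' k' \<Longrightarrow> j < k \<Longrightarrow> j' < k' \<Longrightarrow> k \<le> n \<Longrightarrow> k' \<le> n \<Longrightarrow> (j, k) = (j', k')"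
proof -
  define G where "G = psum p"
  have per: "G (m + n) = G m + psum x n" for m
    unfolding G_def p_def by (rule psum_periodic)
  have weak_rec_G: "weak_rec (dropn a p) m \<longleftrightarrow> (\<forall>i\<le>m. G (a + i) \<le> G (a + m))" for a m
    by (auto simp: weak_rec_def psum_dropn G_def)
  have hits_G: "hits_at 0 (dropn a p) m \<longleftrightarrow> m \<ge> 1 \<and> (\<forall>i\<in>{1..m-1}. G (a + i) < G a) \<and> G (a + m) \<ge> G a" for a m
    by (auto simp: hits_at_def below_def psum_dropn G_def)
  have sum_nonneg: "psum x n \<ge> 0" if "weak_rec (dropn a p) n" for a
    using that per[of a] by (force simp: weak_rec_G)
  define good where "good m \<longleftrightarrow> (\<forall>l\<le>n. G (m - l) \<le> G m)" for m
  have good_iff: "weak_rec (dropn a p) n \<longleftrightarrow> good a" if "a \<ge> n" "psum x n \<ge> 0" for a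
  proof
    assume *: "weak_rec (dropn a p) n"
    show "good a" unfolding good_def
    proof (intro allI impI)
      fix l assume l: "l \<le> n"
      have "G (a + (n - l)) \<le> G (a + n)" using * by (simp add: weak_rec_G)
      moreover have "G (a + (n - l)) = G (a - l) + psum x n"
        using per[of "a - l"] l that by (simp add: add.commute)
      ultimately show "G (a - l) \<le> G a" by (simp add: per)
    qed
  next
    assume *: "good a"
    show "weak_rec (dropn a p) n" unfolding weak_rec_G
    proof (intro allI impI)
      fix i assume i: "i \<le> n"
      have "G (a - (n - i)) \<le> G a" using * by (simp add: good_def)
      moreover have "G (a + i) = G (a - (n - i)) + psum x n"
        using per[of "a - (n - i)"] i that by (simp add: add.commute)
      ultimately show "G (a + i) \<le> G (a + n)" by (simp add: per)
    qed
  qed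
  have next_good: "good (a + k)" if a: "good a" "a \<ge> n" and k: "k \<le> n" "hits_at 0 (dropn a p) k" for a k
    unfolding good_def
  proof (intro allI impI)
    fix l assume l: "l \<le> n"
    have "G (a + k - l) \<le> G a" if "l \<noteq> 0"
    proof (cases "l \<ge> k")
      case True
      then have "a + k - l = a - (l - k)" by simp
      moreover have "G (a - (l - k)) \<le> G a" using a(1) l by (simp add: good_def)
      ultimately show ?thesis by (simp only:)
    next
      case False
      then have "a + k - l = a + (k - l)" "k - l \<in> {1..k - 1}" using that by auto
      then show ?thesis using k by (auto simp: hits_G intro: less_imp_le)
    qed
    then show "G (a + k - l) \<le> G (a + k)" using k by (cases "l = 0") (auto simp: hits_G)
  qed
  have not_good: "\<not> good (a + i)" if "hits_at 0 (dropn a p) k" "i \<in> {1..k - 1}" "k \<le> n" for a k i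
    using that by (force simp: hits_G good_def dest!: spec[of _ i])
  show "psum x n \<ge> 0 \<longleftrightarrow> (\<exists>k j. j < k \<and> k \<le> n \<and> E j k)"
  proof
    assume s: "psum x n \<ge> 0"
    obtain m where m: "m \<in> {n+1..2*n}" "\<And>i. i \<in> {n+1..2*n} \<Longrightarrow> G i \<le> G m"
    proof -
      have "Max (G ` {n+1..2*n}) \<in> G ` {n+1..2*n}" using \<open>n \<ge> 1\<close> by (intro Max_in) auto
      then obtain i where "i \<in> {n+1..2*n}" "G i = Max (G ` {n+1..2*n})" by auto
      then show ?thesis by (intro that) auto
    qed
    have "good m" unfolding good_def
    proof (intro allI impI)
      fix l assume l: "l \<le> n"
      show "G (m - l) \<le> G m"
      proof (cases "m - l \<ge> n + 1")
        case True
        then show ?thesis using m by (intro m(2)) auto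
      next
        case False
        then have "m - l + n \<in> {n+1..2*n}" using m(1) l by auto
        then have "G (m - l + n) \<le> G m" by (rule m(2))
        then show ?thesis using s by (simp add: per)
      qed
    qed
    define g where "g = Max {i. i \<le> 2 * n \<and> good i}"
    have fin: "finite {i. i \<le> 2 * n \<and> good i}" by simp
    have "g \<in> {i. i \<le> 2 * n \<and> good i}" unfolding g_def
      using \<open>good m\<close> m(1) by (intro Max_in fin) auto
    moreover have "m \<le> g" unfolding g_def using \<open>good m\<close> m(1) by (intro Max_ge fin) auto
    ultimately have g: "good g" "g \<le> 2 * n" "g \<ge> n + 1" using m(1) by auto
    have g_last: "i \<le> g" if "good i" "i \<le> 2 * n" for i
      unfolding g_def using that by (intro Max_ge fin) auto
    define k where "k = (LEAST k. k \<ge> 1 \<and> G (g + k) \<ge> G g)"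
    have ex: "n \<ge> 1 \<and> G (g + n) \<ge> G g" using \<open>n \<ge> 1\<close> s by (simp add: per)
    have k: "k \<ge> 1 \<and> G (g + k) \<ge> G g" unfolding k_def by (rule LeastI[of _ n]) (rule ex)
    have "k \<le> n" unfolding k_def by (rule Least_le) (rule ex)
    have h: "hits_at 0 (dropn g p) k"
      unfolding hits_G
    proof (intro conjI ballI)
      fix i assume "i \<in> {1..k-1}"
      then have "i < k" "i \<ge> 1" using k by auto
      then show "G (g + i) < G g" using not_less_Least[of i "\<lambda>k. k \<ge> 1 \<and> G (g + k) \<ge> G g"]
        by (fold k_def) auto
    qed (use k in auto)
    have "good (g + k)" using next_good g \<open>k \<le> n\<close> h by auto
    then have "2 * n < g + k" using g_last k by force
    moreover have "dropn g p = dropn (2 * n - (2 * n - g)) p" using g by simp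
    moreover have "weak_rec (dropn g p) n" using good_iff g s by auto
    ultimately show "\<exists>k j. j < k \<and> k \<le> n \<and> E j k"
      using h \<open>k \<le> n\<close> g by (intro exI[of _ k] exI[of _ "2 * n - g"]) (auto simp: E_def)
  next
    assume "\<exists>k j. j < k \<and> k \<le> n \<and> E j k"
    then show "psum x n \<ge> 0" using sum_nonneg by (auto simp: E_def)
  qed
  show "(j, k) = (j', k')" if "E j k" "E j' k'" "j < k" "j' < k'" "k \<le> n" "k' \<le> n"
  proof -
    have s: "psum x n \<ge> 0" using that sum_nonneg by (auto simp: E_def)
    have A: "\<not> b < a" if "E a ka" "E b kb" "a < ka" "b < kb" "ka \<le> n" "kb \<le> n" for a b ka kb
    proof
      assume "b < a"
      have "2 * n - b = (2 * n - a) + (a - b)" using that \<open>b < a\<close> by auto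
      moreover have "a - b \<in> {1..ka - 1}" using that \<open>b < a\<close> by auto
      moreover have "\<not> good (2 * n - a + (a - b))"
        using not_good[of "2 * n - a" ka "a - b"] that calculation(2) by (simp add: E_def)
      ultimately have "\<not> good (2 * n - b)" by metis
      moreover have "good (2 * n - b)" using that good_iff[of "2 * n - b"] s by (auto simp: E_def)
      ultimately show False by simp
    qed
    have "j = j'" using A[of j k j' k'] A[of j' k' j k] that by (meson linorder_cases)
    moreover have "k = k'" using that \<open>j = j'\<close> hits_at_unique by (auto simp: E_def)
    ultimately show ?thesis by simp
  qed
qed

lemma inj_extend_by_id:
  fixes r :: "nat \<Rightarrow> nat"
  assumes "inj_on r {..<n}" "\<And>i. r i < n"
  shows "inj (\<lambda>i. if i < n then r i else i)"
proof (rule injI)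
  fix a b assume eq: "(if a < n then r a else a) = (if b < n then r b else b)"
  show "a = b"
    using eq assms(2)[of a] assms(2)[of b] inj_onD[OF assms(1), of a b] by (simp split: if_splits)
qed

lemma weak_rec_of_hits_at:
  assumes "hits_at 0 x k" "k \<le> n"
  shows "weak_rec x n \<longleftrightarrow> weak_rec (dropn k x) (n - k)"
proof -
  have *: "psum x i \<le> psum x k" if "i \<le> k" for i
  proof (cases "i = 0 \<or> i = k")
    case True
    then show ?thesis using assms by (auto simp: hits_at_def)
  next
    case False
    then have "i \<in> {1..k - 1}" using that by auto
    then have "psum x i < 0" using assms by (simp add: hits_at_def below_def)
    then show ?thesis using assms by (simp add: hits_at_def)
  qed
  show ?thesis
  proof
    assume w: "weak_rec x n"
    show "weak_rec (dropn k x) (n - k)"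
      using w assms by (auto simp: weak_rec_def psum_dropn)
  next
    assume w: "weak_rec (dropn k x) (n - k)"
    show "weak_rec x n" unfolding weak_rec_def
    proof (intro allI impI)
      fix j assume "j \<le> n"
      have "psum x k \<le> psum x n" using w assms by (auto simp: weak_rec_def psum_dropn dest: spec[of _ 0])
      moreover have "psum x j \<le> psum x n" if "\<not> j \<le> k"
        using w assms \<open>j \<le> n\<close> that by (auto simp: weak_rec_def psum_dropn dest!: spec[of _ "j - k"])
      ultimately show "psum x j \<le> psum x n" using *[of j] by (cases "j \<le> k") auto
    qed
  qed
qed

context iid_steps begin

definition "prob_below c n = P.prob {x. below c x n}"
definition "prob_hit c n = P.prob {x. hits_at c x n}"
definition "prob_weak_rec n = P.prob {x. weak_rec x n}"
definition "prob_weak_rec_less c n = P.prob {x. weak_rec x n \<and> psum x n < c}"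
definition "prob_nonneg n = P.prob {x. 0 \<le> psum x n}"

lemma sets_Collect_S: "Measurable.pred S Q \<Longrightarrow> {x. Q x} \<in> sets S"
  by (simp add: pred_def)

lemma prob_last_maximum:
  assumes Q: "\<And>a b. a \<le> b \<Longrightarrow> Q b \<Longrightarrow> Q a" and [measurable]: "Measurable.pred borel Q"
  shows "P.prob {x. \<forall>i\<le>n. Q (psum x i)} = (\<Sum>k\<le>n. P.prob {x. weak_rec x k \<and> Q (psum x k)} * prob_below 0 (n - k))"
proof -
  let ?A = "\<lambda>k. {x. (weak_rec x k \<and> Q (psum x k)) \<and> below 0 (dropn k x) (n - k)}"
  have m: "?A k \<in> sets S" for k
    by (rule sets_Collect_S) measurable
  have "{x. \<forall>i\<le>n. Q (psum x i)} = (\<Union>k\<le>n. ?A k)"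
  proof (rule set_eqI)
    fix x
    show "x \<in> {x. \<forall>i\<le>n. Q (psum x i)} \<longleftrightarrow> x \<in> (\<Union>k\<le>n. ?A k)"
      using last_maximum_iff[of Q n x] Q by blast
  qed
  also have "P.prob \<dots> = (\<Sum>k\<le>n. P.prob (?A k))"
  proof (rule P.finite_measure_finite_Union)
    show "disjoint_family_on ?A {..n}"
      unfolding disjoint_family_on_def using last_maximum_unique by fast
  qed (use m in auto)
  also have "\<dots> = (\<Sum>k\<le>n. P.prob {x. weak_rec x k \<and> Q (psum x k)} * prob_below 0 (n - k))"
  proof (rule sum.cong)
    fix k
    show "P.prob (?A k) = P.prob {x. weak_rec x k \<and> Q (psum x k)} * prob_below 0 (n - k)"
      unfolding prob_below_def
    proof (rule prob_split)
      show "(weak_rec x k \<and> Q (psum x k)) = (weak_rec y k \<and> Q (psum y k))" if "\<And>i. i < k \<Longrightarrow> x i = y i" for x y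
        using weak_rec_cong[of k x y] psum_cong[of k x y] that by simp
    qed measurable
  qed simp
  finally show ?thesis .
qed

lemma prob_below_renewal: "c > 0 \<Longrightarrow> prob_below c n = (\<Sum>k\<le>n. prob_weak_rec_less c k * prob_below 0 (n - k))"
proof -
  assume "c > 0"
  have "{x. \<forall>i\<le>n. psum x i < c} = {x. below c x n}"
  proof -
    have "(\<forall>i\<le>n. psum x i < c) \<longleftrightarrow> below c x n" for x
    proof -
      have "psum x i < c \<longleftrightarrow> (i \<ge> 1 \<longrightarrow> psum x i < c)" for i
        using \<open>c > 0\<close> by (cases "i = 0") auto
      then show ?thesis unfolding below_def by (metis atLeastAtMost_iff)
    qed
    then show ?thesis by simp
  qed
  then show ?thesis
    using prob_last_maximum[of "\<lambda>a. a < c" n] by (simp add: prob_below_def prob_weak_rec_less_def)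
qed

lemma prob_weak_rec_renewal: "(\<Sum>k\<le>n. prob_weak_rec k * prob_below 0 (n - k)) = 1"
proof -
  have "P.prob {x. True} = 1" using P.prob_space by simp
  then show ?thesis
    using prob_last_maximum[of "\<lambda>_. True" n] by (simp add: prob_weak_rec_def)
qed

lemma prob_hit_Suc: "prob_hit c (Suc n) = prob_below c n - prob_below c (Suc n)"
proof -
  have [measurable]: "{x. below c x n} \<in> sets S" "{x. below c x (Suc n)} \<in> sets S"
    by (rule sets_Collect_S; measurable)+
  have "{x. hits_at c x (Suc n)} = {x. below c x n} - {x. below c x (Suc n)}"
    by (auto simp: hits_at_Suc)
  then show ?thesis
    unfolding prob_hit_def prob_below_def using below_antimono[of n "Suc n" c]
    by (simp add: P.finite_measure_Diff subset_eq)
qed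

lemma prob_hit_0 [simp]: "prob_hit c 0 = 0"
  by (simp add: prob_hit_def hits_at_def)

lemma prob_nonneg_eq_sum: "n \<ge> 1 \<Longrightarrow> prob_nonneg n = (\<Sum>k=1..n. real k * prob_hit 0 k * prob_weak_rec (n - k))"
proof -
  assume n: "n \<ge> 1"
  let ?y = "\<lambda>j x. dropn (2 * n - j) (\<lambda>i. x (i mod n)) :: nat \<Rightarrow> real"
  let ?E = "\<lambda>j k x. hits_at 0 (?y j x) k \<and> weak_rec (?y j x) n"
  let ?F = "\<lambda>k x. hits_at 0 x k \<and> weak_rec x n"
  define e where "e j i = (if i < n then (i + (2 * n - j)) mod n else i)" for i j
  have inj_e: "inj (e j)" for j
  proof -
    have "\<not> a < b" if "b < n" "(a + (2 * n - j)) mod n = (b + (2 * n - j)) mod n" for a b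
    proof
      assume "a < b"
      then have "n dvd (b + (2 * n - j)) - (a + (2 * n - j))"
        using that mod_eq_dvd_iff_nat[of "a + (2 * n - j)" "b + (2 * n - j)" n] by simp
      then have "n dvd b - a" by simp
      then show False using \<open>a < b\<close> \<open>b < n\<close> by (auto dest: dvd_imp_le)
    qed
    then have "inj_on (\<lambda>i. (i + (2 * n - j)) mod n) {..<n}"
      by (intro inj_onI) (metis lessThan_iff nat_neq_iff)
    moreover have "(i + (2 * n - j)) mod n < n" for i using n by simp
    ultimately show ?thesis unfolding e_def by (rule inj_extend_by_id)
  qed
  have E_eq: "?E j k x \<longleftrightarrow> ?F k (\<lambda>i. x (e j i))" if "k \<le> n" for j k x
  proof -
    have *: "?y j x i = x (e j i)" if "i < n" for i using that by (simp add: dropn_def e_def)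
    have "hits_at 0 (?y j x) k = hits_at 0 (\<lambda>i. x (e j i)) k"
      using * \<open>k \<le> n\<close> by (intro hits_at_cong) auto
    moreover have "weak_rec (?y j x) n = weak_rec (\<lambda>i. x (e j i)) n"
      using * by (intro weak_rec_cong) auto
    ultimately show ?thesis by simp
  qed
  have probF: "P.prob {x. ?F k x} = prob_hit 0 k * prob_weak_rec (n - k)" if "k \<le> n" for k
  proof -
    have "{x. ?F k x} = {x. hits_at 0 x k \<and> weak_rec (dropn k x) (n - k)}"
      using weak_rec_of_hits_at that by auto
    then show ?thesis
      using prob_split[of "\<lambda>x. hits_at 0 x k" "\<lambda>x. weak_rec x (n - k)" k, OF pred_hits_at pred_weak_rec hits_at_cong]
      by (simp add: prob_hit_def prob_weak_rec_def)
  qed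
  have probE: "P.prob {x. ?E j k x} = prob_hit 0 k * prob_weak_rec (n - k)" if "k \<le> n" for j k
  proof -
    have "Measurable.pred S (?F k)" by measurable
    then have "P.prob {x. ?F k (\<lambda>i. x (e j i))} = P.prob {x. ?F k x}"
      by (rule prob_reindex) (rule inj_e)
    then show ?thesis using probF[OF that] unfolding E_eq[OF that] by simp
  qed
  have mE: "{x. ?E j k x} \<in> sets S" if "k \<le> n" for j k
  proof -
    have r: "(\<lambda>x i. x (e j i)) \<in> measurable S S"
    proof (rule measurable_PiM_single')
      show "\<And>i. i \<in> UNIV \<Longrightarrow> (\<lambda>x. x (e j i)) \<in> measurable S M"
        by (simp add: measurable_component_singleton)
    qed auto
    have "{x. ?F k x} \<in> sets S" by (rule sets_Collect_S) measurable
    from measurable_sets[OF r this] show ?thesis unfolding E_eq[OF that] by (simp add: vimage_def)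
  qed
  let ?I = "Sigma {1..n} (\<lambda>k. {..<k})"
  let ?A = "\<lambda>(k, j). {x. ?E j k x}"
  have "{x. 0 \<le> psum x n} = (\<Union>i\<in>?I. ?A i)"
  proof (rule set_eqI)
    fix x
    have "x \<in> (\<Union>i\<in>?I. ?A i) \<longleftrightarrow> (\<exists>k j. 1 \<le> k \<and> k \<le> n \<and> j < k \<and> ?E j k x)"
      by (simp add: Bex_def)
    also have "\<dots> \<longleftrightarrow> (\<exists>k j. j < k \<and> k \<le> n \<and> ?E j k x)"
      by (metis hits_at_def)
    finally show "x \<in> {x. 0 \<le> psum x n} \<longleftrightarrow> x \<in> (\<Union>i\<in>?I. ?A i)"
      using cyclic_decomposition(1)[OF n, of x] by blast
  qed
  then have "prob_nonneg n = P.prob (\<Union>i\<in>?I. ?A i)" by (simp add: prob_nonneg_def)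
  also have "\<dots> = (\<Sum>i\<in>?I. P.prob (?A i))"
  proof (rule P.finite_measure_finite_Union)
    show "disjoint_family_on ?A ?I"
      unfolding disjoint_family_on_def
    proof (intro ballI impI)
      fix i i' assume i: "i \<in> ?I" "i' \<in> ?I" "i \<noteq> i'"
      obtain k j k' j' where [simp]: "i = (k, j)" "i' = (k', j')" by fastforce
      have "\<not> (?E j k x \<and> ?E j' k' x)" for x
        using cyclic_decomposition(2)[OF n, where x=x and j=j and k=k and j'=j' and k'=k'] i by auto
      then show "?A i \<inter> ?A i' = {}" by auto
    qed
  next
    show "?A ` ?I \<subseteq> sets S"
    proof (rule image_subsetI)
      fix i assume "i \<in> ?I"
      then show "?A i \<in> sets S" using mE by (cases i) (simp only: prod.case, simp)
    qed
  qed simp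
  also have "\<dots> = (\<Sum>k=1..n. \<Sum>j<k. P.prob {x. ?E j k x})"
  proof (subst sum.Sigma)
    show "(\<Sum>i\<in>?I. P.prob (?A i)) = (\<Sum>(k, j)\<in>?I. P.prob {x. ?E j k x})"
      by (rule sum.cong) (simp_all only: prod.case split_paired_all)
  qed simp_all
  also have "\<dots> = (\<Sum>k=1..n. real k * prob_hit 0 k * prob_weak_rec (n - k))"
    using probE by (intro sum.cong) auto
  finally show ?thesis .
qed

end

section \<open>Generating functions and the Sparre Andersen identity\<close>

definition genfun :: "(nat \<Rightarrow> real) \<Rightarrow> real \<Rightarrow> real" where
  "genfun b z = (\<Sum>n. b n * z ^ n)"

lemma summable_norm_genfun:
  fixes b :: "nat \<Rightarrow> real"
  assumes "\<And>n. \<bar>b n\<bar> \<le> B" "\<bar>z\<bar> < 1"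
  shows "summable (\<lambda>n. norm (b n * z ^ n))"
proof (rule summable_comparison_test)
  show "summable (\<lambda>n. B * \<bar>z\<bar> ^ n)"
    using assms by (intro summable_mult summable_geometric) auto
  show "\<exists>N. \<forall>n\<ge>N. norm (norm (b n * z ^ n)) \<le> B * \<bar>z\<bar> ^ n"
    using assms(1) by (auto simp: abs_mult power_abs intro!: mult_right_mono)
qed

lemma summable_genfun:
  fixes b :: "nat \<Rightarrow> real"
  assumes "\<And>n. \<bar>b n\<bar> \<le> B" "\<bar>z\<bar> < 1"
  shows "summable (\<lambda>n. b n * z ^ n)"
  using summable_norm_cancel[OF summable_norm_genfun[OF assms]] .

lemma genfun_mult:
  fixes a b :: "nat \<Rightarrow> real"
  assumes "\<And>n. \<bar>a n\<bar> \<le> A" "\<And>n. \<bar>b n\<bar> \<le> B" "\<bar>z\<bar> < 1"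
  shows "genfun a z * genfun b z = genfun (\<lambda>n. \<Sum>k\<le>n. a k * b (n - k)) z"
proof -
  have "genfun a z * genfun b z = (\<Sum>n. \<Sum>k\<le>n. a k * z ^ k * (b (n - k) * z ^ (n - k)))"
    unfolding genfun_def by (rule Cauchy_product) (rule summable_norm_genfun[OF assms(1,3)] summable_norm_genfun[OF assms(2,3)])+
  also have "(\<lambda>n. \<Sum>k\<le>n. a k * z ^ k * (b (n - k) * z ^ (n - k))) = (\<lambda>n. (\<Sum>k\<le>n. a k * b (n - k)) * z ^ n)"
  proof
    fix n
    have "a k * z ^ k * (b (n - k) * z ^ (n - k)) = a k * b (n - k) * z ^ n" if "k \<le> n" for k
      using that power_add[of z k "n - k"] by simp
    then show "(\<Sum>k\<le>n. a k * z ^ k * (b (n - k) * z ^ (n - k))) = (\<Sum>k\<le>n. a k * b (n - k)) * z ^ n"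
      unfolding sum_distrib_right by (intro sum.cong) auto
  qed
  finally show ?thesis by (simp add: genfun_def)
qed

lemma genfun_nonneg: "(\<And>n. 0 \<le> b n) \<Longrightarrow> 0 \<le> z \<Longrightarrow> summable (\<lambda>n. b n * z ^ n) \<Longrightarrow> 0 \<le> genfun b z"
  unfolding genfun_def by (intro suminf_nonneg) auto

lemma has_field_derivative_genfun:
  fixes b :: "nat \<Rightarrow> real"
  assumes "\<And>n. \<bar>b n\<bar> \<le> B" "\<bar>z\<bar> < 1"
  shows "(genfun b has_field_derivative genfun (diffs b) z) (at z)"
  using termdiffs_strong'[of 1 b z] summable_genfun[OF assms(1)] assms(2)
  by (simp add: genfun_def[abs_def])

lemma genfun_inverse_nat:
  assumes "\<bar>z\<bar> < 1" shows "genfun (\<lambda>n. 1 / real n) z = - ln (1 - z)"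
  using sums_minus[OF ln_series'[of "- z"]] assms by (simp add: genfun_def sums_iff)

lemma tendsto_genfun_at_1:
  assumes b: "summable b" "\<And>n. 0 \<le> b n" and z: "z \<longlonglongrightarrow> 1" "\<And>n. 0 \<le> z n" "\<And>n. z n \<le> 1"
  shows "(\<lambda>n. genfun b (z n)) \<longlonglongrightarrow> suminf b"
proof -
  have "(\<lambda>n. suminf (\<lambda>k. b k * z n ^ k)) \<longlonglongrightarrow> suminf b"
  proof (rule conjunct2[OF conjunct2[OF tannerys_theorem[where M=b]]])
    show "(\<lambda>n. b k * z n ^ k) \<longlonglongrightarrow> b k" for k
      using tendsto_mult[OF tendsto_const tendsto_power[OF z(1)], of "b k" k] by simp
    show "\<forall>\<^sub>F (k, n) in sequentially \<times>\<^sub>F sequentially. norm (b k * z n ^ k) \<le> b k"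
      using b z by (intro always_eventually) (auto simp: abs_mult power_le_one intro!: mult_left_le)
  qed (use b in auto)
  then show ?thesis by (simp add: genfun_def)
qed

lemma tendsto_genfun_diff_0:
  fixes b :: "nat \<Rightarrow> real"
  assumes B: "\<And>n. \<bar>b n\<bar> \<le> B" and b: "b \<longlonglongrightarrow> 0"
    and y: "y \<longlonglongrightarrow> 1" "\<And>n. 0 \<le> y n" "\<And>n. y n < 1"
    and z: "z \<longlonglongrightarrow> 1" "\<And>n. 0 \<le> z n" "\<And>n. z n < 1"
    and lam: "(\<lambda>n. (1 - z n) / (1 - y n)) \<longlonglongrightarrow> \<theta>" "\<theta> > 0"
  shows "(\<lambda>n. genfun (\<lambda>n. b n / real n) (y n) - genfun (\<lambda>n. b n / real n) (z n)) \<longlonglongrightarrow> 0"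
proof (rule LIMSEQ_I)
  fix r :: real assume "r > 0"
  define C where "C = \<bar>ln \<theta>\<bar> + 1"
  have "C > 0" by (simp add: C_def)
  define e where "e = r / (2 * C)"
  have "e > 0" using \<open>r > 0\<close> \<open>C > 0\<close> by (simp add: e_def)
  have lnlim: "(\<lambda>n. \<bar>ln ((1 - z n) / (1 - y n))\<bar>) \<longlonglongrightarrow> \<bar>ln \<theta>\<bar>"
    using lam by (intro tendsto_rabs tendsto_ln) auto
  have ev1: "eventually (\<lambda>n. \<bar>ln ((1 - z n) / (1 - y n))\<bar> < C) sequentially"
    using order_tendstoD(2)[OF lnlim, of C] by (simp add: C_def)
  obtain K where K: "\<And>k. k \<ge> K \<Longrightarrow> \<bar>b k\<bar> \<le> e"
    using LIMSEQ_D[OF b \<open>e > 0\<close>] by (auto intro: less_imp_le)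
  have "(\<lambda>n. \<Sum>k<K. \<bar>b k / real k\<bar> * \<bar>y n ^ k - z n ^ k\<bar>) \<longlonglongrightarrow> (\<Sum>k<K. \<bar>b k / real k\<bar> * \<bar>1 ^ k - 1 ^ k\<bar>)"
    using y z by (intro tendsto_intros)
  then have ev2: "eventually (\<lambda>n. (\<Sum>k<K. \<bar>b k / real k\<bar> * \<bar>y n ^ k - z n ^ k\<bar>) < r / 2) sequentially"
    using order_tendstoD(2)[of _ 0 sequentially "r / 2"] \<open>r > 0\<close> by simp
  have key: "\<bar>genfun (\<lambda>n. b n / real n) u - genfun (\<lambda>n. b n / real n) v\<bar>
      \<le> (\<Sum>k<K. \<bar>b k / real k\<bar> * \<bar>u ^ k - v ^ k\<bar>) + e * \<bar>ln ((1 - v) / (1 - u))\<bar>"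
    if uv: "0 \<le> u" "u < 1" "0 \<le> v" "v < 1" "v \<le> u" for u v
  proof -
    define t where "t k = 1 / real k * u ^ k - 1 / real k * v ^ k" for k
    have inv: "\<bar>1 / real k\<bar> \<le> 1" for k by (cases k) auto
    have su: "summable (\<lambda>k. 1 / real k * u ^ k)" "summable (\<lambda>k. 1 / real k * v ^ k)"
      using summable_genfun[OF inv] uv by auto
    have "(\<Sum>k. t k) = genfun (\<lambda>n. 1 / real n) u - genfun (\<lambda>n. 1 / real n) v"
      unfolding t_def genfun_def by (rule suminf_diff[symmetric]) (rule su)+
    also have "\<dots> = ln ((1 - v) / (1 - u))" using uv by (simp add: genfun_inverse_nat ln_div)
    finally have t_sum: "(\<Sum>k. t k) = ln ((1 - v) / (1 - u))" .
    have st: "summable t" unfolding t_def by (intro summable_diff su)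
    have t_nonneg: "t k \<ge> 0" for k
      using uv power_mono[of v u k] by (simp add: t_def divide_right_mono)
    have Bk: "\<bar>b k / real k\<bar> \<le> B" for k
    proof (cases k)
      case 0
      then show ?thesis using B[of 0] by simp
    next
      case (Suc j)
      have "\<bar>b k\<bar> / real k \<le> \<bar>b k\<bar> / 1" using Suc by (intro divide_left_mono) auto
      then show ?thesis using B[of k] by simp
    qed
    have sbu: "summable (\<lambda>k. b k / real k * u ^ k)" "summable (\<lambda>k. b k / real k * v ^ k)"
      using summable_genfun[OF Bk] uv by auto
    have "genfun (\<lambda>n. b n / real n) u - genfun (\<lambda>n. b n / real n) v = (\<Sum>k. b k / real k * u ^ k - b k / real k * v ^ k)"
      unfolding genfun_def by (rule suminf_diff) (rule sbu)+
    also have "(\<lambda>k. b k / real k * u ^ k - b k / real k * v ^ k) = (\<lambda>k. b k * t k)"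
      by (auto simp: t_def right_diff_distrib)
    finally have eq: "genfun (\<lambda>n. b n / real n) u - genfun (\<lambda>n. b n / real n) v = (\<Sum>k. b k * t k)" .
    have sbt: "summable (\<lambda>k. \<bar>b k * t k\<bar>)"
    proof (rule summable_comparison_test')
      show "summable (\<lambda>k. B * t k)" using st by (rule summable_mult)
      show "norm \<bar>b k * t k\<bar> \<le> B * t k" for k
        using B[of k] t_nonneg[of k] by (simp add: abs_mult mult_right_mono)
    qed
    have "\<bar>\<Sum>k. b k * t k\<bar> \<le> (\<Sum>k. \<bar>b k * t k\<bar>)" by (rule summable_rabs[OF sbt])
    also have "\<dots> = (\<Sum>k. \<bar>b (k + K) * t (k + K)\<bar>) + (\<Sum>k<K. \<bar>b k * t k\<bar>)"
      by (rule suminf_split_initial_segment[OF sbt])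
    also have "(\<Sum>k. \<bar>b (k + K) * t (k + K)\<bar>) \<le> (\<Sum>k. e * t (k + K))"
    proof (rule suminf_le)
      show "\<bar>b (k + K) * t (k + K)\<bar> \<le> e * t (k + K)" for k
        using K[of "k + K"] t_nonneg[of "k + K"] by (simp add: abs_mult mult_right_mono)
      show "summable (\<lambda>k. \<bar>b (k + K) * t (k + K)\<bar>)" using sbt by (rule summable_ignore_initial_segment)
      show "summable (\<lambda>k. e * t (k + K))" using st by (intro summable_mult summable_ignore_initial_segment)
    qed
    also have "(\<Sum>k. e * t (k + K)) = e * (\<Sum>k. t (k + K))"
      using st by (intro suminf_mult summable_ignore_initial_segment)
    also have "(\<Sum>k. t (k + K)) \<le> (\<Sum>k. t k)"
      using suminf_split_initial_segment[OF st, of K] sum_nonneg[of "{..<K}" t] t_nonneg by simp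
    also have "(\<Sum>k. t k) \<le> \<bar>ln ((1 - v) / (1 - u))\<bar>" using t_sum by simp
    finally have "\<bar>\<Sum>k. b k * t k\<bar> \<le> e * \<bar>ln ((1 - v) / (1 - u))\<bar> + (\<Sum>k<K. \<bar>b k * t k\<bar>)"
      using \<open>e > 0\<close> by (simp add: mult_left_mono)
    moreover have "b k * t k = b k / real k * (u ^ k - v ^ k)" for k
      by (simp add: t_def algebra_simps diff_divide_distrib)
    ultimately show ?thesis unfolding eq by (simp add: abs_mult)
  qed
  have "eventually (\<lambda>n. \<bar>genfun (\<lambda>n. b n / real n) (y n) - genfun (\<lambda>n. b n / real n) (z n)\<bar> < r) sequentially"
    using ev1 ev2
  proof eventually_elim
    case (elim n)
    have "\<bar>genfun (\<lambda>n. b n / real n) (y n) - genfun (\<lambda>n. b n / real n) (z n)\<bar>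
      \<le> (\<Sum>k<K. \<bar>b k / real k\<bar> * \<bar>y n ^ k - z n ^ k\<bar>) + e * \<bar>ln ((1 - z n) / (1 - y n))\<bar>"
    proof (cases "z n \<le> y n")
      case True
      then show ?thesis using key[of "y n" "z n"] y z by simp
    next
      case False
      have "\<bar>ln ((1 - z n) / (1 - y n))\<bar> = \<bar>ln ((1 - y n) / (1 - z n))\<bar>"
        using y z by (simp add: ln_div abs_minus_commute)
      then show ?thesis using key[of "z n" "y n"] y z False by (simp add: abs_minus_commute)
    qed
    also have "\<dots> < r / 2 + e * C" using elim \<open>e > 0\<close> by (intro add_strict_mono mult_strict_left_mono)
    also have "\<dots> = r" using \<open>C > 0\<close> by (simp add: e_def)
    finally show ?case .
  qed
  then show "\<exists>no. \<forall>n\<ge>no. norm (genfun (\<lambda>n. b n / real n) (y n) - genfun (\<lambda>n. b n / real n) (z n) - 0) < r"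
    by (simp add: eventually_sequentially)
qed

lemma tendsto_genfun_diff:
  fixes b :: "nat \<Rightarrow> real"
  assumes B: "\<And>n. \<bar>b n\<bar> \<le> B" and b: "b \<longlonglongrightarrow> \<rho>"
    and y: "y \<longlonglongrightarrow> 1" "\<And>n. 0 \<le> y n" "\<And>n. y n < 1"
    and z: "z \<longlonglongrightarrow> 1" "\<And>n. 0 \<le> z n" "\<And>n. z n < 1"
    and lam: "(\<lambda>n. (1 - z n) / (1 - y n)) \<longlonglongrightarrow> \<theta>" "\<theta> > 0"
  shows "(\<lambda>n. genfun (\<lambda>n. b n / real n) (y n) - genfun (\<lambda>n. b n / real n) (z n)) \<longlonglongrightarrow> \<rho> * ln \<theta>"
proof -
  have B': "\<bar>b n - \<rho>\<bar> \<le> B + \<bar>\<rho>\<bar>" for n using B[of n] by linarith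
  have "(\<lambda>n. b n - \<rho>) \<longlonglongrightarrow> 0" using tendsto_diff[OF b tendsto_const[of \<rho>]] by simp
  note * = tendsto_genfun_diff_0[OF B' this y z lam]
  have **: "genfun (\<lambda>n. (b n - \<rho>) / real n) u = genfun (\<lambda>n. b n / real n) u + \<rho> * ln (1 - u)" if "0 \<le> u" "u < 1" for u
  proof -
    have Bk: "\<bar>b k / real k\<bar> \<le> B" for k
    proof (cases k)
      case 0
      then show ?thesis using B[of 0] by simp
    next
      case (Suc j)
      have "\<bar>b k\<bar> / real k \<le> \<bar>b k\<bar> / 1" using Suc by (intro divide_left_mono) auto
      then show ?thesis using B[of k] by simp
    qed
    have inv: "\<bar>1 / real k\<bar> \<le> 1" for k by (cases k) auto
    have s1: "summable (\<lambda>k. b k / real k * u ^ k)" using summable_genfun[OF Bk] that by simp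
    have s2: "summable (\<lambda>k. 1 / real k * u ^ k)" using summable_genfun[OF inv] that by simp
    have "genfun (\<lambda>n. (b n - \<rho>) / real n) u = (\<Sum>k. b k / real k * u ^ k - \<rho> * (1 / real k * u ^ k))"
      unfolding genfun_def by (intro suminf_cong) (simp add: field_simps diff_divide_distrib)
    also have "\<dots> = genfun (\<lambda>n. b n / real n) u - \<rho> * genfun (\<lambda>n. 1 / real n) u"
      unfolding genfun_def using suminf_diff[OF s1 summable_mult[OF s2]] suminf_mult[OF s2] by simp
    finally show ?thesis using that by (simp add: genfun_inverse_nat)
  qed
  have "(\<lambda>n. \<rho> * ln ((1 - z n) / (1 - y n))) \<longlonglongrightarrow> \<rho> * ln \<theta>"
    using lam by (intro tendsto_intros) auto
  from tendsto_add[OF * this] have "(\<lambda>n. genfun (\<lambda>n. (b n - \<rho>) / real n) (y n) - genfun (\<lambda>n. (b n - \<rho>) / real n) (z n)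
      + \<rho> * ln ((1 - z n) / (1 - y n))) \<longlonglongrightarrow> \<rho> * ln \<theta>" by simp
  moreover have "genfun (\<lambda>n. (b n - \<rho>) / real n) (y n) - genfun (\<lambda>n. (b n - \<rho>) / real n) (z n)
      + \<rho> * ln ((1 - z n) / (1 - y n)) = genfun (\<lambda>n. b n / real n) (y n) - genfun (\<lambda>n. b n / real n) (z n)" for n
    using y(2)[of n] z(2)[of n] y(3)[of n] z(3)[of n] less_imp_neq[OF y(3)[of n]] less_imp_neq[OF z(3)[of n]]
    by (simp add: ** ln_div algebra_simps)
  ultimately show ?thesis by simp
qed

lemma tendsto_genfun_imp_summable:
  assumes b: "\<And>n. 0 \<le> b n" "\<And>n. b n \<le> B" and z: "z \<longlonglongrightarrow> 1" "\<And>n. 0 \<le> z n" "\<And>n. z n < 1"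
    and bound: "\<And>n. genfun b (z n) \<le> C"
  shows "summable b"
proof (rule summableI_nonneg_bounded)
  show "0 \<le> b n" for n by (rule b)
  show "(\<Sum>k<n. b k) \<le> C" for n
  proof (rule LIMSEQ_le_const2)
    show "(\<lambda>i. \<Sum>k<n. b k * z i ^ k) \<longlonglongrightarrow> (\<Sum>k<n. b k)"
    proof -
      have "(\<lambda>i. \<Sum>k<n. b k * z i ^ k) \<longlonglongrightarrow> (\<Sum>k<n. b k * 1 ^ k)"
        by (intro tendsto_intros z)
      then show ?thesis by simp
    qed
    have "(\<Sum>k<n. b k * z i ^ k) \<le> C" for i
    proof -
      have "(\<Sum>k<n. b k * z i ^ k) \<le> genfun b (z i)"
        unfolding genfun_def
      proof (rule sum_le_suminf)
        show "summable (\<lambda>n. b n * z i ^ n)"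
          using b z by (intro summable_genfun[of _ B]) auto
      qed (use b z in auto)
      then show ?thesis using bound[of i] by simp
    qed
    then show "\<exists>N. \<forall>i\<ge>N. (\<Sum>k<n. b k * z i ^ k) \<le> C" by blast
  qed
qed

context iid_steps begin

lemma prob_coeff [simp]:
  "\<bar>prob_below c n\<bar> \<le> 1" "\<bar>prob_hit c n\<bar> \<le> 1" "\<bar>prob_weak_rec n\<bar> \<le> 1" "\<bar>prob_weak_rec_less c n\<bar> \<le> 1" "\<bar>prob_nonneg n\<bar> \<le> 1"
  "0 \<le> prob_below c n" "0 \<le> prob_hit c n" "0 \<le> prob_weak_rec n" "0 \<le> prob_weak_rec_less c n" "0 \<le> prob_nonneg n"
  by (simp_all add: prob_below_def prob_hit_def prob_weak_rec_def prob_weak_rec_less_def prob_nonneg_def)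

definition "spitzer_series z = genfun (\<lambda>n. prob_nonneg n / real n) z"

lemma coeff_L: "\<bar>prob_nonneg n / real n\<bar> \<le> 1"
  using prob_coeff(5)[of n] by (cases n) (auto simp: divide_le_eq)

lemma prob_below_0 [simp]: "prob_below c 0 = 1"
  using P.prob_space by (simp add: prob_below_def below_def)

lemma one_minus_genfun_prob_hit:
  assumes "\<bar>z\<bar> < 1" shows "1 - genfun (prob_hit c) z = (1 - z) * genfun (prob_below c) z"
proof -
  have sq: "summable (\<lambda>n. prob_below c n * z ^ n)" by (rule summable_genfun[OF prob_coeff(1) assms])
  have sf: "summable (\<lambda>n. prob_hit c n * z ^ n)" by (rule summable_genfun[OF prob_coeff(2) assms])
  have sq1: "summable (\<lambda>n. prob_below c (Suc n) * z ^ Suc n)" using summable_ignore_initial_segment[OF sq, of 1] by simp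
  have "genfun (prob_hit c) z = (\<Sum>n. prob_hit c (Suc n) * z ^ Suc n)"
    unfolding genfun_def using suminf_split_head[OF sf] by simp
  also have "\<dots> = (\<Sum>n. z * (prob_below c n * z ^ n) - prob_below c (Suc n) * z ^ Suc n)"
    by (simp add: prob_hit_Suc algebra_simps)
  also have "\<dots> = z * genfun (prob_below c) z - (\<Sum>n. prob_below c (Suc n) * z ^ Suc n)"
    unfolding genfun_def using suminf_diff[OF summable_mult[OF sq] sq1] suminf_mult[OF sq] by simp
  also have "(\<Sum>n. prob_below c (Suc n) * z ^ Suc n) = genfun (prob_below c) z - 1"
    unfolding genfun_def using suminf_split_head[OF sq] by simp
  finally show ?thesis by (simp add: algebra_simps)
qed

lemma genfun_prob_weak_rec:
  assumes "\<bar>z\<bar> < 1" shows "genfun prob_weak_rec z * (1 - genfun (prob_hit 0) z) = 1"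
proof -
  have "genfun prob_weak_rec z * genfun (prob_below 0) z = genfun (\<lambda>n. 1) z"
    using genfun_mult[OF prob_coeff(3) prob_coeff(1) assms] by (simp add: prob_weak_rec_renewal)
  also have "\<dots> = 1 / (1 - z)" unfolding genfun_def using assms by (simp add: suminf_geometric)
  finally show ?thesis using assms by (simp add: one_minus_genfun_prob_hit field_simps)
qed

lemma one_minus_genfun_prob_hit_eq:
  assumes "\<bar>z\<bar> < 1" "c > 0" shows "1 - genfun (prob_hit c) z = genfun (prob_weak_rec_less c) z * (1 - genfun (prob_hit 0) z)"
proof -
  have "genfun (prob_weak_rec_less c) z * genfun (prob_below 0) z = genfun (prob_below c) z"
    using genfun_mult[of "prob_weak_rec_less c" 1 "prob_below 0" 1 z, OF prob_coeff(4) prob_coeff(1) assms(1)]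
    unfolding prob_below_renewal[OF assms(2), symmetric] by simp
  then show ?thesis using assms by (simp add: one_minus_genfun_prob_hit)
qed

lemma genfun_prob_hit_0:
  assumes z: "\<bar>z\<bar> < 1" shows "1 - genfun (prob_hit 0) z = exp (- spitzer_series z)"
proof -
  let ?h = "\<lambda>z. (1 - genfun (prob_hit 0) z) * exp (spitzer_series z)"
  have "(?h has_field_derivative 0) (at x)" if x: "\<bar>x\<bar> < 1" for x
  proof -
    have dL: "diffs (\<lambda>n. prob_nonneg n / real n) = (\<lambda>n. prob_nonneg (Suc n))" by (auto simp: diffs_def)
    have "prob_nonneg (Suc n) = (\<Sum>k\<le>n. diffs (prob_hit 0) k * prob_weak_rec (n - k))" for n
    proof -
      have "prob_nonneg (Suc n) = (\<Sum>k=1..Suc n. real k * prob_hit 0 k * prob_weak_rec (Suc n - k))"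
        by (rule prob_nonneg_eq_sum) simp
      also have "\<dots> = (\<Sum>k=0..n. real (Suc k) * prob_hit 0 (Suc k) * prob_weak_rec (n - k))"
        using sum.atLeast_Suc_atMost_Suc_shift[of "\<lambda>k. real k * prob_hit 0 k * prob_weak_rec (Suc n - k)" 0 n]
        by (simp del: of_nat_Suc)
      finally show ?thesis by (simp add: diffs_def atMost_atLeast0)
    qed
    then have dap: "genfun (\<lambda>n. prob_nonneg (Suc n)) x = genfun (diffs (prob_hit 0)) x * genfun prob_weak_rec x"
    proof -
      assume *: "\<And>n. prob_nonneg (Suc n) = (\<Sum>k\<le>n. diffs (prob_hit 0) k * prob_weak_rec (n - k))"
      have s: "summable (\<lambda>n. norm (diffs (prob_hit 0) n * x ^ n))"
      proof -
        obtain K where K: "\<bar>x\<bar> < K" "K < 1" using dense[OF x] by blast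
        have "summable (\<lambda>n. diffs (prob_hit 0) n * K ^ n)"
          by (rule termdiff_converges[of _ 1]) (use K summable_genfun[OF prob_coeff(2)] in auto)
        from powser_insidea[OF this, of x] show ?thesis using K by simp
      qed
      have "genfun (diffs (prob_hit 0)) x * genfun prob_weak_rec x = (\<Sum>n. \<Sum>k\<le>n. diffs (prob_hit 0) k * x ^ k * (prob_weak_rec (n - k) * x ^ (n - k)))"
        unfolding genfun_def by (rule Cauchy_product) (rule s summable_norm_genfun[OF prob_coeff(3) x])+
      also have "(\<lambda>n. \<Sum>k\<le>n. diffs (prob_hit 0) k * x ^ k * (prob_weak_rec (n - k) * x ^ (n - k))) = (\<lambda>n. prob_nonneg (Suc n) * x ^ n)"
      proof
        fix n
        have "diffs (prob_hit 0) k * x ^ k * (prob_weak_rec (n - k) * x ^ (n - k)) = diffs (prob_hit 0) k * prob_weak_rec (n - k) * x ^ n" if "k \<le> n" for k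
          using that power_add[of x k "n - k"] by simp
        then show "(\<Sum>k\<le>n. diffs (prob_hit 0) k * x ^ k * (prob_weak_rec (n - k) * x ^ (n - k))) = prob_nonneg (Suc n) * x ^ n"
          unfolding * sum_distrib_right by (intro sum.cong) auto
      qed
      finally show ?thesis by (simp add: genfun_def)
    qed
    have "(genfun (prob_hit 0) has_field_derivative genfun (diffs (prob_hit 0)) x) (at x)"
      by (rule has_field_derivative_genfun[OF prob_coeff(2) x])
    moreover have "(spitzer_series has_field_derivative genfun (\<lambda>n. prob_nonneg (Suc n)) x) (at x)"
      unfolding spitzer_series_def[abs_def] using has_field_derivative_genfun[of "\<lambda>n. prob_nonneg n / real n" 1 x] coeff_L x by (simp add: dL)
    ultimately have "(?h has_field_derivative
        (0 - genfun (diffs (prob_hit 0)) x) * exp (spitzer_series x) + (exp (spitzer_series x) * genfun (\<lambda>n. prob_nonneg (Suc n)) x) * (1 - genfun (prob_hit 0) x)) (at x)"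
      by (auto intro!: derivative_eq_intros)
    moreover have "(0 - genfun (diffs (prob_hit 0)) x) * exp (spitzer_series x) + (exp (spitzer_series x) * genfun (\<lambda>n. prob_nonneg (Suc n)) x) * (1 - genfun (prob_hit 0) x)
       = exp (spitzer_series x) * genfun (diffs (prob_hit 0)) x * (genfun prob_weak_rec x * (1 - genfun (prob_hit 0) x) - 1)"
      unfolding dap by (simp add: algebra_simps)
    ultimately show ?thesis using genfun_prob_weak_rec[OF x] by (metis diff_self mult_zero_right)
  qed
  then have "\<exists>c. \<forall>x\<in>{-1<..<1}. ?h x = c"
    by (intro has_field_derivative_zero_constant) (auto intro: has_field_derivative_at_within)
  then obtain c where c: "\<And>x. x \<in> {-1<..<1} \<Longrightarrow> ?h x = c" by blast
  have "?h z = ?h 0" using z c[of z] c[of 0] by (simp add: abs_less_iff)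
  also have "\<dots> = 1"
  proof -
    have "genfun b 0 = b 0" for b by (simp add: genfun_def powser_zero)
    then show ?thesis by (simp add: spitzer_series_def)
  qed
  finally show ?thesis by (simp add: exp_minus field_simps)
qed

lemma one_minus_genfun_prob_hit_exp:
  "\<bar>z\<bar> < 1 \<Longrightarrow> c > 0 \<Longrightarrow> 1 - genfun (prob_hit c) z = genfun (prob_weak_rec_less c) z * exp (- spitzer_series z)"
  by (simp add: one_minus_genfun_prob_hit_eq genfun_prob_hit_0)

end

section \<open>The renewal structure of the record times\<close>

definition hits :: "real \<Rightarrow> (nat \<Rightarrow> real) \<Rightarrow> bool" where
  "hits c x \<longleftrightarrow> (\<exists>n. hits_at c x n)"

definition hit :: "real \<Rightarrow> (nat \<Rightarrow> real) \<Rightarrow> nat" where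
  "hit c x = (LEAST n. hits_at c x n)"

definition step :: "real \<Rightarrow> (nat \<Rightarrow> real) \<Rightarrow> nat \<Rightarrow> real" where
  "step c x = dropn (hit c x) x"

definition gap :: "real \<Rightarrow> nat \<Rightarrow> (nat \<Rightarrow> real) \<Rightarrow> nat" where
  "gap c l x = hit c ((step c ^^ l) x)"

definition reach :: "real \<Rightarrow> nat \<Rightarrow> (nat \<Rightarrow> real) \<Rightarrow> bool" where
  "reach c m x \<longleftrightarrow> (\<forall>l<m. hits c ((step c ^^ l) x))"

definition tau :: "real \<Rightarrow> nat \<Rightarrow> (nat \<Rightarrow> real) \<Rightarrow> nat" where
  "tau c m x = (\<Sum>l<m. gap c l x)"

definition record_count :: "real \<Rightarrow> nat \<Rightarrow> (nat \<Rightarrow> real) \<Rightarrow> nat" where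
  "record_count c n x = card {k. k \<le> n \<and> weak_sigma_record c (psum x) k}"

lemma sigma_record_count_eq: "sigma_record_count c X n \<omega> = record_count c n (\<lambda>i. X i \<omega>)"
  by (simp add: sigma_record_count_def record_count_def walk_eq_psum)

lemma hit_eq: "hits_at c x n \<Longrightarrow> hit c x = n"
  unfolding hit_def by (rule Least_equality) (auto dest: hits_at_unique)

lemma hits_at_hit: "hits c x \<Longrightarrow> hits_at c x (hit c x)"
  using hit_eq by (auto simp: hits_def)

lemma hits_at_iff: "hits_at c x n \<longleftrightarrow> hits c x \<and> hit c x = n"
  using hits_at_hit hit_eq by (auto simp: hits_def)

lemma gap_0: "gap c 0 x = hit c x"
  and gap_Suc: "gap c (Suc l) x = gap c l (step c x)"
  by (simp_all add: gap_def funpow_swap1)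

lemma reach_0 [simp]: "reach c 0 x"
  by (simp add: reach_def)

lemma reach_Suc: "reach c (Suc m) x \<longleftrightarrow> hits c x \<and> reach c m (step c x)"
  by (auto simp: reach_def less_Suc_eq_0_disj funpow_swap1)

lemma reach_antimono: "m \<le> n \<Longrightarrow> reach c n x \<Longrightarrow> reach c m x"
  by (auto simp: reach_def)

lemma tau_0 [simp]: "tau c 0 x = 0"
  by (simp add: tau_def)

lemma tau_Suc: "tau c (Suc m) x = hit c x + tau c m (step c x)"
  unfolding tau_def by (subst sum.lessThan_Suc_shift) (simp add: gap_0 gap_Suc)

lemma tau_mono: "m \<le> n \<Longrightarrow> tau c m x \<le> tau c n x"
  unfolding tau_def by (intro sum_mono2) auto

lemma weak_sigma_record_dropn:
  assumes "weak_sigma_record c (psum (dropn k x)) i" "weak_sigma_record c (psum x) k"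
  shows "weak_sigma_record c (psum x) (k + i)"
  using assms
proof (induction rule: weak_sigma_record.induct)
  case first
  then show ?case by simp
next
  case (next_record l j)
  show ?case
  proof (rule weak_sigma_record.next_record[OF next_record.IH[OF next_record.prems]])
    show "k + l < k + j" "c \<le> psum x (k + j) - psum x (k + l)"
      using next_record.hyps by (simp_all add: psum_dropn)
    show "psum x i - psum x (k + l) < c" if "k + l < i" "i < k + j" for i
      using next_record.hyps(4)[of "i - k"] that by (simp add: psum_dropn)
  qed
qed

lemma weak_sigma_record_hits_at: "hits_at c x k \<Longrightarrow> weak_sigma_record c (psum x) k"
  by (rule weak_sigma_record.next_record[OF weak_sigma_record.first])
     (auto simp: hits_at_def below_def)

lemma weak_sigma_record_iff:
  "weak_sigma_record c (psum x) j \<longleftrightarrow>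
     j = 0 \<or> (hits c x \<and> hit c x \<le> j \<and> weak_sigma_record c (psum (step c x)) (j - hit c x))"
proof
  assume "weak_sigma_record c (psum x) j"
  then show "j = 0 \<or> (hits c x \<and> hit c x \<le> j \<and> weak_sigma_record c (psum (step c x)) (j - hit c x))"
  proof (induction rule: weak_sigma_record.induct)
    case first
    then show ?case by simp
  next
    case (next_record k j)
    show ?case
    proof (cases "k = 0")
      case True
      then have "hits_at c x j" using next_record.hyps
        by (auto simp: hits_at_def below_def)
      then show ?thesis by (auto simp: hits_at_iff intro: weak_sigma_record.first)
    next
      case False
      with next_record.IH have k: "hits c x" "hit c x \<le> k" "weak_sigma_record c (psum (step c x)) (k - hit c x)"
        by auto
      have "weak_sigma_record c (psum (step c x)) (j - hit c x)"
      proof (rule weak_sigma_record.next_record[OF k(3)])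
        show "k - hit c x < j - hit c x" using k next_record.hyps by auto
        show "c \<le> psum (step c x) (j - hit c x) - psum (step c x) (k - hit c x)"
          using k next_record.hyps by (simp add: step_def psum_dropn)
        show "psum (step c x) i - psum (step c x) (k - hit c x) < c"
          if "k - hit c x < i" "i < j - hit c x" for i
          using k next_record.hyps(4)[of "hit c x + i"] that by (simp add: step_def psum_dropn)
      qed
      then show ?thesis using k next_record.hyps by auto
    qed
  qed
next
  assume "j = 0 \<or> (hits c x \<and> hit c x \<le> j \<and> weak_sigma_record c (psum (step c x)) (j - hit c x))"
  then show "weak_sigma_record c (psum x) j"
    using weak_sigma_record_dropn[of c "hit c x" x "j - hit c x"] weak_sigma_record_hits_at[OF hits_at_hit, of c x]
    by (auto simp: step_def intro: weak_sigma_record.first)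
qed

lemma hit_pos: "hits c x \<Longrightarrow> hit c x \<ge> 1"
  using hits_at_hit[of c x] by (simp add: hits_at_def)

lemma record_count_eq:
  "record_count c n x = (if hits c x \<and> hit c x \<le> n then Suc (record_count c (n - hit c x) (step c x)) else 1)"
proof (cases "hits c x \<and> hit c x \<le> n")
  case True
  let ?B = "{k. k \<le> n - hit c x \<and> weak_sigma_record c (psum (step c x)) k}"
  have "{k. k \<le> n \<and> weak_sigma_record c (psum x) k} = insert 0 ((\<lambda>k. hit c x + k) ` ?B)"
  proof (intro set_eqI iffI)
    fix k assume "k \<in> {k. k \<le> n \<and> weak_sigma_record c (psum x) k}"
    then show "k \<in> insert 0 ((\<lambda>k. hit c x + k) ` ?B)"
      by (auto simp: weak_sigma_record_iff[of c x k] image_iff intro!: exI[of _ "k - hit c x"])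
  next
    fix k assume "k \<in> insert 0 ((\<lambda>k. hit c x + k) ` ?B)"
    then show "k \<in> {k. k \<le> n \<and> weak_sigma_record c (psum x) k}"
      using True by (auto simp: weak_sigma_record_iff[of c x k] weak_sigma_record.first)
  qed
  moreover have "0 \<notin> (\<lambda>k. hit c x + k) ` ?B" using True hit_pos[of c x] by auto
  ultimately have "record_count c n x = Suc (card ((\<lambda>k. hit c x + k) ` ?B))"
    unfolding record_count_def by simp
  also have "card ((\<lambda>k. hit c x + k) ` ?B) = card ?B" by (rule card_image) (simp add: inj_on_def)
  finally show ?thesis using True by (simp add: record_count_def)
next
  case False
  then have "{k. k \<le> n \<and> weak_sigma_record c (psum x) k} = {0}"
    by (auto simp: weak_sigma_record_iff[of c x])
  then have "record_count c n x = 1" by (simp add: record_count_def)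
  then show ?thesis using False by auto
qed

lemma less_record_count_iff: "m < record_count c n x \<longleftrightarrow> reach c m x \<and> tau c m x \<le> n"
proof (induction m arbitrary: n x)
  case 0
  then show ?case by (simp add: record_count_eq[of c n x])
next
  case (Suc m)
  show ?case
    unfolding record_count_eq[of c n x] reach_Suc tau_Suc using Suc.IH[of "n - hit c x" "step c x"] by auto
qed

context iid_steps begin

lemma measurable_hit [measurable]: "hit c \<in> measurable S (count_space UNIV)"
  unfolding hit_def by measurable

lemma pred_hits [measurable]: "Measurable.pred S (hits c)"
  unfolding hits_def[abs_def] by measurable

lemma measurable_step [measurable]: "step c \<in> measurable S S"
  unfolding step_def[abs_def]
  by (rule measurable_compose_countable[where g="hit c", OF measurable_dropn measurable_hit])

lemma measurable_step_funpow [measurable]: "(step c ^^ l) \<in> measurable S S"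
proof (induction l)
  case 0
  then show ?case by (simp add: id_def)
next
  case (Suc l)
  then show ?case unfolding funpow.simps by (rule measurable_comp) (rule measurable_step)
qed

lemma measurable_gap [measurable]: "gap c l \<in> measurable S (count_space UNIV)"
  unfolding gap_def[abs_def] by (rule measurable_compose[OF measurable_step_funpow measurable_hit])

lemma pred_reach [measurable]: "Measurable.pred S (reach c m)"
proof -
  have [measurable]: "Measurable.pred S (\<lambda>x. hits c ((step c ^^ l) x))" for l
    by (rule measurable_compose[OF measurable_step_funpow pred_hits])
  show ?thesis unfolding reach_def[abs_def] by measurable
qed

lemma measurable_tau [measurable]: "tau c m \<in> measurable S (count_space UNIV)"
  unfolding tau_def[abs_def] by measurable

definition gap_weight :: "real \<Rightarrow> (nat \<Rightarrow> real) \<Rightarrow> nat \<Rightarrow> (nat \<Rightarrow> real) \<Rightarrow> real" where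
  "gap_weight c z m x = of_bool (reach c m x) * (\<Prod>l<m. z l ^ gap c l x)"

lemma measurable_gap_weight [measurable]: "gap_weight c z m \<in> borel_measurable S"
  unfolding gap_weight_def[abs_def] by measurable

lemma gap_weight_Suc:
  "gap_weight c z (Suc m) x = of_bool (hits c x) * z 0 ^ hit c x * gap_weight c (\<lambda>l. z (Suc l)) m (step c x)"
  unfolding gap_weight_def reach_Suc
  by (subst prod.lessThan_Suc_shift) (simp add: gap_0 gap_Suc)

lemma gap_weight_nonneg: "(\<And>l. 0 \<le> z l) \<Longrightarrow> 0 \<le> gap_weight c z m x"
  by (simp add: gap_weight_def prod_nonneg)

lemma sums_prob_hit: assumes z: "0 \<le> z" "z \<le> 1"
  shows "summable (\<lambda>n. prob_hit c n * z ^ n)"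
proof (rule summable_comparison_test')
  show "summable (\<lambda>n. prob_hit c n)"
  proof -
    have "(\<lambda>n. P.prob {x. hits_at c x n}) sums P.prob (\<Union>n. {x. hits_at c x n})"
    proof (rule P.finite_measure_UNION)
      show "range (\<lambda>n. {x. hits_at c x n}) \<subseteq> sets S"
        using sets_Collect_S[OF pred_hits_at] by auto
      show "disjoint_family (\<lambda>n. {x. hits_at c x n})"
        by (auto simp: disjoint_family_on_def dest: hits_at_unique)
    qed
    then show ?thesis by (auto simp: prob_hit_def[abs_def] sums_iff)
  qed
  show "norm (prob_hit c n * z ^ n) \<le> prob_hit c n" for n
    using z by (auto simp: abs_mult intro!: mult_left_le power_le_one)
qed

lemma nn_integral_gap_weight:
  assumes z: "\<And>l. 0 \<le> z l" "\<And>l. z l \<le> 1"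
  shows "(\<integral>\<^sup>+x. ennreal (gap_weight c z m x) \<partial>S) = ennreal (\<Prod>l<m. genfun (prob_hit c) (z l))"
  using z
proof (induction m arbitrary: z)
  case 0
  then show ?case using P.emeasure_space_1 by (simp add: gap_weight_def)
next
  case (Suc m)
  let ?z = "\<lambda>l. z (Suc l)"
  have ms: "{x. hits_at c x n} \<in> sets S" for n by (rule sets_Collect_S[OF pred_hits_at])
  have "(\<integral>\<^sup>+x. ennreal (gap_weight c z (Suc m) x) \<partial>S)
      = (\<integral>\<^sup>+x. (\<Sum>n. (indicator {x. hits_at c x n} x * ennreal (z 0 ^ n)) * ennreal (gap_weight c ?z m (dropn n x))) \<partial>S)"
  proof (rule nn_integral_cong)
    fix x
    show "ennreal (gap_weight c z (Suc m) x) =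
      (\<Sum>n. (indicator {x. hits_at c x n} x * ennreal (z 0 ^ n)) * ennreal (gap_weight c ?z m (dropn n x)))"
    proof (cases "hits c x")
      case True
      have "(\<Sum>n. (indicator {x. hits_at c x n} x * ennreal (z 0 ^ n)) * ennreal (gap_weight c ?z m (dropn n x)))
          = (\<Sum>n\<in>{hit c x}. (indicator {x. hits_at c x n} x * ennreal (z 0 ^ n)) * ennreal (gap_weight c ?z m (dropn n x)))"
        by (rule suminf_finite) (auto simp: hits_at_iff)
      then show ?thesis using True Suc.prems
        by (simp add: gap_weight_Suc hits_at_hit step_def ennreal_mult gap_weight_nonneg)
    next
      case False
      then show ?thesis by (simp add: gap_weight_Suc hits_at_iff)
    qed
  qed
  also have "\<dots> = (\<Sum>n. \<integral>\<^sup>+x. (indicator {x. hits_at c x n} x * ennreal (z 0 ^ n)) * ennreal (gap_weight c ?z m (dropn n x)) \<partial>S)"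
    using ms by (intro nn_integral_suminf) (auto intro!: borel_measurable_times_ennreal measurable_compose[OF measurable_dropn])
  also have "\<dots> = (\<Sum>n. ennreal (prob_hit c n * z 0 ^ n) * ennreal (\<Prod>l<m. genfun (prob_hit c) (?z l)))"
  proof (rule suminf_cong)
    fix n
    have "(\<integral>\<^sup>+x. (indicator {x. hits_at c x n} x * ennreal (z 0 ^ n)) * ennreal (gap_weight c ?z m (dropn n x)) \<partial>S)
       = (\<integral>\<^sup>+x. indicator {x. hits_at c x n} x * ennreal (z 0 ^ n) \<partial>S) * (\<integral>\<^sup>+x. ennreal (gap_weight c ?z m x) \<partial>S)"
    proof (rule nn_integral_split)
      show "indicator {x. hits_at c x n} x * ennreal (z 0 ^ n) = indicator {x. hits_at c x n} y * ennreal (z 0 ^ n)"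
        if "\<And>i. i < n \<Longrightarrow> x i = y i" for x y
        using hits_at_cong[of n x y c, OF that] by (simp add: indicator_def)
    qed (use ms in auto)
    also have "(\<integral>\<^sup>+x. indicator {x. hits_at c x n} x * ennreal (z 0 ^ n) \<partial>S) = emeasure S {x. hits_at c x n} * ennreal (z 0 ^ n)"
      using ms by (simp add: nn_integral_multc)
    also have "\<dots> = ennreal (prob_hit c n * z 0 ^ n)"
      using Suc.prems by (simp add: prob_hit_def P.emeasure_eq_measure ennreal_mult)
    finally show "(\<integral>\<^sup>+x. (indicator {x. hits_at c x n} x * ennreal (z 0 ^ n)) * ennreal (gap_weight c ?z m (dropn n x)) \<partial>S)
       = ennreal (prob_hit c n * z 0 ^ n) * ennreal (\<Prod>l<m. genfun (prob_hit c) (?z l))"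
      using Suc.IH[of ?z] Suc.prems by simp
  qed
  also have "\<dots> = (\<Sum>n. ennreal (prob_hit c n * z 0 ^ n)) * ennreal (\<Prod>l<m. genfun (prob_hit c) (?z l))"
    by simp
  also have "(\<Sum>n. ennreal (prob_hit c n * z 0 ^ n)) = ennreal (genfun (prob_hit c) (z 0))"
    unfolding genfun_def using Suc.prems sums_prob_hit[of "z 0" c] by (intro suminf_ennreal2) auto
  also have "\<dots> * ennreal (\<Prod>l<m. genfun (prob_hit c) (?z l)) = ennreal (\<Prod>l<Suc m. genfun (prob_hit c) (z l))"
    using Suc.prems by (subst prod.lessThan_Suc_shift, subst ennreal_mult)
      (auto intro!: genfun_nonneg sums_prob_hit prod_nonneg)
  finally show ?case .
qed

lemma integral_gap_weight:
  assumes z: "\<And>l. 0 \<le> z l" "\<And>l. z l \<le> 1"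
  shows "(\<integral>x. gap_weight c z m x \<partial>S) = (\<Prod>l<m. genfun (prob_hit c) (z l))"
proof -
  have "0 \<le> (\<Prod>l<m. genfun (prob_hit c) (z l))"
    using z by (intro prod_nonneg ballI genfun_nonneg sums_prob_hit) auto
  then show ?thesis
    using nn_integral_gap_weight[of z c m] z
    by (subst integral_eq_nn_integral) (auto simp: gap_weight_nonneg)
qed

lemma prob_reach: "P.prob {x. reach c m x} = genfun (prob_hit c) 1 ^ m"
proof -
  have "P.prob {x. reach c m x} = (\<integral>x. indicator {x. reach c m x} x \<partial>S)"
    using sets_Collect_S[OF pred_reach] by simp
  also have "\<dots> = (\<integral>x. gap_weight c (\<lambda>_. 1) m x \<partial>S)"
    by (intro Bochner_Integration.integral_cong) (auto simp: gap_weight_def indicator_def)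
  finally show ?thesis by (simp add: integral_gap_weight)
qed

lemma AE_reach:
  assumes "genfun (prob_hit c) 1 = 1" shows "AE x in S. \<forall>m. reach c m x"
  unfolding AE_all_countable
proof
  fix m
  have "P.prob {x\<in>space S. reach c m x} = 1" using prob_reach[of c m] assms by simp
  then show "AE x in S. reach c m x"
    using sets_Collect_S[OF pred_reach] by (subst (asm) P.prob_Collect_eq_1) simp_all
qed

end

section \<open>The ladder renewal function\<close>

lemma weak_record_times_psum: "weak_record_times (psum s) = {n. n \<ge> 1 \<and> weak_rec s n}"
proof -
  have "psum s n = Max (psum s ` {0..n}) \<longleftrightarrow> weak_rec s n" for n
  proof
    assume *: "psum s n = Max (psum s ` {0..n})"
    have "psum s j \<le> Max (psum s ` {0..n})" if "j \<le> n" for j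
      using that by (intro Max_ge) auto
    then show "weak_rec s n" using * by (simp add: weak_rec_def)
  next
    assume "weak_rec s n"
    then show "psum s n = Max (psum s ` {0..n})"
      by (intro Max_eqI[symmetric]) (auto simp: weak_rec_def)
  qed
  then show ?thesis by (simp add: weak_record_times_def)
qed

lemma card_less_inj:
  fixes W :: "nat set"
  assumes "k \<in> W" "l \<in> W" "card (W \<inter> {..<k}) = card (W \<inter> {..<l})"
  shows "k = l"
proof -
  have "card (W \<inter> {..<a}) < card (W \<inter> {..<b})" if "a \<in> W" "a < b" for a b
    using that by (intro psubset_card_mono) auto
  then show ?thesis using assms by (metis linorder_neqE_nat less_irrefl)
qed

lemma enumerate_card_less:
  fixes W :: "nat set"
  assumes "\<not> (finite W \<and> card W < Suc n)"
  shows "enumerate W n \<in> W \<and> card (W \<inter> {..<enumerate W n}) = n"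
proof -
  have mono: "enumerate W i < enumerate W j" if "i < j" "j \<le> n" for i j
    using that assms by (cases "finite W") (auto intro: enumerate_mono finite_enumerate_mono)
  have mem: "enumerate W i \<in> W" if "i \<le> n" for i
    using that assms by (cases "finite W") (auto intro: enumerate_in_set finite_enumerate_in_set)
  have "W \<inter> {..<enumerate W n} = enumerate W ` {..<n}"
  proof (intro set_eqI iffI)
    fix k assume k: "k \<in> W \<inter> {..<enumerate W n}"
    then obtain i where i: "k = enumerate W i" "finite W \<longrightarrow> i < card W"
      using enumerate_Ex[of W k] finite_enumerate_Ex[of W k] by (cases "finite W") auto
    have "i < n"
    proof (rule ccontr)
      assume "\<not> i < n"
      then have "enumerate W n \<le> enumerate W i"
      proof (cases "i = n")
        case False
        with \<open>\<not> i < n\<close> have "n < i" by simp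
        then have "enumerate W n < enumerate W i"
          using i(2) by (cases "finite W") (simp_all add: enumerate_mono finite_enumerate_mono)
        then show ?thesis by simp
      qed simp
      then show False using k i by auto
    qed
    then show "k \<in> enumerate W ` {..<n}" using i by auto
  qed (use mono mem in \<open>auto intro: less_imp_le\<close>)
  moreover have "inj_on (enumerate W) {..<n}"
    by (rule inj_onI) (metis lessThan_iff less_imp_le less_irrefl linorder_neqE_nat mono)
  ultimately show ?thesis using mem by (simp add: card_image)
qed

lemma weak_ladder_height_Suc_le_iff:
  "weak_ladder_height (psum s) (Suc n) \<le> ereal x \<longleftrightarrow>
   (\<exists>k. k \<ge> 1 \<and> weak_rec s k \<and> card {j. 1 \<le> j \<and> j < k \<and> weak_rec s j} = n \<and> psum s k \<le> x)"
proof -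
  define W where "W = {n. n \<ge> 1 \<and> weak_rec s n}"
  have W: "weak_record_times (psum s) = W" by (simp add: W_def weak_record_times_psum)
  have W_int: "{j. 1 \<le> j \<and> j < k \<and> weak_rec s j} = W \<inter> {..<k}" for k by (auto simp: W_def)
  have "weak_ladder_height (psum s) (Suc n) \<le> ereal x \<longleftrightarrow>
      (\<exists>k\<in>W. card (W \<inter> {..<k}) = n \<and> psum s k \<le> x)"
  proof (cases "finite W \<and> card W < Suc n")
    case True
    have "card (W \<inter> {..<k}) < n" if "k \<in> W" for k
    proof -
      have "card (W \<inter> {..<k}) < card W" using that True by (intro psubset_card_mono) auto
      then show ?thesis using True by simp
    qed
    then show ?thesis
      using True by (auto simp: weak_ladder_height_def W)
  next
    case False
    note * = enumerate_card_less[OF False]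
    have "(\<exists>k\<in>W. card (W \<inter> {..<k}) = n \<and> psum s k \<le> x) \<longleftrightarrow> psum s (enumerate W n) \<le> x"
      using * card_less_inj by metis
    then show ?thesis
      using False by (auto simp: weak_ladder_height_def W Let_def)
  qed
  then show ?thesis unfolding W_int by (auto simp: W_def)
qed

lemma card_late_jumps:
  fixes x \<epsilon> :: real
  assumes "N * \<epsilon> > x"
  shows "card {k. k < K \<and> weak_rec s k \<and> psum s k \<le> x \<and> (\<forall>i<N. \<epsilon> \<le> dropn k s i)} \<le> N" (is "card ?A \<le> N")
proof (cases "?A = {}")
  case False
  have fin: "finite ?A" by simp
  define k where "k = Min ?A"
  have k: "k \<in> ?A" unfolding k_def by (rule Min_in[OF fin False])
  have "?A \<subseteq> {k..<k + N}"
  proof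
    fix l assume l: "l \<in> ?A"
    then have "k \<le> l" unfolding k_def by (intro Min_le fin)
    moreover have "l < k + N"
    proof (rule ccontr)
      assume "\<not> l < k + N"
      then have "psum s (k + N) \<le> psum s l" using l by (simp add: weak_rec_def)
      moreover have "psum (dropn k s) N \<ge> (\<Sum>i<N. \<epsilon>)"
        unfolding psum_def using k by (intro sum_mono) auto
      moreover have "psum s k \<ge> 0" using k by (auto simp: weak_rec_def dest!: spec[of _ 0])
      ultimately show False using assms l by (simp add: psum_dropn)
    qed
    ultimately show "l \<in> {k..<k + N}" by simp
  qed
  then have "card ?A \<le> card {k..<k + N}" by (intro card_mono) auto
  then show ?thesis by simp
next
  case True
  then show ?thesis by (simp only: card.empty)
qed

lemma ex_ge_1_iff: "(\<exists>k::nat. k \<ge> 1 \<and> R k) \<longleftrightarrow> (\<exists>k. R (Suc k))"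
proof
  assume "\<exists>k::nat. k \<ge> 1 \<and> R k"
  then obtain k where "k \<ge> 1" "R k" by blast
  then show "\<exists>k. R (Suc k)" by (intro exI[of _ "k - 1"]) simp
next
  assume "\<exists>k. R (Suc k)"
  then obtain k where "R (Suc k)" by blast
  then show "\<exists>k::nat. k \<ge> 1 \<and> R k" by (intro exI[of _ "Suc k"]) simp
qed

lemma card_eq_sum_of_bool: "card {j::nat. 1 \<le> j \<and> j < k \<and> Q j} = (\<Sum>j<k. of_bool (1 \<le> j \<and> Q j))"
proof -
  have "{j. 1 \<le> j \<and> j < k \<and> Q j} = {..<k} \<inter> {j. 1 \<le> j \<and> Q j}" by auto
  moreover have "(\<Sum>j\<in>{..<k}. of_bool (1 \<le> j \<and> Q j)) = card ({..<k} \<inter> {j. 1 \<le> j \<and> Q j})"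
    by (subst sum_of_bool_eq) auto
  ultimately show ?thesis by metis
qed

context iid_steps begin

definition "prob_weak_rec_le x n = P.prob {s. weak_rec s n \<and> psum s n \<le> x}"

definition "ladder_V x = (\<Sum>n. P.prob {s. weak_ladder_height (psum s) n \<le> ereal x})"

lemma measurable_card_weak_rec [measurable]:
  "(\<lambda>s. card {j. 1 \<le> j \<and> j < k \<and> weak_rec s j}) \<in> measurable S (count_space UNIV)"
  unfolding card_eq_sum_of_bool by measurable

lemma pred_weak_ladder_height: "Measurable.pred S (\<lambda>s. weak_ladder_height (psum s) n \<le> ereal x)"
proof (cases n)
  case 0
  then show ?thesis by (simp add: weak_ladder_height_def)
next
  case (Suc m)
  show ?thesis unfolding Suc weak_ladder_height_Suc_le_iff by measurable
qed

lemma suminf_prob_weak_rec_le: "(\<Sum>k. ennreal (prob_weak_rec_le x k)) = (\<Sum>n. ennreal (P.prob {s. weak_ladder_height (psum s) n \<le> ereal x}))"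
proof -
  let ?c = "\<lambda>s k. card {j. 1 \<le> j \<and> j < k \<and> weak_rec s j}"
  let ?A = "\<lambda>n k. {s. weak_rec s (Suc k) \<and> ?c s (Suc k) = n \<and> psum s (Suc k) \<le> x}"
  have mA: "?A n k \<in> sets S" for n k
    by (rule sets_Collect_S) measurable
  have 1: "emeasure S {s. weak_ladder_height (psum s) (Suc n) \<le> ereal x} = (\<Sum>k. emeasure S (?A n k))" for n
  proof -
    have "{s. weak_ladder_height (psum s) (Suc n) \<le> ereal x} = (\<Union>k. ?A n k)"
    proof (rule set_eqI)
      fix s
      show "s \<in> {s. weak_ladder_height (psum s) (Suc n) \<le> ereal x} \<longleftrightarrow> s \<in> (\<Union>k. ?A n k)"
        using ex_ge_1_iff[of "\<lambda>k. weak_rec s k \<and> ?c s k = n \<and> psum s k \<le> x"]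
        unfolding weak_ladder_height_Suc_le_iff by blast
    qed
    moreover have "disjoint_family (?A n)"
      unfolding disjoint_family_on_def
    proof (intro ballI impI)
      fix k l :: nat assume "k \<noteq> l"
      show "?A n k \<inter> ?A n l = {}"
      proof (rule ccontr)
        assume "?A n k \<inter> ?A n l \<noteq> {}"
        then obtain s where s: "s \<in> ?A n k" "s \<in> ?A n l" by blast
        let ?W = "{j. 1 \<le> j \<and> weak_rec s j}"
        have W: "{j. 1 \<le> j \<and> j < a \<and> weak_rec s j} = ?W \<inter> {..<a}" for a by auto
        have "Suc k \<in> ?W" "Suc l \<in> ?W" using s by simp_all
        moreover have "?c s (Suc k) = n" "?c s (Suc l) = n" using s by blast+
        then have "card (?W \<inter> {..<Suc k}) = card (?W \<inter> {..<Suc l})" by (simp only: W)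
        ultimately have "Suc k = Suc l" by (rule card_less_inj)
        then show False using \<open>k \<noteq> l\<close> by simp
      qed
    qed
    ultimately show ?thesis using mA by (simp add: suminf_emeasure image_subset_iff)
  qed
  have 2: "(\<Sum>n. emeasure S (?A n k)) = ennreal (prob_weak_rec_le x (Suc k))" for k
  proof -
    have "(\<Union>n. ?A n k) = {s. weak_rec s (Suc k) \<and> psum s (Suc k) \<le> x}" by auto
    moreover have "disjoint_family (\<lambda>n. ?A n k)" by (auto simp: disjoint_family_on_def)
    ultimately show ?thesis using mA
      by (subst suminf_emeasure) (auto simp: prob_weak_rec_le_def P.emeasure_eq_measure image_subset_iff)
  qed
  have 0: "P.prob {s. weak_ladder_height (psum s) 0 \<le> ereal x} = prob_weak_rec_le x 0"
    by (simp add: weak_ladder_height_def prob_weak_rec_le_def weak_rec_def)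
  have "(\<Sum>n. ennreal (P.prob {s. weak_ladder_height (psum s) n \<le> ereal x}))
      = ennreal (prob_weak_rec_le x 0) + (\<Sum>n. emeasure S {s. weak_ladder_height (psum s) (Suc n) \<le> ereal x})"
    by (subst suminf_offset[of _ 1]) (simp_all add: 0 P.emeasure_eq_measure)
  also have "(\<Sum>n. emeasure S {s. weak_ladder_height (psum s) (Suc n) \<le> ereal x}) = (\<Sum>n k. emeasure S (?A n k))"
    by (simp only: 1)
  also have "\<dots> = (\<integral>\<^sup>+n. (\<Sum>k. emeasure S (?A n k)) \<partial>count_space UNIV)"
    by (rule nn_integral_count_space_nat[symmetric])
  also have "\<dots> = (\<Sum>k. \<integral>\<^sup>+n. emeasure S (?A n k) \<partial>count_space UNIV)"
    by (rule nn_integral_suminf) simp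
  also have "\<dots> = (\<Sum>k n. emeasure S (?A n k))"
    by (simp only: nn_integral_count_space_nat)
  also have "\<dots> = (\<Sum>k. ennreal (prob_weak_rec_le x (Suc k)))" by (simp only: 2)
  also have "ennreal (prob_weak_rec_le x 0) + \<dots> = (\<Sum>k. ennreal (prob_weak_rec_le x k))"
    by (subst suminf_offset[of "\<lambda>k. ennreal (prob_weak_rec_le x k)" 1]) simp_all
  finally show ?thesis by simp
qed

lemma prob_weak_rec_le_nonneg [simp]: "0 \<le> prob_weak_rec_le x n" by (simp add: prob_weak_rec_le_def)

lemma prob_all_ge_pos:
  assumes "P.prob {s. \<epsilon> \<le> s 0} > 0" shows "P.prob {s. \<forall>i<N. \<epsilon> \<le> s i} > 0"
proof (induction N)
  case 0
  then show ?case using P.prob_space by simp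
next
  case (Suc N)
  have [measurable]: "(\<lambda>x. x i) \<in> borel_measurable S" for i by (rule measurable_coord)
  have "{s. \<forall>i<Suc N. \<epsilon> \<le> s i} = {s. \<epsilon> \<le> s 0 \<and> (\<forall>i<N. \<epsilon> \<le> dropn 1 s i)}"
    by (auto simp: dropn_def less_Suc_eq_0_disj)
  moreover have "P.prob {s. \<epsilon> \<le> s 0 \<and> (\<forall>i<N. \<epsilon> \<le> dropn 1 s i)} = P.prob {s. \<epsilon> \<le> s 0} * P.prob {s. \<forall>i<N. \<epsilon> \<le> s i}"
  proof (rule prob_split)
    show "Measurable.pred S (\<lambda>s. \<epsilon> \<le> s 0)" by (intro borel_measurable_pred_le measurable_coord) simp
    show "Measurable.pred S (\<lambda>s. \<forall>i<N. \<epsilon> \<le> s i)"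
      by (intro pred_intros_countable pred_intros_imp' borel_measurable_pred_le measurable_coord) simp
  qed simp
  ultimately show ?case using Suc assms by simp
qed

lemma summable_prob_weak_rec_le:
  assumes nondeg: "\<not> (\<exists>c. AE s in S. s 0 = c)"
  shows "summable (prob_weak_rec_le x)"
proof (cases "P.prob {s. s 0 > 0} > 0")
  case True
  have mc: "{s. a \<le> s i} \<in> sets S" for a i
    by (rule sets_Collect_S) (intro borel_measurable_pred_le measurable_coord; simp)
  have "\<exists>\<epsilon>>0. P.prob {s. \<epsilon> \<le> s 0} > 0"
  proof (rule ccontr)
    assume no: "\<not> (\<exists>\<epsilon>>0. P.prob {s. \<epsilon> \<le> s 0} > 0)"
    then have *: "P.prob {s. \<epsilon> \<le> s 0} = 0" if e: "\<epsilon> > 0" for \<epsilon>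
      using no e measure_nonneg[of S "{s. \<epsilon> \<le> s 0}"] by (auto simp: less_le)
    have "{s::nat \<Rightarrow> real. s 0 > 0} = (\<Union>n. {s. inverse (real (Suc n)) \<le> s 0})" (is "_ = ?U")
    proof (intro set_eqI iffI)
      fix s :: "nat \<Rightarrow> real" assume "s \<in> {s. s 0 > 0}"
      then obtain n where "inverse (real (Suc n)) < s 0" using reals_Archimedean by auto
      then show "s \<in> ?U" by (auto intro: less_imp_le)
    next
      fix s :: "nat \<Rightarrow> real" assume "s \<in> ?U"
      then obtain n where "inverse (real (Suc n)) \<le> s 0" by auto
      moreover have "inverse (real (Suc n)) > 0" by simp
      ultimately have "s 0 > 0" by linarith
      then show "s \<in> {s. s 0 > 0}" by simp
    qed
    moreover have "P.prob ?U = 0"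
      by (rule P.measure_countably_zero) (use * mc in auto)
    ultimately have "P.prob {s. s 0 > 0} = 0" by (simp only:)
    then show False using True by (simp only: less_irrefl)
  qed
  then obtain \<epsilon> where \<epsilon>: "\<epsilon> > 0" "P.prob {s. \<epsilon> \<le> s 0} > 0" by blast
  obtain N :: nat where "x < real N * \<epsilon>" using ex_less_of_nat_mult[OF \<epsilon>(1)] by auto
  define p where "p = P.prob {s. \<forall>i<N. \<epsilon> \<le> s i}"
  have "p > 0" unfolding p_def by (rule prob_all_ge_pos[OF \<epsilon>(2)])
  let ?E = "\<lambda>k s. (weak_rec s k \<and> psum s k \<le> x) \<and> (\<forall>i<N. \<epsilon> \<le> dropn k s i)"
  have predN: "Measurable.pred S (\<lambda>s. \<forall>i<N. \<epsilon> \<le> s i)"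
    by (intro pred_intros_countable pred_intros_imp' borel_measurable_pred_le measurable_coord) simp
  have pE: "P.prob {s. ?E k s} = prob_weak_rec_le x k * p" for k
    unfolding prob_weak_rec_le_def p_def
  proof (rule prob_split[OF _ predN])
    show "(weak_rec s k \<and> psum s k \<le> x) = (weak_rec t k \<and> psum t k \<le> x)" if "\<And>i. i < k \<Longrightarrow> s i = t i" for s t
      using weak_rec_cong[of k s t] psum_cong[of k s t] that by simp
  qed measurable
  have mE: "{s. ?E k s} \<in> sets S" for k
    by (rule sets_Collect_S) (intro pred_intros_logic pred_weak_rec borel_measurable_pred_le measurable_psum
      measurable_compose[OF measurable_dropn predN]; simp)
  show ?thesis
  proof (rule summableI_nonneg_bounded)
    show "(\<Sum>k<K. prob_weak_rec_le x k) \<le> real N / p" for K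
    proof -
      have "(\<Sum>k<K. prob_weak_rec_le x k) * p = (\<Sum>k<K. P.prob {s. ?E k s})"
        unfolding pE sum_distrib_right ..
      also have "\<dots> = (\<Sum>k<K. \<integral>s. indicator {s. ?E k s} s \<partial>S)"
        using mE by simp
      also have "\<dots> = (\<integral>s. (\<Sum>k<K. indicator {s. ?E k s} s) \<partial>S)"
        using mE by (intro Bochner_Integration.integral_sum[symmetric]) (auto simp: P.emeasure_eq_measure)
      also have "\<dots> \<le> real N"
      proof (rule P.integral_le_const)
        show "integrable S (\<lambda>s. \<Sum>k<K. indicator {s. ?E k s} s :: real)"
          using mE by (intro Bochner_Integration.integrable_sum) (auto simp: P.emeasure_eq_measure)
        show "AE s in S. (\<Sum>k<K. indicator {s. ?E k s} s) \<le> real N"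
        proof (rule AE_I2)
          fix s
          have "(\<Sum>k<K. indicator {s. ?E k s} s) = real (card {k. k < K \<and> weak_rec s k \<and> psum s k \<le> x \<and> (\<forall>i<N. \<epsilon> \<le> dropn k s i)})"
            by (simp add: indicator_def sum.If_cases Int_def)
          then show "(\<Sum>k<K. indicator {s. ?E k s} s) \<le> real N"
            using card_late_jumps[OF \<open>x < real N * \<epsilon>\<close>, of K s] by simp
        qed
      qed
      finally show ?thesis using \<open>p > 0\<close> by (simp add: field_simps)
    qed
  qed simp
next
  case False
  then have "P.prob {s. s 0 > 0} = 0" using measure_nonneg[of S "{s. s 0 > 0}"] by (auto simp: less_le)
  have coord: "P.prob {s. s i > 0} = 0" for i
  proof -
    have "P.prob {s. (\<lambda>j. s (j + i)) 0 > 0} = P.prob {s. s 0 > 0}"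
      by (rule prob_reindex) (auto intro!: borel_measurable_pred_less measurable_coord simp: inj_on_def)
    then show ?thesis using \<open>P.prob {s. s 0 > 0} = 0\<close> by simp
  qed
  have m0: "{s. s i > 0} \<in> sets S" "{s. s 0 < 0} \<in> sets S" for i
    by (rule sets_Collect_S; intro borel_measurable_pred_less measurable_coord; simp)+
  have le0: "AE s in S. \<forall>i. s i \<le> 0"
    unfolding AE_all_countable
  proof
    fix i
    have "AE s in S. s \<notin> {s. s i > 0}"
      using coord[of i] m0(1)[of i] by (intro AE_not_in null_setsI) (simp_all add: P.emeasure_eq_measure)
    then show "AE s in S. s i \<le> 0" by (rule AE_mp) (auto intro!: AE_I2)
  qed
  define \<delta> where "\<delta> = P.prob {s. s 0 < 0}"
  have "\<delta> > 0"
  proof (rule ccontr)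
    assume "\<not> \<delta> > 0"
    then have "\<delta> = 0" using measure_nonneg[of S "{s. s 0 < 0}"] by (auto simp: less_le \<delta>_def)
    then have "AE s in S. s \<notin> {s. s 0 < 0}"
      unfolding \<delta>_def using m0(2) by (intro AE_not_in null_setsI) (simp_all add: P.emeasure_eq_measure)
    with le0 have "AE s in S. s 0 = 0" by eventually_elim (auto intro: antisym)
    then show False using nondeg by blast
  qed
  have prob_below_ge: "prob_below 0 n \<ge> \<delta>" for n
    unfolding prob_below_def \<delta>_def
  proof (rule P.finite_measure_mono_AE)
    show "AE s in S. s \<in> {s. s 0 < 0} \<longrightarrow> s \<in> {s. below 0 s n}"
      using le0
    proof eventually_elim
      case (elim s)
      have "psum s (Suc i) < 0" if "s 0 < 0" for i
        using elim that by (induction i) (auto simp: psum_Suc intro: add_neg_nonpos)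
      then show ?case by (auto simp: below_def) (metis Suc_le_D)
    qed
    show "{s. below 0 s n} \<in> sets S" by (rule sets_Collect_S[OF pred_below])
  qed
  show ?thesis
  proof (rule summableI_nonneg_bounded)
    show "(\<Sum>k<n. prob_weak_rec_le x k) \<le> 1 / \<delta>" for n
    proof -
      have "(\<Sum>k<n. prob_weak_rec_le x k) * \<delta> \<le> (\<Sum>k\<le>n. prob_weak_rec_le x k * \<delta>)"
        unfolding sum_distrib_right using \<open>\<delta> > 0\<close> by (intro sum_mono2) auto
      also have "\<dots> \<le> (\<Sum>k\<le>n. prob_weak_rec_le x k * prob_below 0 (n - k))"
        by (intro sum_mono mult_left_mono prob_below_ge) auto
      also have "\<dots> = P.prob {s. \<forall>i\<le>n. psum s i \<le> x}"
        unfolding prob_weak_rec_le_def by (rule prob_last_maximum[symmetric]) auto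
      also have "\<dots> \<le> 1" by simp
      finally show ?thesis using \<open>\<delta> > 0\<close> by (simp add: field_simps)
    qed
  qed simp
qed

lemma ladder_V_eq:
  assumes nondeg: "\<not> (\<exists>c. AE s in S. s 0 = c)"
  shows "ladder_V x = suminf (prob_weak_rec_le x)"
proof -
  have "(\<Sum>n. ennreal (P.prob {s. weak_ladder_height (psum s) n \<le> ereal x})) = ennreal (suminf (prob_weak_rec_le x))"
    unfolding suminf_prob_weak_rec_le[symmetric] using summable_prob_weak_rec_le[OF nondeg] by (intro suminf_ennreal2) auto
  moreover from this have "summable (\<lambda>n. P.prob {s. weak_ladder_height (psum s) n \<le> ereal x})"
    by (intro summable_suminf_not_top) auto
  ultimately have "ennreal (ladder_V x) = ennreal (suminf (prob_weak_rec_le x))"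
    unfolding ladder_V_def by (subst suminf_ennreal2[symmetric]) auto
  then show ?thesis
    using summable_prob_weak_rec_le[OF nondeg] \<open>summable (\<lambda>n. P.prob {s. weak_ladder_height (psum s) n \<le> ereal x})\<close>
    by (subst (asm) ennreal_inj) (auto simp: ladder_V_def intro!: suminf_nonneg)
qed

lemma prob_weak_rec_le_0: "0 \<le> x \<Longrightarrow> prob_weak_rec_le x 0 = 1"
  using P.prob_space by (simp add: prob_weak_rec_le_def weak_rec_def)

lemma prob_weak_rec_le_neg: "x < 0 \<Longrightarrow> prob_weak_rec_le x n = 0"
proof -
  assume "x < 0"
  then have "{s. weak_rec s n \<and> psum s n \<le> x} = {}"
    by (force simp: weak_rec_def dest: spec[of _ 0])
  then show ?thesis unfolding prob_weak_rec_le_def by (simp only: measure_empty)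
qed

lemma ladder_V_continuity:
  assumes nondeg: "\<not> (\<exists>c. AE s in S. s 0 = c)" and \<sigma>: "\<sigma> \<ge> 0" "isCont ladder_V \<sigma>"
  shows "\<sigma> > 0" "summable (prob_weak_rec_less \<sigma>)" "suminf (prob_weak_rec_less \<sigma>) = ladder_V \<sigma>" "ladder_V \<sigma> \<ge> 1"
proof -
  note V = ladder_V_eq[OF nondeg] and sw = summable_prob_weak_rec_le[OF nondeg]
  let ?x = "\<lambda>n. \<sigma> - inverse (real (Suc n))"
  have "(\<lambda>n. \<sigma> - inverse (real (Suc n))) \<longlonglongrightarrow> \<sigma> - 0"
    by (intro tendsto_intros LIMSEQ_inverse_real_of_nat)
  then have lim: "(\<lambda>n. ladder_V (?x n)) \<longlonglongrightarrow> ladder_V \<sigma>"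
    using \<sigma>(2) by (intro isCont_tendsto_compose[OF \<sigma>(2)]) simp
  have "sum (prob_weak_rec_le \<sigma>) {..<1} \<le> suminf (prob_weak_rec_le \<sigma>)"
    by (rule sum_le_suminf[OF sw]) auto
  then show ge1: "ladder_V \<sigma> \<ge> 1" using \<sigma>(1) by (simp add: V prob_weak_rec_le_0)
  show "\<sigma> > 0"
  proof (rule ccontr)
    assume "\<not> \<sigma> > 0"
    then have "\<sigma> = 0" using \<sigma>(1) by simp
    then have "prob_weak_rec_le (?x n) = (\<lambda>_. 0)" for n by (intro ext prob_weak_rec_le_neg) simp
    then have "ladder_V (?x n) = 0" for n unfolding V by (simp only: suminf_zero)
    then have "(\<lambda>n. 0) \<longlonglongrightarrow> ladder_V \<sigma>" using lim by (simp only:)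
    then have "ladder_V \<sigma> = 0" by (simp only: LIMSEQ_const_iff)
    then show False using ge1 by simp
  qed
  have mw: "{s. weak_rec s n \<and> psum s n \<le> x} \<in> sets S" "{s. weak_rec s n \<and> psum s n < x} \<in> sets S" for x n
    by (rule sets_Collect_S; measurable)+
  have vw: "prob_weak_rec_less \<sigma> n \<le> prob_weak_rec_le \<sigma> n" for n
    unfolding prob_weak_rec_less_def prob_weak_rec_le_def using mw by (intro P.finite_measure_mono) auto
  have wv: "prob_weak_rec_le x n \<le> prob_weak_rec_less \<sigma> n" if "x < \<sigma>" for x n
    unfolding prob_weak_rec_less_def prob_weak_rec_le_def using mw that by (intro P.finite_measure_mono) auto
  show sv: "summable (prob_weak_rec_less \<sigma>)"
    using vw by (intro summable_comparison_test'[OF sw[of \<sigma>]]) auto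
  show "suminf (prob_weak_rec_less \<sigma>) = ladder_V \<sigma>"
  proof (rule antisym)
    show "suminf (prob_weak_rec_less \<sigma>) \<le> ladder_V \<sigma>" unfolding V by (intro suminf_le vw sv sw)
    show "ladder_V \<sigma> \<le> suminf (prob_weak_rec_less \<sigma>)"
    proof (rule LIMSEQ_le_const2[OF lim], intro exI allI impI)
      fix n
      show "ladder_V (?x n) \<le> suminf (prob_weak_rec_less \<sigma>)" unfolding V by (intro suminf_le wv sv sw) simp
    qed
  qed
qed

end

section \<open>Convergence of moments\<close>

lemma sum_Bernstein_variance:
  assumes "n \<ge> 1"
  shows "(\<Sum>k\<le>n. (real k / real n - x)\<^sup>2 * Bernstein n k x) = x * (1 - x) / real n"
proof -
  have "(\<Sum>k\<le>n. (real k / real n - x)\<^sup>2 * Bernstein n k x) =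
     (\<Sum>k\<le>n. (real k * (real k - 1) * Bernstein n k x) / (real n)\<^sup>2 + (real k * Bernstein n k x) * (1 / (real n)\<^sup>2 - 2 * x / real n)
        + x\<^sup>2 * Bernstein n k x)"
    using assms by (intro sum.cong) (auto simp: field_simps power2_eq_square)
  also have "\<dots> = real n * (real n - 1) * x\<^sup>2 / (real n)\<^sup>2 + real n * x * (1 / (real n)\<^sup>2 - 2 * x / real n) + x\<^sup>2"
    by (simp only: sum.distrib sum_divide_distrib[symmetric] sum_distrib_right[symmetric] sum_distrib_left[symmetric]
          sum_kk_Bernstein sum_k_Bernstein sum_Bernstein mult_1_right)
  also have "\<dots> = x * (1 - x) / real n"
    using assms by (simp add: field_simps power2_eq_square)
  finally show ?thesis .
qed

lemma Bernstein_approx_lipschitz: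
  assumes x: "0 \<le> x" "x \<le> 1" and n: "n \<ge> 1"
    and lip: "\<And>y. 0 \<le> y \<Longrightarrow> y \<le> 1 \<Longrightarrow> \<bar>g y - g x\<bar> \<le> C * \<bar>y - x\<bar>" and "C \<ge> 0"
  shows "\<bar>(\<Sum>k\<le>n. g (real k / real n) * Bernstein n k x) - g x\<bar> \<le> 2 * C / sqrt (real n)"
proof -
  let ?h = "1 / sqrt (real n)"
  have h0: "?h > 0" using n by simp
  have "sqrt (real n) * (1 / (sqrt (real n) * sqrt (real n))) = ?h" using n by (simp only: divide_simps) simp
  then have h: "?h > 0" "1 / ?h * (1 / real n) = ?h" using h0 by simp_all
  have abs_le: "\<bar>t\<bar> \<le> ?h + t\<^sup>2 * (1 / ?h)" for t :: real
  proof (cases "\<bar>t\<bar> \<le> ?h")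
    case True
    moreover have "0 \<le> t\<^sup>2 * (1 / ?h)" using h0 by simp
    ultimately show ?thesis by linarith
  next
    case False
    then have "\<bar>t\<bar> * ?h \<le> \<bar>t\<bar> * \<bar>t\<bar>" by (intro mult_left_mono) auto
    then have "\<bar>t\<bar> \<le> t\<^sup>2 / ?h" using h0 by (simp only: pos_le_divide_eq) (simp add: power2_eq_square)
    then show ?thesis using h0 by (simp only: times_divide_eq_right mult_1_right)
  qed
  have "(\<Sum>k\<le>n. g (real k / real n) * Bernstein n k x) - g x = (\<Sum>k\<le>n. (g (real k / real n) - g x) * Bernstein n k x)"
    by (simp add: left_diff_distrib sum_subtractf sum_distrib_left[symmetric])
  also have "\<bar>\<dots>\<bar> \<le> (\<Sum>k\<le>n. \<bar>(g (real k / real n) - g x) * Bernstein n k x\<bar>)" by (rule sum_abs)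
  also have "\<dots> \<le> (\<Sum>k\<le>n. C * ((?h + (real k / real n - x)\<^sup>2 * (1 / ?h)) * Bernstein n k x))"
  proof (rule sum_mono)
    fix k assume "k \<in> {..n}"
    then have "\<bar>g (real k / real n) - g x\<bar> \<le> C * \<bar>real k / real n - x\<bar>"
      using n by (intro lip) auto
    also have "\<dots> \<le> C * (?h + (real k / real n - x)\<^sup>2 * (1 / ?h))"
      using abs_le \<open>C \<ge> 0\<close> by (intro mult_left_mono)
    finally have "\<bar>g (real k / real n) - g x\<bar> * Bernstein n k x \<le> C * (?h + (real k / real n - x)\<^sup>2 * (1 / ?h)) * Bernstein n k x"
      using Bernstein_nonneg[OF x] by (intro mult_right_mono)
    then show "\<bar>(g (real k / real n) - g x) * Bernstein n k x\<bar> \<le> C * ((?h + (real k / real n - x)\<^sup>2 * (1 / ?h)) * Bernstein n k x)"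
      using Bernstein_nonneg[OF x, of n k] by (simp only: abs_mult abs_of_nonneg mult.assoc)
  qed
  also have "\<dots> = C * (?h * (\<Sum>k\<le>n. Bernstein n k x) + (1 / ?h) * (\<Sum>k\<le>n. (real k / real n - x)\<^sup>2 * Bernstein n k x))"
    by (simp only: sum_distrib_left[symmetric] sum.distrib distrib_right mult.assoc mult.left_commute[of _ "1 / ?h"])
  also have "\<dots> = C * (?h + (1 / ?h) * (x * (1 - x) / real n))"
    by (simp only: sum_Bernstein_variance[OF n] sum_Bernstein mult_1_right)
  also have "\<dots> \<le> C * (?h + (1 / ?h) * (1 / real n))"
    using x h \<open>C \<ge> 0\<close> n by (intro mult_left_mono add_left_mono divide_right_mono mult_le_one) auto
  also have "\<dots> = 2 * C / sqrt (real n)" using h(2) by simp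
  finally show ?thesis .
qed

lemma Bernstein_expand:
  "Bernstein n k x = (\<Sum>j\<le>n-k. (real (n choose k) * real ((n - k) choose j) * (-1) ^ j) * x ^ (k + j))"
proof -
  have "(1 - x) ^ (n - k) = (\<Sum>j\<le>n-k. of_nat ((n - k) choose j) * (-x) ^ j)"
    using binomial_ring[of "-x" 1 "n - k"] by simp
  then show ?thesis
    unfolding Bernstein_def by (simp add: sum_distrib_left power_add power_minus[of x] mult_ac)
qed

definition cube :: "(nat \<Rightarrow> real) set" where
  "cube = {u. \<forall>i. 0 \<le> u i \<and> u i \<le> 1}"

definition lipschitz_upto :: "nat \<Rightarrow> real \<Rightarrow> ((nat \<Rightarrow> real) \<Rightarrow> real) \<Rightarrow> bool" where
  "lipschitz_upto I C G \<longleftrightarrow> C \<ge> 0 \<and> (\<forall>u\<in>cube. \<forall>w\<in>cube. \<bar>G u - G w\<bar> \<le> C * (\<Sum>i<I. \<bar>u i - w i\<bar>))"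

lemma cube_upd: "u \<in> cube \<Longrightarrow> 0 \<le> a \<Longrightarrow> a \<le> 1 \<Longrightarrow> u(i := a) \<in> cube"
  by (simp add: cube_def)

lemma lipschitz_upto_upd:
  assumes "lipschitz_upto (Suc I) C G" "0 \<le> a" "a \<le> 1"
  shows "lipschitz_upto I C (\<lambda>u. G (u(I := a)))"
  unfolding lipschitz_upto_def
proof (intro conjI ballI)
  fix u w assume "u \<in> cube" "w \<in> cube"
  then have "\<bar>G (u(I := a)) - G (w(I := a))\<bar> \<le> C * (\<Sum>i<Suc I. \<bar>(u(I := a)) i - (w(I := a)) i\<bar>)"
    using assms cube_upd unfolding lipschitz_upto_def by blast
  also have "(\<Sum>i<Suc I. \<bar>(u(I := a)) i - (w(I := a)) i\<bar>) = (\<Sum>i<I. \<bar>u i - w i\<bar>)"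
    unfolding sum.lessThan_Suc by (auto intro: sum.cong)
  finally show "\<bar>G (u(I := a)) - G (w(I := a))\<bar> \<le> C * (\<Sum>i<I. \<bar>u i - w i\<bar>)" .
qed (use assms in \<open>simp add: lipschitz_upto_def\<close>)

lemma lipschitz_upto_bernstein:
  assumes "lipschitz_upto (Suc I) C G" "u \<in> cube" "n \<ge> 1"
  shows "\<bar>(\<Sum>k\<le>n. G (u(I := real k / real n)) * Bernstein n k (u I)) - G u\<bar> \<le> 2 * C / sqrt (real n)"
proof -
  have "\<bar>(\<Sum>k\<le>n. (\<lambda>y. G (u(I := y))) (real k / real n) * Bernstein n k (u I)) - (\<lambda>y. G (u(I := y))) (u I)\<bar> \<le> 2 * C / sqrt (real n)"
  proof (rule Bernstein_approx_lipschitz)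
    show "0 \<le> u I" "u I \<le> 1" using assms(2) by (simp_all add: cube_def)
    show "C \<ge> 0" using assms(1) by (simp add: lipschitz_upto_def)
    fix y :: real assume y: "0 \<le> y" "y \<le> 1"
    have "u(I := u I) \<in> cube" using assms(2) by simp
    then have "\<bar>G (u(I := y)) - G (u(I := u I))\<bar> \<le> C * (\<Sum>i<Suc I. \<bar>(u(I := y)) i - (u(I := u I)) i\<bar>)"
      using assms(1) cube_upd[OF assms(2) y] unfolding lipschitz_upto_def by blast
    also have "(\<Sum>i<Suc I. \<bar>(u(I := y)) i - (u(I := u I)) i\<bar>) = \<bar>y - u I\<bar>" by simp
    finally show "\<bar>G (u(I := y)) - G (u(I := u I))\<bar> \<le> C * \<bar>y - u I\<bar>" .
  qed (rule assms(3))
  then show ?thesis by simp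
qed

lemma tendsto_2C_sqrt: "(\<lambda>n. 2 * C / sqrt (real n)) \<longlonglongrightarrow> 0"
  by (intro tendsto_divide_0[OF tendsto_const] filterlim_at_top_imp_at_infinity
       filterlim_compose[OF sqrt_at_top filterlim_real_sequentially])

lemma measurable_lipschitz_upto:
  assumes U [measurable]: "\<And>i. U i \<in> borel_measurable M" and cube: "\<And>\<omega>. (\<lambda>i. U i \<omega>) \<in> cube"
    and lip: "lipschitz_upto I C G"
  shows "(\<lambda>\<omega>. G (\<lambda>i. U i \<omega>)) \<in> borel_measurable M"
  using lip
proof (induction I arbitrary: G)
  case 0
  have "G (\<lambda>i. U i \<omega>) = G (\<lambda>_. 0)" for \<omega>
  proof -
    have "(\<lambda>_. 0) \<in> cube" by (simp add: cube_def)
    then have "\<bar>G (\<lambda>i. U i \<omega>) - G (\<lambda>_. 0)\<bar> \<le> C * (\<Sum>i<0. \<bar>U i \<omega> - 0\<bar>)"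
      using 0 cube[of \<omega>] unfolding lipschitz_upto_def by blast
    then show ?thesis by simp
  qed
  then have "(\<lambda>\<omega>. G (\<lambda>i. U i \<omega>)) = (\<lambda>_. G (\<lambda>_. 0))" by (rule ext)
  then show ?case by simp
next
  case (Suc I)
  let ?B = "\<lambda>n \<omega>. \<Sum>k\<le>n. G ((\<lambda>i. U i \<omega>)(I := real k / real n)) * Bernstein n k (U I \<omega>)"
  show ?case
  proof (rule borel_measurable_LIMSEQ_real)
    fix \<omega>
    have "(\<lambda>n. ?B n \<omega> - G (\<lambda>i. U i \<omega>)) \<longlonglongrightarrow> 0"
    proof (rule Lim_null_comparison[OF _ tendsto_2C_sqrt])
      show "\<forall>\<^sub>F n in sequentially. norm (?B n \<omega> - G (\<lambda>i. U i \<omega>)) \<le> 2 * C / sqrt (real n)"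
      proof (rule eventually_sequentiallyI[of 1])
        fix n :: nat assume "1 \<le> n"
        from lipschitz_upto_bernstein[OF Suc.prems cube this, of \<omega>]
        show "norm (?B n \<omega> - G (\<lambda>i. U i \<omega>)) \<le> 2 * C / sqrt (real n)" by (simp only: real_norm_def)
      qed
    qed
    then show "(\<lambda>n. ?B n \<omega>) \<longlonglongrightarrow> G (\<lambda>i. U i \<omega>)" by (simp add: LIM_zero_iff)
  next
    fix n
    show "?B n \<in> borel_measurable M"
    proof (rule borel_measurable_sum, rule borel_measurable_times)
      fix k assume "k \<in> {..n}"
      then have "lipschitz_upto I C (\<lambda>u. G (u(I := real k / real n)))"
        by (intro lipschitz_upto_upd[OF Suc.prems]) (auto simp: divide_le_eq_1)
      from Suc.IH[OF this] show "(\<lambda>\<omega>. G ((\<lambda>i. U i \<omega>)(I := real k / real n))) \<in> borel_measurable M" .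
      show "(\<lambda>\<omega>. Bernstein n k (U I \<omega>)) \<in> borel_measurable M" unfolding Bernstein_def by measurable
    qed
  qed
qed

lemma lipschitz_upto_bounded:
  assumes "lipschitz_upto I C G" "u \<in> cube" shows "\<bar>G u\<bar> \<le> \<bar>G (\<lambda>_. 0)\<bar> + C * real I"
proof -
  have "(\<lambda>_. 0) \<in> cube" by (simp add: cube_def)
  then have "\<bar>G u - G (\<lambda>_. 0)\<bar> \<le> C * (\<Sum>i<I. \<bar>u i - 0\<bar>)"
    using assms unfolding lipschitz_upto_def by blast
  also have "\<dots> \<le> C * (\<Sum>i<I. 1)"
    using assms by (intro mult_left_mono sum_mono) (auto simp: lipschitz_upto_def cube_def)
  finally show ?thesis by simp
qed

definition mono_fn :: "nat \<Rightarrow> (nat \<Rightarrow> nat) \<Rightarrow> (nat \<Rightarrow> real) \<Rightarrow> real" where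
  "mono_fn J k u = (\<Prod>i<J. u i ^ k i)"

lemma mono_fn_mult: "I < J \<Longrightarrow> u I ^ m * mono_fn J k u = mono_fn J (k(I := k I + m)) u"
proof -
  assume "I < J"
  then have *: "mono_fn J k u = u I ^ k I * (\<Prod>i\<in>{..<J} - {I}. u i ^ k i)" for k
    unfolding mono_fn_def by (subst prod.remove[of _ I]) auto
  show ?thesis unfolding *[of k] *[of "k(I := k I + m)"] by (simp add: power_add)
qed

lemma mono_fn_bound: "u \<in> cube \<Longrightarrow> \<bar>mono_fn J k u\<bar> \<le> 1"
  unfolding mono_fn_def abs_prod
  by (intro prod_le_1) (auto simp: cube_def power_abs power_le_one)

lemma moment_convergence_aux:
  assumes M: "prob_space M" and N: "prob_space N"
    and U [measurable]: "\<And>n i. U n i \<in> borel_measurable M" and cubeU: "\<And>n \<omega>. (\<lambda>i. U n i \<omega>) \<in> cube"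
    and V [measurable]: "\<And>i. V i \<in> borel_measurable N" and cubeV: "\<And>\<omega>. (\<lambda>i. V i \<omega>) \<in> cube"
    and mom: "\<And>k. (\<lambda>n. \<integral>\<omega>. mono_fn J k (\<lambda>i. U n i \<omega>) \<partial>M) \<longlonglongrightarrow> (\<integral>\<omega>. mono_fn J k (\<lambda>i. V i \<omega>) \<partial>N)"
    and "I \<le> J" and lip: "lipschitz_upto I C G"
  shows "(\<lambda>n. \<integral>\<omega>. G (\<lambda>i. U n i \<omega>) * mono_fn J k (\<lambda>i. U n i \<omega>) \<partial>M)
      \<longlonglongrightarrow> (\<integral>\<omega>. G (\<lambda>i. V i \<omega>) * mono_fn J k (\<lambda>i. V i \<omega>) \<partial>N)"
  using \<open>I \<le> J\<close> lip
proof (induction I arbitrary: G k)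
  interpret M: prob_space M by (rule M)
  interpret N: prob_space N by (rule N)
  case 0
  have G0: "G u = G (\<lambda>_. 0)" if "u \<in> cube" for u
  proof -
    have "(\<lambda>_. 0) \<in> cube" by (simp add: cube_def)
    then have "\<bar>G u - G (\<lambda>_. 0)\<bar> \<le> C * (\<Sum>i<0. \<bar>u i - 0\<bar>)"
      using 0 that unfolding lipschitz_upto_def by blast
    then show ?thesis by simp
  qed
  show ?case
    unfolding G0[OF cubeU] G0[OF cubeV] integral_mult_right_zero by (intro tendsto_mult_left mom)
next
  interpret M: prob_space M by (rule M)
  interpret N: prob_space N by (rule N)
  case (Suc I)
  note lipS = Suc.prems(2)
  have mm [measurable]: "(\<lambda>\<omega>. mono_fn J k (\<lambda>i. U n i \<omega>)) \<in> borel_measurable M"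
    "(\<lambda>\<omega>. mono_fn J k (\<lambda>i. V i \<omega>)) \<in> borel_measurable N" for n k
    unfolding mono_fn_def by measurable
  have intU: "integrable M (\<lambda>\<omega>. H (\<lambda>i. U n i \<omega>) * mono_fn J k (\<lambda>i. U n i \<omega>))"
    and intV: "integrable N (\<lambda>\<omega>. H (\<lambda>i. V i \<omega>) * mono_fn J k (\<lambda>i. V i \<omega>))"
    if H: "lipschitz_upto L C H" for H n k L
  proof -
    have bd: "norm (H u * mono_fn J k u) \<le> \<bar>H (\<lambda>_. 0)\<bar> + C * real L" if "u \<in> cube" for u
    proof -
      have "\<bar>H u\<bar> * \<bar>mono_fn J k u\<bar> \<le> (\<bar>H (\<lambda>_. 0)\<bar> + C * real L) * 1"
        using lipschitz_upto_bounded[OF H that] mono_fn_bound[OF that] by (intro mult_mono) auto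
      then show ?thesis by (simp add: abs_mult)
    qed
    have [measurable]: "(\<lambda>\<omega>. H (\<lambda>i. U n i \<omega>)) \<in> borel_measurable M"
      by (rule measurable_lipschitz_upto[OF U cubeU H])
    have [measurable]: "(\<lambda>\<omega>. H (\<lambda>i. V i \<omega>)) \<in> borel_measurable N"
      by (rule measurable_lipschitz_upto[OF V cubeV H])
    show "integrable M (\<lambda>\<omega>. H (\<lambda>i. U n i \<omega>) * mono_fn J k (\<lambda>i. U n i \<omega>))"
      by (rule M.integrable_const_bound[where B="\<bar>H (\<lambda>_. 0)\<bar> + C * real L"]) (use bd cubeU in auto)
    show "integrable N (\<lambda>\<omega>. H (\<lambda>i. V i \<omega>) * mono_fn J k (\<lambda>i. V i \<omega>))"
      by (rule N.integrable_const_bound[where B="\<bar>H (\<lambda>_. 0)\<bar> + C * real L"]) (use bd cubeV in auto)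
  qed
  define B where "B m u = (\<Sum>l\<le>m. G (u(I := real l / real m)) * Bernstein m l (u I))" for m and u :: "nat \<Rightarrow> real"
  define c where "c m l j = real (m choose l) * real ((m - l) choose j) * (-1) ^ j" for m l j :: nat
  have lipl: "lipschitz_upto I C (\<lambda>u. G (u(I := real l / real m)))" if "l \<in> {..m}" for l m
    using that by (intro lipschitz_upto_upd[OF lipS]) (auto simp: divide_le_eq_1)
  have B_eq: "B m u * mono_fn J k u = (\<Sum>l\<le>m. \<Sum>j\<le>m-l. c m l j * (G (u(I := real l / real m)) * mono_fn J (k(I := k I + (l + j))) u))" for m u
    unfolding B_def sum_distrib_right
  proof (intro sum.cong refl)
    fix l assume "l \<in> {..m}"
    have "G (u(I := real l / real m)) * Bernstein m l (u I) * mono_fn J k u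
       = (\<Sum>j\<le>m-l. c m l j * (G (u(I := real l / real m)) * (u I ^ (l + j) * mono_fn J k u)))"
      unfolding Bernstein_expand c_def by (simp add: sum_distrib_left sum_distrib_right mult_ac)
    also have "\<dots> = (\<Sum>j\<le>m-l. c m l j * (G (u(I := real l / real m)) * mono_fn J (k(I := k I + (l + j))) u))"
      using Suc.prems(1) by (simp only: mono_fn_mult Suc_le_eq)
    finally show "G (u(I := real l / real m)) * Bernstein m l (u I) * mono_fn J k u
       = (\<Sum>j\<le>m-l. c m l j * (G (u(I := real l / real m)) * mono_fn J (k(I := k I + (l + j))) u))" .
  qed
  have intBU: "integrable M (\<lambda>\<omega>. B m (\<lambda>i. U n i \<omega>) * mono_fn J k (\<lambda>i. U n i \<omega>))" for m n
    unfolding B_eq by (intro Bochner_Integration.integrable_sum integrable_mult_right intU[OF lipl])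
  have intBV: "integrable N (\<lambda>\<omega>. B m (\<lambda>i. V i \<omega>) * mono_fn J k (\<lambda>i. V i \<omega>))" for m
    unfolding B_eq by (intro Bochner_Integration.integrable_sum integrable_mult_right intV[OF lipl])
  have convB: "(\<lambda>n. \<integral>\<omega>. B m (\<lambda>i. U n i \<omega>) * mono_fn J k (\<lambda>i. U n i \<omega>) \<partial>M)
      \<longlonglongrightarrow> (\<integral>\<omega>. B m (\<lambda>i. V i \<omega>) * mono_fn J k (\<lambda>i. V i \<omega>) \<partial>N)" for m
  proof -
    have "(\<integral>\<omega>. B m (\<lambda>i. U n i \<omega>) * mono_fn J k (\<lambda>i. U n i \<omega>) \<partial>M)
      = (\<Sum>l\<le>m. \<Sum>j\<le>m-l. c m l j * (\<integral>\<omega>. G ((\<lambda>i. U n i \<omega>)(I := real l / real m)) * mono_fn J (k(I := k I + (l + j))) (\<lambda>i. U n i \<omega>) \<partial>M))" for n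
      unfolding B_eq
      by (subst Bochner_Integration.integral_sum, (intro Bochner_Integration.integrable_sum integrable_mult_right intU[OF lipl]; assumption),
        intro sum.cong refl, subst Bochner_Integration.integral_sum, (intro integrable_mult_right intU[OF lipl]; assumption),
        intro sum.cong refl integral_mult_right_zero)
    moreover have "(\<integral>\<omega>. B m (\<lambda>i. V i \<omega>) * mono_fn J k (\<lambda>i. V i \<omega>) \<partial>N)
      = (\<Sum>l\<le>m. \<Sum>j\<le>m-l. c m l j * (\<integral>\<omega>. G ((\<lambda>i. V i \<omega>)(I := real l / real m)) * mono_fn J (k(I := k I + (l + j))) (\<lambda>i. V i \<omega>) \<partial>N))"
      unfolding B_eq
      by (subst Bochner_Integration.integral_sum, (intro Bochner_Integration.integrable_sum integrable_mult_right intV[OF lipl]; assumption),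
        intro sum.cong refl, subst Bochner_Integration.integral_sum, (intro integrable_mult_right intV[OF lipl]; assumption),
        intro sum.cong refl integral_mult_right_zero)
    ultimately show ?thesis
      using Suc.prems(1) lipl by (auto intro!: tendsto_sum tendsto_mult_left Suc.IH)
  qed
  have diff: "\<bar>B m u * mono_fn J k u - G u * mono_fn J k u\<bar> \<le> 2 * C / sqrt (real m)" if "u \<in> cube" "m \<ge> 1" for m u
  proof -
    have "\<bar>B m u - G u\<bar> * \<bar>mono_fn J k u\<bar> \<le> 2 * C / sqrt (real m) * 1"
    proof (rule mult_mono)
      show *: "\<bar>B m u - G u\<bar> \<le> 2 * C / sqrt (real m)"
        unfolding B_def by (rule lipschitz_upto_bernstein[OF lipS that])
      show "0 \<le> 2 * C / sqrt (real m)" using * by (rule order_trans[OF abs_ge_zero])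
    qed (use mono_fn_bound[OF that(1)] in auto)
    then show ?thesis by (simp add: left_diff_distrib[symmetric] abs_mult)
  qed
  show ?case
  proof (rule LIMSEQ_I)
    fix r :: real assume "r > 0"
    have "\<forall>\<^sub>F m in sequentially. 2 * C / sqrt (real m) < r / 3"
      using order_tendstoD(2)[OF tendsto_2C_sqrt, of "r / 3" C] \<open>r > 0\<close> by simp
    then have "\<forall>\<^sub>F m in sequentially. 2 * C / sqrt (real m) < r / 3 \<and> m \<ge> 1"
      using eventually_ge_at_top[of 1] by eventually_elim simp
    then obtain m where m: "2 * C / sqrt (real m) < r / 3" "m \<ge> 1"
      by (auto simp: eventually_sequentially)
    have 1: "\<bar>(\<integral>\<omega>. B m (\<lambda>i. U n i \<omega>) * mono_fn J k (\<lambda>i. U n i \<omega>) \<partial>M) - (\<integral>\<omega>. G (\<lambda>i. U n i \<omega>) * mono_fn J k (\<lambda>i. U n i \<omega>) \<partial>M)\<bar> \<le> r / 3" for n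
    proof -
      have "\<bar>\<integral>\<omega>. B m (\<lambda>i. U n i \<omega>) * mono_fn J k (\<lambda>i. U n i \<omega>) - G (\<lambda>i. U n i \<omega>) * mono_fn J k (\<lambda>i. U n i \<omega>) \<partial>M\<bar>
         \<le> (\<integral>\<omega>. r / 3 \<partial>M)"
        using order_trans[OF diff[OF cubeU m(2), of n] less_imp_le[OF m(1)]]
        by (intro order_trans[OF integral_abs_bound] integral_mono integrable_abs Bochner_Integration.integrable_diff intBU intU[OF lipS])
          auto
      then show ?thesis
        by (simp add: Bochner_Integration.integral_diff[OF intBU intU[OF lipS]] M.prob_space)
    qed
    have 2: "\<bar>(\<integral>\<omega>. B m (\<lambda>i. V i \<omega>) * mono_fn J k (\<lambda>i. V i \<omega>) \<partial>N) - (\<integral>\<omega>. G (\<lambda>i. V i \<omega>) * mono_fn J k (\<lambda>i. V i \<omega>) \<partial>N)\<bar> \<le> r / 3"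
    proof -
      have "\<bar>\<integral>\<omega>. B m (\<lambda>i. V i \<omega>) * mono_fn J k (\<lambda>i. V i \<omega>) - G (\<lambda>i. V i \<omega>) * mono_fn J k (\<lambda>i. V i \<omega>) \<partial>N\<bar>
         \<le> (\<integral>\<omega>. r / 3 \<partial>N)"
        using order_trans[OF diff[OF cubeV m(2)] less_imp_le[OF m(1)]]
        by (intro order_trans[OF integral_abs_bound] integral_mono integrable_abs Bochner_Integration.integrable_diff intBV intV[OF lipS])
          auto
      then show ?thesis
        by (simp add: Bochner_Integration.integral_diff[OF intBV intV[OF lipS]] N.prob_space)
    qed
    obtain n0 where n0: "\<And>n. n \<ge> n0 \<Longrightarrow> \<bar>(\<integral>\<omega>. B m (\<lambda>i. U n i \<omega>) * mono_fn J k (\<lambda>i. U n i \<omega>) \<partial>M) - (\<integral>\<omega>. B m (\<lambda>i. V i \<omega>) * mono_fn J k (\<lambda>i. V i \<omega>) \<partial>N)\<bar> < r / 3"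
      using LIMSEQ_D[OF convB[of m], of "r / 3"] \<open>r > 0\<close> by auto
    show "\<exists>n0. \<forall>n\<ge>n0. norm ((\<integral>\<omega>. G (\<lambda>i. U n i \<omega>) * mono_fn J k (\<lambda>i. U n i \<omega>) \<partial>M) - (\<integral>\<omega>. G (\<lambda>i. V i \<omega>) * mono_fn J k (\<lambda>i. V i \<omega>) \<partial>N)) < r"
    proof (intro exI allI impI)
      fix n assume "n0 \<le> n"
      with n0[of n] 1[of n] 2 show "norm ((\<integral>\<omega>. G (\<lambda>i. U n i \<omega>) * mono_fn J k (\<lambda>i. U n i \<omega>) \<partial>M) - (\<integral>\<omega>. G (\<lambda>i. V i \<omega>) * mono_fn J k (\<lambda>i. V i \<omega>) \<partial>N)) < r"
        unfolding real_norm_def by linarith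
    qed
  qed
qed

lemma moment_convergence:
  assumes M: "prob_space M" and N: "prob_space N"
    and U [measurable]: "\<And>n i. U n i \<in> borel_measurable M" and cubeU: "\<And>n \<omega>. (\<lambda>i. U n i \<omega>) \<in> cube"
    and V [measurable]: "\<And>i. V i \<in> borel_measurable N" and cubeV: "\<And>\<omega>. (\<lambda>i. V i \<omega>) \<in> cube"
    and mom: "\<And>k. (\<lambda>n. \<integral>\<omega>. (\<Prod>i<J. U n i \<omega> ^ k i) \<partial>M) \<longlonglongrightarrow> (\<integral>\<omega>. (\<Prod>i<J. V i \<omega> ^ k i) \<partial>N)"
    and lip: "lipschitz_upto J C G"
  shows "(\<lambda>n. \<integral>\<omega>. G (\<lambda>i. U n i \<omega>) \<partial>M) \<longlonglongrightarrow> (\<integral>\<omega>. G (\<lambda>i. V i \<omega>) \<partial>N)"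
  using moment_convergence_aux[of M N U V J J C G "\<lambda>_. 0", OF M N U cubeU V cubeV _ order_refl lip] mom
  by (simp add: mono_fn_def)

definition clamp01 :: "real \<Rightarrow> real" where "clamp01 y = max 0 (min 1 y)"

lemma clamp01_range [simp]: "0 \<le> clamp01 y" "clamp01 y \<le> 1"
  by (auto simp: clamp01_def)

lemma clamp01_id: "0 \<le> y \<Longrightarrow> y \<le> 1 \<Longrightarrow> clamp01 y = y"
  by (simp add: clamp01_def)

lemma measurable_clamp01 [measurable]: "clamp01 \<in> borel_measurable borel"
  unfolding clamp01_def[abs_def] by measurable

lemma weak_conv_of_moments:
  assumes M: "prob_space M" and \<mu>: "real_distribution \<mu>"
    and Y [measurable]: "\<And>n. Y n \<in> borel_measurable M" and Y01: "\<And>n \<omega>. 0 \<le> Y n \<omega>" "\<And>n \<omega>. Y n \<omega> \<le> 1"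
    and \<mu>01: "AE y in \<mu>. 0 \<le> y \<and> y \<le> 1"
    and mom: "\<And>k. (\<lambda>n. \<integral>\<omega>. Y n \<omega> ^ k \<partial>M) \<longlonglongrightarrow> (\<integral>y. y ^ k \<partial>\<mu>)"
  shows "weak_conv_m (\<lambda>n. distr M borel (Y n)) \<mu>"
proof (rule integral_cts_step_conv_imp_weak_conv)
  interpret M: prob_space M by (rule M)
  interpret \<mu>: real_distribution \<mu> by (rule \<mu>)
  show "real_distribution (distr M borel (Y n))" for n by (rule M.real_distribution_distr) simp
  show "real_distribution \<mu>" by (rule \<mu>)
  fix x y :: real assume "x < y"
  have [measurable]: "cts_step x y \<in> borel_measurable borel"
    unfolding cts_step_def[abs_def] by measurable
  have [measurable]: "clamp01 \<in> borel_measurable \<mu>" by simp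
  have lip: "\<bar>cts_step x y a - cts_step x y b\<bar> \<le> 1 / (y - x) * \<bar>a - b\<bar>" for a b
  proof -
    have *: "cts_step x y a = clamp01 ((y - a) / (y - x))" for a
      using \<open>x < y\<close> by (auto simp: cts_step_def clamp01_def field_simps min_def max_def)
    have "\<bar>clamp01 p - clamp01 q\<bar> \<le> \<bar>p - q\<bar>" for p q by (auto simp: clamp01_def)
    then have "\<bar>cts_step x y a - cts_step x y b\<bar> \<le> \<bar>(y - a) / (y - x) - (y - b) / (y - x)\<bar>" unfolding * by blast
    also have "\<dots> = 1 / (y - x) * \<bar>a - b\<bar>" using \<open>x < y\<close> by (simp add: diff_divide_distrib[symmetric] abs_minus_commute)
    finally show ?thesis .
  qed
  have clamp_AE: "AE y in \<mu>. clamp01 y = y" using \<mu>01 by eventually_elim (simp add: clamp01_id)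
  have "(\<lambda>n. \<integral>\<omega>. (\<lambda>u. cts_step x y (u 0)) (\<lambda>i::nat. Y n \<omega>) \<partial>M) \<longlonglongrightarrow> (\<integral>z. (\<lambda>u. cts_step x y (u 0)) (\<lambda>i::nat. clamp01 z) \<partial>\<mu>)"
  proof (rule moment_convergence[where J=1 and C="1 / (y - x)" and G="\<lambda>u. cts_step x y (u 0)"
        and U="\<lambda>n i. Y n" and V="\<lambda>i. clamp01", OF M \<mu>.prob_space_axioms])
    show "lipschitz_upto 1 (1 / (y - x)) (\<lambda>u. cts_step x y (u 0))"
      using lip \<open>x < y\<close> by (simp add: lipschitz_upto_def)
    fix k :: "nat \<Rightarrow> nat"
    have "(\<integral>z. clamp01 z ^ k 0 \<partial>\<mu>) = (\<integral>z. z ^ k 0 \<partial>\<mu>)"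
    proof (rule integral_cong_AE)
      show "AE z in \<mu>. clamp01 z ^ k 0 = z ^ k 0" using clamp_AE by eventually_elim simp
    qed measurable
    then show "(\<lambda>n. \<integral>\<omega>. (\<Prod>i<1. Y n \<omega> ^ k i) \<partial>M) \<longlonglongrightarrow> (\<integral>z. (\<Prod>i<1. clamp01 z ^ k i) \<partial>\<mu>)"
      using mom[of "k 0"] by simp
  qed (use Y01 in \<open>auto simp: cube_def\<close>)
  moreover have "(\<integral>z. cts_step x y (clamp01 z) \<partial>\<mu>) = (\<integral>z. cts_step x y z \<partial>\<mu>)"
  proof (rule integral_cong_AE)
    show "AE z in \<mu>. cts_step x y (clamp01 z) = cts_step x y z" using clamp_AE by eventually_elim simp
  qed measurable
  ultimately show "(\<lambda>n. integral\<^sup>L (distr M borel (Y n)) (cts_step x y)) \<longlonglongrightarrow> integral\<^sup>L \<mu> (cts_step x y)"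
    by (simp add: integral_distr)
qed

lemma exists_powr_moments:
  assumes M: "prob_space M"
    and Y [measurable]: "\<And>n. Y n \<in> borel_measurable M" and Y01: "\<And>n \<omega>. 0 \<le> Y n \<omega>" "\<And>n \<omega>. Y n \<omega> \<le> 1"
    and mom: "\<And>l. 0 < l \<Longrightarrow> (\<lambda>n. \<integral>\<omega>. Y n \<omega> powr l \<partial>M) \<longlonglongrightarrow> \<phi> l"
  obtains \<kappa> where "real_distribution \<kappa>" "AE y in \<kappa>. 0 \<le> y \<and> y \<le> 1" "\<And>l. 0 < l \<Longrightarrow> (\<integral>y. y powr l \<partial>\<kappa>) = \<phi> l"
proof -
  interpret M: prob_space M by (rule M)
  define \<mu> where "\<mu> n = distr M borel (Y n)" for n
  have rd: "real_distribution (\<mu> n)" for n unfolding \<mu>_def by (rule M.real_distribution_distr) simp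
  have "tight \<mu>"
    unfolding tight_def
  proof (intro conjI allI impI)
    show "real_distribution (\<mu> n)" for n by (rule rd)
    fix \<epsilon> :: real assume "\<epsilon> > 0"
    have "measure (\<mu> n) {-1<..1} = 1" for n
    proof -
      have "Y n -` {-1<..1} \<inter> space M = space M"
      proof -
        have "-1 < Y n \<omega>" for \<omega> using Y01(1)[of n \<omega>] by linarith
        then show ?thesis using Y01(2) by auto
      qed
      then show ?thesis by (simp add: \<mu>_def measure_distr M.prob_space)
    qed
    then show "\<exists>a b. a < b \<and> (\<forall>n. 1 - \<epsilon> < measure (\<mu> n) {a<..b})"
      using \<open>\<epsilon> > 0\<close> by (intro exI[of _ "-1"] exI[of _ 1]) simp
  qed
  from tight_imp_convergent_subsubsequence[OF this strict_mono_id]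
  obtain r \<kappa> where r: "strict_mono r" and \<kappa>: "real_distribution \<kappa>" and wc: "weak_conv_m (\<mu> \<circ> id \<circ> r) \<kappa>" by blast
  interpret \<kappa>: real_distribution \<kappa> by (rule \<kappa>)
  have conv: "(\<lambda>n. \<integral>\<omega>. f (Y (r n) \<omega>) \<partial>M) \<longlonglongrightarrow> (\<integral>y. f y \<partial>\<kappa>)"
    if f: "\<And>x. isCont f x" "\<And>x. norm (f x) \<le> 1" for f :: "real \<Rightarrow> real"
  proof -
    have "f \<in> borel_measurable borel" using f(1) by (intro borel_measurable_continuous_onI continuous_at_imp_continuous_on) auto
    moreover have "(\<lambda>n. integral\<^sup>L ((\<mu> \<circ> id \<circ> r) n) f) \<longlonglongrightarrow> integral\<^sup>L \<kappa> f"
      by (rule weak_conv_imp_integral_bdd_continuous_conv[OF _ \<kappa> wc f]) (use rd in auto)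
    ultimately show ?thesis by (simp add: \<mu>_def integral_distr)
  qed
  have AE01: "AE y in \<kappa>. 0 \<le> y \<and> y \<le> 1"
  proof -
    let ?f = "\<lambda>y::real. min 1 \<bar>y - clamp01 y\<bar>"
    have c: "isCont ?f x" for x unfolding clamp01_def by (intro continuous_intros)
    have "(\<lambda>n. \<integral>\<omega>. ?f (Y (r n) \<omega>) \<partial>M) \<longlonglongrightarrow> (\<integral>y. ?f y \<partial>\<kappa>)" by (rule conv[OF c]) auto
    then have "(\<integral>y. ?f y \<partial>\<kappa>) = 0" using Y01 by (simp add: clamp01_id LIMSEQ_const_iff)
    moreover have "integrable \<kappa> ?f"
      by (rule \<kappa>.integrable_const_bound[where B=1]) auto
    ultimately have "AE y in \<kappa>. ?f y = 0"
      by (subst (asm) integral_nonneg_eq_0_iff_AE) auto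
    then show ?thesis by eventually_elim (auto simp: min_def clamp01_def split: if_splits)
  qed
  have pm: "(\<integral>y. y powr l \<partial>\<kappa>) = \<phi> l" if l: "0 < l" for l
  proof -
    let ?f = "\<lambda>y::real. clamp01 y powr l"
    have "isCont ?f x" for x
      unfolding isCont_def clamp01_def using l by (intro tendsto_powr' tendsto_intros) auto
    then have "(\<lambda>n. \<integral>\<omega>. ?f (Y (r n) \<omega>) \<partial>M) \<longlonglongrightarrow> (\<integral>y. ?f y \<partial>\<kappa>)"
      using l by (intro conv) (auto intro: powr_le1)
    then have "(\<lambda>n. \<integral>\<omega>. Y (r n) \<omega> powr l \<partial>M) \<longlonglongrightarrow> (\<integral>y. ?f y \<partial>\<kappa>)" using Y01 by (simp add: clamp01_id)
    moreover have "(\<lambda>n. \<integral>\<omega>. Y (r n) \<omega> powr l \<partial>M) \<longlonglongrightarrow> \<phi> l"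
      using LIMSEQ_subseq_LIMSEQ[OF mom[OF l] r] by (simp add: comp_def)
    ultimately have "(\<integral>y. ?f y \<partial>\<kappa>) = \<phi> l" by (rule LIMSEQ_unique)
    moreover have "(\<integral>y. ?f y \<partial>\<kappa>) = (\<integral>y. y powr l \<partial>\<kappa>)"
    proof (rule integral_cong_AE)
      show "AE y in \<kappa>. ?f y = y powr l" using AE01 by eventually_elim (simp add: clamp01_id)
    qed measurable
    ultimately show ?thesis by simp
  qed
  show thesis by (rule that[OF \<kappa> AE01 pm])
qed

lemma tendsto_fact_ratio_half: "(\<lambda>n. fact (k + n) / fact n * (1/2) ^ n :: real) \<longlonglongrightarrow> 0"
proof (rule summable_LIMSEQ_zero, rule summable_ratio_test[where c="3/4" and N="2 * k"])
  fix n assume n: "2 * k \<le> n"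
  have "fact (k + Suc n) / fact (Suc n) * (1/2) ^ Suc n
      = (real (k + n + 1) / (2 * (real n + 1))) * (fact (k + n) / fact n * (1/2) ^ n :: real)"
    by (simp add: field_simps)
  also have "\<dots> \<le> 3/4 * (fact (k + n) / fact n * (1/2) ^ n)"
    using n by (intro mult_right_mono) (auto simp: field_simps)
  finally show "norm (fact (k + Suc n) / fact (Suc n) * (1/2) ^ Suc n :: real) \<le> 3/4 * norm (fact (k + n) / fact n * (1/2) ^ n :: real)"
    by simp
qed simp

lemma iexp_moment_expansion:
  fixes a h :: real
  assumes \<mu>: "real_distribution \<mu>" and nn: "AE x in \<mu>. 0 \<le> x"
    and int: "\<And>k. integrable \<mu> (\<lambda>x. x ^ k)" and bound: "\<And>k. (\<integral>x. x ^ k \<partial>\<mu>) \<le> C * fact k"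
    and h: "\<bar>h\<bar> \<le> 1 / 2"
  shows "(\<lambda>n. \<Sum>j\<le>n. (\<i> * of_real h) ^ j / fact j * (\<integral>x. of_real (x ^ (k + j)) * iexp (a * x) \<partial>\<mu>))
     \<longlonglongrightarrow> (\<integral>x. of_real (x ^ k) * iexp ((a + h) * x) \<partial>\<mu>)"
proof -
  interpret real_distribution \<mu> by (rule \<mu>)
  have inti: "integrable \<mu> (\<lambda>x. of_real (x ^ k) * iexp (b * x))" for k b
    by (rule Bochner_Integration.integrable_bound[OF int[of k]]) (auto simp: norm_mult simp del: of_real_power)
  have eq: "(\<Sum>j\<le>n. (\<i> * of_real h) ^ j / fact j * (\<integral>x. of_real (x ^ (k + j)) * iexp (a * x) \<partial>\<mu>))
    = (\<integral>x. of_real (x ^ k) * iexp (a * x) * (\<Sum>j\<le>n. (\<i> * of_real (h * x)) ^ j / fact j) \<partial>\<mu>)" for n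
  proof -
    have "(\<integral>x. of_real (x ^ k) * iexp (a * x) * (\<Sum>j\<le>n. (\<i> * of_real (h * x)) ^ j / fact j) \<partial>\<mu>)
      = (\<integral>x. (\<Sum>j\<le>n. (\<i> * of_real h) ^ j / fact j * (of_real (x ^ (k + j)) * iexp (a * x))) \<partial>\<mu>)"
      by (intro Bochner_Integration.integral_cong refl) (simp add: sum_distrib_left power_add power_mult_distrib mult_ac)
    also have "\<dots> = (\<Sum>j\<le>n. (\<i> * of_real h) ^ j / fact j * (\<integral>x. of_real (x ^ (k + j)) * iexp (a * x) \<partial>\<mu>))"
      by (subst Bochner_Integration.integral_sum) (intro integrable_mult_right inti, simp add: integral_mult_right_zero)
    finally show ?thesis ..
  qed
  have err: "norm ((\<integral>x. of_real (x ^ k) * iexp ((a + h) * x) \<partial>\<mu>)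
      - (\<Sum>j\<le>n. (\<i> * of_real h) ^ j / fact j * (\<integral>x. of_real (x ^ (k + j)) * iexp (a * x) \<partial>\<mu>)))
      \<le> \<bar>C\<bar> * (fact (k + Suc n) / fact (Suc n) * (1/2) ^ Suc n)" for n
  proof -
    let ?R = "\<lambda>x. iexp (h * x) - (\<Sum>j\<le>n. (\<i> * of_real (h * x)) ^ j / fact j)"
    let ?g = "\<lambda>x::real. of_real (x ^ k) * iexp (a * x) * ?R x"
    have int2: "integrable \<mu> (\<lambda>x. of_real (x ^ k) * iexp (a * x) * (\<Sum>j\<le>n. (\<i> * of_real (h * x)) ^ j / fact j))"
    proof -
      have "(\<lambda>x::real. of_real (x ^ k) * iexp (a * x) * (\<Sum>j\<le>n. (\<i> * of_real (h * x)) ^ j / fact j))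
        = (\<lambda>x. (\<Sum>j\<le>n. (\<i> * of_real h) ^ j / fact j * (of_real (x ^ (k + j)) * iexp (a * x))))"
        by (rule ext) (simp add: sum_distrib_left power_add power_mult_distrib mult_ac)
      then show ?thesis by (simp only:) (intro Bochner_Integration.integrable_sum integrable_mult_right inti)
    qed
    have split: "of_real (x ^ k) * iexp ((a + h) * x) = of_real (x ^ k) * iexp (a * x) * iexp (h * x)" for x
      by (simp add: exp_add[symmetric] distrib_right distrib_left)
    have int1: "integrable \<mu> (\<lambda>x. of_real (x ^ k) * iexp (a * x) * iexp (h * x))"
      unfolding split[symmetric] by (rule inti)
    have "(\<integral>x. of_real (x ^ k) * iexp ((a + h) * x) \<partial>\<mu>)
      - (\<Sum>j\<le>n. (\<i> * of_real h) ^ j / fact j * (\<integral>x. of_real (x ^ (k + j)) * iexp (a * x) \<partial>\<mu>)) = (\<integral>x. ?g x \<partial>\<mu>)"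
      unfolding eq split by (subst Bochner_Integration.integral_diff[OF int1 int2, symmetric]) (simp only: right_diff_distrib)
    also have "norm \<dots> \<le> (\<integral>x. norm (?g x) \<partial>\<mu>)" by (rule integral_norm_bound)
    also have "\<dots> \<le> (\<integral>x. \<bar>h\<bar> ^ Suc n / fact (Suc n) * x ^ (k + Suc n) \<partial>\<mu>)"
    proof (rule integral_mono_AE)
      show "integrable \<mu> (\<lambda>x. norm (?g x))"
        using int1 int2 by (intro integrable_norm) (simp only: right_diff_distrib, rule Bochner_Integration.integrable_diff)
      show "integrable \<mu> (\<lambda>x. \<bar>h\<bar> ^ Suc n / fact (Suc n) * x ^ (k + Suc n))" by (intro integrable_mult_right int)
      show "AE x in \<mu>. norm (?g x) \<le> \<bar>h\<bar> ^ Suc n / fact (Suc n) * x ^ (k + Suc n)"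
        using nn
      proof eventually_elim
        case (elim x)
        have "norm (?g x) = x ^ k * norm (?R x)" using elim by (simp add: norm_mult norm_power)
        also have "x ^ k * norm (?R x) \<le> x ^ k * (\<bar>h * x\<bar> ^ Suc n / fact (Suc n))"
          using elim by (intro mult_left_mono iexp_approx1) simp
        also have "\<bar>h * x\<bar> ^ Suc n / fact (Suc n) = \<bar>h\<bar> ^ Suc n / fact (Suc n) * x ^ Suc n"
          using elim by (simp only: abs_mult power_mult_distrib abs_of_nonneg times_divide_eq_left)
        also have "x ^ k * (\<bar>h\<bar> ^ Suc n / fact (Suc n) * x ^ Suc n) = \<bar>h\<bar> ^ Suc n / fact (Suc n) * x ^ (k + Suc n)"
          by (simp only: power_add mult.left_commute)
        finally show ?case .
      qed
    qed
    also have "\<dots> = \<bar>h\<bar> ^ Suc n / fact (Suc n) * (\<integral>x. x ^ (k + Suc n) \<partial>\<mu>)" by (rule integral_mult_right_zero)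
    also have "\<dots> \<le> (1/2) ^ Suc n / fact (Suc n) * (\<bar>C\<bar> * fact (k + Suc n))"
    proof (rule mult_mono)
      show "\<bar>h\<bar> ^ Suc n / fact (Suc n) \<le> (1/2) ^ Suc n / fact (Suc n)"
        using h by (intro divide_right_mono power_mono) auto
      have "C * fact (k + Suc n) \<le> \<bar>C\<bar> * fact (k + Suc n)" by (intro mult_right_mono) auto
      then show "(\<integral>x. x ^ (k + Suc n) \<partial>\<mu>) \<le> \<bar>C\<bar> * fact (k + Suc n)" using bound[of "k + Suc n"] by linarith
      show "0 \<le> (\<integral>x. x ^ (k + Suc n) \<partial>\<mu>)" using nn by (intro integral_nonneg_AE) (auto elim: eventually_mono)
    qed simp
    finally show ?thesis by (simp add: mult_ac)
  qed
  have "(\<lambda>n. \<bar>C\<bar> * (fact (k + Suc n) / fact (Suc n) * (1/2) ^ Suc n)) \<longlonglongrightarrow> 0"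
    using tendsto_mult_right_zero[OF LIMSEQ_Suc[OF tendsto_fact_ratio_half]] .
  then have "(\<lambda>n. (\<integral>x. of_real (x ^ k) * iexp ((a + h) * x) \<partial>\<mu>)
      - (\<Sum>j\<le>n. (\<i> * of_real h) ^ j / fact j * (\<integral>x. of_real (x ^ (k + j)) * iexp (a * x) \<partial>\<mu>))) \<longlonglongrightarrow> 0"
    by (rule Lim_null_comparison[rotated]) (intro always_eventually allI err)
  from tendsto_diff[OF tendsto_const[of "\<integral>x. of_real (x ^ k) * iexp ((a + h) * x) \<partial>\<mu>"] this]
  show ?thesis by simp
qed

lemma moments_determine_distribution:
  assumes \<mu>: "real_distribution \<mu>" "AE x in \<mu>. 0 \<le> x" "\<And>k. integrable \<mu> (\<lambda>x. x ^ k)"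
    and \<nu>: "real_distribution \<nu>" "AE x in \<nu>. 0 \<le> x" "\<And>k. integrable \<nu> (\<lambda>x. x ^ k)"
    and eq: "\<And>k. (\<integral>x. x ^ k \<partial>\<mu>) = (\<integral>x. x ^ k \<partial>\<nu>)" and bound: "\<And>k. (\<integral>x. x ^ k \<partial>\<mu>) \<le> C * fact k"
  shows "\<mu> = \<nu>"
proof (rule Levy_uniqueness[OF \<mu>(1) \<nu>(1)], rule ext)
  fix t :: real
  obtain N :: nat where N: "2 * \<bar>t\<bar> \<le> real N" "N \<ge> 1"
    using real_arch_simple[of "max 1 (2 * \<bar>t\<bar>)"] by (auto simp: max_def split: if_splits)
  define h where "h = t / real N"
  have h: "\<bar>h\<bar> \<le> 1 / 2" using N by (simp add: h_def field_simps)
  have "(\<integral>x. of_real (x ^ k) * iexp ((real m * h) * x) \<partial>\<mu>) = (\<integral>x. of_real (x ^ k) * iexp ((real m * h) * x) \<partial>\<nu>)" for m k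
  proof (induction m arbitrary: k)
    case 0
    show ?case using eq[of k] by (simp del: of_real_power)
  next
    case (Suc m)
    have a: "real (Suc m) * h = real m * h + h" by (simp add: algebra_simps)
    have "(\<lambda>n. \<Sum>j\<le>n. (\<i> * of_real h) ^ j / fact j * (\<integral>x. of_real (x ^ (k + j)) * iexp ((real m * h) * x) \<partial>\<mu>))
      \<longlonglongrightarrow> (\<integral>x. of_real (x ^ k) * iexp ((real m * h + h) * x) \<partial>\<mu>)"
      by (rule iexp_moment_expansion[OF \<mu> bound h])
    moreover have "(\<lambda>n. \<Sum>j\<le>n. (\<i> * of_real h) ^ j / fact j * (\<integral>x. of_real (x ^ (k + j)) * iexp ((real m * h) * x) \<partial>\<mu>))
      \<longlonglongrightarrow> (\<integral>x. of_real (x ^ k) * iexp ((real m * h + h) * x) \<partial>\<nu>)"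
      unfolding Suc.IH by (rule iexp_moment_expansion[OF \<nu> _ h]) (use bound eq in simp)
    ultimately show ?case unfolding a by (rule LIMSEQ_unique)
  qed
  from this[of 0 N] show "char \<mu> t = char \<nu> t"
    using N by (simp add: char_def h_def)
qed

lemma Gamma_ge_exp_minus_1: "0 \<le> x \<Longrightarrow> exp (-1) \<le> Gamma (1 + x :: real)"
proof -
  assume x: "0 \<le> x"
  have "ennreal (exp (-1)) = (\<integral>\<^sup>+t. ennreal (exp (-t) * indicator {1..} t) \<partial>lborel)"
    using nn_integral_has_integral_lebesgue[OF _ has_integral_exp_minus_to_infinity[of 1 1]] by (simp add: mult.commute)
  also have "\<dots> \<le> (\<integral>\<^sup>+t. ennreal (indicator {0..} t * t powr ((1 + x) - 1) / exp t) \<partial>lborel)"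
    using x by (intro nn_integral_mono ennreal_leI) (auto simp: indicator_def exp_minus field_simps ge_one_powr_ge_zero)
  also have "\<dots> = ennreal (Gamma (1 + x))" using x by (subst Gamma_conv_nn_integral_real) auto
  finally show ?thesis using x by (subst (asm) ennreal_le_iff) auto
qed

lemma mittag_leffler_eqI:
  assumes \<mu>: "real_distribution \<mu>" "AE x in \<mu>. 0 \<le> x" "\<And>k. integrable \<mu> (\<lambda>x. x ^ k)" and \<rho>: "0 \<le> \<rho>"
    and mom: "\<And>m. (\<integral>x. x ^ m \<partial>\<mu>) = fact m / Gamma (1 + real m * \<rho>)"
  shows "mittag_leffler \<rho> = \<mu>"
  unfolding mittag_leffler_def
proof (rule the_equality)
  have meas0: "measure \<nu> {..<0} = 0 \<longleftrightarrow> (AE x in \<nu>. 0 \<le> x)" if "real_distribution \<nu>" for \<nu> :: "real measure"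
  proof -
    interpret real_distribution \<nu> by (rule that)
    have "measure \<nu> {..<0} = 0 \<longleftrightarrow> (AE x in \<nu>. x \<notin> {..<0})"
      by (subst AE_iff_measurable[of "{..<0}"]) (auto simp: emeasure_eq_measure)
    then show ?thesis by (simp add: not_less)
  qed
  show "real_distribution \<mu> \<and> measure \<mu> {..<0} = 0 \<and>
     (\<forall>m::nat. integrable \<mu> (\<lambda>x. x ^ m) \<and> (\<integral>x. x ^ m \<partial>\<mu>) = fact m / Gamma (1 + real m * \<rho>))"
    using \<mu> mom meas0 by simp
  fix \<nu> :: "real measure"
  assume \<nu>: "real_distribution \<nu> \<and> measure \<nu> {..<0} = 0 \<and>
     (\<forall>m::nat. integrable \<nu> (\<lambda>x. x ^ m) \<and> (\<integral>x. x ^ m \<partial>\<nu>) = fact m / Gamma (1 + real m * \<rho>))"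
  show "\<nu> = \<mu>"
  proof (rule moments_determine_distribution[where C="exp 1"])
    fix k
    have "exp 1 * Gamma (1 + real k * \<rho>) \<ge> 1"
      using Gamma_ge_exp_minus_1[of "real k * \<rho>"] \<rho> by (simp add: exp_minus field_simps)
    moreover have "Gamma (1 + real k * \<rho>) > 0" using \<rho> by (intro Gamma_real_pos) (simp add: add_pos_nonneg)
    ultimately have "1 / Gamma (1 + real k * \<rho>) \<le> exp 1" by (simp add: field_simps)
    then have "fact k * (1 / Gamma (1 + real k * \<rho>)) \<le> fact k * exp 1" by (intro mult_left_mono) auto
    then show "(\<integral>x. x ^ k \<partial>\<nu>) \<le> exp 1 * fact k" using \<nu> by (simp add: mult.commute)
  qed (use \<nu> \<mu> mom meas0 in auto)
qed

section \<open>One-dimensional limits\<close>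

lemma nn_integral_powr_exp_scaled:
  assumes "s > 0" "d > 0"
  shows "(\<integral>\<^sup>+t. ennreal (indicator {0..} t * t powr (s - 1) * exp (- (d * t))) \<partial>lborel) = ennreal (Gamma s * d powr (- s))"
proof -
  have "ennreal (Gamma s) = (\<integral>\<^sup>+t. ennreal (indicator {0..} t * t powr (s - 1) / exp t) \<partial>lborel)"
    using Gamma_conv_nn_integral_real[OF assms(1)] .
  also have "\<dots> = ennreal \<bar>d\<bar> * (\<integral>\<^sup>+t. ennreal (indicator {0..} (0 + d * t) * (0 + d * t) powr (s - 1) / exp (0 + d * t)) \<partial>lborel)"
    using assms by (intro nn_integral_real_affine) auto
  also have "(\<integral>\<^sup>+t. ennreal (indicator {0..} (0 + d * t) * (0 + d * t) powr (s - 1) / exp (0 + d * t)) \<partial>lborel)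
    = (\<integral>\<^sup>+t. ennreal (d powr (s - 1)) * ennreal (indicator {0..} t * t powr (s - 1) * exp (- (d * t))) \<partial>lborel)"
  proof (rule nn_integral_cong)
    fix t :: real
    show "ennreal (indicator {0..} (0 + d * t) * (0 + d * t) powr (s - 1) / exp (0 + d * t))
       = ennreal (d powr (s - 1)) * ennreal (indicator {0..} t * t powr (s - 1) * exp (- (d * t)))"
      using assms by (cases "t \<ge> 0")
        (auto simp: indicator_def powr_mult exp_minus field_simps ennreal_mult[symmetric] zero_le_mult_iff)
  qed
  also have "\<dots> = ennreal (d powr (s - 1)) * (\<integral>\<^sup>+t. ennreal (indicator {0..} t * t powr (s - 1) * exp (- (d * t))) \<partial>lborel)"
    by (rule nn_integral_cmult) measurable
  finally have "ennreal (Gamma s) = ennreal (d * d powr (s - 1)) * (\<integral>\<^sup>+t. ennreal (indicator {0..} t * t powr (s - 1) * exp (- (d * t))) \<partial>lborel)"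
    using assms by (simp add: ennreal_mult mult.assoc)
  also have "d * d powr (s - 1) = d powr s"
    using assms by (simp add: powr_mult_base)
  finally have "ennreal (d powr (- s)) * ennreal (Gamma s) = ennreal (d powr (- s)) * ennreal (d powr s) * (\<integral>\<^sup>+t. ennreal (indicator {0..} t * t powr (s - 1) * exp (- (d * t))) \<partial>lborel)"
    by (simp add: mult.assoc)
  also have "ennreal (d powr (- s)) * ennreal (d powr s) = 1"
    using assms by (simp add: ennreal_mult[symmetric] powr_add[symmetric])
  finally show ?thesis using assms by (simp add: ennreal_mult mult.commute)
qed

lemma nn_integral_powr_exp_powr:
  assumes "\<rho> > 0" "m \<ge> (1::nat)"
  shows "(\<integral>\<^sup>+t. ennreal (indicator {0..} t * t powr (\<rho> * real m - 1) * exp (- (t powr \<rho>))) \<partial>lborel) = ennreal (fact m / (\<rho> * real m))"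
proof -
  define s where "s = \<rho> * real m"
  have s: "s > 0" using assms by (simp add: s_def)
  let ?h = "\<lambda>t w. ennreal (indicator {0..} t * t powr (s - 1)) * ennreal (indicator {t powr \<rho>..} w * exp (- w))"
  have ind: "indicator {t powr \<rho>..} w = (if t powr \<rho> \<le> w then 1 else (0::real))" for t w
    by (simp add: indicator_def)
  have [measurable]: "(\<lambda>(t, w). ?h t w) \<in> borel_measurable (lborel \<Otimes>\<^sub>M lborel)"
    unfolding ind by measurable
  have 1: "ennreal (exp (- (t powr \<rho>))) = (\<integral>\<^sup>+w. ennreal (indicator {t powr \<rho>..} w * exp (- w)) \<partial>lborel)" for t
    using nn_integral_has_integral_lebesgue[OF _ has_integral_exp_minus_to_infinity[of 1 "t powr \<rho>"]] by simp
  have 2: "(\<integral>\<^sup>+t. ennreal (indicator {0..b} t * t powr (s - 1)) \<partial>lborel) = ennreal (b powr s / s)" if "b \<ge> 0" for b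
  proof -
    have "((\<lambda>x. x powr (s - 1)) has_integral (b powr ((s - 1) + 1) / ((s - 1) + 1))) {0..b}"
      using s that by (intro has_integral_powr_from_0) auto
    from nn_integral_has_integral_lebesgue[OF _ this] show ?thesis by simp
  qed
  have "(\<integral>\<^sup>+t. ennreal (indicator {0..} t * t powr (s - 1) * exp (- (t powr \<rho>))) \<partial>lborel) = (\<integral>\<^sup>+t. \<integral>\<^sup>+w. ?h t w \<partial>lborel \<partial>lborel)"
    by (intro nn_integral_cong) (simp add: 1 ennreal_mult nn_integral_cmult)
  also have "\<dots> = (\<integral>\<^sup>+w. \<integral>\<^sup>+t. ?h t w \<partial>lborel \<partial>lborel)"
    by (rule lborel_pair.Fubini'[symmetric]) (simp add: case_prod_unfold)
  also have "\<dots> = (\<integral>\<^sup>+w. ennreal (1 / s) * ennreal (indicator {0..} w * w powr ((real m + 1) - 1) / exp w) \<partial>lborel)"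
  proof (rule nn_integral_cong)
    fix w :: real
    show "(\<integral>\<^sup>+t. ?h t w \<partial>lborel) = ennreal (1 / s) * ennreal (indicator {0..} w * w powr ((real m + 1) - 1) / exp w)"
    proof (cases "w \<ge> 0")
      case True
      have "t powr \<rho> \<le> w \<longleftrightarrow> t \<le> w powr (1 / \<rho>)" if "t \<ge> 0" for t
      proof
        assume "t powr \<rho> \<le> w"
        then have "(t powr \<rho>) powr (1 / \<rho>) \<le> w powr (1 / \<rho>)" using assms by (intro powr_mono2) auto
        then show "t \<le> w powr (1 / \<rho>)" using assms that by (simp add: powr_powr)
      next
        assume "t \<le> w powr (1 / \<rho>)"
        then have "t powr \<rho> \<le> (w powr (1 / \<rho>)) powr \<rho>" using assms that by (intro powr_mono2) auto
        then show "t powr \<rho> \<le> w" using assms True by (simp add: powr_powr)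
      qed
      then have "(\<integral>\<^sup>+t. ?h t w \<partial>lborel) = (\<integral>\<^sup>+t. ennreal (exp (- w)) * ennreal (indicator {0..w powr (1 / \<rho>)} t * t powr (s - 1)) \<partial>lborel)"
        by (intro nn_integral_cong) (auto simp: indicator_def ennreal_mult[symmetric] mult.commute)
      also have "\<dots> = ennreal (exp (- w)) * ennreal ((w powr (1 / \<rho>)) powr s / s)"
        by (simp add: nn_integral_cmult 2)
      also have "(w powr (1 / \<rho>)) powr s = w powr real m" using assms by (simp add: powr_powr s_def)
      finally show ?thesis using True s by (simp add: ennreal_mult[symmetric] exp_minus field_simps)
    next
      case False
      have zero: "?h t w = 0" for t
      proof -
        have "\<not> t powr \<rho> \<le> w" using False powr_ge_zero[of t \<rho>] by linarith
        then show ?thesis by (simp add: indicator_def)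
      qed
      have "(\<integral>\<^sup>+t. ?h t w \<partial>lborel) = (\<integral>\<^sup>+(t::real). 0 \<partial>lborel)" by (rule nn_integral_cong) (rule zero)
      then show ?thesis using False by simp
    qed
  qed
  also have "\<dots> = ennreal (1 / s) * ennreal (Gamma (real m + 1))"
    by (simp add: nn_integral_cmult Gamma_conv_nn_integral_real)
  also have "\<dots> = ennreal (fact m / s)"
    using s Gamma_fact[of m, where 'a=real] by (simp add: ennreal_mult[symmetric] add.commute)
  finally show ?thesis by (simp add: s_def)
qed

text \<open>Here \<open>\<kappa>\<close> is the law of \<open>exp (- D)\<close> for a positive stable variable \<open>D\<close> of index \<open>\<rho>\<close>.\<close>

lemma stable_mittag_leffler:
  assumes \<kappa>: "real_distribution \<kappa>" "AE y in \<kappa>. 0 \<le> y \<and> y \<le> 1" and \<rho>: "\<rho> > 0"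
    and pm: "\<And>l. 0 < l \<Longrightarrow> (\<integral>y. y powr l \<partial>\<kappa>) = exp (- (l powr \<rho>))"
  shows "AE y in \<kappa>. 0 < y \<and> y < 1"
    and "mittag_leffler \<rho> = distr \<kappa> borel (\<lambda>y. (- ln y) powr (- \<rho>))"
    and "real_distribution (mittag_leffler \<rho>)"
proof -
  interpret \<kappa>: real_distribution \<kappa> by (rule \<kappa>(1))
  have prob1: "\<kappa>.prob UNIV = 1" "emeasure \<kappa> UNIV = 1"
    using \<kappa>.prob_space \<kappa>.emeasure_space_1 by simp_all
  have AE_pos: "AE y in \<kappa>. 0 < y"
  proof -
    have "(\<lambda>n. \<integral>y. y powr (1 / real (Suc n)) \<partial>\<kappa>) \<longlonglongrightarrow> (\<integral>y. y powr 0 \<partial>\<kappa>)"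
    proof (rule integral_dominated_convergence[where w="\<lambda>_. 1"])
      show "AE y in \<kappa>. (\<lambda>n. y powr (1 / real (Suc n))) \<longlonglongrightarrow> y powr 0"
      proof (rule AE_I2)
        fix y :: real
        show "(\<lambda>n. y powr (1 / real (Suc n))) \<longlonglongrightarrow> y powr 0"
        proof (cases "y = 0")
          case False
          then show ?thesis by (intro tendsto_powr tendsto_const LIMSEQ_Suc[OF lim_1_over_n]) auto
        qed simp
      qed
      show "AE y in \<kappa>. norm (y powr (1 / real (Suc n))) \<le> 1" for n
        using \<kappa>(2) by eventually_elim (auto intro: powr_le1)
    qed auto
    moreover have "(\<lambda>n. exp (- ((1 / real (Suc n)) powr \<rho>))) \<longlonglongrightarrow> exp (- 0)"
    proof -
      have "(\<lambda>n. (1 / real (Suc n)) powr \<rho>) \<longlonglongrightarrow> 0 powr \<rho>"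
        by (intro tendsto_powr' tendsto_const LIMSEQ_Suc[OF lim_1_over_n]) (use \<rho> in auto)
      then show ?thesis by (intro tendsto_intros) simp
    qed
    ultimately have "(\<integral>y. y powr 0 \<partial>\<kappa>) = 1"
      by (simp only: pm zero_less_divide_1_iff of_nat_0_less_iff zero_less_Suc) (auto intro: LIMSEQ_unique)
    moreover have i0: "integrable \<kappa> (\<lambda>y. y powr 0)"
      by (rule \<kappa>.integrable_const_bound[where B=1]) (auto simp: powr_def)
    ultimately have "(\<integral>y. 1 - y powr 0 \<partial>\<kappa>) = 0" by (subst Bochner_Integration.integral_diff) (auto simp: prob1)
    then have "AE y in \<kappa>. 1 - y powr 0 = 0"
      using i0 by (subst (asm) integral_nonneg_eq_0_iff_AE) (auto simp: powr_def)
    with \<kappa>(2) show ?thesis by eventually_elim (auto simp: less_le split: if_splits)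
  qed
  have AE_less: "AE y in \<kappa>. y < 1"
  proof -
    have "(\<lambda>n. \<integral>y. y powr real (Suc n) \<partial>\<kappa>) \<longlonglongrightarrow> (\<integral>y. indicator {1} y \<partial>\<kappa>)"
    proof (rule integral_dominated_convergence[where w="\<lambda>_. 1"])
      show "AE y in \<kappa>. (\<lambda>n. y powr real (Suc n)) \<longlonglongrightarrow> indicator {1} y"
        using AE_pos \<kappa>(2)
      proof eventually_elim
        case (elim y)
        then have eq: "y powr real (Suc n) = y ^ Suc n" for n by (simp only: powr_realpow)
        show ?case
        proof (cases "y = 1")
          case False
          then show ?thesis using elim unfolding eq by (intro LIMSEQ_Suc) (simp add: LIMSEQ_power_zero)
        qed simp
      qed
      show "AE y in \<kappa>. norm (y powr real (Suc n)) \<le> 1" for n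
        using \<kappa>(2) by eventually_elim (auto intro: powr_le1)
    qed auto
    moreover have "(\<lambda>n. exp (- (real (Suc n) powr \<rho>))) \<longlonglongrightarrow> 0"
    proof -
      have "filterlim (\<lambda>n. real n powr \<rho>) at_top sequentially"
        by (intro filterlim_compose[OF real_powr_at_top[OF \<rho>]] filterlim_real_sequentially)
      then have "filterlim (\<lambda>n. real (Suc n) powr \<rho>) at_top sequentially"
        by (rule filterlim_compose[OF _ filterlim_Suc])
      then show ?thesis
        by (intro filterlim_compose[OF exp_at_bot] filterlim_compose[OF filterlim_uminus_at_bot_at_top])
    qed
    ultimately have "(\<integral>y. indicator {1} y \<partial>\<kappa>) = (0::real)"
      by (simp only: pm of_nat_0_less_iff zero_less_Suc) (auto intro: LIMSEQ_unique)
    then have "measure \<kappa> {1} = 0" by simp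
    then have "AE y in \<kappa>. y \<notin> {1}"
      by (intro AE_not_in null_setsI) (auto simp: \<kappa>.emeasure_eq_measure)
    with \<kappa>(2) show ?thesis by eventually_elim auto
  qed
  show AE01: "AE y in \<kappa>. 0 < y \<and> y < 1" using AE_pos AE_less by eventually_elim simp
  let ?\<mu> = "distr \<kappa> borel (\<lambda>y. (- ln y) powr (- \<rho>))"
  have nn: "(\<integral>\<^sup>+y. ennreal (((- ln y) powr (- \<rho>)) ^ m) \<partial>\<kappa>) = ennreal (fact m / Gamma (1 + real m * \<rho>))" for m
  proof (cases "m = 0")
    case True
    then show ?thesis by (simp add: prob1)
  next
    case False
    define s where "s = \<rho> * real m"
    have s: "s > 0" using \<rho> False by (simp add: s_def)
    let ?h = "\<lambda>y t. ennreal (indicator {0..} t * t powr (s - 1)) * ennreal (exp (- ((- ln y) * t)))"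
    interpret pair_sigma_finite \<kappa> lborel ..
    have meas [measurable]: "(\<lambda>(y, t). ?h y t) \<in> borel_measurable (\<kappa> \<Otimes>\<^sub>M lborel)" by measurable
    have "ennreal (Gamma s) * (\<integral>\<^sup>+y. ennreal (((- ln y) powr (- \<rho>)) ^ m) \<partial>\<kappa>)
      = (\<integral>\<^sup>+y. ennreal (Gamma s) * ennreal (((- ln y) powr (- \<rho>)) ^ m) \<partial>\<kappa>)"
      by (rule nn_integral_cmult[symmetric]) measurable
    also have "\<dots> = (\<integral>\<^sup>+y. \<integral>\<^sup>+t. ?h y t \<partial>lborel \<partial>\<kappa>)"
    proof (rule nn_integral_cong_AE)
      show "AE y in \<kappa>. ennreal (Gamma s) * ennreal (((- ln y) powr (- \<rho>)) ^ m) = (\<integral>\<^sup>+t. ?h y t \<partial>lborel)"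
        using AE01
      proof eventually_elim
        case (elim y)
        then have d: "- ln y > 0" by simp
        have "((- ln y) powr (- \<rho>)) ^ m = (- ln y) powr (- s)"
          using d by (simp only: powr_realpow[symmetric] powr_gt_zero powr_powr s_def) simp
        then show ?case
          using nn_integral_powr_exp_scaled[OF s d] s by (simp add: ennreal_mult)
      qed
    qed
    also have "\<dots> = (\<integral>\<^sup>+t. \<integral>\<^sup>+y. ?h y t \<partial>\<kappa> \<partial>lborel)"
      by (rule Fubini'[symmetric]) (simp add: meas)
    also have "\<dots> = (\<integral>\<^sup>+t. ennreal (indicator {0..} t * t powr (\<rho> * real m - 1) * exp (- (t powr \<rho>))) \<partial>lborel)"
    proof (rule nn_integral_cong_AE)
      have "AE t in lborel. t \<noteq> (0::real)" by (rule AE_lborel_singleton)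
      then show "AE t in lborel. (\<integral>\<^sup>+y. ?h y t \<partial>\<kappa>) = ennreal (indicator {0..} t * t powr (\<rho> * real m - 1) * exp (- (t powr \<rho>)))"
      proof eventually_elim
        case (elim t)
        show ?case
        proof (cases "t > 0")
          case True
          have "(\<integral>\<^sup>+y. ennreal (exp (- ((- ln y) * t))) \<partial>\<kappa>) = (\<integral>\<^sup>+y. ennreal (y powr t) \<partial>\<kappa>)"
          proof (rule nn_integral_cong_AE)
            show "AE y in \<kappa>. ennreal (exp (- ((- ln y) * t))) = ennreal (y powr t)"
              using AE01 by eventually_elim (simp add: powr_def mult.commute)
          qed
          also have "\<dots> = ennreal (\<integral>y. y powr t \<partial>\<kappa>)"
          proof (intro nn_integral_eq_integral \<kappa>.integrable_const_bound[where B=1])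
            show "AE y in \<kappa>. norm (y powr t) \<le> 1"
              using \<kappa>(2) by eventually_elim (use True in \<open>auto intro: powr_le1\<close>)
          qed auto
          also have "\<dots> = ennreal (exp (- (t powr \<rho>)))" by (simp add: pm[OF True])
          finally show ?thesis by (simp add: nn_integral_cmult ennreal_mult s_def)
        next
          case False
          then show ?thesis using elim by simp
        qed
      qed
    qed
    also have "\<dots> = ennreal (fact m / s)"
      unfolding s_def using False by (intro nn_integral_powr_exp_powr \<rho>) simp
    finally have "ennreal (1 / Gamma s) * ennreal (Gamma s) * (\<integral>\<^sup>+y. ennreal (((- ln y) powr (- \<rho>)) ^ m) \<partial>\<kappa>)
       = ennreal (1 / Gamma s) * ennreal (fact m / s)"
      by (simp add: mult.assoc)
    moreover have "ennreal (1 / Gamma s) * ennreal (Gamma s) = 1"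
      using Gamma_real_pos[OF s] by (simp add: ennreal_mult[symmetric])
    moreover have "ennreal (1 / Gamma s) * ennreal (fact m / s) = ennreal (fact m / Gamma (1 + real m * \<rho>))"
      using s Gamma_real_pos[OF s] Gamma_plus1[of s]
      by (subst ennreal_mult[symmetric]) (auto simp: s_def mult.commute add.commute nonpos_Ints_def)
    ultimately show ?thesis by simp
  qed
  have ml_int: "integrable \<kappa> (\<lambda>y. ((- ln y) powr (- \<rho>)) ^ m)"
    and ml_val: "(\<integral>y. ((- ln y) powr (- \<rho>)) ^ m \<partial>\<kappa>) = fact m / Gamma (1 + real m * \<rho>)" for m
  proof -
    have "Gamma (1 + real m * \<rho>) > 0" using \<rho> by (intro Gamma_real_pos) (simp add: add_pos_nonneg)
    then have "has_bochner_integral \<kappa> (\<lambda>y. ((- ln y) powr (- \<rho>)) ^ m) (fact m / Gamma (1 + real m * \<rho>))"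
      using nn[of m] by (intro has_bochner_integral_nn_integral) auto
    then show "integrable \<kappa> (\<lambda>y. ((- ln y) powr (- \<rho>)) ^ m)"
      "(\<integral>y. ((- ln y) powr (- \<rho>)) ^ m \<partial>\<kappa>) = fact m / Gamma (1 + real m * \<rho>)"
      by (simp_all add: has_bochner_integral_iff)
  qed
  have rd: "real_distribution ?\<mu>" by (rule \<kappa>.real_distribution_distr) measurable
  show eq: "mittag_leffler \<rho> = ?\<mu>"
  proof (rule mittag_leffler_eqI[OF rd])
    show "AE x in ?\<mu>. 0 \<le> x" by (subst AE_distr_iff) auto
    show "integrable ?\<mu> (\<lambda>x. x ^ k)" for k by (subst integrable_distr_eq) (auto simp: ml_int)
    show "(\<integral>x. x ^ m \<partial>?\<mu>) = fact m / Gamma (1 + real m * \<rho>)" for m by (subst integral_distr) (auto simp: ml_val)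
  qed (use \<rho> in simp)
  show "real_distribution (mittag_leffler \<rho>)" unfolding eq by (rule rd)
qed

lemma mittag_leffler_0:
  shows "mittag_leffler 0 = density lborel (exponential_density 1)"
    and "real_distribution (mittag_leffler 0)"
    and "0 \<le> x \<Longrightarrow> cdf (mittag_leffler 0) x = 1 - exp (- x)"
    and "x < 0 \<Longrightarrow> cdf (mittag_leffler 0) x = 0"
proof -
  let ?\<mu> = "density lborel (exponential_density 1)"
  interpret e: prob_space ?\<mu> by (rule prob_space_exponential_density) simp
  have rd: "real_distribution ?\<mu>" by unfold_locales auto
  have dist: "distributed ?\<mu> lborel (\<lambda>x. x) (exponential_density 1)"
    by (auto simp: distributed_def exponential_density_nonneg intro!: distr_id2)
  have d0: "distributed ?\<mu> lborel (\<lambda>x. x) (erlang_density 0 1)"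
    using dist by (simp add: exponential_density_def)
  have AE0: "AE x in ?\<mu>. 0 \<le> x"
    by (subst AE_density) (auto simp: exponential_density_def erlang_density_def)
  have nn: "(\<integral>\<^sup>+x. ennreal (x ^ k) \<partial>?\<mu>) = ennreal (fact k)" for k
  proof -
    have "(\<integral>\<^sup>+x. ennreal (x ^ k) \<partial>?\<mu>) = (\<integral>\<^sup>+x. ennreal (erlang_density 0 1 x * x ^ k) \<partial>lborel)"
      by (subst nn_integral_density)
         (auto simp: exponential_density_def ennreal_mult'[symmetric] erlang_density_nonneg intro!: nn_integral_cong)
    also have "\<dots> = ennreal (fact k)"
      using nn_integral_erlang_ith_moment[of 1 0 k] by simp
    finally show ?thesis .
  qed
  have hb: "has_bochner_integral ?\<mu> (\<lambda>x. x ^ k) (fact k)" for k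
    using nn[of k] AE0 by (intro has_bochner_integral_nn_integral) (auto elim: eventually_mono)
  show eq: "mittag_leffler 0 = ?\<mu>"
  proof (rule mittag_leffler_eqI[OF rd AE0])
    show "integrable ?\<mu> (\<lambda>x. x ^ k)" for k using hb[of k] by (simp add: has_bochner_integral_iff)
    show "(\<integral>x. x ^ m \<partial>?\<mu>) = fact m / Gamma (1 + real m * 0)" for m
      using hb[of m] by (simp add: has_bochner_integral_iff)
  qed simp
  show "real_distribution (mittag_leffler 0)" unfolding eq by (rule rd)
  show "0 \<le> x \<Longrightarrow> cdf (mittag_leffler 0) x = 1 - exp (- x)"
    unfolding eq cdf_def using e.exponential_distributedD_le[OF dist, of x] by (simp add: atMost_def)
  show "x < 0 \<Longrightarrow> cdf (mittag_leffler 0) x = 0"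
  proof -
    assume "x < 0"
    have "AE y in ?\<mu>. y \<notin> {..x}" using AE0 by eventually_elim (use \<open>x < 0\<close> in auto)
    then have "emeasure ?\<mu> {..x} = 0" by (subst (asm) AE_iff_measurable[of "{..x}"]) auto
    then show "cdf (mittag_leffler 0) x = 0" unfolding eq cdf_def by (simp add: measure_def)
  qed
qed

lemma tendsto_one_minus_power:
  fixes a :: "nat \<Rightarrow> real"
  assumes a: "\<And>n. 0 \<le> a n" "a \<longlonglongrightarrow> 0" and k: "(\<lambda>n. real (k n) * a n) \<longlonglongrightarrow> t"
  shows "(\<lambda>n. (1 - a n) ^ k n) \<longlonglongrightarrow> exp (- t)"
proof -
  have ev: "\<forall>\<^sub>F n in sequentially. a n < 1 / 2"
    using order_tendstoD(2)[OF a(2), of "1/2"] by simp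
  have "(\<lambda>n. real (k n) * ln (1 - a n)) \<longlonglongrightarrow> - t"
  proof (rule tendsto_sandwich)
    show "\<forall>\<^sub>F n in sequentially. - (real (k n) * a n) - 2 * (real (k n) * a n) * a n \<le> real (k n) * ln (1 - a n)"
      using ev
    proof eventually_elim
      case (elim n)
      have "real (k n) * (- a n - 2 * (a n)\<^sup>2) \<le> real (k n) * ln (1 - a n)"
        using a(1)[of n] elim by (intro mult_left_mono ln_one_minus_pos_lower_bound) auto
      then show ?case by (simp add: algebra_simps power2_eq_square)
    qed
    show "\<forall>\<^sub>F n in sequentially. real (k n) * ln (1 - a n) \<le> - (real (k n) * a n)"
      using ev
    proof eventually_elim
      case (elim n)
      have "real (k n) * ln (1 - a n) \<le> real (k n) * (- a n)"
        using ln_le_minus_one[of "1 - a n"] elim by (intro mult_left_mono) auto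
      then show ?case by simp
    qed
    have "(\<lambda>n. - (real (k n) * a n) - 2 * (real (k n) * a n) * a n) \<longlonglongrightarrow> - t - 2 * t * 0"
      by (intro tendsto_intros k a)
    then show "(\<lambda>n. - (real (k n) * a n) - 2 * (real (k n) * a n) * a n) \<longlonglongrightarrow> - t" by simp
    show "(\<lambda>n. - (real (k n) * a n)) \<longlonglongrightarrow> - t" by (intro tendsto_intros k)
  qed
  then have "(\<lambda>n. exp (real (k n) * ln (1 - a n))) \<longlonglongrightarrow> exp (- t)" by (intro tendsto_intros)
  moreover have "\<forall>\<^sub>F n in sequentially. exp (real (k n) * ln (1 - a n)) = (1 - a n) ^ k n"
    using ev by eventually_elim (simp add: exp_of_nat_mult)
  ultimately show ?thesis by (rule Lim_transform_eventually)
qed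

lemma tendsto_nat_floor_mult:
  assumes c: "filterlim c at_top sequentially" and "0 \<le> v"
  shows "(\<lambda>n. real (nat \<lfloor>c n * v\<rfloor>) / c n) \<longlonglongrightarrow> v"
proof (rule tendsto_sandwich)
  have pos: "\<forall>\<^sub>F n in sequentially. c n > 0" using c by (simp add: filterlim_at_top_dense)
  show "\<forall>\<^sub>F n in sequentially. v - 1 / c n \<le> real (nat \<lfloor>c n * v\<rfloor>) / c n"
    using pos
  proof eventually_elim
    case (elim n)
    have "c n * v - 1 \<le> real (nat \<lfloor>c n * v\<rfloor>)" using elim assms(2) by simp
    then have "(c n * v - 1) / c n \<le> real (nat \<lfloor>c n * v\<rfloor>) / c n" using elim by (intro divide_right_mono) auto
    then show ?case using elim by (simp add: diff_divide_distrib)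
  qed
  show "\<forall>\<^sub>F n in sequentially. real (nat \<lfloor>c n * v\<rfloor>) / c n \<le> v"
    using pos
  proof eventually_elim
    case (elim n)
    have "real (nat \<lfloor>c n * v\<rfloor>) \<le> c n * v" using elim assms(2) by simp
    then have "real (nat \<lfloor>c n * v\<rfloor>) / c n \<le> c n * v / c n" using elim by (intro divide_right_mono) auto
    then show ?case using elim by simp
  qed
  have "(\<lambda>n. inverse (c n)) \<longlonglongrightarrow> 0" by (rule tendsto_inverse_0_at_top[OF c])
  then have "(\<lambda>n. v - inverse (c n)) \<longlonglongrightarrow> v - 0" by (intro tendsto_intros)
  then show "(\<lambda>n. v - 1 / c n) \<longlonglongrightarrow> v" by (simp add: inverse_eq_divide)
qed simp

lemma not_summable_over_nat:
  fixes b :: "nat \<Rightarrow> real"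
  assumes "b \<longlonglongrightarrow> \<rho>" "\<rho> > 0" shows "\<not> summable (\<lambda>n. b n / real n)"
proof
  assume s: "summable (\<lambda>n. b n / real n)"
  obtain N where N: "\<And>n. n \<ge> N \<Longrightarrow> \<rho> / 2 < b n"
    using order_tendstoD(1)[OF assms(1), of "\<rho> / 2"] assms(2) by (auto simp: eventually_sequentially)
  have "summable (\<lambda>n. inverse (real n))"
  proof (rule summable_comparison_test'[where N=N])
    show "summable (\<lambda>n. 2 / \<rho> * (b n / real n))" using s by (rule summable_mult)
    fix n assume "N \<le> n"
    show "norm (inverse (real n)) \<le> 2 / \<rho> * (b n / real n)"
    proof (cases "n = 0")
      case False
      then show ?thesis using N[OF \<open>N \<le> n\<close>] assms(2) by (simp add: field_simps)
    qed simp
  qed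
  then show False using not_summable_harmonic[where 'a=real] by simp
qed

context iid_steps begin

definition "norming c n = exp (spitzer_series (1 - 1 / real n)) / suminf (prob_weak_rec_less c)"

lemma tendsto_norming_mult:
  assumes c: "c > 0" "summable (prob_weak_rec_less c)" "suminf (prob_weak_rec_less c) \<ge> 1" and prob_nonneg: "prob_nonneg \<longlonglongrightarrow> \<rho>" and l: "l > 0"
  shows "(\<lambda>n. norming c n * (1 - genfun (prob_hit c) (exp (- (l / real n))))) \<longlonglongrightarrow> l powr \<rho>"
proof (rule LIMSEQ_imp_Suc)
  let ?y = "\<lambda>n. 1 - 1 / real (Suc n)" and ?z = "\<lambda>n. exp (- (l / real (Suc n)))"
  let ?V = "suminf (prob_weak_rec_less c)"
  have inv0: "(\<lambda>n. 1 / real (Suc n)) \<longlonglongrightarrow> 0" by (rule LIMSEQ_Suc[OF lim_1_over_n])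
  have y1: "?y \<longlonglongrightarrow> 1" using tendsto_diff[OF tendsto_const inv0, of 1] by simp
  have "(\<lambda>n. l / real (Suc n)) \<longlonglongrightarrow> 0"
    using tendsto_mult[OF tendsto_const inv0, of l] by simp
  then have "?z \<longlonglongrightarrow> exp (- 0)" by (intro tendsto_intros)
  then have z1: "?z \<longlonglongrightarrow> 1" by simp
  have "(\<lambda>n. (1 - ?z n) / (1 - ?y n)) \<longlonglongrightarrow> l"
  proof -
    have "((\<lambda>x. exp (- (l * x))) has_field_derivative (- l)) (at 0)"
      by (auto intro!: derivative_eq_intros)
    then have "((\<lambda>x. (exp (- (l * x)) - 1) / x) \<longlongrightarrow> - l) (at 0)"
      by (simp add: has_field_derivative_iff)
    moreover have "filterlim (\<lambda>n. 1 / real (Suc n)) (at 0) sequentially"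
      using inv0 by (intro filterlim_atI) auto
    ultimately have "(\<lambda>n. (exp (- (l * (1 / real (Suc n)))) - 1) / (1 / real (Suc n))) \<longlonglongrightarrow> - l"
      by (rule filterlim_compose)
    from tendsto_minus[OF this] show ?thesis
      by (simp add: minus_divide_left[symmetric] algebra_simps)
  qed
  from tendsto_genfun_diff[of prob_nonneg 1, OF prob_coeff(5) prob_nonneg y1 _ _ z1 _ _ this l]
  have "(\<lambda>n. spitzer_series (?y n) - spitzer_series (?z n)) \<longlonglongrightarrow> \<rho> * ln l"
    using l by (simp add: spitzer_series_def)
  then have e: "(\<lambda>n. exp (spitzer_series (?y n) - spitzer_series (?z n))) \<longlonglongrightarrow> exp (\<rho> * ln l)" by (intro tendsto_intros)
  have g: "(\<lambda>n. genfun (prob_weak_rec_less c) (?z n)) \<longlonglongrightarrow> ?V"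
    by (rule tendsto_genfun_at_1[OF c(2) _ z1]) (use l in auto)
  have "(\<lambda>n. genfun (prob_weak_rec_less c) (?z n) / ?V * exp (spitzer_series (?y n) - spitzer_series (?z n))) \<longlonglongrightarrow> ?V / ?V * exp (\<rho> * ln l)"
    using c(3) by (intro tendsto_intros e g) auto
  moreover have "genfun (prob_weak_rec_less c) (?z n) / ?V * exp (spitzer_series (?y n) - spitzer_series (?z n)) = norming c (Suc n) * (1 - genfun (prob_hit c) (?z n))" for n
  proof -
    have "1 - genfun (prob_hit c) (?z n) = genfun (prob_weak_rec_less c) (?z n) * exp (- spitzer_series (?z n))"
      using l c(1) by (intro one_minus_genfun_prob_hit_exp) auto
    then have "norming c (Suc n) * (1 - genfun (prob_hit c) (?z n)) = norming c (Suc n) * (genfun (prob_weak_rec_less c) (?z n) * exp (- spitzer_series (?z n)))"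
      by (simp only:)
    also have "\<dots> = genfun (prob_weak_rec_less c) (?z n) / ?V * exp (spitzer_series (?y n) - spitzer_series (?z n))"
      unfolding norming_def diff_conv_add_uminus[of "spitzer_series (?y n)"] exp_add by (simp only: times_divide_eq_left times_divide_eq_right mult_ac)
    finally show ?thesis ..
  qed
  ultimately show "(\<lambda>n. norming c (Suc n) * (1 - genfun (prob_hit c) (?z n))) \<longlonglongrightarrow> l powr \<rho>"
    using c(3) l by (simp add: powr_def)
qed

lemma spitzer_series_mono: "0 \<le> y \<Longrightarrow> y \<le> z \<Longrightarrow> z < 1 \<Longrightarrow> spitzer_series y \<le> spitzer_series z"
  unfolding spitzer_series_def genfun_def
  by (intro suminf_le mult_left_mono power_mono summable_genfun[OF coeff_L]) auto

lemma spitzer_series_at_top: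
  assumes "\<not> summable (\<lambda>n. prob_nonneg n / real n)"
  shows "filterlim (\<lambda>n. spitzer_series (1 - 1 / real n)) at_top sequentially"
  unfolding filterlim_at_top
proof
  fix K :: real
  have "\<exists>n. spitzer_series (1 - 1 / real (Suc n)) > K"
  proof (rule ccontr)
    assume "\<not> (\<exists>n. spitzer_series (1 - 1 / real (Suc n)) > K)"
    then have "spitzer_series (1 - 1 / real (Suc n)) \<le> K" for n by (simp add: not_less)
    moreover have "(\<lambda>n. 1 - 1 / real (Suc n)) \<longlonglongrightarrow> 1"
      using tendsto_diff[OF tendsto_const LIMSEQ_Suc[OF lim_1_over_n], of 1] by simp
    moreover have "prob_nonneg n / real n \<le> 1" for n using coeff_L[of n] by linarith
    ultimately have "summable (\<lambda>n. prob_nonneg n / real n)"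
      by (intro tendsto_genfun_imp_summable[of _ 1 "\<lambda>n. 1 - 1 / real (Suc n)" K]) (auto simp: spitzer_series_def)
    then show False using assms by simp
  qed
  then obtain n0 where n0: "spitzer_series (1 - 1 / real (Suc n0)) > K" by blast
  show "\<forall>\<^sub>F n in sequentially. K \<le> spitzer_series (1 - 1 / real n)"
  proof (rule eventually_sequentiallyI[of "Suc n0"])
    fix n assume "Suc n0 \<le> n"
    then have "spitzer_series (1 - 1 / real (Suc n0)) \<le> spitzer_series (1 - 1 / real n)"
      by (intro spitzer_series_mono) (auto intro!: divide_left_mono simp: divide_le_eq_1)
    then show "K \<le> spitzer_series (1 - 1 / real n)" using n0 by simp
  qed
qed

lemma norming_at_top:
  assumes "suminf (prob_weak_rec_less c) \<ge> 1" "\<not> summable (\<lambda>n. prob_nonneg n / real n)"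
  shows "filterlim (norming c) at_top sequentially"
proof -
  have "filterlim (\<lambda>n. exp (spitzer_series (1 - 1 / real n))) at_top sequentially"
    by (rule filterlim_compose[OF exp_at_top spitzer_series_at_top[OF assms(2)]])
  then have "filterlim (\<lambda>n. (1 / suminf (prob_weak_rec_less c)) * exp (spitzer_series (1 - 1 / real n))) at_top sequentially"
    using assms(1) by (intro filterlim_tendsto_pos_mult_at_top[OF tendsto_const]) auto
  then show ?thesis by (simp add: norming_def[abs_def])
qed

lemma genfun_prob_hit_1:
  assumes "c > 0" "summable (prob_weak_rec_less c)" "\<not> summable (\<lambda>n. prob_nonneg n / real n)"
  shows "genfun (prob_hit c) 1 = 1"
proof -
  let ?y = "\<lambda>n. 1 - 1 / real (Suc n)"
  have y1: "?y \<longlonglongrightarrow> 1" using tendsto_diff[OF tendsto_const LIMSEQ_Suc[OF lim_1_over_n], of 1] by simp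
  have "(\<lambda>n. genfun (prob_hit c) (?y n)) \<longlonglongrightarrow> suminf (prob_hit c)"
    by (rule tendsto_genfun_at_1[OF _ _ y1]) (use sums_prob_hit[of 1 c] in auto)
  then have "(\<lambda>n. 1 - genfun (prob_hit c) (?y n)) \<longlonglongrightarrow> 1 - genfun (prob_hit c) 1"
    by (intro tendsto_diff tendsto_const) (simp add: genfun_def)
  moreover have "(\<lambda>n. genfun (prob_weak_rec_less c) (?y n) * exp (- spitzer_series (?y n))) \<longlonglongrightarrow> suminf (prob_weak_rec_less c) * 0"
  proof (intro tendsto_mult)
    show "(\<lambda>n. genfun (prob_weak_rec_less c) (?y n)) \<longlonglongrightarrow> suminf (prob_weak_rec_less c)" by (rule tendsto_genfun_at_1[OF assms(2) _ y1]) auto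
    have "filterlim (\<lambda>n. spitzer_series (?y n)) at_top sequentially"
      using filterlim_compose[OF spitzer_series_at_top[OF assms(3)] filterlim_Suc] by simp
    then show "(\<lambda>n. exp (- spitzer_series (?y n))) \<longlonglongrightarrow> 0"
      by (intro filterlim_compose[OF exp_at_bot]) (simp add: filterlim_uminus_at_top)
  qed
  moreover have "1 - genfun (prob_hit c) (?y n) = genfun (prob_weak_rec_less c) (?y n) * exp (- spitzer_series (?y n))" for n
    using assms(1) by (intro one_minus_genfun_prob_hit_exp) (auto simp: abs_le_iff divide_le_eq_1 abs_less_iff)
  ultimately have "1 - genfun (prob_hit c) 1 = suminf (prob_weak_rec_less c) * 0" by (simp only:) (rule LIMSEQ_unique)
  then show ?thesis by simp
qed

lemma genfun_prob_hit_le_1: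
  assumes "0 \<le> z" "z \<le> 1" shows "genfun (prob_hit c) z \<le> 1"
proof -
  have "genfun (prob_hit c) z \<le> genfun (prob_hit c) 1"
    unfolding genfun_def using assms by (intro suminf_le sums_prob_hit mult_left_mono power_mono) auto
  also have "genfun (prob_hit c) 1 = P.prob {x. reach c 1 x}" by (simp add: prob_reach)
  also have "\<dots> \<le> 1" by simp
  finally show ?thesis .
qed

lemma tendsto_genfun_prob_hit_power:
  assumes c: "c > 0" "summable (prob_weak_rec_less c)" "suminf (prob_weak_rec_less c) \<ge> 1" and prob_nonneg: "prob_nonneg \<longlonglongrightarrow> \<rho>"
    and ns: "\<not> summable (\<lambda>n. prob_nonneg n / real n)"
    and k: "(\<lambda>n. real (k n) / norming c n) \<longlonglongrightarrow> v" and l: "l > 0"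
  shows "(\<lambda>n. genfun (prob_hit c) (exp (- (l / real n))) ^ k n) \<longlonglongrightarrow> exp (- (v * l powr \<rho>))"
proof -
  let ?a = "\<lambda>n. 1 - genfun (prob_hit c) (exp (- (l / real n)))"
  have top: "filterlim (norming c) at_top sequentially" by (rule norming_at_top[OF c(3) ns])
  have pos: "norming c n > 0" for n using c(3) by (simp add: norming_def)
  note lim = tendsto_norming_mult[OF c prob_nonneg l]
  have "(\<lambda>n. inverse (norming c n) * (norming c n * ?a n)) \<longlonglongrightarrow> 0 * l powr \<rho>"
    by (intro tendsto_mult tendsto_inverse_0_at_top top lim)
  then have a0: "?a \<longlonglongrightarrow> 0" using pos[THEN less_imp_neq] by (simp add: mult.assoc[symmetric])
  have "(\<lambda>n. (real (k n) / norming c n) * (norming c n * ?a n)) \<longlonglongrightarrow> v * l powr \<rho>"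
    by (intro tendsto_mult k lim)
  then have "(\<lambda>n. real (k n) * ?a n) \<longlonglongrightarrow> v * l powr \<rho>" using pos[THEN less_imp_neq] by simp
  from tendsto_one_minus_power[OF _ a0 this] show ?thesis
    using l genfun_prob_hit_le_1 by simp
qed

text \<open>\<open>scaled_time c v n\<close> is \<open>exp (- T / n)\<close> for the time \<open>T\<close> of the record number \<open>v * norming c n\<close>.\<close>

definition scaled_time :: "real \<Rightarrow> real \<Rightarrow> nat \<Rightarrow> (nat \<Rightarrow> real) \<Rightarrow> real" where
  "scaled_time c v n x = (let m = nat \<lfloor>norming c n * v\<rfloor> in
     of_bool (reach c m x) * exp (- (real (tau c m x) / real n)))"

lemma measurable_scaled_time [measurable]: "scaled_time c v n \<in> borel_measurable S"
  unfolding scaled_time_def[abs_def] Let_def by measurable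

lemma scaled_time_range: "0 \<le> scaled_time c v n x" "scaled_time c v n x \<le> 1"
  by (simp_all add: scaled_time_def Let_def)

lemma gap_weight_const:
  "gap_weight c (\<lambda>_. exp (- (l / real n))) m x = of_bool (reach c m x) * exp (- (l * real (tau c m x) / real n))"
proof -
  have "(\<Prod>i<m. exp (- (l / real n)) ^ gap c i x) = exp (- (l * real (tau c m x) / real n))"
  proof -
    have "(\<Prod>i<m. exp (- (l / real n)) ^ gap c i x) = exp (- (l / real n)) ^ tau c m x"
      by (simp only: power_sum tau_def)
    also have "\<dots> = exp (real (tau c m x) * (- (l / real n)))" by (rule exp_of_nat_mult[symmetric])
    finally show ?thesis by (simp add: mult.commute)
  qed
  then show ?thesis by (simp add: gap_weight_def)
qed

lemma scaled_time_powr: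
  "l > 0 \<Longrightarrow> scaled_time c v n x powr l = gap_weight c (\<lambda>_. exp (- (l / real n))) (nat \<lfloor>norming c n * v\<rfloor>) x"
  by (simp add: gap_weight_const scaled_time_def Let_def powr_def)

lemma tendsto_scaled_time_powr:
  assumes c: "c > 0" "summable (prob_weak_rec_less c)" "suminf (prob_weak_rec_less c) \<ge> 1" and prob_nonneg: "prob_nonneg \<longlonglongrightarrow> \<rho>"
    and ns: "\<not> summable (\<lambda>n. prob_nonneg n / real n)" and v: "v \<ge> 0" and l: "l > 0"
  shows "(\<lambda>n. \<integral>x. scaled_time c v n x powr l \<partial>S) \<longlonglongrightarrow> exp (- (v * l powr \<rho>))"
  unfolding scaled_time_powr[OF l]
  using tendsto_genfun_prob_hit_power[OF c prob_nonneg ns tendsto_nat_floor_mult[OF norming_at_top[OF c(3) ns] v] l] l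
  by (simp add: integral_gap_weight)

lemma less_record_count_iff_scaled_time:
  assumes "suminf (prob_weak_rec_less c) \<ge> 1" "v \<ge> 0" "n \<ge> 1"
  shows "norming c n * v < real (record_count c n x) \<longleftrightarrow> exp (-1) \<le> scaled_time c v n x"
proof -
  have pos: "norming c n * v \<ge> 0" using assms by (simp add: norming_def)
  have "norming c n * v < real (record_count c n x) \<longleftrightarrow> nat \<lfloor>norming c n * v\<rfloor> < record_count c n x"
    using pos by linarith
  also have "\<dots> \<longleftrightarrow> exp (-1) \<le> scaled_time c v n x"
    unfolding less_record_count_iff scaled_time_def Let_def using assms(3)
    by (cases "reach c (nat \<lfloor>norming c n * v\<rfloor>) x") (auto simp: divide_le_eq_1)
  finally show ?thesis .
qed

lemma tendsto_prob_record_count: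
  assumes c: "c > 0" "summable (prob_weak_rec_less c)" "suminf (prob_weak_rec_less c) \<ge> 1" and prob_nonneg: "prob_nonneg \<longlonglongrightarrow> \<rho>"
    and ns: "\<not> summable (\<lambda>n. prob_nonneg n / real n)" and v: "v \<ge> 0"
    and \<kappa>: "real_distribution \<kappa>" "AE y in \<kappa>. 0 \<le> y \<and> y \<le> 1"
      "\<And>k::nat. k \<ge> 1 \<Longrightarrow> (\<integral>y. y ^ k \<partial>\<kappa>) = exp (- (v * real k powr \<rho>))"
    and atom: "measure \<kappa> {exp (-1)} = 0"
  shows "(\<lambda>n. P.prob {x. norming c n * v < real (record_count c n x)}) \<longlonglongrightarrow> measure \<kappa> {exp (-1)..}"
proof -
  interpret \<kappa>: real_distribution \<kappa> by (rule \<kappa>(1))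
  have "weak_conv_m (\<lambda>n. distr S borel (scaled_time c v n)) \<kappa>"
  proof (rule weak_conv_of_moments[OF P.prob_space_axioms \<kappa>(1) _ _ _ \<kappa>(2)])
    fix k :: nat
    show "(\<lambda>n. \<integral>x. scaled_time c v n x ^ k \<partial>S) \<longlonglongrightarrow> (\<integral>y. y ^ k \<partial>\<kappa>)"
    proof (cases "k = 0")
      case True
      then show ?thesis using P.prob_space \<kappa>.prob_space by simp
    next
      case False
      have "scaled_time c v n x ^ k = scaled_time c v n x powr real k" for n x
      proof (cases "scaled_time c v n x = 0")
        case True
        then show ?thesis using False by simp
      next
        case pos: False
        then have "0 < scaled_time c v n x" using scaled_time_range(1)[of c v n x] by simp
        then show ?thesis by (rule powr_realpow[symmetric])
      qed
      then show ?thesis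
        using tendsto_scaled_time_powr[OF c prob_nonneg ns v, of "real k"] False by (simp add: \<kappa>(3))
    qed
  qed (simp_all add: scaled_time_range)
  note wc = this
  have "(\<lambda>n. measure (distr S borel (scaled_time c v n)) {exp (-1)..}) \<longlonglongrightarrow> measure \<kappa> {exp (-1)..}"
  proof (rule weak_conv_imp_continuity_set_conv[OF _ \<kappa>(1) wc])
    show "real_distribution (distr S borel (scaled_time c v n))" for n
      by (rule P.real_distribution_distr) simp
    have "frontier {exp (-1::real)..} = {exp (-1)}" by simp
    then show "emeasure \<kappa> (frontier {exp (-1)..}) = 0"
      using atom by (simp add: \<kappa>.emeasure_eq_measure)
  qed simp
  moreover have "\<forall>\<^sub>F n in sequentially. measure (distr S borel (scaled_time c v n)) {exp (-1)..}
      = P.prob {x. norming c n * v < real (record_count c n x)}"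
  proof (rule eventually_sequentiallyI[of 1])
    fix n :: nat assume "1 \<le> n"
    then show "measure (distr S borel (scaled_time c v n)) {exp (-1)..} = P.prob {x. norming c n * v < real (record_count c n x)}"
      using less_record_count_iff_scaled_time[OF c(3) v]
      by (subst measure_distr) (auto intro!: arg_cong[where f="P.prob"])
  qed
  ultimately show ?thesis by (rule Lim_transform_eventually)
qed

lemma pred_less_record_count [measurable]: "Measurable.pred S (\<lambda>x. m < record_count c n x)"
  unfolding less_record_count_iff by measurable

lemma measurable_record_count [measurable]: "record_count c n \<in> measurable S (count_space UNIV)"
proof -
  have "record_count c n x = k \<longleftrightarrow> \<not> k < record_count c n x \<and> (\<forall>j<k. j < record_count c n x)" for x k
    by (metis linorder_neqE_nat less_irrefl)
  moreover have "Measurable.pred S (\<lambda>x. \<not> k < record_count c n x \<and> (\<forall>j<k. j < record_count c n x))" for k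
    by measurable
  ultimately have "{x\<in>space S. record_count c n x = k} \<in> sets S" for k
    by (simp add: pred_def)
  then show ?thesis by (subst measurable_count_space_eq2_countable) (auto simp: vimage_def Int_def)
qed

lemma cdf_record_count:
  assumes "suminf (prob_weak_rec_less c) \<ge> 1"
  shows "cdf (distr S borel (\<lambda>x. real (record_count c n x) / norming c n)) v
    = 1 - P.prob {x. norming c n * v < real (record_count c n x)}"
proof -
  have pos: "norming c n > 0" using assms by (simp add: norming_def)
  have m: "{x\<in>space S. norming c n * v < real (record_count c n x)} \<in> sets S" by measurable
  have "cdf (distr S borel (\<lambda>x. real (record_count c n x) / norming c n)) v
      = P.prob (space S - {x\<in>space S. norming c n * v < real (record_count c n x)})"
    unfolding cdf_def using pos by (subst measure_distr) (auto intro!: arg_cong[where f="P.prob"] simp: field_simps not_less)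
  also have "\<dots> = 1 - P.prob {x. norming c n * v < real (record_count c n x)}"
    using P.prob_compl[OF m] by simp
  finally show ?thesis .
qed

lemma cdf_record_count_nonpos:
  assumes "suminf (prob_weak_rec_less c) \<ge> 1" "v \<le> 0"
  shows "cdf (distr S borel (\<lambda>x. real (record_count c n x) / norming c n)) v = 0"
proof -
  have "norming c n > 0" using assms by (simp add: norming_def)
  then have "norming c n * v < real (record_count c n x)" for x
    using assms(2) record_count_eq[of c n x] mult_nonneg_nonpos[of "norming c n" v]
    by (auto intro: le_less_trans split: if_splits)
  then show ?thesis using P.prob_space unfolding cdf_record_count[OF assms(1)] by simp
qed

lemma weak_conv_record_count_mittag_leffler:
  assumes c: "c > 0" "summable (prob_weak_rec_less c)" "suminf (prob_weak_rec_less c) \<ge> 1" and prob_nonneg: "prob_nonneg \<longlonglongrightarrow> \<rho>"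
    and ns: "\<not> summable (\<lambda>n. prob_nonneg n / real n)" and \<rho>: "\<rho> > 0"
  shows "weak_conv_m (\<lambda>n. distr S borel (\<lambda>x. real (record_count c n x) / norming c n)) (mittag_leffler \<rho>)"
proof -
  obtain \<kappa> where \<kappa>: "real_distribution \<kappa>" "AE y in \<kappa>. 0 \<le> y \<and> y \<le> 1"
    and pm: "\<And>l. 0 < l \<Longrightarrow> (\<integral>y. y powr l \<partial>\<kappa>) = exp (- (l powr \<rho>))"
    using exists_powr_moments[where Y="scaled_time c 1" and \<phi>="\<lambda>l. exp (- (l powr \<rho>))",
        OF P.prob_space_axioms measurable_scaled_time scaled_time_range]
      tendsto_scaled_time_powr[OF c prob_nonneg ns, of 1] by (simp only: mult_1 zero_le_one) blast
  interpret \<kappa>: real_distribution \<kappa> by (rule \<kappa>(1))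
  have ml: "AE y in \<kappa>. 0 < y \<and> y < 1"
    "mittag_leffler \<rho> = distr \<kappa> borel (\<lambda>y. (- ln y) powr (- \<rho>))"
    "real_distribution (mittag_leffler \<rho>)"
    by (rule stable_mittag_leffler[OF \<kappa> \<rho>]; rule pm; assumption)+
  let ?L = "\<lambda>y::real. (- ln y) powr (- \<rho>)"
  show ?thesis unfolding weak_conv_m_def weak_conv_def
  proof (intro allI impI)
    fix v assume cont: "isCont (cdf (mittag_leffler \<rho>)) v"
    show "(\<lambda>n. cdf (distr S borel (\<lambda>x. real (record_count c n x) / norming c n)) v) \<longlonglongrightarrow> cdf (mittag_leffler \<rho>) v"
    proof (cases "v \<le> 0")
      case True
      have "AE y in mittag_leffler \<rho>. y \<notin> {..v}"
        unfolding ml(2)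
      proof (subst AE_distr_iff)
        show "AE y in \<kappa>. ?L y \<notin> {..v}"
          using ml(1)
        proof eventually_elim
          case (elim y)
          then have "?L y > 0" by simp
          then show ?case using True by (simp only: atMost_iff)
        qed
      qed auto
      then have "{..v} \<in> null_sets (mittag_leffler \<rho>)"
        unfolding ml(2) by (subst AE_iff_null_sets) auto
      then have "cdf (mittag_leffler \<rho>) v = 0"
        unfolding cdf_def by (simp add: measure_def null_setsD1)
      then show ?thesis by (simp add: cdf_record_count_nonpos[OF c(3) True])
    next
      case False
      then have v: "v > 0" by simp
      define r where "r = v powr (1 / \<rho>)"
      have r: "r > 0" using v by (simp add: r_def)
      define \<kappa>' where "\<kappa>' = distr \<kappa> borel (\<lambda>y. y powr r)"
      have k1: "real_distribution \<kappa>'" unfolding \<kappa>'_def by (rule \<kappa>.real_distribution_distr) measurable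
      have k2: "AE y in \<kappa>'. 0 \<le> y \<and> y \<le> 1"
        unfolding \<kappa>'_def
      proof (subst AE_distr_iff)
        show "AE y in \<kappa>. 0 \<le> y powr r \<and> y powr r \<le> 1"
          using \<kappa>(2) by eventually_elim (use r in \<open>auto intro: powr_le1\<close>)
      qed auto
      have k3: "(\<integral>y. y ^ k \<partial>\<kappa>') = exp (- (v * real k powr \<rho>))" if "k \<ge> 1" for k
      proof -
        have "(\<integral>y. y ^ k \<partial>\<kappa>') = (\<integral>y. (y powr r) ^ k \<partial>\<kappa>)" unfolding \<kappa>'_def by (subst integral_distr) auto
        also have "\<dots> = (\<integral>y. y powr (r * real k) \<partial>\<kappa>)"
        proof (rule integral_cong_AE)
          show "AE y in \<kappa>. (y powr r) ^ k = y powr (r * real k)"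
            using ml(1) by eventually_elim (simp add: powr_realpow[symmetric] powr_powr)
        qed measurable
        also have "\<dots> = exp (- ((r * real k) powr \<rho>))" using r that by (intro pm) simp
        also have "(r * real k) powr \<rho> = v * real k powr \<rho>"
          using v \<rho> by (simp add: powr_mult r_def powr_powr)
        finally show ?thesis .
      qed
      have iff: "?L y = v \<longleftrightarrow> y powr r = exp (-1)" "v \<le> ?L y \<longleftrightarrow> exp (-1) \<le> y powr r" if "0 < y" "y < 1" for y
      proof -
        have d: "- ln y > 0" using that by simp
        have "v = (r powr \<rho>)" using v \<rho> by (simp add: r_def powr_powr)
        also have "\<dots> = (1 / r) powr (- \<rho>)" using r by (simp add: powr_minus powr_divide)
        finally have v_eq: "v = (1 / r) powr (- \<rho>)" .
        have "v \<le> ?L y \<longleftrightarrow> - ln y \<le> 1 / r" unfolding v_eq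
        proof
          assume "- ln y \<le> 1 / r"
          then show "(1 / r) powr (- \<rho>) \<le> ?L y" using d \<rho> by (intro powr_mono2') auto
        next
          assume *: "(1 / r) powr (- \<rho>) \<le> ?L y"
          show "- ln y \<le> 1 / r"
          proof (rule ccontr)
            assume "\<not> - ln y \<le> 1 / r"
            then have "?L y < (1 / r) powr (- \<rho>)" using r \<rho> by (intro powr_less_mono2_neg) auto
            then show False using * by simp
          qed
        qed
        also have "\<dots> \<longleftrightarrow> -1 \<le> r * ln y" using r by (simp add: field_simps)
        also have "\<dots> \<longleftrightarrow> exp (-1) \<le> y powr r" using that by (simp add: powr_def mult.commute)
        finally show "v \<le> ?L y \<longleftrightarrow> exp (-1) \<le> y powr r" .
        have "?L y = v \<longleftrightarrow> - ln y = 1 / r"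
        proof
          assume "?L y = v"
          then have "(?L y) powr (- 1 / \<rho>) = ((1 / r) powr (- \<rho>)) powr (- 1 / \<rho>)" using v_eq by simp
          then show "- ln y = 1 / r" using d r \<rho> by (simp add: powr_powr)
        qed (simp add: v_eq)
        also have "\<dots> \<longleftrightarrow> r * ln y = -1" using r by (auto simp: field_simps)
        also have "\<dots> \<longleftrightarrow> y powr r = exp (-1)" using that by (simp add: powr_def mult.commute)
        finally show "?L y = v \<longleftrightarrow> y powr r = exp (-1)" .
      qed
      have rdml: "real_distribution (mittag_leffler \<rho>)" by (rule ml(3))
      interpret G: real_distribution "mittag_leffler \<rho>" by (rule rdml)
      have meq: "measure \<kappa>' A = measure (mittag_leffler \<rho>) B"
        if "A \<in> sets borel" "B \<in> sets borel" "\<And>y. 0 < y \<Longrightarrow> y < 1 \<Longrightarrow> y powr r \<in> A \<longleftrightarrow> ?L y \<in> B" for A B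
      proof -
        have "measure \<kappa>' A = measure \<kappa> {y\<in>space \<kappa>. y powr r \<in> A}"
          unfolding \<kappa>'_def using that(1) by (subst measure_distr) (auto simp: vimage_def Int_def)
        also have "\<dots> = measure \<kappa> {y\<in>space \<kappa>. ?L y \<in> B}"
        proof (rule measure_eq_AE)
          show "AE y in \<kappa>. y \<in> {y\<in>space \<kappa>. y powr r \<in> A} \<longleftrightarrow> y \<in> {y\<in>space \<kappa>. ?L y \<in> B}"
            using ml(1) by eventually_elim (use that(3) in auto)
        qed (use that in measurable)
        also have "\<dots> = measure (mittag_leffler \<rho>) B"
          unfolding ml(2) using that(2) by (subst measure_distr) (auto simp: vimage_def Int_def)
        finally show ?thesis .
      qed
      have at0: "measure (mittag_leffler \<rho>) {v} = 0"
        using cont by (simp add: G.isCont_cdf)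
      have "measure \<kappa>' {exp (-1)} = measure (mittag_leffler \<rho>) {v}" by (rule meq) (auto simp: iff)
      then have k4: "measure \<kappa>' {exp (-1)} = 0" using at0 by simp
      have "measure \<kappa>' {exp (-1)..} = measure (mittag_leffler \<rho>) {v..}" by (rule meq) (auto simp: iff)
      also have "\<dots> = measure (mittag_leffler \<rho>) {v} + measure (mittag_leffler \<rho>) {v<..}"
        by (subst G.finite_measure_Union[symmetric]) (auto intro!: arg_cong[where f="measure (mittag_leffler \<rho>)"])
      also have "\<dots> = 1 - cdf (mittag_leffler \<rho>) v"
        using at0 G.prob_compl[of "{..v}"] by (simp add: cdf_def Compl_atMost[symmetric] Compl_eq_Diff_UNIV)
      finally have "(\<lambda>n. P.prob {x. norming c n * v < real (record_count c n x)}) \<longlonglongrightarrow> 1 - cdf (mittag_leffler \<rho>) v"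
        using tendsto_prob_record_count[OF c prob_nonneg ns less_imp_le[OF v] k1 k2 k3 k4] by simp
      from tendsto_diff[OF tendsto_const[of 1] this] show ?thesis
        by (simp add: cdf_record_count[OF c(3)])
    qed
  qed
qed

end

lemma psum_tau_nonneg: "0 \<le> c \<Longrightarrow> reach c m x \<Longrightarrow> 0 \<le> psum x (tau c m x)"
proof (induction m arbitrary: x)
  case (Suc m)
  then have h: "hits_at c x (hit c x)" and r: "reach c m (step c x)"
    by (simp_all add: reach_Suc hits_at_hit)
  have "psum x (tau c (Suc m) x) = psum x (hit c x) + psum (step c x) (tau c m (step c x))"
    by (simp add: tau_Suc step_def psum_dropn)
  then show ?case using Suc.IH[OF Suc.prems(1) r] h Suc.prems(1) by (simp add: hits_at_def)
qed simp

lemma le_tau: "reach c m x \<Longrightarrow> m \<le> tau c m x"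
proof (induction m arbitrary: x)
  case (Suc m)
  then have "hits c x" "reach c m (step c x)" by (simp_all add: reach_Suc)
  then show ?case using Suc.IH[of "step c x"] hit_pos[of c x] by (simp add: tau_Suc)
qed simp

definition total_count :: "real \<Rightarrow> (nat \<Rightarrow> real) \<Rightarrow> enat" where
  "total_count c x = lim (\<lambda>n. enat (record_count c n x))"

lemma total_sigma_record_count_eq: "total_sigma_record_count c X \<omega> = total_count c (\<lambda>i. X i \<omega>)"
  by (simp add: total_sigma_record_count_def total_count_def sigma_record_count_eq)

lemma less_total_count_iff: "enat m < total_count c x \<longleftrightarrow> reach c m x"
proof -
  have "incseq (\<lambda>n. enat (record_count c n x))"
    unfolding record_count_def by (intro monoI) (auto intro!: card_mono)
  then have "(\<lambda>n. enat (record_count c n x)) \<longlonglongrightarrow> (SUP n. enat (record_count c n x))" by (rule LIMSEQ_SUP)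
  then have "total_count c x = (SUP n. enat (record_count c n x))" unfolding total_count_def by (rule limI)
  then have "enat m < total_count c x \<longleftrightarrow> (\<exists>n. m < record_count c n x)" by (simp add: less_SUP_iff)
  also have "\<dots> \<longleftrightarrow> reach c m x" by (auto simp: less_record_count_iff)
  finally show ?thesis .
qed

context iid_steps begin

lemma weak_conv_record_count_exponential:
  assumes c: "c > 0" "summable (prob_weak_rec_less c)" "suminf (prob_weak_rec_less c) \<ge> 1" and prob_nonneg: "prob_nonneg \<longlonglongrightarrow> 0"
    and ns: "\<not> summable (\<lambda>n. prob_nonneg n / real n)"
  shows "weak_conv_m (\<lambda>n. distr S borel (\<lambda>x. real (record_count c n x) / norming c n)) (mittag_leffler 0)"
  unfolding weak_conv_m_def weak_conv_def
proof (intro allI impI)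
  fix v
  show "(\<lambda>n. cdf (distr S borel (\<lambda>x. real (record_count c n x) / norming c n)) v) \<longlonglongrightarrow> cdf (mittag_leffler 0) v"
  proof (cases "v \<le> 0")
    case True
    then have "cdf (mittag_leffler 0) v = 0"
      using mittag_leffler_0(3)[of v] mittag_leffler_0(4)[of v] by (cases "v = 0") auto
    then show ?thesis by (simp add: cdf_record_count_nonpos[OF c(3) True])
  next
    case False
    define p where "p = bernoulli_pmf (exp (- v))"
    define \<kappa> where "\<kappa> = distr (measure_pmf p) borel (\<lambda>b. of_bool b :: real)"
    have k1: "real_distribution \<kappa>" unfolding \<kappa>_def by (rule prob_space.real_distribution_distr[OF measure_pmf.prob_space_axioms]) simp
    have k2: "AE y in \<kappa>. 0 \<le> y \<and> y \<le> 1" unfolding \<kappa>_def by (subst AE_distr_iff) auto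
    have k3: "(\<integral>y. y ^ k \<partial>\<kappa>) = exp (- (v * real k powr 0))" if "k \<ge> 1" for k
      unfolding \<kappa>_def p_def using that False by (subst integral_distr) (auto simp: integral_bernoulli_pmf)
    have vim: "(\<lambda>b. of_bool b :: real) -` A = {b. of_bool b \<in> A}" for A by auto
    have "{b. of_bool b \<in> {exp (-1::real)}} = {}" by (auto simp: of_bool_def)
    then have k4: "measure \<kappa> {exp (-1)} = 0" unfolding \<kappa>_def by (subst measure_distr) (simp_all add: vim)
    have "{b. of_bool b \<in> {exp (-1::real)..}} = {True}" by (auto simp: of_bool_def split: if_splits)
    then have k5: "measure \<kappa> {exp (-1)..} = exp (- v)"
      unfolding \<kappa>_def using False by (subst measure_distr) (simp_all add: vim p_def measure_pmf_single)
    have "(\<lambda>n. P.prob {x. norming c n * v < real (record_count c n x)}) \<longlonglongrightarrow> exp (- v)"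
      using tendsto_prob_record_count[OF c prob_nonneg ns _ k1 k2 k3 k4] False k5 by simp
    from tendsto_diff[OF tendsto_const[of 1] this] show ?thesis
      using mittag_leffler_0(3)[of v] False by (simp add: cdf_record_count[OF c(3)])
  qed
qed

lemma weak_conv_record_count_degenerate:
  assumes c: "c > 0" "summable (prob_weak_rec_less c)" "suminf (prob_weak_rec_less c) \<ge> 1" and prob_nonneg: "prob_nonneg \<longlonglongrightarrow> 1"
  shows "weak_conv_m (\<lambda>n. distr S borel (\<lambda>x. real (record_count c n x) / norming c n)) (return borel 1)"
  unfolding weak_conv_m_def weak_conv_def
proof (intro allI impI)
  have ns: "\<not> summable (\<lambda>n. prob_nonneg n / real n)" by (rule not_summable_over_nat[OF prob_nonneg]) simp
  have cdf1: "cdf (return borel 1) v = (if 1 \<le> v then 1 else 0)" for v :: real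
    by (simp add: cdf_def measure_return)
  interpret r: real_distribution "return borel (1::real)"
    by (rule real_distribution.intro[OF prob_space_return]) (auto intro!: real_distribution_axioms.intro)
  fix v :: real assume "isCont (cdf (return borel 1)) v"
  then have "measure (return borel 1) {v} = 0" by (simp add: r.isCont_cdf)
  then have v1: "v \<noteq> 1" by (auto simp: measure_return)
  show "(\<lambda>n. cdf (distr S borel (\<lambda>x. real (record_count c n x) / norming c n)) v) \<longlonglongrightarrow> cdf (return borel 1) v"
  proof (cases "v \<le> 0")
    case True
    then show ?thesis by (simp add: cdf_record_count_nonpos[OF c(3) True] cdf1)
  next
    case False
    have k1: "real_distribution (return borel (exp (- v)))"
      by (rule real_distribution.intro[OF prob_space_return]) (auto intro!: real_distribution_axioms.intro)
    have k2: "AE y in return borel (exp (- v)). 0 \<le> y \<and> y \<le> 1" using False by (subst AE_return) auto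
    have k3: "(\<integral>y. y ^ k \<partial>return borel (exp (- v))) = exp (- (v * real k powr 1))" for k
      by (subst integral_return) (auto simp: exp_of_nat_mult[symmetric] mult.commute)
    have k4: "measure (return borel (exp (- v))) {exp (-1)} = 0" using v1 by (simp add: measure_return)
    have "(\<lambda>n. P.prob {x. norming c n * v < real (record_count c n x)}) \<longlonglongrightarrow> measure (return borel (exp (- v))) {exp (-1)..}"
      using tendsto_prob_record_count[OF c prob_nonneg ns _ k1 k2 k3 k4] False by simp
    from tendsto_diff[OF tendsto_const[of 1] this] show ?thesis
      using v1 by (cases "v < 1") (simp_all add: cdf_record_count[OF c(3)] cdf1 measure_return indicator_def)
  qed
qed

lemma drift_to_minus_infinity:
  assumes c: "c > 0" "summable (prob_weak_rec_less c)" "suminf (prob_weak_rec_less c) \<ge> 1"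
    and drift: "AE x in S. filterlim (psum x) at_bot sequentially"
  shows "summable (\<lambda>n. prob_nonneg n / real n)"
    and "1 - genfun (prob_hit c) 1 = suminf (prob_weak_rec_less c) * exp (- (\<Sum>n. prob_nonneg n / real n))"
    and "0 < 1 - genfun (prob_hit c) 1" "1 - genfun (prob_hit c) 1 \<le> 1"
proof -
  have F0: "0 \<le> genfun (prob_hit c) 1" using sums_prob_hit[of 1 c] by (intro genfun_nonneg) auto
  have "genfun (prob_hit c) 1 \<noteq> 1"
  proof
    assume "genfun (prob_hit c) 1 = 1"
    from AE_reach[OF this] drift have "AE x in S. False"
    proof eventually_elim
      case (elim x)
      then obtain N where N: "\<And>n. n \<ge> N \<Longrightarrow> psum x n < 0"
        unfolding filterlim_at_bot_dense eventually_sequentially by blast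
      have "psum x (tau c N x) < 0" using le_tau[of c N x] elim by (intro N) auto
      then show False using psum_tau_nonneg[of c N x] c(1) elim by auto
    qed
    then show False by simp
  qed
  then show pos: "0 < 1 - genfun (prob_hit c) 1" using genfun_prob_hit_le_1[of 1 c] by simp
  show "1 - genfun (prob_hit c) 1 \<le> 1" using F0 by simp
  let ?V = "suminf (prob_weak_rec_less c)" and ?y = "\<lambda>n. 1 - 1 / real (Suc n)"
  have y1: "?y \<longlonglongrightarrow> 1" using tendsto_diff[OF tendsto_const LIMSEQ_Suc[OF lim_1_over_n], of 1] by simp
  have yr: "0 \<le> ?y n" "?y n < 1" "\<bar>?y n\<bar> < 1" for n by (auto simp: divide_le_eq_1 abs_less_iff)
  have eq: "1 - genfun (prob_hit c) (?y n) = genfun (prob_weak_rec_less c) (?y n) * exp (- spitzer_series (?y n))" for n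
    by (rule one_minus_genfun_prob_hit_exp[OF yr(3) c(1)])
  have "spitzer_series (?y n) \<le> - ln ((1 - genfun (prob_hit c) 1) / ?V)" for n
  proof -
    have "genfun (prob_hit c) (?y n) \<le> genfun (prob_hit c) 1"
      unfolding genfun_def using yr[of n] by (intro suminf_le sums_prob_hit mult_left_mono power_mono) auto
    moreover have "genfun (prob_weak_rec_less c) (?y n) \<le> ?V"
      unfolding genfun_def
    proof (intro suminf_le c(2))
      show "summable (\<lambda>k. prob_weak_rec_less c k * ?y n ^ k)" by (rule summable_genfun[OF prob_coeff(4) yr(3)])
      show "prob_weak_rec_less c k * ?y n ^ k \<le> prob_weak_rec_less c k" for k using yr[of n] by (intro mult_left_le power_le_one) auto
    qed
    moreover from this have "genfun (prob_weak_rec_less c) (?y n) * exp (- spitzer_series (?y n)) \<le> ?V * exp (- spitzer_series (?y n))"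
      by (intro mult_right_mono) auto
    ultimately have "1 - genfun (prob_hit c) 1 \<le> ?V * exp (- spitzer_series (?y n))"
      using eq[of n] by linarith
    then have "(1 - genfun (prob_hit c) 1) / ?V \<le> exp (- spitzer_series (?y n))" using c(3) by (simp add: field_simps)
    then have "ln ((1 - genfun (prob_hit c) 1) / ?V) \<le> ln (exp (- spitzer_series (?y n)))" using pos c(3) by (subst ln_le_cancel_iff) auto
    then show ?thesis by simp
  qed
  moreover have "prob_nonneg n / real n \<le> 1" for n using coeff_L[of n] by linarith
  ultimately show sL: "summable (\<lambda>n. prob_nonneg n / real n)"
    using yr by (intro tendsto_genfun_imp_summable[OF _ _ y1, where B=1 and C="- ln ((1 - genfun (prob_hit c) 1) / ?V)"]) (auto simp: spitzer_series_def)
  have "(\<lambda>n. 1 - genfun (prob_hit c) (?y n)) \<longlonglongrightarrow> 1 - suminf (prob_hit c)"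
    by (intro tendsto_diff tendsto_const tendsto_genfun_at_1 y1) (use sums_prob_hit[of 1 c] yr in \<open>auto intro: less_imp_le\<close>)
  moreover have "(\<lambda>n. genfun (prob_weak_rec_less c) (?y n) * exp (- spitzer_series (?y n))) \<longlonglongrightarrow> ?V * exp (- (\<Sum>n. prob_nonneg n / real n))"
    unfolding spitzer_series_def
    by (intro tendsto_intros tendsto_genfun_at_1 y1 c(2) sL) (use yr in \<open>auto intro: less_imp_le\<close>)
  ultimately have "1 - suminf (prob_hit c) = ?V * exp (- (\<Sum>n. prob_nonneg n / real n))"
    unfolding eq by (rule LIMSEQ_unique)
  then show "1 - genfun (prob_hit c) 1 = ?V * exp (- (\<Sum>n. prob_nonneg n / real n))" by (simp add: genfun_def)
qed

lemma measurable_total_count [measurable]: "total_count c \<in> measurable S (count_space UNIV)"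
proof -
  have eq: "total_count c x = a \<longleftrightarrow> (\<forall>m. enat m < a \<longleftrightarrow> reach c m x)" for a x
  proof
    assume *: "\<forall>m. enat m < a \<longleftrightarrow> reach c m x"
    have "enat m < a \<longleftrightarrow> enat m < total_count c x" for m using * less_total_count_iff by blast
    then show "total_count c x = a"
      by (metis enat_ord_simps(2) enat_ord_simps(4) linorder_neqE less_irrefl not_enat_eq)
  qed (auto simp: less_total_count_iff)
  have "{x\<in>space S. total_count c x = a} \<in> sets S" for a
    unfolding eq by measurable
  then show ?thesis by (subst measurable_count_space_eq2_countable) (auto simp: vimage_def Int_def)
qed

lemma distr_total_count:
  assumes p: "p = 1 - genfun (prob_hit c) 1" "0 < p" "p \<le> 1"
  shows "distr S (count_space UNIV) (total_count c) = measure_pmf (map_pmf (\<lambda>j. enat (Suc j)) (geometric_pmf p))"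
proof (rule measure_eqI_countable[of _ UNIV])
  fix a :: enat
  let ?G = "map_pmf (\<lambda>j. enat (Suc j)) (geometric_pmf p)"
  have "measure (distr S (count_space UNIV) (total_count c)) {a} = P.prob {x. total_count c x = a}"
    by (subst measure_distr) (auto intro!: arg_cong[where f=P.prob])
  also have "\<dots> = pmf ?G a"
  proof (cases "\<exists>j. a = enat (Suc j)")
    case True
    then obtain j where j: "a = enat (Suc j)" by blast
    have "total_count c x = a \<longleftrightarrow> reach c j x \<and> \<not> reach c (Suc j) x" for x
      unfolding less_total_count_iff[symmetric] j
      by (cases "total_count c x") auto
    then have "{x. total_count c x = a} = {x. reach c j x} - {x. reach c (Suc j) x}" by auto
    then have "P.prob {x. total_count c x = a} = genfun (prob_hit c) 1 ^ j - genfun (prob_hit c) 1 ^ Suc j"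
      using sets_Collect_S[OF pred_reach] reach_antimono[of j "Suc j" c]
      by (simp only: prob_reach[symmetric]) (subst P.finite_measure_Diff, auto)
    also have "\<dots> = (1 - p) ^ j * p" by (simp add: p(1) algebra_simps)
    also have "\<dots> = pmf (geometric_pmf p) j" using p by (simp add: geometric_pmf.rep_eq)
    also have "\<dots> = pmf ?G a" unfolding j by (subst pmf_map_inj') (auto simp: inj_on_def)
    finally show ?thesis .
  next
    case False
    then have "pmf ?G a = 0" by (subst pmf_map_outside) auto
    moreover have "P.prob {x. total_count c x = a} = 0"
    proof (cases a)
      case (enat k)
      then have "k = 0" using False by (cases k) auto
      have "total_count c x \<noteq> a" for x
        using less_total_count_iff[of 0 c x] enat \<open>k = 0\<close> by auto
      then show ?thesis by simp
    next
      case infinity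
      have "P.prob {x. total_count c x = a} \<le> (1 - p) ^ m" for m
      proof -
        have "P.prob {x. total_count c x = a} \<le> P.prob {x. reach c m x}"
          using infinity by (intro P.finite_measure_mono sets_Collect_S[OF pred_reach])
            (auto simp: less_total_count_iff[symmetric])
        then show ?thesis by (simp add: prob_reach p(1))
      qed
      moreover have "(\<lambda>m. (1 - p) ^ m) \<longlonglongrightarrow> 0" using p by (intro LIMSEQ_power_zero) auto
      ultimately have "P.prob {x. total_count c x = a} \<le> 0" by (intro LIMSEQ_le_const) auto
      then show ?thesis using measure_nonneg by (intro antisym)
    qed
    ultimately show ?thesis by simp
  qed
  finally show "emeasure (distr S (count_space UNIV) (total_count c)) {a} = emeasure (measure_pmf ?G) {a}"
    using P.prob_space_distr[OF measurable_total_count]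
    by (simp add: emeasure_pmf_single finite_measure.emeasure_eq_measure prob_space.finite_measure)
qed auto

end

section \<open>Approximation in the Skorokhod space\<close>

definition step_path :: "real \<Rightarrow> (nat \<Rightarrow> real) \<Rightarrow> real \<Rightarrow> real" where
  "step_path r a = (\<lambda>t\<in>{0..}. a (nat \<lfloor>r * t\<rfloor>))"

lemma step_path_in_skorokhod_D:
  assumes "r \<ge> 0" shows "step_path r a \<in> skorokhod_D"
proof (cases "r = 0")
  case True
  have *: "\<forall>\<^sub>F s in at t within A. step_path r a s = a 0" if "A \<subseteq> {0<..}" for t A
    using that True by (auto simp: eventually_at_filter step_path_def subset_eq intro!: always_eventually)
  have "(step_path r a \<longlongrightarrow> a 0) (at_right t)" if "t \<ge> 0" for t
    by (rule tendsto_eventually) (use that in \<open>intro *; auto\<close>)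
  moreover have "\<exists>l. (step_path r a \<longlongrightarrow> l) (at_left t)" if "t > 0" for t
  proof -
    have "\<forall>\<^sub>F s in at_left t. s \<in> {0<..<t}" using that by (rule eventually_at_left_real)
    then have "\<forall>\<^sub>F s in at_left t. step_path r a s = a 0" by eventually_elim (simp add: step_path_def True)
    then show ?thesis by (auto intro: tendsto_eventually)
  qed
  ultimately show ?thesis using True by (auto simp: skorokhod_D_def step_path_def)
next
  case False
  then have r: "r > 0" using assms by simp
  have right: "(step_path r a \<longlongrightarrow> step_path r a t) (at_right t)" if t: "t \<ge> 0" for t
  proof (rule tendsto_eventually)
    define b where "b = (of_int \<lfloor>r * t\<rfloor> + 1) / r"
    have "t < b" using r unfolding b_def by (simp add: pos_less_divide_eq mult.commute)
    then have "\<forall>\<^sub>F s in at_right t. s \<in> {t<..<b}" by (rule eventually_at_right_real)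
    then show "\<forall>\<^sub>F s in at_right t. step_path r a s = step_path r a t"
    proof eventually_elim
      case (elim s)
      have "r * t \<le> r * s" using elim r by simp
      moreover have "r * s < of_int \<lfloor>r * t\<rfloor> + 1" using elim r unfolding b_def by (simp add: pos_less_divide_eq mult.commute)
      ultimately have "\<lfloor>r * s\<rfloor> = \<lfloor>r * t\<rfloor>" by linarith
      then show ?case using elim t by (simp add: step_path_def)
    qed
  qed
  have left: "\<exists>l. (step_path r a \<longlongrightarrow> l) (at_left t)" if t: "t > 0" for t
  proof (intro exI tendsto_eventually)
    define b where "b = (of_int \<lceil>r * t\<rceil> - 1) / r"
    have "b < t" using r unfolding b_def by (simp add: pos_divide_less_eq mult.commute) linarith
    moreover have "b \<ge> 0"
    proof -
      have "0 < r * t" using r t by simp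
      then have "\<lceil>r * t\<rceil> \<ge> 1" by linarith
      then show ?thesis using r unfolding b_def by simp
    qed
    ultimately have "\<forall>\<^sub>F s in at_left t. s \<in> {b<..<t}" by (intro eventually_at_left_real)
    then show "\<forall>\<^sub>F s in at_left t. step_path r a s = a (nat (\<lceil>r * t\<rceil> - 1))"
    proof eventually_elim
      case (elim s)
      have "r * s < r * t" using elim r by simp
      moreover have "of_int \<lceil>r * t\<rceil> - 1 < r * s" using elim r unfolding b_def by (simp add: pos_divide_less_eq mult.commute)
      ultimately have "\<lfloor>r * s\<rfloor> = \<lceil>r * t\<rceil> - 1" by linarith
      then show ?case using elim \<open>b \<ge> 0\<close> by (simp add: step_path_def)
    qed
  qed
  show ?thesis using right left by (auto simp: skorokhod_D_def step_path_def)
qed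

lemma time_change_id: "time_change (\<lambda>t. t)"
  by (auto simp: time_change_def strict_mono_on_def bij_betw_def inj_on_def)

lemma continuous_skorokhod_seq:
  assumes f: "continuous_map skorokhod_topology euclideanreal f"
    and D: "x \<in> skorokhod_D" "\<And>k. y k \<in> skorokhod_D"
    and lim: "\<And>T \<epsilon>. 0 < T \<Longrightarrow> 0 < \<epsilon> \<Longrightarrow> \<forall>\<^sub>F k in sequentially. \<forall>t\<in>{0..T}. \<bar>y k t - x t\<bar> < \<epsilon>"
  shows "(\<lambda>k. f (y k)) \<longlonglongrightarrow> f x"
proof (rule tendstoI)
  fix e :: real assume "e > 0"
  have "openin skorokhod_topology {z \<in> topspace skorokhod_topology. f z \<in> ball (f x) e}"
    using f by (rule openin_continuous_map_preimage) simp
  then have "openin skorokhod_topology {z \<in> skorokhod_D. f z \<in> ball (f x) e}"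
    by (simp add: topspace_skorokhod_topology)
  moreover have "x \<in> {z \<in> skorokhod_D. f z \<in> ball (f x) e}" using D \<open>e > 0\<close> by simp
  ultimately obtain T \<epsilon> where T: "T > 0" "\<epsilon> > 0" "skorokhod_nbhd x T \<epsilon> \<subseteq> {z \<in> skorokhod_D. f z \<in> ball (f x) e}"
    unfolding openin_skorokhod_topology by blast
  show "\<forall>\<^sub>F k in sequentially. dist (f (y k)) (f x) < e"
    using lim[OF T(1,2)]
  proof eventually_elim
    case (elim k)
    then have "y k \<in> skorokhod_nbhd x T \<epsilon>"
      unfolding skorokhod_nbhd_def using D T(2) time_change_id by (auto intro!: exI[of _ "\<lambda>t. t"])
    then show ?case using T(3) by (auto simp: dist_commute)
  qed
qed

text \<open>The Moreau-Yosida type regularization of \<open>f\<close> with respect to the uniform distance on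
  \<open>[0, j]\<close>: it is Lipschitz and increases to \<open>f\<close>.\<close>

definition reg_set :: "((real \<Rightarrow> real) \<Rightarrow> real) \<Rightarrow> nat \<Rightarrow> (real \<Rightarrow> real) \<Rightarrow> real set" where
  "reg_set f j x = {f y + real j * r | y r. y \<in> skorokhod_D \<and> 0 \<le> r \<and> (\<forall>t\<in>{0..real j}. \<bar>x t - y t\<bar> \<le> r)}"

definition reg :: "((real \<Rightarrow> real) \<Rightarrow> real) \<Rightarrow> nat \<Rightarrow> (real \<Rightarrow> real) \<Rightarrow> real" where
  "reg f j x = Inf (reg_set f j x)"

context
  fixes f :: "(real \<Rightarrow> real) \<Rightarrow> real" and B :: real
  assumes f_cont: "continuous_map skorokhod_topology euclideanreal f"
    and f_bound: "\<forall>x\<in>skorokhod_D. \<bar>f x\<bar> \<le> B"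
begin

lemma reg_set_self: "x \<in> skorokhod_D \<Longrightarrow> f x \<in> reg_set f j x"
  unfolding reg_set_def by (auto intro!: exI[of _ x] exI[of _ "0::real"])

lemma reg_set_ge: "z \<in> reg_set f j x \<Longrightarrow> - B \<le> z"
proof -
  assume "z \<in> reg_set f j x"
  then obtain y r where "z = f y + real j * r" "y \<in> skorokhod_D" "0 \<le> r" unfolding reg_set_def by auto
  moreover from this have "- B \<le> f y" using bspec[OF f_bound, of y] by (simp add: abs_le_iff)
  moreover have "0 \<le> real j * r" using \<open>0 \<le> r\<close> by simp
  ultimately show "- B \<le> z" by linarith
qed

lemma bdd_below_reg_set: "bdd_below (reg_set f j x)"
  using reg_set_ge by (intro bdd_belowI)

lemma reg_le: "x \<in> skorokhod_D \<Longrightarrow> reg f j x \<le> f x"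
  unfolding reg_def by (intro cInf_lower reg_set_self bdd_below_reg_set)

lemma reg_ge: "x \<in> skorokhod_D \<Longrightarrow> - B \<le> reg f j x"
  unfolding reg_def using reg_set_self by (intro cInf_greatest) (auto dest: reg_set_ge)

lemma reg_lipschitz:
  assumes "x \<in> skorokhod_D" "x' \<in> skorokhod_D" "0 \<le> d" "\<And>t. 0 \<le> t \<Longrightarrow> t \<le> real j \<Longrightarrow> \<bar>x t - x' t\<bar> \<le> d"
  shows "reg f j x' \<le> reg f j x + real j * d"
proof -
  have "reg f j x' - real j * d \<le> z" if zz: "z \<in> reg_set f j x" for z
  proof -
    obtain y r where z: "z = f y + real j * r" "y \<in> skorokhod_D" "0 \<le> r" "\<forall>t\<in>{0..real j}. \<bar>x t - y t\<bar> \<le> r"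
      using zz unfolding reg_set_def by blast
    have "\<bar>x' t - y t\<bar> \<le> r + d" if "t \<in> {0..real j}" for t
    proof -
      have "\<bar>x t - y t\<bar> \<le> r" using z(4) that by blast
      moreover have "\<bar>x t - x' t\<bar> \<le> d" using assms(4)[of t] that by simp
      ultimately show ?thesis by linarith
    qed
    then have "f y + real j * (r + d) \<in> reg_set f j x'"
      unfolding reg_set_def using z assms(3) by (auto intro!: exI[of _ y] exI[of _ "r + d"])
    then have "reg f j x' \<le> f y + real j * (r + d)" unfolding reg_def by (intro cInf_lower bdd_below_reg_set)
    then show ?thesis using z(1) by (simp add: distrib_left)
  qed
  then have "reg f j x' - real j * d \<le> reg f j x"
    unfolding reg_def[of f j x] using reg_set_self[OF assms(1)] by (intro cInf_greatest) auto
  then show ?thesis by simp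
qed

lemma reg_lipschitz_abs:
  assumes "x \<in> skorokhod_D" "x' \<in> skorokhod_D" "0 \<le> d" "\<And>t. 0 \<le> t \<Longrightarrow> t \<le> real j \<Longrightarrow> \<bar>x t - x' t\<bar> \<le> d"
  shows "\<bar>reg f j x - reg f j x'\<bar> \<le> real j * d"
proof -
  have "reg f j x' \<le> reg f j x + real j * d"
    by (rule reg_lipschitz[OF assms(1,2,3)]) (rule assms(4))
  moreover have "reg f j x \<le> reg f j x' + real j * d"
    by (rule reg_lipschitz[OF assms(2,1,3)]) (simp add: assms(4) abs_minus_commute)
  ultimately show ?thesis by linarith
qed

lemma tendsto_reg:
  assumes x: "x \<in> skorokhod_D" shows "(\<lambda>j. reg f j x) \<longlonglongrightarrow> f x"
proof -
  have "\<exists>y r. y \<in> skorokhod_D \<and> 0 \<le> r \<and> (\<forall>t\<in>{0..real j}. \<bar>x t - y t\<bar> \<le> r) \<and> f y + real j * r < reg f j x + 1 / real (Suc j)" for j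
  proof -
    have "\<exists>z\<in>reg_set f j x. z < reg f j x + 1 / real (Suc j)"
      unfolding reg_def using reg_set_self[OF x] by (intro cInf_lessD) auto
    then show ?thesis unfolding reg_set_def by blast
  qed
  then obtain y r where yr: "\<And>j. y j \<in> skorokhod_D" "\<And>j. 0 \<le> r j" "\<And>j t. t \<in> {0..real j} \<Longrightarrow> \<bar>x t - y j t\<bar> \<le> r j"
    "\<And>j. f (y j) + real j * r j < reg f j x + 1 / real (Suc j)" by metis
  have inv0: "(\<lambda>n. 1 / real (Suc n)) \<longlonglongrightarrow> 0" by (rule LIMSEQ_Suc[OF lim_1_over_n])
  have r_le: "real j * r j \<le> 2 * B + 1" for j
  proof -
    have "1 / real (Suc j) \<le> 1" by simp
    moreover have "reg f j x \<le> B" using reg_le[OF x, of j] bspec[OF f_bound x] by (simp add: abs_le_iff)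
    moreover have "- B \<le> f (y j)" using bspec[OF f_bound yr(1)[of j]] by (simp add: abs_le_iff)
    ultimately show ?thesis using yr(4)[of j] by linarith
  qed
  have r0: "\<forall>\<^sub>F j in sequentially. r j < \<epsilon>" if "\<epsilon> > 0" for \<epsilon>
  proof -
    obtain N :: nat where N: "(2 * B + 1) / \<epsilon> < real N" using reals_Archimedean2 by blast
    show ?thesis
    proof (rule eventually_sequentiallyI[of "max 1 N"])
      fix j assume j: "max 1 N \<le> j"
      show "r j < \<epsilon>"
      proof (rule ccontr)
        assume "\<not> r j < \<epsilon>"
        then have "real j * \<epsilon> \<le> real j * r j" by (intro mult_left_mono) auto
        moreover have "real N * \<epsilon> \<le> real j * \<epsilon>" using j \<open>\<epsilon> > 0\<close> by (intro mult_right_mono) auto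
        moreover have "2 * B + 1 < real N * \<epsilon>" using N \<open>\<epsilon> > 0\<close> by (simp add: pos_divide_less_eq)
        ultimately show False using r_le[of j] by linarith
      qed
    qed
  qed
  have fy: "(\<lambda>j. f (y j)) \<longlonglongrightarrow> f x"
  proof (rule continuous_skorokhod_seq[OF f_cont x yr(1)])
    fix T \<epsilon> :: real assume "0 < T" "0 < \<epsilon>"
    obtain N :: nat where "T \<le> real N" using real_arch_simple by blast
    have "\<forall>\<^sub>F j in sequentially. j \<ge> N" by (rule eventually_ge_at_top)
    with r0[OF \<open>0 < \<epsilon>\<close>] show "\<forall>\<^sub>F j in sequentially. \<forall>t\<in>{0..T}. \<bar>y j t - x t\<bar> < \<epsilon>"
    proof eventually_elim
      case (elim j)
      show ?case
      proof
        fix t assume "t \<in> {0..T}"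
        then have "t \<in> {0..real j}" using elim(2) \<open>T \<le> real N\<close> by auto
        from yr(3)[OF this] elim(1) show "\<bar>y j t - x t\<bar> < \<epsilon>" by linarith
      qed
    qed
  qed
  show ?thesis
  proof (rule tendsto_sandwich)
    show "\<forall>\<^sub>F j in sequentially. f (y j) - 1 / real (Suc j) \<le> reg f j x"
    proof (rule always_eventually, rule allI)
      fix j
      have "0 \<le> real j * r j" using yr(2)[of j] by simp
      then show "f (y j) - 1 / real (Suc j) \<le> reg f j x" using yr(4)[of j] by linarith
    qed
    show "\<forall>\<^sub>F j in sequentially. reg f j x \<le> f x" using reg_le[OF x] by (intro always_eventually) auto
    show "(\<lambda>j. f (y j) - 1 / real (Suc j)) \<longlonglongrightarrow> f x" using tendsto_diff[OF fy inv0] by simp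
  qed simp
qed

end

text \<open>Discretization: \<open>y i\<close> stands for \<open>exp (- T)\<close>, with \<open>T\<close> the hitting time of the level
  \<open>i / \<kappa>\<close> by the path \<open>x\<close>.\<close>

definition hitting_rel :: "nat \<Rightarrow> (nat \<Rightarrow> real) \<Rightarrow> (real \<Rightarrow> real) \<Rightarrow> bool" where
  "hitting_rel \<kappa> y x \<longleftrightarrow> (\<forall>i t. 0 \<le> t \<longrightarrow> (exp (- t) \<le> y i \<longrightarrow> real i / real \<kappa> \<le> x t) \<and>
     (y i < exp (- t) \<longrightarrow> x t \<le> real i / real \<kappa>))"

definition ramp :: "nat \<Rightarrow> nat \<Rightarrow> real \<Rightarrow> real" where
  "ramp \<kappa> l y = clamp01 ((y - exp (- (real l / real \<kappa>))) / (exp (- ((real l - 1) / real \<kappa>)) - exp (- (real l / real \<kappa>))))"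

definition level_count :: "nat \<Rightarrow> (nat \<Rightarrow> real) \<Rightarrow> nat \<Rightarrow> real" where
  "level_count \<kappa> y l = (\<Sum>i=1..\<kappa> * \<kappa>. ramp \<kappa> l (y i)) / real \<kappa>"

definition mesh_error :: "nat \<Rightarrow> nat \<Rightarrow> (nat \<Rightarrow> real) \<Rightarrow> real" where
  "mesh_error j \<kappa> y = Max ((\<lambda>l. level_count \<kappa> y (l + 2) - level_count \<kappa> y l) ` {..j * \<kappa>}) + 1 / real \<kappa>"

definition overflow :: "nat \<Rightarrow> real \<Rightarrow> real" where
  "overflow j y = clamp01 ((y - exp (- (real j + 2))) / (exp (- (real j + 1)) - exp (- (real j + 2))))"

definition lower_approx :: "((real \<Rightarrow> real) \<Rightarrow> real) \<Rightarrow> real \<Rightarrow> nat \<Rightarrow> nat \<Rightarrow> (nat \<Rightarrow> real) \<Rightarrow> real" where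
  "lower_approx f B j \<kappa> y = max (- (3 * B)) (reg f j (step_path (real \<kappa>) (level_count \<kappa> y))
     - real j * mesh_error j \<kappa> y - 2 * B * overflow j (y (\<kappa> * \<kappa>)))"

lemma clamp01_eq: "y \<le> 0 \<Longrightarrow> clamp01 y = 0" "1 \<le> y \<Longrightarrow> clamp01 y = 1"
  by (simp_all add: clamp01_def)

lemma ramp_eq:
  assumes "\<kappa> \<ge> 1"
  shows "y \<le> exp (- (real l / real \<kappa>)) \<Longrightarrow> ramp \<kappa> l y = 0"
    and "exp (- (real l / real \<kappa>)) \<le> y \<Longrightarrow> ramp \<kappa> (l + 1) y = 1"
proof -
  have less: "exp (- (real l / real \<kappa>)) < exp (- ((real l - 1) / real \<kappa>))" for l
    using assms by (simp add: divide_strict_right_mono)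
  show "y \<le> exp (- (real l / real \<kappa>)) \<Longrightarrow> ramp \<kappa> l y = 0"
    unfolding ramp_def using less[of l] by (intro clamp01_eq(1)) (simp add: divide_le_0_iff)
  show "exp (- (real l / real \<kappa>)) \<le> y \<Longrightarrow> ramp \<kappa> (l + 1) y = 1"
    unfolding ramp_def using less[of "l + 1"] by (intro clamp01_eq(2)) (simp add: le_divide_eq_1)
qed

lemma level_count_bounds:
  assumes \<kappa>: "\<kappa> \<ge> 1" and rel: "hitting_rel \<kappa> y x" and y: "antimono y" and x: "mono_on {0..} x" "0 \<le> x 0"
  shows "level_count \<kappa> y l \<le> x (real l / real \<kappa>)"
    and "y (\<kappa> * \<kappa>) < exp (- (real l / real \<kappa>)) \<Longrightarrow> x (real l / real \<kappa>) \<le> level_count \<kappa> y (l + 1) + 1 / real \<kappa>"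
    and "0 \<le> level_count \<kappa> y l"
proof -
  have x0: "0 \<le> x t" if "0 \<le> t" for t
    using x(2) mono_onD[OF x(1), of 0 t] that by simp
  let ?e = "exp (- (real l / real \<kappa>))" and ?I = "\<kappa> * \<kappa>"
  define A where "A = {i. i \<le> ?I \<and> (i = 0 \<or> ?e \<le> y i)}"
  have fin: "finite A" by (simp add: A_def)
  have "0 \<in> A" by (simp add: A_def)
  define p where "p = Max A"
  have pA: "p \<in> A" unfolding p_def using fin \<open>0 \<in> A\<close> by (intro Max_in) auto
  have p_max: "i \<le> p" if "i \<in> A" for i unfolding p_def using fin that by (rule Max_ge)
  have t0: "0 \<le> real l / real \<kappa>" by simp
  have ramp01: "0 \<le> ramp \<kappa> l z" "ramp \<kappa> l z \<le> 1" for l z by (simp_all add: ramp_def)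
  show "0 \<le> level_count \<kappa> y l" unfolding level_count_def by (intro divide_nonneg_nonneg sum_nonneg ramp01) auto
  have "(\<Sum>i=1..?I. ramp \<kappa> l (y i)) \<le> (\<Sum>i=1..?I. if i \<le> p then 1 else 0)"
  proof (rule sum_mono)
    fix i assume i: "i \<in> {1..?I}"
    show "ramp \<kappa> l (y i) \<le> (if i \<le> p then 1 else 0)"
    proof (cases "i \<le> p")
      case False
      then have "i \<notin> A" using p_max by auto
      then have "y i \<le> ?e" using i by (auto simp: A_def)
      then show ?thesis using ramp_eq(1)[OF \<kappa>] False by simp
    qed (simp add: ramp01)
  qed
  also have "\<dots> = real (card ({1..?I} \<inter> {i. i \<le> p}))" by (simp add: sum.If_cases)
  also have "{1..?I} \<inter> {i. i \<le> p} = {1..p}" using pA by (auto simp: A_def)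
  finally have "(\<Sum>i=1..?I. ramp \<kappa> l (y i)) \<le> real p" by simp
  then have le_p: "level_count \<kappa> y l \<le> real p / real \<kappa>" unfolding level_count_def by (intro divide_right_mono) auto
  have "real p / real \<kappa> \<le> x (real l / real \<kappa>)"
  proof (cases "p = 0")
    case True
    then show ?thesis using x0[OF t0] by simp
  next
    case False
    then have "?e \<le> y p" using pA by (simp add: A_def)
    then show ?thesis using rel t0 unfolding hitting_rel_def by blast
  qed
  with le_p show "level_count \<kappa> y l \<le> x (real l / real \<kappa>)" by linarith
  assume over: "y ?I < ?e"
  have "?I \<ge> 1" using \<kappa> by (simp add: Suc_le_eq)
  have "p \<noteq> ?I"
  proof
    assume "p = ?I"
    then have "?e \<le> y ?I" using pA \<open>?I \<ge> 1\<close> by (auto simp: A_def)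
    then show False using over by simp
  qed
  then have "p + 1 \<le> ?I" using pA by (simp add: A_def)
  have "p + 1 \<notin> A" using p_max[of "p + 1"] by auto
  then have "y (p + 1) < ?e" using \<open>p + 1 \<le> ?I\<close> by (simp add: A_def)
  then have "x (real l / real \<kappa>) \<le> real (p + 1) / real \<kappa>" using rel t0 unfolding hitting_rel_def by blast
  moreover have "real p / real \<kappa> \<le> level_count \<kappa> y (l + 1)"
  proof -
    have "real p = (\<Sum>i=1..p. ramp \<kappa> (l + 1) (y i))"
    proof -
      have "ramp \<kappa> (l + 1) (y i) = 1" if "i \<in> {1..p}" for i
      proof -
        have "?e \<le> y p" using pA that by (auto simp: A_def)
        also have "y p \<le> y i" using y that by (intro antimonoD[OF y]) auto
        finally show ?thesis by (rule ramp_eq(2)[OF \<kappa>])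
      qed
      then show ?thesis by simp
    qed
    also have "\<dots> \<le> (\<Sum>i=1..?I. ramp \<kappa> (l + 1) (y i))"
      using \<open>p + 1 \<le> ?I\<close> ramp01 by (intro sum_mono2) auto
    finally show ?thesis unfolding level_count_def by (intro divide_right_mono) auto
  qed
  ultimately show "x (real l / real \<kappa>) \<le> level_count \<kappa> y (l + 1) + 1 / real \<kappa>"
    by (simp add: add_divide_distrib)
qed

lemma mesh_error_ge: "l \<le> j * \<kappa> \<Longrightarrow> level_count \<kappa> y (l + 2) - level_count \<kappa> y l + 1 / real \<kappa> \<le> mesh_error j \<kappa> y"
  unfolding mesh_error_def by (intro add_right_mono Max_ge) auto

lemma step_path_approx:
  assumes \<kappa>: "\<kappa> \<ge> 1" and rel: "hitting_rel \<kappa> y x" and y: "antimono y"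
    and x: "mono_on {0..} x" "0 \<le> x 0" and over: "y (\<kappa> * \<kappa>) < exp (- (real j + 1))"
    and t: "0 \<le> t" "t \<le> real j"
  shows "\<bar>step_path (real \<kappa>) (level_count \<kappa> y) t - x t\<bar> \<le> mesh_error j \<kappa> y"
proof -
  define l where "l = nat \<lfloor>real \<kappa> * t\<rfloor>"
  have x0: "0 \<le> x t" if "0 \<le> t" for t
    using x(2) mono_onD[OF x(1), of 0 t] that by simp
  note lb = level_count_bounds[OF \<kappa> rel y x]
  have "0 \<le> real \<kappa> * t" using t by simp
  then have l: "real l \<le> real \<kappa> * t" "real \<kappa> * t < real l + 1" unfolding l_def by linarith+
  have lj: "l \<le> j * \<kappa>"
  proof -
    have "real \<kappa> * t \<le> real \<kappa> * real j" using t by (intro mult_left_mono) auto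
    then have "real l \<le> real (j * \<kappa>)" using l by (simp add: mult.commute)
    then show ?thesis by (simp only: of_nat_le_iff)
  qed
  have \<kappa>0: "real \<kappa> > 0" using \<kappa> by simp
  have lt: "real l / real \<kappa> \<le> t" "t \<le> real (l + 1) / real \<kappa>"
    using l \<kappa>0 by (simp_all add: pos_divide_le_eq pos_le_divide_eq mult.commute)
  have "real (l + 1) / real \<kappa> \<le> real j + 1"
  proof -
    have "l + 1 \<le> j * \<kappa> + \<kappa>" using lj \<kappa> by linarith
    then have "real (l + 1) \<le> real (j * \<kappa> + \<kappa>)" by (rule of_nat_mono)
    then have "real (l + 1) / real \<kappa> \<le> real (j * \<kappa> + \<kappa>) / real \<kappa>" by (intro divide_right_mono) auto
    also have "\<dots> = real j + 1" using \<kappa>0 by (simp add: add_divide_distrib)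
    finally show ?thesis .
  qed
  then have "exp (- (real j + 1)) \<le> exp (- (real (l + 1) / real \<kappa>))" by simp
  then have over': "y (\<kappa> * \<kappa>) < exp (- (real (l + 1) / real \<kappa>))" using over by linarith
  have "level_count \<kappa> y l \<le> x (real l / real \<kappa>)" by (rule lb(1))
  also have "\<dots> \<le> x t" using lt t by (intro mono_onD[OF x(1)]) auto
  finally have 1: "level_count \<kappa> y l \<le> x t" .
  have "x t \<le> x (real (l + 1) / real \<kappa>)" using lt t by (intro mono_onD[OF x(1)]) auto
  also have "\<dots> \<le> level_count \<kappa> y (l + 1 + 1) + 1 / real \<kappa>" by (rule lb(2)[OF over'])
  finally have 2: "x t \<le> level_count \<kappa> y (l + 2) + 1 / real \<kappa>" by simp
  have "step_path (real \<kappa>) (level_count \<kappa> y) t = level_count \<kappa> y l"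
    using t by (simp add: step_path_def l_def)
  then show ?thesis using 1 2 mesh_error_ge[OF lj, of y] by linarith
qed

lemma overflow_eq: "y \<le> exp (- (real j + 2)) \<Longrightarrow> overflow j y = 0" "exp (- (real j + 1)) \<le> y \<Longrightarrow> overflow j y = 1"
  and overflow_nonneg: "0 \<le> overflow j y"
  unfolding overflow_def by (auto intro!: clamp01_eq simp: divide_le_0_iff le_divide_eq_1)

lemma mesh_error_nonneg:
  assumes "\<kappa> \<ge> 1" "hitting_rel \<kappa> y x" "antimono y" "mono_on {0..} x" "0 \<le> x 0" "y (\<kappa> * \<kappa>) < exp (- (real j + 1))"
  shows "0 \<le> mesh_error j \<kappa> y"
  using step_path_approx[OF assms, of 0] by (intro order_trans[OF abs_ge_zero]) auto

context
  fixes f :: "(real \<Rightarrow> real) \<Rightarrow> real" and B :: real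
  assumes f_cont: "continuous_map skorokhod_topology euclideanreal f"
    and f_bound: "\<forall>x\<in>skorokhod_D. \<bar>f x\<bar> \<le> B"
begin

lemma B_nonneg: "0 \<le> B"
  using bspec[OF f_bound step_path_in_skorokhod_D[of 1 "\<lambda>_. 0"]] by linarith

lemma lower_approx_le:
  assumes \<kappa>: "\<kappa> \<ge> 1" and rel: "hitting_rel \<kappa> y x" and y: "antimono y"
    and x: "x \<in> skorokhod_D" "mono_on {0..} x" "0 \<le> x 0"
  shows "lower_approx f B j \<kappa> y \<le> f x"
proof -
  let ?s = "step_path (real \<kappa>) (level_count \<kappa> y)"
  have s: "?s \<in> skorokhod_D" by (rule step_path_in_skorokhod_D) simp
  have x0: "0 \<le> x t" if "0 \<le> t" for t
    using x(3) mono_onD[OF x(2), of 0 t] that by simp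
  have fx: "- B \<le> f x" using bspec[OF f_bound x(1)] by (simp add: abs_le_iff)
  have "reg f j ?s - real j * mesh_error j \<kappa> y - 2 * B * overflow j (y (\<kappa> * \<kappa>)) \<le> f x"
  proof (cases "y (\<kappa> * \<kappa>) < exp (- (real j + 1))")
    case True
    have "reg f j ?s \<le> reg f j x + real j * mesh_error j \<kappa> y"
      using step_path_approx[OF \<kappa> rel y x(2,3) True] mesh_error_nonneg[OF \<kappa> rel y x(2,3) True]
      by (intro reg_lipschitz[OF f_cont f_bound x(1) s]) (auto simp: abs_minus_commute)
    moreover have "reg f j x \<le> f x" by (rule reg_le[OF f_cont f_bound x(1)])
    moreover have "0 \<le> 2 * B * overflow j (y (\<kappa> * \<kappa>))" using B_nonneg overflow_nonneg by simp
    ultimately show ?thesis by linarith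
  next
    case False
    then have "overflow j (y (\<kappa> * \<kappa>)) = 1" by (intro overflow_eq(2)) simp
    moreover have "reg f j ?s \<le> B"
      using reg_le[OF f_cont f_bound s, of j] bspec[OF f_bound s] by (simp add: abs_le_iff)
    moreover have "0 \<le> mesh_error j \<kappa> y"
    proof -
      have *: "level_count \<kappa> y 0 \<le> level_count \<kappa> y 2"
        unfolding level_count_def
      proof (intro divide_right_mono sum_mono)
        fix i
        show "ramp \<kappa> 0 (y i) \<le> ramp \<kappa> 2 (y i)"
        proof (cases "y i \<le> exp (- (real 0 / real \<kappa>))")
          case True
          then show ?thesis using ramp_eq(1)[OF \<kappa> True] by (simp add: ramp_def)
        next
          case False
          have "exp (- (real 1 / real \<kappa>)) \<le> exp (- (real 0 / real \<kappa>))" by simp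
          then have "exp (- (real 1 / real \<kappa>)) \<le> y i" using False by linarith
          then have "ramp \<kappa> (1 + 1) (y i) = 1" by (rule ramp_eq(2)[OF \<kappa>])
          then show ?thesis by (simp add: ramp_def numeral_2_eq_2)
        qed
      qed simp
      have "level_count \<kappa> y (0 + 2) - level_count \<kappa> y 0 + 1 / real \<kappa> \<le> mesh_error j \<kappa> y"
        by (rule mesh_error_ge) simp
      moreover have "0 \<le> 1 / real \<kappa>" by simp
      moreover have "level_count \<kappa> y 0 \<le> level_count \<kappa> y (0 + 2)" using * by (simp only: add_0)
      ultimately show ?thesis by linarith
    qed
    then have "0 \<le> real j * mesh_error j \<kappa> y" by simp
    moreover have "2 * B * overflow j (y (\<kappa> * \<kappa>)) = 2 * B" using calculation(1) by simp
    ultimately show ?thesis using fx by linarith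
  qed
  then show ?thesis using fx B_nonneg unfolding lower_approx_def by linarith
qed

lemma tendsto_mesh_error:
  assumes rel': "\<forall>\<kappa>\<ge>1. hitting_rel \<kappa> (y \<kappa>) x" and y': "\<forall>\<kappa>. antimono (y \<kappa>)"
    and x: "continuous_on {0..} x" "mono_on {0..} x" "x 0 = 0"
  shows "(\<lambda>\<kappa>. mesh_error j \<kappa> (y \<kappa>)) \<longlonglongrightarrow> 0"
    and "\<forall>\<^sub>F \<kappa> in sequentially. y \<kappa> (\<kappa> * \<kappa>) < exp (- (real j + 2))"
proof -
  note rel = rel'[rule_format] and y = y'[rule_format]
  have small: "\<forall>\<^sub>F \<kappa> in sequentially. \<kappa> \<ge> 1 \<and> y \<kappa> (\<kappa> * \<kappa>) < exp (- (real j + 2))" for j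
  proof -
    obtain N :: nat where N: "x (real j + 2) < real N" using reals_Archimedean2 by blast
    show ?thesis
    proof (rule eventually_sequentiallyI[of "max 1 N"], rule conjI)
      fix \<kappa> assume \<kappa>: "max 1 N \<le> \<kappa>"
      then show "\<kappa> \<ge> 1" by simp
      show "y \<kappa> (\<kappa> * \<kappa>) < exp (- (real j + 2))"
      proof (rule ccontr)
        assume "\<not> y \<kappa> (\<kappa> * \<kappa>) < exp (- (real j + 2))"
        then have "exp (- (real j + 2)) \<le> y \<kappa> (\<kappa> * \<kappa>)" by simp
        moreover have "0 \<le> real j + 2" "\<kappa> \<ge> 1" using \<kappa> by auto
        ultimately have "real (\<kappa> * \<kappa>) / real \<kappa> \<le> x (real j + 2)"
          using rel[of \<kappa>] unfolding hitting_rel_def by blast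
        then show False using N \<kappa> by auto
      qed
    qed
  qed
  show "\<forall>\<^sub>F \<kappa> in sequentially. y \<kappa> (\<kappa> * \<kappa>) < exp (- (real j + 2))"
    using small[of j] by (rule eventually_mono) simp
  show "(\<lambda>\<kappa>. mesh_error j \<kappa> (y \<kappa>)) \<longlonglongrightarrow> 0"
  proof (rule LIMSEQ_I)
    fix e :: real assume "e > 0"
    have "uniformly_continuous_on {0..real j + 2} x"
      by (intro compact_uniformly_continuous continuous_on_subset[OF x(1)]) auto
    then obtain d where d: "d > 0" "\<And>s t. s \<in> {0..real j + 2} \<Longrightarrow> t \<in> {0..real j + 2} \<Longrightarrow> dist t s < d \<Longrightarrow> dist (x t) (x s) < e / 2"
      using \<open>e > 0\<close> unfolding uniformly_continuous_on_def by (meson half_gt_zero)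
    obtain N :: nat where N: "4 / min d e < real N" using reals_Archimedean2 by blast
    have "\<forall>\<^sub>F \<kappa> in sequentially. \<bar>mesh_error j \<kappa> (y \<kappa>)\<bar> < e"
      using small[of j] eventually_ge_at_top[of "max 2 N"]
    proof eventually_elim
      case (elim \<kappa>)
      then have \<kappa>: "\<kappa> \<ge> 1" "real \<kappa> > 0" by auto
      have "4 < real N * min d e" using N d(1) \<open>e > 0\<close> by (simp add: pos_divide_less_eq)
      also have "\<dots> \<le> real \<kappa> * min d e" using elim d(1) \<open>e > 0\<close> by (intro mult_right_mono) auto
      finally have "4 / real \<kappa> < min d e" unfolding pos_divide_less_eq[OF \<kappa>(2)] by (simp only: mult.commute)
      then have k4: "4 / real \<kappa> < d" "4 / real \<kappa> < e" by auto
      have "0 \<le> x 0" by (simp add: x(3))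
      note lb = level_count_bounds[OF \<kappa>(1) rel[OF \<kappa>(1)] y x(2) this]
      have bound: "level_count \<kappa> (y \<kappa>) (l + 2) - level_count \<kappa> (y \<kappa>) l < e / 2 + 1 / real \<kappa>" if l: "l \<le> j * \<kappa>" for l
      proof -
        have l2: "real (l + 2) / real \<kappa> \<le> real j + 2"
        proof -
          have "l + 2 \<le> j * \<kappa> + 2 * \<kappa>" using l \<kappa> by linarith
          then have "real (l + 2) \<le> real (j * \<kappa> + 2 * \<kappa>)" by (rule of_nat_mono)
          then have "real (l + 2) / real \<kappa> \<le> real (j * \<kappa> + 2 * \<kappa>) / real \<kappa>" by (intro divide_right_mono) auto
          also have "\<dots> = real j + 2" using \<kappa>(2) by (simp add: add_divide_distrib)
          finally show ?thesis .
        qed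
        have prob_weak_rec: "level_count \<kappa> (y \<kappa>) (l + 2) \<le> x (real (l + 2) / real \<kappa>)" by (rule lb(1))
        show ?thesis
        proof (cases l)
          case 0
          have "dist (x (real (l + 2) / real \<kappa>)) (x 0) < e / 2"
          proof (rule d(2))
            have "2 / real \<kappa> \<le> 4 / real \<kappa>" using \<kappa> by (intro divide_right_mono) auto
            then show "dist (real (l + 2) / real \<kappa>) 0 < d" using 0 k4 by simp
          qed (use l2 in auto)
          then have "x (real (l + 2) / real \<kappa>) < e / 2" using x(3) by (simp add: dist_real_def)
          moreover have "0 \<le> level_count \<kappa> (y \<kappa>) l" by (rule lb(3))
          moreover have "0 < 1 / real \<kappa>" using \<kappa> by simp
          ultimately show ?thesis using prob_weak_rec by linarith
        next
          case (Suc l')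
          have le: "real l' / real \<kappa> \<le> real (l + 2) / real \<kappa>" using Suc by (intro divide_right_mono) auto
          have "exp (- (real j + 2)) \<le> exp (- (real l' / real \<kappa>))" using le l2 by simp
          then have "y \<kappa> (\<kappa> * \<kappa>) < exp (- (real l' / real \<kappa>))" using elim by linarith
          from lb(2)[OF this] have low: "x (real l' / real \<kappa>) \<le> level_count \<kappa> (y \<kappa>) l + 1 / real \<kappa>" using Suc by simp
          have "dist (x (real (l + 2) / real \<kappa>)) (x (real l' / real \<kappa>)) < e / 2"
          proof (rule d(2))
            have "real (l + 2) / real \<kappa> - real l' / real \<kappa> = 3 / real \<kappa>" using Suc by (simp add: diff_divide_distrib[symmetric])
            moreover have "3 / real \<kappa> \<le> 4 / real \<kappa>" using \<kappa> by (intro divide_right_mono) auto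
            ultimately show "dist (real (l + 2) / real \<kappa>) (real l' / real \<kappa>) < d"
              using k4(1) le unfolding dist_real_def by linarith
          qed (use l2 le in auto)
          then show ?thesis using prob_weak_rec low unfolding dist_real_def by linarith
        qed
      qed
      have "Max ((\<lambda>l. level_count \<kappa> (y \<kappa>) (l + 2) - level_count \<kappa> (y \<kappa>) l) ` {..j * \<kappa>}) < e / 2 + 1 / real \<kappa>"
        using bound by (subst Max_less_iff) auto
      then have "mesh_error j \<kappa> (y \<kappa>) < e / 2 + 1 / real \<kappa> + 1 / real \<kappa>"
        unfolding mesh_error_def by (rule add_strict_right_mono)
      also have "\<dots> = e / 2 + 2 / real \<kappa>" by simp
      also have "\<dots> < e" using k4(2) by simp
      finally have "mesh_error j \<kappa> (y \<kappa>) < e" .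
      moreover have "0 \<le> mesh_error j \<kappa> (y \<kappa>)"
      proof (rule mesh_error_nonneg[OF \<kappa>(1) rel[OF \<kappa>(1)] y x(2)])
        have "exp (- (real j + 2)) \<le> exp (- (real j + 1))" by simp
        then show "y \<kappa> (\<kappa> * \<kappa>) < exp (- (real j + 1))" using elim by linarith
      qed (simp add: x(3))
      ultimately show ?case by simp
    qed
    then show "\<exists>n0. \<forall>\<kappa>\<ge>n0. norm (mesh_error j \<kappa> (y \<kappa>) - 0) < e" by (simp add: eventually_sequentially)
  qed
qed

lemma tendsto_lower_approx:
  assumes rel': "\<forall>\<kappa>\<ge>1. hitting_rel \<kappa> (y \<kappa>) x" and y': "\<forall>\<kappa>. antimono (y \<kappa>)"
    and x: "x \<in> skorokhod_D" "continuous_on {0..} x" "mono_on {0..} x" "x 0 = 0"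
  shows "(\<lambda>\<kappa>. lower_approx f B j \<kappa> (y \<kappa>)) \<longlonglongrightarrow> reg f j x"
proof -
  note rel = rel'[rule_format] and y = y'[rule_format]
  note me = tendsto_mesh_error[OF rel' y' x(2,3,4)]
  let ?s = "\<lambda>\<kappa>. step_path (real \<kappa>) (level_count \<kappa> (y \<kappa>))"
  have s: "?s \<kappa> \<in> skorokhod_D" for \<kappa> by (rule step_path_in_skorokhod_D) simp
  have "(\<lambda>\<kappa>. reg f j (?s \<kappa>) - reg f j x) \<longlonglongrightarrow> 0"
  proof (rule Lim_null_comparison)
    show "(\<lambda>\<kappa>. real j * mesh_error j \<kappa> (y \<kappa>)) \<longlonglongrightarrow> 0" using tendsto_mult_right_zero[OF me(1)] by simp
    show "\<forall>\<^sub>F \<kappa> in sequentially. norm (reg f j (?s \<kappa>) - reg f j x) \<le> real j * mesh_error j \<kappa> (y \<kappa>)"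
      using me(2)[of j] eventually_ge_at_top[of 1]
    proof eventually_elim
      case (elim \<kappa>)
      have "exp (- (real j + 2)) \<le> exp (- (real j + 1))" by simp
      then have o: "y \<kappa> (\<kappa> * \<kappa>) < exp (- (real j + 1))" using elim by linarith
      show ?case unfolding real_norm_def
        using step_path_approx[OF elim(2) rel[OF elim(2)] y x(3) _ o] x(4)
          mesh_error_nonneg[OF elim(2) rel[OF elim(2)] y x(3) _ o]
        by (intro reg_lipschitz_abs[OF f_cont f_bound s x(1)]) auto
    qed
  qed
  then have r: "(\<lambda>\<kappa>. reg f j (?s \<kappa>)) \<longlonglongrightarrow> reg f j x" by (simp add: LIM_zero_iff)
  have o: "(\<lambda>\<kappa>. overflow j (y \<kappa> (\<kappa> * \<kappa>))) \<longlonglongrightarrow> 0"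
    by (rule tendsto_eventually, rule eventually_mono[OF me(2)[of j]]) (intro overflow_eq(1), simp)
  have "(\<lambda>\<kappa>. lower_approx f B j \<kappa> (y \<kappa>)) \<longlonglongrightarrow> max (- (3 * B)) (reg f j x - real j * 0 - 2 * B * 0)"
    unfolding lower_approx_def by (intro tendsto_intros r o me(1))
  moreover have "- (3 * B) \<le> reg f j x" using reg_ge[OF f_cont f_bound x(1), of j] B_nonneg by linarith
  ultimately show ?thesis by (simp add: max_def)
qed

end

definition lipschitz_cube :: "nat \<Rightarrow> ((nat \<Rightarrow> real) \<Rightarrow> real) \<Rightarrow> bool" where
  "lipschitz_cube I G \<longleftrightarrow> (\<exists>C. lipschitz_upto I C G)"

lemma lipschitz_upto_mono: "lipschitz_upto I C G \<Longrightarrow> C \<le> C' \<Longrightarrow> lipschitz_upto I C' G"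
  unfolding lipschitz_upto_def
proof (elim conjE, intro conjI ballI)
  fix u w assume "C \<le> C'" "u \<in> cube" "w \<in> cube" "\<forall>u\<in>cube. \<forall>w\<in>cube. \<bar>G u - G w\<bar> \<le> C * (\<Sum>i<I. \<bar>u i - w i\<bar>)"
  then have "\<bar>G u - G w\<bar> \<le> C * (\<Sum>i<I. \<bar>u i - w i\<bar>)" by blast
  also have "\<dots> \<le> C' * (\<Sum>i<I. \<bar>u i - w i\<bar>)"
    using \<open>C \<le> C'\<close> by (intro mult_right_mono sum_nonneg) auto
  finally show "\<bar>G u - G w\<bar> \<le> C' * (\<Sum>i<I. \<bar>u i - w i\<bar>)" .
qed simp

lemma lipschitz_cube_family:
  assumes "finite A" "\<And>l. l \<in> A \<Longrightarrow> lipschitz_cube I (G l)"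
  obtains C where "C \<ge> 0" "\<And>l. l \<in> A \<Longrightarrow> lipschitz_upto I C (G l)"
proof -
  obtain c where c: "\<And>l. l \<in> A \<Longrightarrow> lipschitz_upto I (c l) (G l)"
    using assms(2) unfolding lipschitz_cube_def by metis
  have c0: "c l \<ge> 0" if "l \<in> A" for l using c[OF that] by (simp add: lipschitz_upto_def)
  show ?thesis
  proof (rule that[of "sum c A"])
    show "0 \<le> sum c A" using c0 by (intro sum_nonneg)
    show "lipschitz_upto I (sum c A) (G l)" if "l \<in> A" for l
      using c[OF that] by (rule lipschitz_upto_mono) (use assms(1) that c0 in \<open>auto intro: member_le_sum\<close>)
  qed
qed

lemma lipschitz_cube_compose:
  assumes "lipschitz_cube I G" "K \<ge> 0" "\<And>a b. \<bar>h a - h b\<bar> \<le> K * \<bar>a - b\<bar>"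
  shows "lipschitz_cube I (\<lambda>u. h (G u))"
proof -
  obtain C where C: "lipschitz_upto I C G" using assms(1) by (auto simp: lipschitz_cube_def)
  have "lipschitz_upto I (K * C) (\<lambda>u. h (G u))"
    unfolding lipschitz_upto_def
  proof (intro conjI ballI)
    show "0 \<le> K * C" using C assms(2) by (simp add: lipschitz_upto_def)
    fix u w assume "u \<in> cube" "w \<in> cube"
    then have "\<bar>G u - G w\<bar> \<le> C * (\<Sum>i<I. \<bar>u i - w i\<bar>)" using C unfolding lipschitz_upto_def by blast
    then have "K * \<bar>G u - G w\<bar> \<le> K * (C * (\<Sum>i<I. \<bar>u i - w i\<bar>))" using assms(2) by (intro mult_left_mono)
    then show "\<bar>h (G u) - h (G w)\<bar> \<le> K * C * (\<Sum>i<I. \<bar>u i - w i\<bar>)"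
      using assms(3)[of "G u" "G w"] by (simp add: mult.assoc)
  qed
  then show ?thesis unfolding lipschitz_cube_def by blast
qed

lemma lipschitz_cube_const: "lipschitz_cube I (\<lambda>_. c)"
  unfolding lipschitz_cube_def lipschitz_upto_def by (intro exI[of _ 0]) simp

lemma lipschitz_cube_add:
  assumes "lipschitz_cube I F" "lipschitz_cube I G" shows "lipschitz_cube I (\<lambda>u. F u + G u)"
proof -
  obtain C D where CD: "lipschitz_upto I C F" "lipschitz_upto I D G" using assms by (auto simp: lipschitz_cube_def)
  have "lipschitz_upto I (C + D) (\<lambda>u. F u + G u)"
    unfolding lipschitz_upto_def
  proof (intro conjI ballI)
    show "0 \<le> C + D" using CD by (simp add: lipschitz_upto_def)
    fix u w assume uw: "u \<in> cube" "w \<in> cube"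
    have "\<bar>F u - F w\<bar> \<le> C * (\<Sum>i<I. \<bar>u i - w i\<bar>)" "\<bar>G u - G w\<bar> \<le> D * (\<Sum>i<I. \<bar>u i - w i\<bar>)"
      using CD uw unfolding lipschitz_upto_def by blast+
    then show "\<bar>F u + G u - (F w + G w)\<bar> \<le> (C + D) * (\<Sum>i<I. \<bar>u i - w i\<bar>)"
      unfolding distrib_right by linarith
  qed
  then show ?thesis unfolding lipschitz_cube_def by blast
qed

lemma lipschitz_cube_cmult: "lipschitz_cube I G \<Longrightarrow> lipschitz_cube I (\<lambda>u. c * G u)"
  by (rule lipschitz_cube_compose[where K="\<bar>c\<bar>"]) (auto simp: abs_mult[symmetric] right_diff_distrib)

lemma lipschitz_cube_diff: "lipschitz_cube I F \<Longrightarrow> lipschitz_cube I G \<Longrightarrow> lipschitz_cube I (\<lambda>u. F u - G u)"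
  using lipschitz_cube_add[of I F "\<lambda>u. (-1) * G u"] lipschitz_cube_cmult[of I G "-1"] by simp

lemma lipschitz_cube_sum: "finite A \<Longrightarrow> (\<And>i. i \<in> A \<Longrightarrow> lipschitz_cube I (G i)) \<Longrightarrow> lipschitz_cube I (\<lambda>u. \<Sum>i\<in>A. G i u)"
  by (induction A rule: finite_induct) (auto intro: lipschitz_cube_const lipschitz_cube_add)

lemma lipschitz_cube_clamp01: "lipschitz_cube I G \<Longrightarrow> lipschitz_cube I (\<lambda>u. clamp01 (G u))"
  by (rule lipschitz_cube_compose[where K=1]) (auto simp: clamp01_def)

lemma lipschitz_cube_max_const: "lipschitz_cube I G \<Longrightarrow> lipschitz_cube I (\<lambda>u. max c (G u))"
  by (rule lipschitz_cube_compose[where K=1]) (auto simp: max_def)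

lemma lipschitz_cube_Max:
  assumes A: "finite A" "A \<noteq> {}" and G: "\<And>l. l \<in> A \<Longrightarrow> lipschitz_cube I (G l)"
  shows "lipschitz_cube I (\<lambda>u. Max ((\<lambda>l. G l u) ` A))"
proof -
  obtain C where C: "C \<ge> 0" "\<And>l. l \<in> A \<Longrightarrow> lipschitz_upto I C (G l)"
    using lipschitz_cube_family[of A I G] A G by blast
  have le: "Max ((\<lambda>l. G l u) ` A) \<le> Max ((\<lambda>l. G l w) ` A) + C * (\<Sum>i<I. \<bar>u i - w i\<bar>)"
    if uw: "u \<in> cube" "w \<in> cube" for u w
  proof -
    have "G l u \<le> Max ((\<lambda>l. G l w) ` A) + C * (\<Sum>i<I. \<bar>u i - w i\<bar>)" if l: "l \<in> A" for l
    proof -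
      have "\<bar>G l u - G l w\<bar> \<le> C * (\<Sum>i<I. \<bar>u i - w i\<bar>)" using C(2)[OF l] uw unfolding lipschitz_upto_def by blast
      moreover have "G l w \<le> Max ((\<lambda>l. G l w) ` A)" using A l by (intro Max_ge) auto
      ultimately show ?thesis by linarith
    qed
    then show ?thesis using A by (subst Max_le_iff) auto
  qed
  have "lipschitz_upto I C (\<lambda>u. Max ((\<lambda>l. G l u) ` A))"
    unfolding lipschitz_upto_def
  proof (intro conjI ballI)
    fix u w assume uw: "u \<in> cube" "w \<in> cube"
    show "\<bar>Max ((\<lambda>l. G l u) ` A) - Max ((\<lambda>l. G l w) ` A)\<bar> \<le> C * (\<Sum>i<I. \<bar>u i - w i\<bar>)"
      using le[OF uw] le[OF uw(2,1)] by (simp add: abs_le_iff abs_minus_commute)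
  qed (rule C)
  then show ?thesis unfolding lipschitz_cube_def by blast
qed

definition partial_prod :: "(nat \<Rightarrow> real) \<Rightarrow> nat \<Rightarrow> real" where
  "partial_prod u i = (\<Prod>l<i. u l)"

lemma partial_prod_range: "u \<in> cube \<Longrightarrow> 0 \<le> partial_prod u i \<and> partial_prod u i \<le> 1"
  unfolding partial_prod_def cube_def by (auto intro: prod_nonneg prod_le_1)

lemma antimono_partial_prod: "u \<in> cube \<Longrightarrow> antimono (partial_prod u)"
proof (rule decseq_SucI)
  fix i assume "u \<in> cube"
  then show "partial_prod u (Suc i) \<le> partial_prod u i"
    using partial_prod_range[of u i] by (auto simp: partial_prod_def cube_def intro: mult_left_le)
qed

lemma lipschitz_cube_partial_prod: "i \<le> I \<Longrightarrow> lipschitz_cube I (\<lambda>u. partial_prod u i)"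
proof -
  assume "i \<le> I"
  have *: "\<bar>partial_prod u i - partial_prod w i\<bar> \<le> (\<Sum>l<i. \<bar>u l - w l\<bar>)" if "u \<in> cube" "w \<in> cube" for u w
  proof (induction i)
    case (Suc i)
    have "partial_prod u (Suc i) - partial_prod w (Suc i) = (partial_prod u i - partial_prod w i) * u i + partial_prod w i * (u i - w i)"
      by (simp add: partial_prod_def algebra_simps)
    also have "\<bar>\<dots>\<bar> \<le> \<bar>partial_prod u i - partial_prod w i\<bar> * \<bar>u i\<bar> + \<bar>partial_prod w i\<bar> * \<bar>u i - w i\<bar>"
      by (rule order_trans[OF abs_triangle_ineq]) (simp add: abs_mult)
    also have "\<dots> \<le> \<bar>partial_prod u i - partial_prod w i\<bar> * 1 + 1 * \<bar>u i - w i\<bar>"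
      using that partial_prod_range[OF that(2), of i] by (intro add_mono mult_left_mono mult_right_mono) (auto simp: cube_def)
    finally show ?case using Suc by simp
  qed (simp add: partial_prod_def)
  have "lipschitz_upto I 1 (\<lambda>u. partial_prod u i)"
    unfolding lipschitz_upto_def
  proof (intro conjI ballI)
    fix u w assume "u \<in> cube" "w \<in> cube"
    from *[OF this] have "\<bar>partial_prod u i - partial_prod w i\<bar> \<le> (\<Sum>l<i. \<bar>u l - w l\<bar>)" .
    also have "\<dots> \<le> (\<Sum>l<I. \<bar>u l - w l\<bar>)" using \<open>i \<le> I\<close> by (intro sum_mono2) auto
    finally show "\<bar>partial_prod u i - partial_prod w i\<bar> \<le> 1 * (\<Sum>l<I. \<bar>u l - w l\<bar>)" by simp
  qed simp
  then show ?thesis unfolding lipschitz_cube_def by blast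
qed

lemma lipschitz_cube_lower_approx:
  assumes f: "continuous_map skorokhod_topology euclideanreal f" "\<forall>x\<in>skorokhod_D. \<bar>f x\<bar> \<le> B" and \<kappa>: "\<kappa> \<ge> 1"
  shows "lipschitz_cube (\<kappa> * \<kappa>) (\<lambda>u. lower_approx f B j \<kappa> (partial_prod u))"
proof -
  let ?I = "\<kappa> * \<kappa>"
  have lc: "lipschitz_cube ?I (\<lambda>u. level_count \<kappa> (partial_prod u) l)" for l
  proof -
    have "lipschitz_cube ?I (\<lambda>u. (1 / real \<kappa>) * (\<Sum>i=1..?I. clamp01 ((1 / (exp (- ((real l - 1) / real \<kappa>)) - exp (- (real l / real \<kappa>)))) *
         (partial_prod u i - exp (- (real l / real \<kappa>))))))"
      by (intro lipschitz_cube_cmult lipschitz_cube_sum lipschitz_cube_clamp01 lipschitz_cube_diff lipschitz_cube_const lipschitz_cube_partial_prod) auto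
    then show ?thesis by (simp add: level_count_def ramp_def)
  qed
  have me: "lipschitz_cube ?I (\<lambda>u. mesh_error j \<kappa> (partial_prod u))"
    unfolding mesh_error_def by (intro lipschitz_cube_add lipschitz_cube_const lipschitz_cube_Max lipschitz_cube_diff lc) auto
  have ov: "lipschitz_cube ?I (\<lambda>u. overflow j (partial_prod u (\<kappa> * \<kappa>)))"
  proof -
    have "lipschitz_cube ?I (\<lambda>u. clamp01 ((1 / (exp (- (real j + 1)) - exp (- (real j + 2)))) * (partial_prod u ?I - exp (- (real j + 2)))))"
      by (intro lipschitz_cube_cmult lipschitz_cube_clamp01 lipschitz_cube_diff lipschitz_cube_const lipschitz_cube_partial_prod) auto
    then show ?thesis by (simp add: overflow_def)
  qed
  have re: "lipschitz_cube ?I (\<lambda>u. reg f j (step_path (real \<kappa>) (level_count \<kappa> (partial_prod u))))"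
  proof -
    obtain C where C: "C \<ge> 0" "\<And>l. l \<in> {..j * \<kappa>} \<Longrightarrow> lipschitz_upto ?I C (\<lambda>u. level_count \<kappa> (partial_prod u) l)"
      using lipschitz_cube_family[of "{..j * \<kappa>}" ?I "\<lambda>l u. level_count \<kappa> (partial_prod u) l"] lc by blast
    have "lipschitz_upto ?I (real j * C) (\<lambda>u. reg f j (step_path (real \<kappa>) (level_count \<kappa> (partial_prod u))))"
      unfolding lipschitz_upto_def
    proof (intro conjI ballI)
      show "0 \<le> real j * C" using C by simp
      fix u w assume uw: "u \<in> cube" "w \<in> cube"
      let ?d = "C * (\<Sum>i<?I. \<bar>u i - w i\<bar>)"
      have "\<bar>reg f j (step_path (real \<kappa>) (level_count \<kappa> (partial_prod u))) - reg f j (step_path (real \<kappa>) (level_count \<kappa> (partial_prod w)))\<bar> \<le> real j * ?d"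
      proof (rule reg_lipschitz_abs[OF f])
        show "0 \<le> ?d" using C by (intro mult_nonneg_nonneg sum_nonneg) auto
        fix t :: real assume t: "0 \<le> t" "t \<le> real j"
        have "real \<kappa> * t \<le> real \<kappa> * real j" using t by (intro mult_left_mono) auto
        then have "real \<kappa> * t \<le> real (j * \<kappa>)" by (simp add: mult.commute)
        then have "nat \<lfloor>real \<kappa> * t\<rfloor> \<in> {..j * \<kappa>}" by (simp add: nat_le_iff floor_le_iff)
        from C(2)[OF this] uw t show "\<bar>step_path (real \<kappa>) (level_count \<kappa> (partial_prod u)) t - step_path (real \<kappa>) (level_count \<kappa> (partial_prod w)) t\<bar> \<le> ?d"
          unfolding lipschitz_upto_def step_path_def by simp
      qed (auto intro: step_path_in_skorokhod_D)
      then show "\<bar>reg f j (step_path (real \<kappa>) (level_count \<kappa> (partial_prod u))) - reg f j (step_path (real \<kappa>) (level_count \<kappa> (partial_prod w)))\<bar>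
          \<le> real j * C * (\<Sum>i<?I. \<bar>u i - w i\<bar>)" by (simp add: mult.assoc)
    qed
    then show ?thesis unfolding lipschitz_cube_def by blast
  qed
  show ?thesis
    unfolding lower_approx_def by (intro lipschitz_cube_max_const lipschitz_cube_diff lipschitz_cube_cmult re me ov)
qed

lemma borel_measurable_completion_AE:
  fixes W f :: "'a \<Rightarrow> real"
  assumes W [measurable]: "W \<in> borel_measurable N" and AE: "AE x in N. W x = f x"
  shows "f \<in> borel_measurable (completion N)"
proof (rule measurableI)
  fix A :: "real set" assume [measurable]: "A \<in> sets borel"
  have 1: "Measurable.pred (completion N) (\<lambda>x. f x \<noteq> W x)"
    by (rule sets_completion_AE) (use AE in \<open>auto elim: eventually_mono\<close>)
  have 2: "Measurable.pred (completion N) (\<lambda>x. f x \<in> A \<and> f x \<noteq> W x)"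
    by (rule sets_completion_AE) (use AE in \<open>auto elim: eventually_mono\<close>)
  have 3: "Measurable.pred (completion N) (\<lambda>x. W x \<in> A)"
    by (rule measurable_completion) measurable
  have "f -` A \<inter> space (completion N) =
      ({x\<in>space (completion N). W x \<in> A} - {x\<in>space (completion N). f x \<noteq> W x})
      \<union> {x\<in>space (completion N). f x \<in> A \<and> f x \<noteq> W x}"
    by auto
  also have "\<dots> \<in> sets (completion N)"
    using 1 2 3 unfolding pred_def by (intro sets.Un sets.Diff)
  finally show "f -` A \<inter> space (completion N) \<in> sets (completion N)" .
qed simp

locale functional_limit =
  M: prob_space M + N: prob_space N
  for M :: "'a measure" and N :: "'b measure" +
  fixes Y :: "nat \<Rightarrow> 'a \<Rightarrow> real \<Rightarrow> real" and Z :: "'b \<Rightarrow> real \<Rightarrow> real"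
    and U :: "nat \<Rightarrow> nat \<Rightarrow> nat \<Rightarrow> 'a \<Rightarrow> real" and V :: "nat \<Rightarrow> nat \<Rightarrow> 'b \<Rightarrow> real"
  assumes Y_D: "\<And>n \<omega>. Y n \<omega> \<in> skorokhod_D"
    and Y_meas: "\<And>f n. continuous_map skorokhod_topology euclideanreal f \<Longrightarrow> (\<lambda>\<omega>. f (Y n \<omega>)) \<in> borel_measurable M"
    and Y_mono: "\<And>n \<omega>. mono_on {0..} (Y n \<omega>)" "\<And>n \<omega>. 0 \<le> Y n \<omega> 0"
    and U_meas: "\<And>\<kappa> n i. U \<kappa> n i \<in> borel_measurable M" and U_cube: "\<And>\<kappa> n \<omega>. (\<lambda>i. U \<kappa> n i \<omega>) \<in> cube"
    and V_meas: "\<And>\<kappa> i. V \<kappa> i \<in> borel_measurable N" and V_cube: "\<And>\<kappa> \<omega>. (\<lambda>i. V \<kappa> i \<omega>) \<in> cube"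
    and U_rel: "\<And>\<kappa> n. 1 \<le> \<kappa> \<Longrightarrow> 1 \<le> n \<Longrightarrow> AE \<omega> in M. hitting_rel \<kappa> (partial_prod (\<lambda>i. U \<kappa> n i \<omega>)) (Y n \<omega>)"
    and V_rel: "AE \<omega> in N. \<forall>\<kappa>\<ge>1. hitting_rel \<kappa> (partial_prod (\<lambda>i. V \<kappa> i \<omega>)) (Z \<omega>)"
    and Z_good: "AE \<omega> in N. Z \<omega> \<in> skorokhod_D \<and> continuous_on {0..} (Z \<omega>) \<and> mono_on {0..} (Z \<omega>) \<and> Z \<omega> 0 = 0"
    and mom: "\<And>\<kappa> k. 1 \<le> \<kappa> \<Longrightarrow> (\<lambda>n. \<integral>\<omega>. (\<Prod>i<\<kappa> * \<kappa>. U \<kappa> n i \<omega> ^ k i) \<partial>M) \<longlonglongrightarrow> (\<integral>\<omega>. (\<Prod>i<\<kappa> * \<kappa>. V \<kappa> i \<omega> ^ k i) \<partial>N)"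
begin

lemma liminf_bound:
  assumes f: "continuous_map skorokhod_topology euclideanreal f" "\<forall>x\<in>skorokhod_D. \<bar>f x\<bar> \<le> B"
  shows "integrable (completion N) (\<lambda>\<omega>. f (Z \<omega>))"
    and "e > 0 \<Longrightarrow> \<forall>\<^sub>F n in sequentially. (\<integral>\<omega>. f (Z \<omega>) \<partial>completion N) - e < (\<integral>\<omega>. f (Y n \<omega>) \<partial>M)"
proof -
  have B0: "0 \<le> B" by (rule B_nonneg[OF f])
  let ?G = "\<lambda>j \<kappa> u. lower_approx f B j \<kappa> (partial_prod u)"
  let ?H = "\<lambda>j \<kappa> \<omega>. ?G j (Suc \<kappa>) (\<lambda>i. V (Suc \<kappa>) i \<omega>)"
  have lip: "\<exists>C. lipschitz_upto (\<kappa> * \<kappa>) C (?G j \<kappa>)" if "\<kappa> \<ge> 1" for j \<kappa>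
    using lipschitz_cube_lower_approx[OF f that] by (simp add: lipschitz_cube_def)
  have H_meas [measurable]: "?H j \<kappa> \<in> borel_measurable N" for j \<kappa>
  proof -
    obtain C where "lipschitz_upto (Suc \<kappa> * Suc \<kappa>) C (?G j (Suc \<kappa>))" using lip[of "Suc \<kappa>"] by auto
    then show ?thesis by (rule measurable_lipschitz_upto[where U="V (Suc \<kappa>)", OF V_meas V_cube])
  qed
  have G_bound: "\<bar>?G j \<kappa> u\<bar> \<le> 3 * B + real j * (\<bar>mesh_error j \<kappa> (partial_prod u)\<bar>)" for j \<kappa> u
  proof -
    let ?s = "step_path (real \<kappa>) (level_count \<kappa> (partial_prod u))"
    have s: "?s \<in> skorokhod_D" by (rule step_path_in_skorokhod_D) simp
    have "reg f j ?s \<le> B" using reg_le[OF f s, of j] bspec[OF f(2) s] by (simp add: abs_le_iff)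
    moreover have "0 \<le> 2 * B * overflow j (partial_prod u (\<kappa> * \<kappa>))" using B0 overflow_nonneg by simp
    moreover have "- (real j * mesh_error j \<kappa> (partial_prod u)) \<le> real j * \<bar>mesh_error j \<kappa> (partial_prod u)\<bar>"
      unfolding minus_mult_right by (intro mult_left_mono) auto
    moreover have "0 \<le> real j * \<bar>mesh_error j \<kappa> (partial_prod u)\<bar>" by simp
    ultimately show ?thesis using B0 unfolding lower_approx_def by (simp only: abs_le_iff max_def split: if_splits) linarith
  qed
  have AE_all: "AE \<omega> in N. (\<forall>j. (\<lambda>\<kappa>. ?H j \<kappa> \<omega>) \<longlonglongrightarrow> reg f j (Z \<omega>)) \<and> Z \<omega> \<in> skorokhod_D \<and> (\<forall>j \<kappa>. ?H j \<kappa> \<omega> \<le> f (Z \<omega>))"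
    using V_rel Z_good
  proof eventually_elim
    case (elim \<omega>)
    have anti: "\<forall>\<kappa>. antimono (partial_prod (\<lambda>i. V \<kappa> i \<omega>))" using antimono_partial_prod[OF V_cube] by blast
    have "(\<lambda>\<kappa>. ?G j \<kappa> (\<lambda>i. V \<kappa> i \<omega>)) \<longlonglongrightarrow> reg f j (Z \<omega>)" for j
      by (rule tendsto_lower_approx[OF f elim(1) anti]) (use elim(2) in auto)
    then have "\<forall>j. (\<lambda>\<kappa>. ?H j \<kappa> \<omega>) \<longlonglongrightarrow> reg f j (Z \<omega>)" using LIMSEQ_Suc by blast
    moreover have "?H j \<kappa> \<omega> \<le> f (Z \<omega>)" for j \<kappa>
      by (rule lower_approx_le[OF f]) (use elim anti in auto)
    ultimately show ?case using elim(2) by blast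
  qed
  define Wj where "Wj j \<omega> = lim (\<lambda>\<kappa>. ?H j \<kappa> \<omega>)" for j \<omega>
  have Wj_meas [measurable]: "Wj j \<in> borel_measurable N" for j
    unfolding Wj_def by measurable
  define W where "W \<omega> = lim (\<lambda>j. Wj j \<omega>)" for \<omega>
  have W_meas [measurable]: "W \<in> borel_measurable N" unfolding W_def by measurable
  have AE_W: "AE \<omega> in N. (\<forall>j. (\<lambda>\<kappa>. ?H j \<kappa> \<omega>) \<longlonglongrightarrow> Wj j \<omega>) \<and> (\<lambda>j. Wj j \<omega>) \<longlonglongrightarrow> W \<omega> \<and> W \<omega> = f (Z \<omega>)
      \<and> (\<forall>j. \<bar>Wj j \<omega>\<bar> \<le> B) \<and> \<bar>W \<omega>\<bar> \<le> B \<and> (\<forall>j \<kappa>. ?H j \<kappa> \<omega> \<le> B)"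
    using AE_all
  proof eventually_elim
    case (elim \<omega>)
    have Wj: "Wj j \<omega> = reg f j (Z \<omega>)" for j unfolding Wj_def using elim by (intro limI) auto
    have Z: "Z \<omega> \<in> skorokhod_D" using elim by simp
    have "(\<lambda>j. Wj j \<omega>) \<longlonglongrightarrow> f (Z \<omega>)" unfolding Wj by (rule tendsto_reg[OF f Z])
    moreover from this have "W \<omega> = f (Z \<omega>)" unfolding W_def by (rule limI)
    moreover have "\<bar>f (Z \<omega>)\<bar> \<le> B" using f(2) Z by blast
    moreover have "\<bar>reg f j (Z \<omega>)\<bar> \<le> B" for j
      using reg_ge[OF f Z, of j] reg_le[OF f Z, of j] \<open>\<bar>f (Z \<omega>)\<bar> \<le> B\<close> by linarith
    moreover have "?H j \<kappa> \<omega> \<le> B" for j \<kappa>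
    proof -
      have "?H j \<kappa> \<omega> \<le> f (Z \<omega>)" using elim by blast
      then show ?thesis using \<open>\<bar>f (Z \<omega>)\<bar> \<le> B\<close> by linarith
    qed
    ultimately show ?case using elim by (simp add: Wj)
  qed
  have W_AE_eq: "AE \<omega> in N. W \<omega> = f (Z \<omega>)" using AE_W by eventually_elim simp
  have fZ_meas: "(\<lambda>\<omega>. f (Z \<omega>)) \<in> borel_measurable (completion N)"
    by (rule borel_measurable_completion_AE[OF W_meas W_AE_eq])
  have int_W: "integrable N W"
    by (rule N.integrable_const_bound[where B=B]) (use AE_W in \<open>auto elim: eventually_mono\<close>)
  have int_Wc: "integrable (completion N) W" using int_W by (subst integrable_completion) auto
  show int_fZ: "integrable (completion N) (\<lambda>\<omega>. f (Z \<omega>))"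
    using int_Wc fZ_meas by (rule integrable_cong_AE_imp) (rule AE_completion[OF W_AE_eq[THEN eventually_mono]], simp)
  have eq: "(\<integral>\<omega>. f (Z \<omega>) \<partial>completion N) = (\<integral>\<omega>. W \<omega> \<partial>N)"
  proof -
    have "(\<integral>\<omega>. f (Z \<omega>) \<partial>completion N) = (\<integral>\<omega>. W \<omega> \<partial>completion N)"
      using fZ_meas by (intro integral_cong_AE measurable_completion[OF W_meas] AE_completion)
        (use W_AE_eq in \<open>auto elim: eventually_mono\<close>)
    then show ?thesis by (simp add: integral_completion)
  qed
  assume "e > 0"
  have "(\<lambda>j. \<integral>\<omega>. Wj j \<omega> \<partial>N) \<longlonglongrightarrow> (\<integral>\<omega>. W \<omega> \<partial>N)"
    by (rule integral_dominated_convergence[where w="\<lambda>_. B"]) (use AE_W in \<open>auto elim: eventually_mono\<close>)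
  then have "\<forall>\<^sub>F j in sequentially. (\<integral>\<omega>. W \<omega> \<partial>N) - e / 2 < (\<integral>\<omega>. Wj j \<omega> \<partial>N)"
    using \<open>e > 0\<close> by (intro order_tendstoD(1)) auto
  then obtain j where j: "(\<integral>\<omega>. W \<omega> \<partial>N) - e / 2 < (\<integral>\<omega>. Wj j \<omega> \<partial>N)"
    by (auto simp: eventually_sequentially)
  have H_lower: "- (3 * B) \<le> ?H j \<kappa> \<omega>" for \<kappa> \<omega> by (simp add: lower_approx_def)
  have "(\<lambda>\<kappa>. \<integral>\<omega>. ?H j \<kappa> \<omega> \<partial>N) \<longlonglongrightarrow> (\<integral>\<omega>. Wj j \<omega> \<partial>N)"
  proof (rule integral_dominated_convergence[where w="\<lambda>_. 3 * B"])
    show "AE \<omega> in N. norm (?H j \<kappa> \<omega>) \<le> 3 * B" for \<kappa>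
      using AE_W
    proof eventually_elim
      case (elim \<omega>)
      then have "?H j \<kappa> \<omega> \<le> B" by blast
      then show ?case using H_lower[of \<kappa> \<omega>] B0 unfolding real_norm_def by linarith
    qed
  qed (use AE_W in \<open>auto elim: eventually_mono\<close>)
  then have "\<forall>\<^sub>F \<kappa> in sequentially. (\<integral>\<omega>. Wj j \<omega> \<partial>N) - e / 2 < (\<integral>\<omega>. ?H j \<kappa> \<omega> \<partial>N)"
    using \<open>e > 0\<close> by (intro order_tendstoD(1)) auto
  then obtain \<kappa> where \<kappa>: "(\<integral>\<omega>. Wj j \<omega> \<partial>N) - e / 2 < (\<integral>\<omega>. ?H j \<kappa> \<omega> \<partial>N)"
    by (auto simp: eventually_sequentially)
  obtain C where C: "lipschitz_upto (Suc \<kappa> * Suc \<kappa>) C (?G j (Suc \<kappa>))" using lip[of "Suc \<kappa>"] by auto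
  have "(\<lambda>n. \<integral>\<omega>. ?G j (Suc \<kappa>) (\<lambda>i. U (Suc \<kappa>) n i \<omega>) \<partial>M) \<longlonglongrightarrow> (\<integral>\<omega>. ?H j \<kappa> \<omega> \<partial>N)"
    by (rule moment_convergence[where U="U (Suc \<kappa>)" and V="V (Suc \<kappa>)" and J="Suc \<kappa> * Suc \<kappa>" and C=C,
          OF M.prob_space_axioms N.prob_space_axioms U_meas U_cube V_meas V_cube mom C]) simp
  then have "\<forall>\<^sub>F n in sequentially. (\<integral>\<omega>. W \<omega> \<partial>N) - e < (\<integral>\<omega>. ?G j (Suc \<kappa>) (\<lambda>i. U (Suc \<kappa>) n i \<omega>) \<partial>M)"
    using j \<kappa> by (intro order_tendstoD(1)) auto
  then show "\<forall>\<^sub>F n in sequentially. (\<integral>\<omega>. f (Z \<omega>) \<partial>completion N) - e < (\<integral>\<omega>. f (Y n \<omega>) \<partial>M)"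
    using eventually_ge_at_top[of 1]
  proof eventually_elim
    case (elim n)
    have fY: "integrable M (\<lambda>\<omega>. f (Y n \<omega>))"
      by (rule M.integrable_const_bound[where B=B]) (use f(2) Y_D Y_meas[OF f(1)] in auto)
    have le: "AE \<omega> in M. ?G j (Suc \<kappa>) (\<lambda>i. U (Suc \<kappa>) n i \<omega>) \<le> f (Y n \<omega>)"
    proof -
      have "AE \<omega> in M. hitting_rel (Suc \<kappa>) (partial_prod (\<lambda>i. U (Suc \<kappa>) n i \<omega>)) (Y n \<omega>)"
        by (rule U_rel) (use elim(2) in auto)
      then show ?thesis
      proof eventually_elim
        case (elim \<omega>)
        show ?case
          by (rule lower_approx_le[OF f _ elim antimono_partial_prod[OF U_cube] Y_D Y_mono]) simp
      qed
    qed
    have gm: "(\<lambda>\<omega>. ?G j (Suc \<kappa>) (\<lambda>i. U (Suc \<kappa>) n i \<omega>)) \<in> borel_measurable M"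
      by (rule measurable_lipschitz_upto[where U="U (Suc \<kappa>) n", OF U_meas U_cube C])
    have "integrable M (\<lambda>\<omega>. ?G j (Suc \<kappa>) (\<lambda>i. U (Suc \<kappa>) n i \<omega>))"
    proof (rule M.integrable_const_bound[where B="3 * B", OF _ gm])
      show "AE \<omega> in M. norm (?G j (Suc \<kappa>) (\<lambda>i. U (Suc \<kappa>) n i \<omega>)) \<le> 3 * B"
        using le
      proof eventually_elim
        case (elim \<omega>)
        have "- (3 * B) \<le> ?G j (Suc \<kappa>) (\<lambda>i. U (Suc \<kappa>) n i \<omega>)" by (simp add: lower_approx_def)
        moreover have "\<bar>f (Y n \<omega>)\<bar> \<le> B" using f(2) Y_D by blast
        ultimately show ?case using elim B0 unfolding real_norm_def by linarith
      qed
    qed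
    then have "(\<integral>\<omega>. ?G j (Suc \<kappa>) (\<lambda>i. U (Suc \<kappa>) n i \<omega>) \<partial>M) \<le> (\<integral>\<omega>. f (Y n \<omega>) \<partial>M)"
      using fY le by (intro integral_mono_AE)
    then show ?case using elim(1) unfolding eq by linarith
  qed
qed

lemma weak_conv_skorokhod: "weak_conv_skorokhod M Y N Z"
  unfolding weak_conv_skorokhod_def
proof (intro conjI allI impI)
  show "AE \<omega> in M. Y n \<omega> \<in> skorokhod_D" for n using Y_D by simp
  show "AE \<omega> in N. Z \<omega> \<in> skorokhod_D" using Z_good by eventually_elim simp
  fix f :: "(real \<Rightarrow> real) \<Rightarrow> real"
  assume "continuous_map skorokhod_topology euclideanreal f \<and> bounded (f ` skorokhod_D)"
  then obtain B where f: "continuous_map skorokhod_topology euclideanreal f" "\<forall>x\<in>skorokhod_D. \<bar>f x\<bar> \<le> B"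
    by (auto simp: bounded_iff)
  have f': "continuous_map skorokhod_topology euclideanreal (\<lambda>x. - f x)" "\<forall>x\<in>skorokhod_D. \<bar>- f x\<bar> \<le> B"
    using f by (auto intro: continuous_map_minus)
  note ym = Y_meas[OF f(1)]
  show "integrable (completion M) (\<lambda>\<omega>. f (Y n \<omega>))" for n
    unfolding integrable_completion[OF ym] by (rule M.integrable_const_bound[where B=B]) (use f(2) Y_D ym in auto)
  show "integrable (completion N) (\<lambda>\<omega>. f (Z \<omega>))" by (rule liminf_bound(1)[OF f])
  show "(\<lambda>n. \<integral>\<omega>. f (Y n \<omega>) \<partial>completion M) \<longlonglongrightarrow> (\<integral>\<omega>. f (Z \<omega>) \<partial>completion N)"
    unfolding integral_completion[OF ym]
  proof (rule tendstoI)
    fix e :: real assume "e > 0"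
    show "\<forall>\<^sub>F n in sequentially. dist (\<integral>\<omega>. f (Y n \<omega>) \<partial>M) (\<integral>\<omega>. f (Z \<omega>) \<partial>completion N) < e"
      using liminf_bound(2)[OF f \<open>e > 0\<close>] liminf_bound(2)[OF f' \<open>e > 0\<close>]
    proof eventually_elim
      case (elim n)
      then show ?case unfolding dist_real_def by simp
    qed
  qed
qed

end

section \<open>The functional limit\<close>

lemma measurable_step_path:
  fixes g :: "nat \<Rightarrow> 'a \<Rightarrow> nat"
  assumes f: "continuous_map skorokhod_topology euclideanreal f" and r: "0 \<le> r"
    and g [measurable]: "\<And>k. g k \<in> measurable M (count_space UNIV)"
  shows "(\<lambda>x. f (step_path r (\<lambda>k. real (g k x) / b))) \<in> borel_measurable M"
proof (rule borel_measurable_LIMSEQ_real)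
  fix K
  define L where "L = Suc K"
  let ?l = "\<lambda>x. map (\<lambda>k. g k x) [0..<L]"
  have l: "?l \<in> measurable M (count_space UNIV)"
  proof (rule measurable_count_space_eq_countable[THEN iffD2, OF _ conjI])
    show "countable (UNIV :: nat list set)" by simp
    show "?l \<in> space M \<rightarrow> UNIV" by simp
    show "\<forall>a\<in>UNIV. ?l -` {a} \<inter> space M \<in> sets M"
    proof
    fix a :: "nat list"
    have "?l x = a \<longleftrightarrow> length a = L \<and> (\<forall>k<L. g k x = a ! k)" for x
      unfolding list_eq_iff_nth_eq by auto
    then have "?l -` {a} \<inter> space M = {x\<in>space M. length a = L \<and> (\<forall>k<L. g k x = a ! k)}" by blast
    also have "\<dots> \<in> sets M" by measurable
    finally show "?l -` {a} \<inter> space M \<in> sets M" .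
    qed
  qed
  have "(\<lambda>a. f (step_path r (\<lambda>k. real (a ! min k K) / b))) \<in> borel_measurable (count_space UNIV)" by simp
  from measurable_compose[OF l this]
  show "(\<lambda>x. f (step_path r (\<lambda>k. real (g (min k K) x) / b))) \<in> borel_measurable M"
    by (simp add: L_def less_Suc_eq_le del: upt_Suc)
next
  fix x
  show "(\<lambda>K. f (step_path r (\<lambda>k. real (g (min k K) x) / b))) \<longlonglongrightarrow> f (step_path r (\<lambda>k. real (g k x) / b))"
  proof (rule continuous_skorokhod_seq[OF f step_path_in_skorokhod_D[OF r] step_path_in_skorokhod_D[OF r]])
    fix T \<epsilon> :: real assume "0 < T" "0 < \<epsilon>"
    show "\<forall>\<^sub>F K in sequentially. \<forall>t\<in>{0..T}. \<bar>step_path r (\<lambda>k. real (g (min k K) x) / b) t - step_path r (\<lambda>k. real (g k x) / b) t\<bar> < \<epsilon>"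
    proof (rule eventually_sequentiallyI[of "nat \<lfloor>r * T\<rfloor>"], rule ballI)
      fix K t assume K: "nat \<lfloor>r * T\<rfloor> \<le> K" and t: "t \<in> {0..T}"
      have "r * t \<le> r * T" using t r by (intro mult_left_mono) auto
      then have "nat \<lfloor>r * t\<rfloor> \<le> nat \<lfloor>r * T\<rfloor>" by (intro nat_mono floor_mono)
      then have "min (nat \<lfloor>r * t\<rfloor>) K = nat \<lfloor>r * t\<rfloor>" using K by simp
      then show "\<bar>step_path r (\<lambda>k. real (g (min k K) x) / b) t - step_path r (\<lambda>k. real (g k x) / b) t\<bar> < \<epsilon>"
        using t \<open>0 < \<epsilon>\<close> by (simp add: step_path_def)
    qed
  qed
qed

lemma inverse_path:
  fixes d :: "real \<Rightarrow> real"
  assumes d0: "d 0 = 0" and mono: "mono_on {0..} d"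
    and strict: "\<And>u v. 0 \<le> u \<Longrightarrow> u < v \<Longrightarrow> d u < d v" and unb: "\<And>b. \<exists>v\<ge>0. b < d v"
  defines "z \<equiv> (\<lambda>t\<in>{0..}. Inf {v. v \<ge> 0 \<and> d v > t})"
  shows "z \<in> skorokhod_D" "continuous_on {0..} z" "mono_on {0..} z" "z 0 = 0"
    and "\<And>v t. 0 \<le> v \<Longrightarrow> 0 \<le> t \<Longrightarrow> d v \<le> t \<Longrightarrow> v \<le> z t"
    and "\<And>v t. 0 \<le> v \<Longrightarrow> 0 \<le> t \<Longrightarrow> t < d v \<Longrightarrow> z t \<le> v"
proof -
  have ne: "{v. v \<ge> 0 \<and> d v > t} \<noteq> {}" for t using unb[of t] by auto
  have bdd: "bdd_below {v. v \<ge> 0 \<and> d v > t}" for t by (auto intro: bdd_belowI[of _ 0])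
  have z_eq: "z t = Inf {v. v \<ge> 0 \<and> d v > t}" if "0 \<le> t" for t using that by (simp add: z_def)
  show lower: "v \<le> z t" if "0 \<le> v" "0 \<le> t" "d v \<le> t" for v t
    unfolding z_eq[OF that(2)]
  proof (rule cInf_greatest[OF ne])
    fix w assume w: "w \<in> {v. v \<ge> 0 \<and> d v > t}"
    show "v \<le> w"
    proof (rule ccontr)
      assume "\<not> v \<le> w"
      then have "d w \<le> d v" using w that by (intro mono_onD[OF mono]) auto
      then show False using w that by simp
    qed
  qed
  show upper: "z t \<le> v" if "0 \<le> v" "0 \<le> t" "t < d v" for v t
    unfolding z_eq[OF that(2)] using that by (intro cInf_lower bdd) auto
  have z_nonneg: "0 \<le> z t" if "0 \<le> t" for t using lower[of 0 t] d0 that by simp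
  show mono_z: "mono_on {0..} z"
  proof (rule mono_onI)
    fix s t :: real assume st: "s \<in> {0..}" "t \<in> {0..}" "s \<le> t"
    have "z s \<le> w" if "w \<in> {v. v \<ge> 0 \<and> d v > t}" for w
      using that st by (intro upper) auto
    then show "z s \<le> z t" using st z_eq[of t] by (auto intro!: cInf_greatest[OF ne])
  qed
  have above: "t < d v" if "z t < v" "0 \<le> t" for t v
  proof -
    have "Inf {v. v \<ge> 0 \<and> d v > t} < v" using that z_eq by simp
    then obtain w where w: "w \<ge> 0" "d w > t" "w < v" using cInf_lessD[OF ne] by blast
    have "d w < d v" using w by (intro strict) auto
    then show ?thesis using w by simp
  qed
  have below: "d v \<le> t" if "v < z t" "0 \<le> t" "0 \<le> v" for t v
    using upper[of v t] that by (meson not_le)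
  show z0: "z 0 = 0"
  proof (rule ccontr)
    assume "z 0 \<noteq> 0"
    then have "0 < z 0" using z_nonneg[of 0] by simp
    then have "d (z 0 / 2) \<le> 0" by (intro below) auto
    moreover have "d 0 < d (z 0 / 2)" using \<open>0 < z 0\<close> by (intro strict) auto
    ultimately show False using d0 by simp
  qed
  show cont: "continuous_on {0..} z"
    unfolding continuous_on_iff
  proof (intro ballI allI impI)
    fix t0 e :: real assume t0: "t0 \<in> {0..}" and e: "e > 0"
    have prob_weak_rec: "t0 < d (z t0 + e / 2)" using t0 e by (intro above) auto
    have "\<exists>\<delta>>0. \<forall>t\<ge>0. t0 - \<delta> < t \<longrightarrow> z t0 - e < z t"
    proof (cases "z t0 < e")
      case True
      show ?thesis
      proof (intro exI[of _ 1] conjI allI impI)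
        fix t :: real assume "0 \<le> t"
        then show "z t0 - e < z t" using z_nonneg[of t] True by linarith
      qed simp
    next
      case False
      let ?u = "z t0 - e / 2" and ?w = "z t0 - e / 4"
      have "0 \<le> ?u" "?u < ?w" "?w < z t0" using False e by auto
      have "d ?u < d ?w" by (rule strict) fact+
      also have "d ?w \<le> t0" using \<open>0 \<le> ?u\<close> \<open>?u < ?w\<close> \<open>?w < z t0\<close> t0 by (intro below) auto
      finally have du: "d ?u < t0" .
      show ?thesis
      proof (intro exI[of _ "t0 - d ?u"] conjI allI impI)
        fix t assume "0 \<le> t" "t0 - (t0 - d ?u) < t"
        then have "?u \<le> z t" using \<open>0 \<le> ?u\<close> by (intro lower) auto
        then show "z t0 - e < z t" using e by linarith
      qed (use du in simp)
    qed
    then obtain \<delta> where \<delta>: "\<delta> > 0" "\<And>t. 0 \<le> t \<Longrightarrow> t0 - \<delta> < t \<Longrightarrow> z t0 - e < z t" by blast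
    show "\<exists>\<delta>>0. \<forall>t\<in>{0..}. dist t t0 < \<delta> \<longrightarrow> dist (z t) (z t0) < e"
    proof (intro exI[of _ "min \<delta> (d (z t0 + e / 2) - t0)"] conjI ballI impI)
      show "0 < min \<delta> (d (z t0 + e / 2) - t0)" using \<delta> prob_weak_rec by simp
      fix t assume t: "t \<in> {0..}" "dist t t0 < min \<delta> (d (z t0 + e / 2) - t0)"
      have "z t \<le> z t0 + e / 2" using t z_nonneg[of t0] t0 e by (intro upper) (auto simp: dist_real_def)
      moreover have "z t0 - e < z t" using t by (intro \<delta>(2)) (auto simp: dist_real_def)
      ultimately show "dist (z t) (z t0) < e" using e by (simp add: dist_real_def)
    qed
  qed
  show "z \<in> skorokhod_D"
    unfolding skorokhod_D_def
  proof (intro CollectI conjI allI impI)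
    show "z \<in> extensional {0..}" by (simp add: z_def)
    show "(z \<longlongrightarrow> z t) (at_right t)" if "0 \<le> t" for t
    proof -
      have "(z \<longlongrightarrow> z t) (at t within {0..})" using cont that by (auto simp: continuous_on_def)
      then show ?thesis by (rule tendsto_within_subset) (use that in auto)
    qed
    show "\<exists>l. (z \<longlongrightarrow> l) (at_left t)" if "0 < t" for t
    proof -
      have "(z \<longlongrightarrow> z t) (at t within {0..})" using cont that by (auto simp: continuous_on_def)
      moreover have "at t within {0..} = at t" using that by (intro at_within_interior) (simp add: interior_real_atLeast)
      ultimately have "(z \<longlongrightarrow> z t) (at t within UNIV)" by simp
      then have "(z \<longlongrightarrow> z t) (at_left t)" by (rule tendsto_within_subset) auto
      then show ?thesis by blast
    qed
  qed
qed

lemma prod_blocks: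
  fixes m :: "nat \<Rightarrow> nat" and g :: "nat \<Rightarrow> nat \<Rightarrow> real"
  assumes m: "mono m" "m 0 = 0"
  shows "(\<Prod>l<m I. g l (LEAST i. l < m (Suc i))) = (\<Prod>i<I. \<Prod>l\<in>{m i..<m (Suc i)}. g l i)"
proof (induction I)
  case (Suc I)
  have idx: "(LEAST i. l < m (Suc i)) = I" if "l \<in> {m I..<m (Suc I)}" for l
  proof (rule Least_equality)
    fix i assume "l < m (Suc i)"
    show "I \<le> i"
    proof (rule ccontr)
      assume "\<not> I \<le> i"
      then have "m (Suc i) \<le> m I" using monoD[OF m(1)] by simp
      then show False using that \<open>l < m (Suc i)\<close> by simp
    qed
  qed (use that in simp)
  have "m I \<le> m (Suc I)" using monoD[OF m(1)] by simp
  then have split: "{..<m (Suc I)} = {..<m I} \<union> {m I..<m (Suc I)}" by auto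
  have "(\<Prod>l<m (Suc I). g l (LEAST i. l < m (Suc i)))
     = (\<Prod>l<m I. g l (LEAST i. l < m (Suc i))) * (\<Prod>l\<in>{m I..<m (Suc I)}. g l (LEAST i. l < m (Suc i)))"
    by (subst split, rule prod.union_disjoint) auto
  also have "(\<Prod>l\<in>{m I..<m (Suc I)}. g l (LEAST i. l < m (Suc i))) = (\<Prod>l\<in>{m I..<m (Suc I)}. g l I)"
    using idx by (intro prod.cong) auto
  finally show ?case using Suc.IH by simp
qed (simp add: m)

locale stable_sub = N: prob_space N for N :: "'b measure" +
  fixes D :: "real \<Rightarrow> 'b \<Rightarrow> real" and \<rho> :: real
  assumes stable: "stable_subordinator \<rho> N D" and \<rho>: "\<rho> > 0"
begin

lemma sub: "subordinator N D"
  using stable by (simp add: stable_subordinator_def)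

lemma D_meas: "0 \<le> v \<Longrightarrow> D v \<in> borel_measurable N"
  using sub by (simp add: subordinator_def)

lemma AE_D: "AE \<omega> in N. D 0 \<omega> = 0 \<and> mono_on {0..} (\<lambda>v. D v \<omega>)"
  using sub unfolding subordinator_def by (auto elim: eventually_mono)

lemma AE_D_nonneg: "AE \<omega> in N. \<forall>v\<ge>0. 0 \<le> D v \<omega>"
  using AE_D
proof eventually_elim
  case (elim \<omega>)
  show ?case
  proof (intro allI impI)
    fix v :: real assume "0 \<le> v"
    then have "D 0 \<omega> \<le> D v \<omega>" using elim by (intro mono_onD[of "{0..}" "\<lambda>v. D v \<omega>"]) auto
    then show "0 \<le> D v \<omega>" using elim by simp
  qed
qed

lemma laplace: "0 \<le> v \<Longrightarrow> 0 \<le> s \<Longrightarrow> (\<integral>\<omega>. exp (- s * D v \<omega>) \<partial>N) = exp (- v * s powr \<rho>)"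
  using stable by (simp add: stable_subordinator_def)

lemma integrable_laplace: "0 \<le> v \<Longrightarrow> 0 \<le> s \<Longrightarrow> integrable N (\<lambda>\<omega>. exp (- s * D v \<omega>))"
proof (rule N.integrable_const_bound[where B=1])
  assume vs: "0 \<le> v" "0 \<le> s"
  show "AE \<omega> in N. norm (exp (- s * D v \<omega>)) \<le> 1"
    using AE_D_nonneg by eventually_elim (use vs in auto)
  show "(\<lambda>\<omega>. exp (- s * D v \<omega>)) \<in> borel_measurable N"
    using D_meas[OF vs(1)] by measurable
qed

lemma prob_D_le:
  assumes "0 \<le> v" "0 \<le> s"
  shows "N.prob {\<omega>\<in>space N. D v \<omega> \<le> b} \<le> exp (s * b) * exp (- v * s powr \<rho>)"
proof -
  have [measurable]: "D v \<in> borel_measurable N" by (rule D_meas[OF assms(1)])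
  have "N.prob {\<omega>\<in>space N. D v \<omega> \<le> b} = (\<integral>\<omega>. indicator {\<omega>\<in>space N. D v \<omega> \<le> b} \<omega> \<partial>N)" by simp
  also have "\<dots> \<le> (\<integral>\<omega>. exp (s * b) * exp (- s * D v \<omega>) \<partial>N)"
  proof (rule integral_mono)
    show "integrable N (\<lambda>\<omega>. exp (s * b) * exp (- s * D v \<omega>))" by (intro integrable_mult_right integrable_laplace assms)
    fix \<omega>
    have "1 \<le> exp (s * b) * exp (- s * D v \<omega>)" if "D v \<omega> \<le> b"
      using mult_left_mono[OF that assms(2)] by (simp add: exp_add[symmetric])
    then show "indicator {\<omega>\<in>space N. D v \<omega> \<le> b} \<omega> \<le> exp (s * b) * exp (- s * D v \<omega>)"
      by (auto simp: indicator_def)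
  qed (auto simp: N.emeasure_eq_measure)
  also have "\<dots> = exp (s * b) * exp (- v * s powr \<rho>)"
    using laplace[OF assms] by simp
  finally show ?thesis .
qed

lemma AE_D_pos: "0 < h \<Longrightarrow> AE \<omega> in N. 0 < D h \<omega>"
proof -
  assume h: "0 < h"
  have [measurable]: "D h \<in> borel_measurable N" using h by (intro D_meas) simp
  have "N.prob {\<omega>\<in>space N. D h \<omega> \<le> 0} \<le> 0"
  proof (rule LIMSEQ_le_const)
    have "filterlim (\<lambda>n. real n powr \<rho>) at_top sequentially"
      by (intro filterlim_compose[OF real_powr_at_top[OF \<rho>]] filterlim_real_sequentially)
    then have "filterlim (\<lambda>n. h * real n powr \<rho>) at_top sequentially"
      by (rule filterlim_tendsto_pos_mult_at_top[OF tendsto_const h])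
    then show "(\<lambda>n. exp (- (h * real n powr \<rho>))) \<longlonglongrightarrow> 0"
      by (intro filterlim_compose[OF exp_at_bot]) (simp add: filterlim_uminus_at_top)
    show "\<exists>n0. \<forall>n\<ge>n0. N.prob {\<omega>\<in>space N. D h \<omega> \<le> 0} \<le> exp (- (h * real n powr \<rho>))"
      using prob_D_le[of h "real n" 0 for n] h by auto
  qed
  then have "N.prob {\<omega>\<in>space N. D h \<omega> \<le> 0} = 0" using measure_nonneg by (intro antisym)
  then have "AE \<omega> in N. \<not> D h \<omega> \<le> 0" by (subst (asm) N.prob_eq_0) auto
  then show ?thesis by eventually_elim simp
qed

lemma distr_increment:
  assumes "0 \<le> u" "u \<le> v"
  shows "distr N borel (\<lambda>\<omega>. D v \<omega> - D u \<omega>) = distr N borel (D (v - u))"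
  using sub assms by (simp add: subordinator_def)

lemma AE_increment_pos: "0 \<le> u \<Longrightarrow> u < v \<Longrightarrow> AE \<omega> in N. D u \<omega> < D v \<omega>"
proof -
  assume uv: "0 \<le> u" "u < v"
  have [measurable]: "D u \<in> borel_measurable N" "D v \<in> borel_measurable N" "D (v - u) \<in> borel_measurable N"
    using uv by (auto intro: D_meas)
  have "AE x in distr N borel (D (v - u)). 0 < x"
    using AE_D_pos[of "v - u"] uv by (subst AE_distr_iff) auto
  then have "AE x in distr N borel (\<lambda>\<omega>. D v \<omega> - D u \<omega>). 0 < x"
    unfolding distr_increment[OF uv(1) less_imp_le[OF uv(2)]] .
  then have "AE \<omega> in N. 0 < D v \<omega> - D u \<omega>" by (subst (asm) AE_distr_iff) auto
  then show ?thesis by eventually_elim simp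
qed

lemma AE_unbounded: "AE \<omega> in N. \<forall>b. \<exists>v\<ge>0. b < D v \<omega>"
proof -
  have "AE \<omega> in N. \<exists>m::nat. real k < D (real m) \<omega>" for k :: nat
  proof -
    have [measurable]: "D (real m) \<in> borel_measurable N" for m by (rule D_meas) simp
    have "N.prob {\<omega>\<in>space N. \<forall>m::nat. D (real m) \<omega> \<le> real k} \<le> 0"
    proof (rule LIMSEQ_le_const)
      have "(\<lambda>m. exp (real k) * exp (- real m)) \<longlonglongrightarrow> exp (real k) * 0"
        by (intro tendsto_intros filterlim_compose[OF exp_at_bot])
          (simp add: filterlim_uminus_at_top[symmetric] filterlim_real_sequentially)
      then show "(\<lambda>m. exp (real k) * exp (- real m)) \<longlonglongrightarrow> 0" by simp
      have "N.prob {\<omega>\<in>space N. \<forall>m::nat. D (real m) \<omega> \<le> real k} \<le> exp (real k) * exp (- real m)" for m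
      proof -
        have "N.prob {\<omega>\<in>space N. \<forall>m::nat. D (real m) \<omega> \<le> real k} \<le> N.prob {\<omega>\<in>space N. D (real m) \<omega> \<le> real k}"
          by (rule N.finite_measure_mono) auto
        also have "\<dots> \<le> exp (1 * real k) * exp (- real m * 1 powr \<rho>)" by (rule prob_D_le) auto
        finally show ?thesis by simp
      qed
      then show "\<exists>n0. \<forall>n\<ge>n0. N.prob {\<omega>\<in>space N. \<forall>m::nat. D (real m) \<omega> \<le> real k} \<le> exp (real k) * exp (- real n)" by blast
    qed
    then have "N.prob {\<omega>\<in>space N. \<forall>m::nat. D (real m) \<omega> \<le> real k} = 0" using measure_nonneg by (intro antisym)
    then have "AE \<omega> in N. \<not> (\<forall>m::nat. D (real m) \<omega> \<le> real k)" by (subst (asm) N.prob_eq_0) auto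
    then show ?thesis by eventually_elim (auto simp: not_le)
  qed
  then have "AE \<omega> in N. \<forall>k. \<exists>m::nat. real k < D (real m) \<omega>" by (simp add: AE_all_countable)
  then show ?thesis
  proof eventually_elim
    case (elim \<omega>)
    show ?case
    proof
      fix b :: real
      obtain k :: nat where "b < real k" using reals_Archimedean2 by blast
      moreover obtain m :: nat where "real k < D (real m) \<omega>" using elim by blast
      ultimately show "\<exists>v\<ge>0. b < D v \<omega>" by (intro exI[of _ "real m"]) auto
    qed
  qed
qed

lemma AE_strict: "AE \<omega> in N. \<forall>u v. 0 \<le> u \<longrightarrow> u < v \<longrightarrow> D u \<omega> < D v \<omega>"
proof -
  have "AE \<omega> in N. \<forall>i k::nat. D (real i / real (Suc k)) \<omega> < D (real (Suc i) / real (Suc k)) \<omega>"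
    unfolding AE_all_countable by (intro allI AE_increment_pos) (auto simp: divide_strict_right_mono)
  with AE_D show ?thesis
  proof eventually_elim
    case (elim \<omega>)
    show ?case
    proof (intro allI impI)
      fix u v :: real assume uv: "0 \<le> u" "u < v"
      obtain k :: nat where k: "2 / (v - u) < real (Suc k)"
        using reals_Archimedean2[of "2 / (v - u)"] by (metis less_trans lessI of_nat_less_iff)
      define q where "q = real (Suc k)"
      have q: "q > 0" "2 < q * (v - u)" using k uv by (auto simp: q_def pos_divide_less_eq)
      define i where "i = nat \<lceil>u * q\<rceil>"
      have "0 \<le> u * q" using uv q by simp
      then have i: "u * q \<le> real i" "real i < u * q + 1" unfolding i_def by linarith+
      have "u \<le> real i / q" using i q by (simp add: pos_le_divide_eq)
      have "real (Suc i) \<le> v * q" using i q by (simp add: algebra_simps)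
      then have "real (Suc i) / q \<le> v" using q by (simp add: pos_divide_le_eq)
      have "D u \<omega> \<le> D (real i / q) \<omega>" using elim(1) uv \<open>u \<le> real i / q\<close> by (intro mono_onD[of "{0..}" "\<lambda>v. D v \<omega>"]) auto
      also have "\<dots> < D (real (Suc i) / q) \<omega>" using elim(2) unfolding q_def by blast
      also have "\<dots> \<le> D v \<omega>" using elim(1) uv q \<open>real (Suc i) / q \<le> v\<close> by (intro mono_onD[of "{0..}" "\<lambda>v. D v \<omega>"]) auto
      finally show "D u \<omega> < D v \<omega>" .
    qed
  qed
qed

lemma AE_inverse_process:
  "AE \<omega> in N. inverse_process D \<omega> \<in> skorokhod_D \<and> continuous_on {0..} (inverse_process D \<omega>) \<and>
     mono_on {0..} (inverse_process D \<omega>) \<and> inverse_process D \<omega> 0 = 0"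
  and AE_inverse_process_rel:
  "AE \<omega> in N. \<forall>v t. 0 \<le> v \<longrightarrow> 0 \<le> t \<longrightarrow> (D v \<omega> \<le> t \<longrightarrow> v \<le> inverse_process D \<omega> t) \<and> (t < D v \<omega> \<longrightarrow> inverse_process D \<omega> t \<le> v)"
proof -
  have "AE \<omega> in N. (inverse_process D \<omega> \<in> skorokhod_D \<and> continuous_on {0..} (inverse_process D \<omega>) \<and>
     mono_on {0..} (inverse_process D \<omega>) \<and> inverse_process D \<omega> 0 = 0) \<and>
     (\<forall>v t. 0 \<le> v \<longrightarrow> 0 \<le> t \<longrightarrow> (D v \<omega> \<le> t \<longrightarrow> v \<le> inverse_process D \<omega> t) \<and> (t < D v \<omega> \<longrightarrow> inverse_process D \<omega> t \<le> v))"
    using AE_D AE_strict AE_unbounded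
  proof eventually_elim
    case (elim \<omega>)
    have "inverse_process D \<omega> = (\<lambda>t\<in>{0..}. Inf {v. v \<ge> 0 \<and> D v \<omega> > t})" by (simp add: inverse_process_def)
    then show ?case
      using inverse_path[of "\<lambda>v. D v \<omega>"] elim by (simp only:) blast
  qed
  then show "AE \<omega> in N. inverse_process D \<omega> \<in> skorokhod_D \<and> continuous_on {0..} (inverse_process D \<omega>) \<and>
     mono_on {0..} (inverse_process D \<omega>) \<and> inverse_process D \<omega> 0 = 0"
    "AE \<omega> in N. \<forall>v t. 0 \<le> v \<longrightarrow> 0 \<le> t \<longrightarrow> (D v \<omega> \<le> t \<longrightarrow> v \<le> inverse_process D \<omega> t) \<and> (t < D v \<omega> \<longrightarrow> inverse_process D \<omega> t \<le> v)"
    by (auto elim: eventually_mono)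
qed

definition exp_increment :: "nat \<Rightarrow> nat \<Rightarrow> 'b \<Rightarrow> real" where
  "exp_increment \<kappa> i \<omega> = exp (- max 0 (D (real (Suc i) / real \<kappa>) \<omega> - D (real i / real \<kappa>) \<omega>))"

lemma exp_increment_meas: "exp_increment \<kappa> i \<in> borel_measurable N"
proof -
  have [measurable]: "D (real (Suc i) / real \<kappa>) \<in> borel_measurable N" "D (real i / real \<kappa>) \<in> borel_measurable N"
    by (auto intro: D_meas)
  show ?thesis unfolding exp_increment_def[abs_def] by measurable
qed

lemma exp_increment_cube: "(\<lambda>i. exp_increment \<kappa> i \<omega>) \<in> cube"
  by (simp add: cube_def exp_increment_def)

lemma hitting_rel_exp_increment:
  "AE \<omega> in N. \<forall>\<kappa>\<ge>1. hitting_rel \<kappa> (partial_prod (\<lambda>i. exp_increment \<kappa> i \<omega>)) (inverse_process D \<omega>)"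
  using AE_D AE_inverse_process_rel
proof eventually_elim
  case (elim \<omega>)
  show ?case
  proof (intro allI impI)
    fix \<kappa> :: nat assume "1 \<le> \<kappa>"
    have pp: "partial_prod (\<lambda>i. exp_increment \<kappa> i \<omega>) i = exp (- D (real i / real \<kappa>) \<omega>)" for i
    proof (induction i)
      case 0
      then show ?case using elim(1) by (simp add: partial_prod_def)
    next
      case (Suc i)
      have "D (real i / real \<kappa>) \<omega> \<le> D (real (Suc i) / real \<kappa>) \<omega>"
        using elim(1) by (intro mono_onD[of "{0..}" "\<lambda>v. D v \<omega>"]) (auto simp: divide_right_mono)
      then have "exp_increment \<kappa> i \<omega> = exp (- (D (real (Suc i) / real \<kappa>) \<omega> - D (real i / real \<kappa>) \<omega>))"
        by (simp add: exp_increment_def)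
      then show ?case using Suc by (simp add: partial_prod_def exp_add[symmetric])
    qed
    show "hitting_rel \<kappa> (partial_prod (\<lambda>i. exp_increment \<kappa> i \<omega>)) (inverse_process D \<omega>)"
      unfolding hitting_rel_def pp using elim(2) by simp
  qed
qed

lemma moments_exp_increment:
  assumes \<kappa>: "\<kappa> \<ge> 1"
  shows "(\<integral>\<omega>. (\<Prod>i<I. exp_increment \<kappa> i \<omega> ^ k i) \<partial>N) = (\<Prod>i<I. exp (- (1 / real \<kappa> * real (k i) powr \<rho>)))"
proof -
  define t where "t i = real i / real \<kappa>" for i :: nat
  have tm: "mono t" "t 0 \<ge> 0" unfolding t_def by (auto intro!: monoI divide_right_mono)
  have ind: "N.indep_vars (\<lambda>_. borel) (\<lambda>i \<omega>. D (t (Suc i)) \<omega> - D (t i) \<omega>) UNIV"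
    using sub tm unfolding subordinator_def by blast
  have ind1: "N.indep_vars (\<lambda>_. borel) (\<lambda>i \<omega>. (\<lambda>x. exp (- max 0 x) ^ k i) (D (t (Suc i)) \<omega> - D (t i) \<omega>)) UNIV"
    by (rule N.indep_vars_compose2[OF ind]) measurable
  have "(\<lambda>i \<omega>. (\<lambda>x. exp (- max 0 x) ^ k i) (D (t (Suc i)) \<omega> - D (t i) \<omega>)) = (\<lambda>i \<omega>. exp_increment \<kappa> i \<omega> ^ k i)"
    by (intro ext) (simp only: exp_increment_def t_def)
  with ind1 have "N.indep_vars (\<lambda>_. borel) (\<lambda>i \<omega>. exp_increment \<kappa> i \<omega> ^ k i) UNIV" by (simp only:)
  then have ind2: "N.indep_vars (\<lambda>_. borel) (\<lambda>i \<omega>. exp_increment \<kappa> i \<omega> ^ k i) {..<I}"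
    by (rule N.indep_vars_subset) simp
  have int: "integrable N (\<lambda>\<omega>. exp_increment \<kappa> i \<omega> ^ k i)" for i
  proof (rule N.integrable_const_bound[where B=1])
    show "AE \<omega> in N. norm (exp_increment \<kappa> i \<omega> ^ k i) \<le> 1"
      by (simp add: exp_increment_def power_le_one)
    show "(\<lambda>\<omega>. exp_increment \<kappa> i \<omega> ^ k i) \<in> borel_measurable N"
      using exp_increment_meas by (intro borel_measurable_power)
  qed
  have "(\<integral>\<omega>. (\<Prod>i<I. exp_increment \<kappa> i \<omega> ^ k i) \<partial>N) = (\<Prod>i<I. \<integral>\<omega>. exp_increment \<kappa> i \<omega> ^ k i \<partial>N)"
    by (rule N.indep_vars_lebesgue_integral[OF _ ind2 int]) simp
  also have "\<dots> = (\<Prod>i<I. exp (- (1 / real \<kappa> * real (k i) powr \<rho>)))"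
  proof (rule prod.cong[OF refl])
    fix i
    let ?u = "real i / real \<kappa>" and ?v = "real (Suc i) / real \<kappa>"
    have uv: "0 \<le> ?u" "?u \<le> ?v" by (auto intro: divide_right_mono)
    have vu: "?v - ?u = 1 / real \<kappa>" by (simp add: diff_divide_distrib[symmetric])
    have [measurable]: "D ?u \<in> borel_measurable N" "D ?v \<in> borel_measurable N" "D (1 / real \<kappa>) \<in> borel_measurable N"
      using uv by (auto intro: D_meas)
    have "(\<integral>\<omega>. exp_increment \<kappa> i \<omega> ^ k i \<partial>N) = (\<integral>x. exp (- max 0 x) ^ k i \<partial>distr N borel (\<lambda>\<omega>. D ?v \<omega> - D ?u \<omega>))"
      by (subst integral_distr) (simp_all add: exp_increment_def del: of_nat_Suc)
    also have "\<dots> = (\<integral>x. exp (- max 0 x) ^ k i \<partial>distr N borel (D (1 / real \<kappa>)))"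
      using distr_increment[OF uv] vu by simp
    also have "\<dots> = (\<integral>\<omega>. exp (- max 0 (D (1 / real \<kappa>) \<omega>)) ^ k i \<partial>N)"
      by (subst integral_distr) simp_all
    also have "\<dots> = (\<integral>\<omega>. exp (- real (k i) * D (1 / real \<kappa>) \<omega>) \<partial>N)"
    proof (rule integral_cong_AE)
      show "AE \<omega> in N. exp (- max 0 (D (1 / real \<kappa>) \<omega>)) ^ k i = exp (- real (k i) * D (1 / real \<kappa>) \<omega>)"
        using AE_D_nonneg by eventually_elim (simp add: exp_of_nat_mult[symmetric])
    qed measurable
    also have "\<dots> = exp (- (1 / real \<kappa>) * real (k i) powr \<rho>)" by (rule laplace) auto
    finally show "(\<integral>\<omega>. exp_increment \<kappa> i \<omega> ^ k i \<partial>N) = exp (- (1 / real \<kappa> * real (k i) powr \<rho>))" by simp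
  qed
  finally show ?thesis .
qed

end

context iid_steps begin

definition level_index :: "real \<Rightarrow> nat \<Rightarrow> nat \<Rightarrow> nat \<Rightarrow> nat" where
  "level_index c \<kappa> n i = nat \<lfloor>norming c n * (real i / real \<kappa>)\<rfloor>"

definition exp_gap :: "real \<Rightarrow> nat \<Rightarrow> nat \<Rightarrow> nat \<Rightarrow> (nat \<Rightarrow> real) \<Rightarrow> real" where
  "exp_gap c \<kappa> n i x = exp (- (real (tau c (level_index c \<kappa> n (Suc i)) x - tau c (level_index c \<kappa> n i) x) / real n))"

definition count_path :: "real \<Rightarrow> nat \<Rightarrow> (nat \<Rightarrow> real) \<Rightarrow> real \<Rightarrow> real" where
  "count_path c n x = step_path (real n) (\<lambda>k. real (record_count c k x) / norming c n)"

lemma measurable_exp_gap: "exp_gap c \<kappa> n i \<in> borel_measurable S"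
  unfolding exp_gap_def[abs_def] by measurable

lemma exp_gap_cube: "(\<lambda>i. exp_gap c \<kappa> n i x) \<in> cube"
  by (simp add: cube_def exp_gap_def)

context
  fixes c :: real
  assumes c: "c > 0" "summable (prob_weak_rec_less c)" "suminf (prob_weak_rec_less c) \<ge> 1" and ns: "\<not> summable (\<lambda>n. prob_nonneg n / real n)"
begin

lemma norming_pos: "0 < norming c n"
  using c(3) by (simp add: norming_def)

lemma mono_level_index: "mono (level_index c \<kappa> n)" and level_index_0: "level_index c \<kappa> n 0 = 0"
  unfolding level_index_def using less_imp_le[OF norming_pos, of n]
  by (auto intro!: monoI nat_mono floor_mono mult_left_mono divide_right_mono)

lemma partial_prod_exp_gap:
  "partial_prod (\<lambda>i. exp_gap c \<kappa> n i x) i = exp (- (real (tau c (level_index c \<kappa> n i) x) / real n))"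
proof (induction i)
  case 0
  then show ?case by (simp add: partial_prod_def level_index_0)
next
  case (Suc i)
  have "tau c (level_index c \<kappa> n i) x \<le> tau c (level_index c \<kappa> n (Suc i)) x"
    using monoD[OF mono_level_index, of i "Suc i"] by (intro tau_mono) simp
  then have "exp_gap c \<kappa> n i x = exp (- (real (tau c (level_index c \<kappa> n (Suc i)) x) / real n - real (tau c (level_index c \<kappa> n i) x) / real n))"
    by (simp add: exp_gap_def of_nat_diff diff_divide_distrib)
  then show ?case using Suc by (simp add: partial_prod_def exp_add[symmetric])
qed

lemma hitting_rel_exp_gap:
  assumes "1 \<le> n" and reach: "\<forall>m. reach c m x"
  shows "hitting_rel \<kappa> (partial_prod (\<lambda>i. exp_gap c \<kappa> n i x)) (count_path c n x)"
  unfolding hitting_rel_def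
proof (intro allI impI)
  fix i and t :: real assume t: "0 \<le> t"
  let ?m = "level_index c \<kappa> n i" and ?N = "nat \<lfloor>real n * t\<rfloor>"
  have n: "real n > 0" using assms by simp
  have "exp (- t) \<le> partial_prod (\<lambda>i. exp_gap c \<kappa> n i x) i \<longleftrightarrow> real (tau c ?m x) \<le> real n * t"
    unfolding partial_prod_exp_gap using n by (simp add: pos_divide_le_eq mult.commute)
  also have "\<dots> \<longleftrightarrow> tau c ?m x \<le> ?N" using t n by (simp add: le_nat_iff le_floor_iff)
  also have "\<dots> \<longleftrightarrow> ?m < record_count c ?N x" using reach by (simp add: less_record_count_iff)
  also have "\<dots> \<longleftrightarrow> norming c n * (real i / real \<kappa>) < real (record_count c ?N x)"
  proof -
    have "0 \<le> norming c n * (real i / real \<kappa>)" using norming_pos[of n] by simp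
    then show ?thesis unfolding level_index_def by linarith
  qed
  also have "\<dots> \<longleftrightarrow> real i / real \<kappa> < count_path c n x t"
    unfolding count_path_def step_path_def using t norming_pos[of n] by (simp add: pos_less_divide_eq mult.commute)
  finally show "(exp (- t) \<le> partial_prod (\<lambda>i. exp_gap c \<kappa> n i x) i \<longrightarrow> real i / real \<kappa> \<le> count_path c n x t) \<and>
     (partial_prod (\<lambda>i. exp_gap c \<kappa> n i x) i < exp (- t) \<longrightarrow> count_path c n x t \<le> real i / real \<kappa>)"
    by linarith
qed

lemma integral_exp_gap:
  "(\<integral>x. (\<Prod>i<I. exp_gap c \<kappa> n i x ^ k i) \<partial>S)
   = (\<Prod>i<I. genfun (prob_hit c) (exp (- (real (k i) / real n))) ^ (level_index c \<kappa> n (Suc i) - level_index c \<kappa> n i))"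
proof -
  let ?m = "level_index c \<kappa> n"
  let ?z = "\<lambda>l. exp (- (real (k (LEAST i. l < ?m (Suc i))) / real n))"
  have "(\<integral>x. (\<Prod>i<I. exp_gap c \<kappa> n i x ^ k i) \<partial>S) = (\<integral>x. gap_weight c ?z (?m I) x \<partial>S)"
  proof (rule integral_cong_AE)
    show "AE x in S. (\<Prod>i<I. exp_gap c \<kappa> n i x ^ k i) = gap_weight c ?z (?m I) x"
      using AE_reach[OF genfun_prob_hit_1[OF c(1,2) ns]]
    proof eventually_elim
      case (elim x)
      have "gap_weight c ?z (?m I) x = (\<Prod>l<?m I. (\<lambda>l i. exp (- (real (k i) / real n)) ^ gap c l x) l (LEAST i. l < ?m (Suc i)))"
        using elim by (simp add: gap_weight_def)
      also have "\<dots> = (\<Prod>i<I. \<Prod>l\<in>{?m i..<?m (Suc i)}. exp (- (real (k i) / real n)) ^ gap c l x)"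
        by (rule prod_blocks[OF mono_level_index level_index_0])
      also have "\<dots> = (\<Prod>i<I. exp_gap c \<kappa> n i x ^ k i)"
      proof (rule prod.cong[OF refl])
        fix i
        have le: "?m i \<le> ?m (Suc i)" using monoD[OF mono_level_index] by simp
        have split: "{..<?m (Suc i)} = {..<?m i} \<union> {?m i..<?m (Suc i)}" using le by auto
        have "tau c (?m (Suc i)) x = tau c (?m i) x + (\<Sum>l\<in>{?m i..<?m (Suc i)}. gap c l x)"
          unfolding tau_def by (subst split, rule sum.union_disjoint) auto
        then have s: "(\<Sum>l\<in>{?m i..<?m (Suc i)}. gap c l x) = tau c (?m (Suc i)) x - tau c (?m i) x" by simp
        have "(\<Prod>l\<in>{?m i..<?m (Suc i)}. exp (- (real (k i) / real n)) ^ gap c l x)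
          = exp (- (real (k i) / real n)) ^ (tau c (?m (Suc i)) x - tau c (?m i) x)"
          unfolding s[symmetric] by (rule power_sum[symmetric])
        also have "\<dots> = exp_gap c \<kappa> n i x ^ k i"
          unfolding exp_gap_def exp_of_nat_mult[symmetric] by (simp add: mult.commute)
        finally show "(\<Prod>l\<in>{?m i..<?m (Suc i)}. exp (- (real (k i) / real n)) ^ gap c l x) = exp_gap c \<kappa> n i x ^ k i" .
      qed
      finally show ?case ..
    qed
    show "(\<lambda>x. \<Prod>i<I. exp_gap c \<kappa> n i x ^ k i) \<in> borel_measurable S"
      by (intro borel_measurable_prod borel_measurable_power measurable_exp_gap)
  qed (rule measurable_gap_weight)
  also have "\<dots> = (\<Prod>l<?m I. (\<lambda>l i. genfun (prob_hit c) (exp (- (real (k i) / real n)))) l (LEAST i. l < ?m (Suc i)))"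
    by (subst integral_gap_weight) auto
  also have "\<dots> = (\<Prod>i<I. \<Prod>l\<in>{?m i..<?m (Suc i)}. genfun (prob_hit c) (exp (- (real (k i) / real n))))"
    by (rule prod_blocks[OF mono_level_index level_index_0])
  finally show ?thesis by simp
qed

lemma tendsto_integral_exp_gap:
  assumes prob_nonneg: "prob_nonneg \<longlonglongrightarrow> \<rho>" and \<kappa>: "\<kappa> \<ge> 1"
  shows "(\<lambda>n. \<integral>x. (\<Prod>i<I. exp_gap c \<kappa> n i x ^ k i) \<partial>S) \<longlonglongrightarrow> (\<Prod>i<I. exp (- (1 / real \<kappa> * real (k i) powr \<rho>)))"
  unfolding integral_exp_gap
proof (rule tendsto_prod)
  fix i
  show "(\<lambda>n. genfun (prob_hit c) (exp (- (real (k i) / real n))) ^ (level_index c \<kappa> n (Suc i) - level_index c \<kappa> n i))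
    \<longlonglongrightarrow> exp (- (1 / real \<kappa> * real (k i) powr \<rho>))"
  proof (cases "k i = 0")
    case True
    then show ?thesis using genfun_prob_hit_1[OF c(1,2) ns] by simp
  next
    case False
    have top: "filterlim (norming c) at_top sequentially" by (rule norming_at_top[OF c(3) ns])
    have l: "(\<lambda>n. real (level_index c \<kappa> n i) / norming c n) \<longlonglongrightarrow> real i / real \<kappa>" for i
      unfolding level_index_def by (rule tendsto_nat_floor_mult[OF top]) simp
    have "(\<lambda>n. real (level_index c \<kappa> n (Suc i)) / norming c n - real (level_index c \<kappa> n i) / norming c n)
      \<longlonglongrightarrow> real (Suc i) / real \<kappa> - real i / real \<kappa>" by (intro tendsto_diff l)
    moreover have "real (level_index c \<kappa> n (Suc i)) / norming c n - real (level_index c \<kappa> n i) / norming c n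
        = real (level_index c \<kappa> n (Suc i) - level_index c \<kappa> n i) / norming c n" for n
      using monoD[OF mono_level_index, of i "Suc i"] by (simp add: of_nat_diff diff_divide_distrib)
    moreover have "real (Suc i) / real \<kappa> - real i / real \<kappa> = 1 / real \<kappa>" by (simp add: diff_divide_distrib[symmetric])
    ultimately have "(\<lambda>n. real (level_index c \<kappa> n (Suc i) - level_index c \<kappa> n i) / norming c n) \<longlonglongrightarrow> 1 / real \<kappa>" by (simp only:)
    from tendsto_genfun_prob_hit_power[OF c prob_nonneg ns this, of "real (k i)"] False show ?thesis by simp
  qed
qed

lemma weak_conv_count_path:
  fixes N :: "'b measure"
  assumes prob_nonneg: "prob_nonneg \<longlonglongrightarrow> \<rho>" and \<rho>: "\<rho> > 0" and stable: "stable_subordinator \<rho> N D"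
  shows "weak_conv_skorokhod S (count_path c) N (inverse_process D)"
proof -
  have "prob_space N" using stable by (simp add: stable_subordinator_def subordinator_def)
  then interpret D: stable_sub N D \<rho>
    by (rule stable_sub.intro) (unfold_locales, rule stable, rule \<rho>)
  have rc_mono: "record_count c k x \<le> record_count c l x" if "k \<le> l" for k l x
    unfolding record_count_def using that by (intro card_mono) auto
  interpret F: functional_limit S N "count_path c" "inverse_process D" "exp_gap c" D.exp_increment
  proof unfold_locales
    show "count_path c n x \<in> skorokhod_D" for n x
      unfolding count_path_def by (rule step_path_in_skorokhod_D) simp
    show "(\<lambda>x. f (count_path c n x)) \<in> borel_measurable S"
      if "continuous_map skorokhod_topology euclideanreal f" for f n
      unfolding count_path_def using that by (rule measurable_step_path) simp_all
    show "mono_on {0..} (count_path c n x)" for n x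
      unfolding count_path_def step_path_def using norming_pos[of n]
      by (intro mono_onI) (auto intro!: divide_right_mono of_nat_mono rc_mono nat_mono floor_mono mult_left_mono)
    show "0 \<le> count_path c n x 0" for n x
      unfolding count_path_def step_path_def using norming_pos[of n] by simp
    show "exp_gap c \<kappa> n i \<in> borel_measurable S" for \<kappa> n i by (rule measurable_exp_gap)
    show "(\<lambda>i. exp_gap c \<kappa> n i x) \<in> cube" for \<kappa> n x by (rule exp_gap_cube)
    show "D.exp_increment \<kappa> i \<in> borel_measurable N" for \<kappa> i by (rule D.exp_increment_meas)
    show "(\<lambda>i. D.exp_increment \<kappa> i \<omega>) \<in> cube" for \<kappa> \<omega> by (rule D.exp_increment_cube)
    show "AE x in S. hitting_rel \<kappa> (partial_prod (\<lambda>i. exp_gap c \<kappa> n i x)) (count_path c n x)"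
      if "1 \<le> \<kappa>" "1 \<le> n" for \<kappa> n
      using AE_reach[OF genfun_prob_hit_1[OF c(1,2) ns]] by eventually_elim (rule hitting_rel_exp_gap[OF that(2)])
    show "AE \<omega> in N. \<forall>\<kappa>\<ge>1. hitting_rel \<kappa> (partial_prod (\<lambda>i. D.exp_increment \<kappa> i \<omega>)) (inverse_process D \<omega>)"
      by (rule D.hitting_rel_exp_increment)
    show "AE \<omega> in N. inverse_process D \<omega> \<in> skorokhod_D \<and> continuous_on {0..} (inverse_process D \<omega>) \<and>
       mono_on {0..} (inverse_process D \<omega>) \<and> inverse_process D \<omega> 0 = 0"
      by (rule D.AE_inverse_process)
    show "(\<lambda>n. \<integral>x. (\<Prod>i<\<kappa> * \<kappa>. exp_gap c \<kappa> n i x ^ k i) \<partial>S) \<longlonglongrightarrow> (\<integral>\<omega>. (\<Prod>i<\<kappa> * \<kappa>. D.exp_increment \<kappa> i \<omega> ^ k i) \<partial>N)"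
      if "1 \<le> \<kappa>" for \<kappa> k
      unfolding D.moments_exp_increment[OF that] by (rule tendsto_integral_exp_gap[OF prob_nonneg that])
  qed
  show ?thesis by (rule F.weak_conv_skorokhod)
qed

end

end

lemma weak_conv_m_cong_eventually:
  assumes "\<forall>\<^sub>F n in sequentially. M n = M' n" "weak_conv_m M L" shows "weak_conv_m M' L"
  unfolding weak_conv_m_def weak_conv_def
proof (intro allI impI)
  fix x assume "isCont (cdf L) x"
  then have "(\<lambda>n. cdf (M n) x) \<longlonglongrightarrow> cdf L x" using assms(2) by (simp add: weak_conv_m_def weak_conv_def)
  moreover have "\<forall>\<^sub>F n in sequentially. cdf (M n) x = cdf (M' n) x" using assms(1) by eventually_elim simp
  ultimately show "(\<lambda>n. cdf (M' n) x) \<longlonglongrightarrow> cdf L x" by (rule Lim_transform_eventually)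
qed

lemma filterlim_at_bot_nat_iff:
  fixes s :: "nat \<Rightarrow> real"
  shows "filterlim s at_bot sequentially \<longleftrightarrow> (\<forall>k::nat. \<exists>N. \<forall>n\<ge>N. s n \<le> - real k)"
proof
  assume "filterlim s at_bot sequentially"
  then show "\<forall>k::nat. \<exists>N. \<forall>n\<ge>N. s n \<le> - real k"
    by (auto simp: filterlim_at_bot eventually_sequentially)
next
  assume *: "\<forall>k::nat. \<exists>N. \<forall>n\<ge>N. s n \<le> - real k"
  show "filterlim s at_bot sequentially"
    unfolding filterlim_at_bot
  proof
    fix z :: real
    obtain k :: nat where "- z \<le> real k" using real_arch_simple by blast
    moreover obtain N where "\<forall>n\<ge>N. s n \<le> - real k" using * by blast
    ultimately show "\<forall>\<^sub>F n in sequentially. s n \<le> z"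
      unfolding eventually_sequentially by (intro exI[of _ N]) force
  qed
qed

context iid_steps begin

lemma spitzer_C_norming:
  assumes "\<And>n. pos_prob M' X n = prob_nonneg n" "n \<ge> 1"
  shows "spitzer_C M' X \<rho> (1 - 1 / real n) * real n powr \<rho> = exp (spitzer_series (1 - 1 / real n))"
proof -
  let ?y = "1 - 1 / real n"
  have y: "0 \<le> ?y" "\<bar>?y\<bar> < 1" using assms(2) by (auto simp: divide_le_eq_1 abs_less_iff)
  have s1: "summable (\<lambda>k. prob_nonneg k / real k * ?y ^ k)" by (rule summable_genfun[OF coeff_L y(2)])
  have inv: "\<bar>1 / real k\<bar> \<le> 1" for k by (cases k) auto
  have s2: "summable (\<lambda>k. 1 / real k * ?y ^ k)" by (rule summable_genfun[OF inv y(2)])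
  have s1': "summable (\<lambda>k. prob_nonneg (Suc k) / real (Suc k) * ?y ^ Suc k)"
    by (rule summable_Suc_iff[of "\<lambda>k. prob_nonneg k / real k * ?y ^ k", THEN iffD2, OF s1])
  have s2': "summable (\<lambda>k. 1 / real (Suc k) * ?y ^ Suc k)"
    by (rule summable_Suc_iff[of "\<lambda>k. 1 / real k * ?y ^ k", THEN iffD2, OF s2])
  have "(\<Sum>k. ?y ^ Suc k / real (Suc k) * (prob_nonneg (Suc k) - \<rho>))
    = (\<Sum>k. prob_nonneg (Suc k) / real (Suc k) * ?y ^ Suc k - \<rho> * (1 / real (Suc k) * ?y ^ Suc k))"
    by (intro suminf_cong) (simp add: algebra_simps diff_divide_distrib)
  also have "\<dots> = (\<Sum>k. prob_nonneg (Suc k) / real (Suc k) * ?y ^ Suc k) - (\<Sum>k. \<rho> * (1 / real (Suc k) * ?y ^ Suc k))"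
    by (rule suminf_diff[OF s1' summable_mult[OF s2'], symmetric])
  also have "(\<Sum>k. \<rho> * (1 / real (Suc k) * ?y ^ Suc k)) = \<rho> * (\<Sum>k. 1 / real (Suc k) * ?y ^ Suc k)"
    by (rule suminf_mult[OF s2'])
  also have "(\<Sum>k. prob_nonneg (Suc k) / real (Suc k) * ?y ^ Suc k) = spitzer_series ?y"
    using suminf_split_head[OF s1] by (simp add: spitzer_series_def genfun_def)
  also have "(\<Sum>k. 1 / real (Suc k) * ?y ^ Suc k) = genfun (\<lambda>k. 1 / real k) ?y"
    using suminf_split_head[OF s2] by (simp add: genfun_def)
  also have "genfun (\<lambda>k. 1 / real k) ?y = ln (real n)"
    unfolding genfun_inverse_nat[OF y(2)] using assms(2) by (simp add: ln_div)
  finally have "spitzer_C M' X \<rho> ?y = exp (spitzer_series ?y - \<rho> * ln (real n))"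
    unfolding spitzer_C_def assms(1) by simp
  then show ?thesis using assms(2) by (simp add: powr_def exp_add[symmetric])
qed

end

theorem theorem4:
  fixes M :: "'a measure" and X :: "nat \<Rightarrow> 'a \<Rightarrow> real" and \<sigma> :: real
  assumes "prob_space M"
    and "prob_space.indep_vars M (\<lambda>_. borel) X UNIV"
    and "\<And>i. distr M borel (X i) = distr M borel (X 0)"
    and "\<not> (\<exists>c. AE \<omega> in M. X 0 \<omega> = c)"
    and "\<sigma> \<ge> 0"
    and "isCont (ladder_renewal M X) \<sigma>"
  shows
    "(\<forall>\<rho>. 0 < \<rho> \<and> \<rho> < 1 \<and> pos_prob M X \<longlonglongrightarrow> \<rho> \<longrightarrow>
        weak_conv_m
          (\<lambda>n. distr M borel (\<lambda>\<omega>. ladder_renewal M X \<sigma> * real (sigma_record_count \<sigma> X n \<omega>)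
                 / (spitzer_C M X \<rho> (1 - 1 / real n) * real n powr \<rho>)))
          (mittag_leffler \<rho>) \<and>
        (\<forall>(N :: 'b measure) D. stable_subordinator \<rho> N D \<longrightarrow>
           weak_conv_skorokhod M
             (\<lambda>n \<omega>. \<lambda>t\<in>{0..}. ladder_renewal M X \<sigma>
                 * real (sigma_record_count \<sigma> X (nat \<lfloor>real n * t\<rfloor>) \<omega>)
                 / (spitzer_C M X \<rho> (1 - 1 / real n) * real n powr \<rho>))
             N (inverse_process D)))
     \<and> (pos_prob M X \<longlonglongrightarrow> 0 \<and> \<not> summable (\<lambda>k. pos_prob M X (Suc k) / real (Suc k)) \<longrightarrow>
        weak_conv_m
          (\<lambda>n. distr M borel (\<lambda>\<omega>. ladder_renewal M X \<sigma> * real (sigma_record_count \<sigma> X n \<omega>)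
                 / spitzer_C M X 0 (1 - 1 / real n)))
          (mittag_leffler 0))
     \<and> (pos_prob M X \<longlonglongrightarrow> 1 \<longrightarrow>
        weak_conv_m
          (\<lambda>n. distr M borel (\<lambda>\<omega>. ladder_renewal M X \<sigma> * real (sigma_record_count \<sigma> X n \<omega>)
                 / (real n * spitzer_C M X 1 (1 - 1 / real n))))
          (return borel 1))
     \<and> ((AE \<omega> in M. filterlim (\<lambda>n. walk X n \<omega>) at_bot sequentially) \<longrightarrow>
        (let p = ladder_renewal M X \<sigma> * exp (- (\<Sum>k. pos_prob M X (Suc k) / real (Suc k)))
         in 0 < p \<and> p \<le> 1 \<and>
            distr M (count_space UNIV) (total_sigma_record_count \<sigma> X)
              = measure_pmf (map_pmf (\<lambda>j. enat (Suc j)) (geometric_pmf p))))"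
proof -
  interpret M: prob_space M by (rule assms(1))
  have X_meas [measurable]: "X i \<in> borel_measurable M" for i
    using assms(2) by (auto simp: M.indep_vars_def)
  define \<mu> where "\<mu> = distr M borel (X 0)"
  have "prob_space \<mu>" unfolding \<mu>_def by (rule M.prob_space_distr) measurable
  then interpret \<mu>: prob_space \<mu> .
  have [simp]: "sets \<mu> = sets borel" by (simp add: \<mu>_def)
  interpret iid_steps \<mu> by unfold_locales simp
  define J where "J \<omega> = (\<lambda>i. X i \<omega>)" for \<omega>
  have J [measurable]: "J \<in> measurable M S"
    unfolding J_def[abs_def]
  proof (rule measurable_PiM_single')
    show "(\<lambda>\<omega>. X i \<omega>) \<in> measurable M \<mu>" for i
      using X_meas[of i] measurable_cong_sets[OF refl \<open>sets \<mu> = sets borel\<close>] by blast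
  qed (simp add: \<mu>_def)
  have distr_J: "distr M S J = S"
  proof -
    have "distr M (PiM UNIV (\<lambda>_. borel)) (\<lambda>\<omega>. \<lambda>i\<in>UNIV. X i \<omega>) = PiM UNIV (\<lambda>i. distr M borel (X i))"
      using assms(2) by (subst (asm) M.indep_vars_iff_distr_eq_PiM) auto
    moreover have "PiM UNIV (\<lambda>i. distr M borel (X i)) = S"
    proof -
      have "(\<lambda>i. distr M borel (X i)) = (\<lambda>i. \<mu>)" unfolding \<mu>_def by (rule ext) (rule assms(3))
      then show ?thesis by (simp only:)
    qed
    moreover have "sets (PiM UNIV (\<lambda>_::nat. borel :: real measure)) = sets S" by (intro sets_PiM_cong) auto
    then have "distr M (PiM UNIV (\<lambda>_. borel)) (\<lambda>\<omega>. \<lambda>i\<in>UNIV. X i \<omega>) = distr M S J"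
      by (intro distr_cong) (auto simp: J_def)
    ultimately show ?thesis by simp
  qed
  have prob_J: "measure M {\<omega>\<in>space M. Q (J \<omega>)} = P.prob {x. Q x}" if "Measurable.pred S Q" for Q
  proof -
    have "P.prob {x. Q x} = measure (distr M S J) {x. Q x}" unfolding distr_J ..
    also have "\<dots> = measure M {\<omega>\<in>space M. Q (J \<omega>)}"
      by (subst measure_distr[OF J sets_Collect_S[OF that]]) (auto intro!: arg_cong[where f="measure M"])
    finally show ?thesis by simp
  qed
  have AE_J: "(AE \<omega> in M. Q (J \<omega>)) \<longleftrightarrow> (AE x in S. Q x)" if "Measurable.pred S Q" for Q
  proof -
    have "{x\<in>space S. Q x} \<in> sets S" using sets_Collect_S[OF that] by simp
    then show ?thesis using AE_distr_iff[OF J, of Q] unfolding distr_J by simp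
  qed
  have distr_fun: "distr M borel (\<lambda>\<omega>. g (J \<omega>)) = distr S borel g" if "g \<in> borel_measurable S" for g :: "(nat \<Rightarrow> real) \<Rightarrow> real"
    using distr_distr[OF that J] unfolding distr_J by (simp add: comp_def)
  have walk_J: "walk X n \<omega> = psum (J \<omega>) n" for n \<omega> by (simp add: walk_eq_psum J_def)
  have pos: "pos_prob M X n = prob_nonneg n" for n
    unfolding pos_prob_def walk_J prob_nonneg_def by (rule prob_J) measurable
  then have pos_fun: "pos_prob M X = prob_nonneg" by (rule ext)
  have V: "ladder_renewal M X = ladder_V"
    unfolding ladder_renewal_def[abs_def] ladder_V_def[abs_def] walk_J
    by (intro ext suminf_cong prob_J pred_weak_ladder_height)
  have nondeg: "\<not> (\<exists>c. AE x in S. x 0 = c)"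
  proof
    assume "\<exists>c. AE x in S. x 0 = c"
    then obtain c where c: "AE x in S. x 0 = c" by blast
    have "Measurable.pred S (\<lambda>x. x 0 = c)"
      by (rule measurable_compose[OF measurable_coord]) simp
    from AE_J[OF this] c have "AE \<omega> in M. X 0 \<omega> = c" by (simp add: J_def)
    then show False using assms(4) by blast
  qed
  have cont: "isCont ladder_V \<sigma>" using assms(6) by (simp add: V)
  note lv = ladder_V_continuity[OF nondeg assms(5) cont]
  have c: "\<sigma> > 0" "summable (prob_weak_rec_less \<sigma>)" "suminf (prob_weak_rec_less \<sigma>) \<ge> 1" using lv by simp_all
  have rc: "sigma_record_count \<sigma> X n \<omega> = record_count \<sigma> n (J \<omega>)" for n \<omega>
    by (simp add: sigma_record_count_eq J_def)
  have norm_eq: "ladder_renewal M X \<sigma> * r / (spitzer_C M X \<rho> (1 - 1 / real n) * real n powr \<rho>) = r / norming \<sigma> n"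
    if "n \<ge> 1" for r \<rho> n
    unfolding spitzer_C_norming[OF pos that] norming_def lv(3) V by simp
  have wc: "weak_conv_m (\<lambda>n. distr M borel (\<lambda>\<omega>. ladder_renewal M X \<sigma> * real (sigma_record_count \<sigma> X n \<omega>)
                 / (spitzer_C M X \<rho> (1 - 1 / real n) * real n powr \<rho>))) L"
    if "weak_conv_m (\<lambda>n. distr S borel (\<lambda>x. real (record_count \<sigma> n x) / norming \<sigma> n)) L" for \<rho> L
  proof (rule weak_conv_m_cong_eventually[OF _ that], rule eventually_sequentiallyI[of 1])
    fix n :: nat assume n: "1 \<le> n"
    show "distr S borel (\<lambda>x. real (record_count \<sigma> n x) / norming \<sigma> n) =
      distr M borel (\<lambda>\<omega>. ladder_renewal M X \<sigma> * real (sigma_record_count \<sigma> X n \<omega>)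
                 / (spitzer_C M X \<rho> (1 - 1 / real n) * real n powr \<rho>))"
      unfolding norm_eq[OF n] rc by (rule distr_fun[symmetric]) measurable
  qed
  have summable_iff: "summable (\<lambda>k. pos_prob M X (Suc k) / real (Suc k)) \<longleftrightarrow> summable (\<lambda>n. prob_nonneg n / real n)"
    unfolding pos by (rule summable_Suc_iff)
  have fun_lim: "weak_conv_skorokhod M
             (\<lambda>n \<omega>. \<lambda>t\<in>{0..}. ladder_renewal M X \<sigma>
                 * real (sigma_record_count \<sigma> X (nat \<lfloor>real n * t\<rfloor>) \<omega>)
                 / (spitzer_C M X \<rho> (1 - 1 / real n) * real n powr \<rho>))
             N (inverse_process D)" (is "weak_conv_skorokhod M ?Y N _")
    if \<rho>: "0 < \<rho>" and prob_nonneg: "prob_nonneg \<longlonglongrightarrow> \<rho>" and D: "stable_subordinator \<rho> N D" for \<rho> and N :: "'b measure" and D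
  proof -
    have ns: "\<not> summable (\<lambda>n. prob_nonneg n / real n)" by (rule not_summable_over_nat[OF prob_nonneg \<rho>])
    have w: "weak_conv_skorokhod S (count_path \<sigma>) N (inverse_process D)"
      by (rule weak_conv_count_path[OF c ns prob_nonneg \<rho> D])
    have Y: "?Y n \<omega> = count_path \<sigma> n (J \<omega>)" if "n \<ge> 1" for n \<omega>
      unfolding norm_eq[OF that] count_path_def step_path_def rc ..
    have Y0: "?Y 0 \<omega> = step_path 0 (\<lambda>_. 0)" for \<omega>
      using \<rho> by (simp add: step_path_def)
    have YD: "?Y n \<omega> \<in> skorokhod_D" for n \<omega>
    proof (cases "n = 0")
      case True
      show ?thesis unfolding True Y0 by (rule step_path_in_skorokhod_D) simp
    next
      case False
      then show ?thesis using Y[of n \<omega>] step_path_in_skorokhod_D[of "real n"] by (simp add: count_path_def)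
    qed
    show ?thesis
      unfolding weak_conv_skorokhod_def
    proof (intro conjI allI impI)
      show "AE \<omega> in M. ?Y n \<omega> \<in> skorokhod_D" for n by (rule AE_I2) (rule YD)
      show "AE \<omega> in N. inverse_process D \<omega> \<in> skorokhod_D" using w by (simp add: weak_conv_skorokhod_def)
      fix f :: "(real \<Rightarrow> real) \<Rightarrow> real"
      assume f: "continuous_map skorokhod_topology euclideanreal f \<and> bounded (f ` skorokhod_D)"
      then obtain B where B: "\<And>x. x \<in> skorokhod_D \<Longrightarrow> \<bar>f x\<bar> \<le> B" by (auto simp: bounded_iff)
      have m: "(\<lambda>x. f (count_path \<sigma> n x)) \<in> borel_measurable S" for n
        unfolding count_path_def using f by (intro measurable_step_path) auto
      have mY: "(\<lambda>\<omega>. f (?Y n \<omega>)) \<in> borel_measurable M" for n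
      proof (cases "n = 0")
        case True
        then show ?thesis using Y0 by simp
      next
        case False
        then have "(\<lambda>\<omega>. f (?Y n \<omega>)) = (\<lambda>\<omega>. f (count_path \<sigma> n (J \<omega>)))" using Y[of n] by (intro ext) simp
        then show ?thesis using measurable_compose[OF J m[of n]] by (simp only:)
      qed
      show "integrable (completion M) (\<lambda>\<omega>. f (?Y n \<omega>))" for n
        unfolding integrable_completion[OF mY]
        by (rule M.integrable_const_bound[where B=B, OF AE_I2 mY]) (use B YD in simp)
      show "integrable (completion N) (\<lambda>\<omega>. f (inverse_process D \<omega>))"
        using w f by (simp add: weak_conv_skorokhod_def)
      have "(\<lambda>n. \<integral>x. f (count_path \<sigma> n x) \<partial>completion S) \<longlonglongrightarrow> (\<integral>\<omega>. f (inverse_process D \<omega>) \<partial>completion N)"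
        using w f by (simp add: weak_conv_skorokhod_def)
      moreover have "\<forall>\<^sub>F n in sequentially. (\<integral>x. f (count_path \<sigma> n x) \<partial>completion S) = (\<integral>\<omega>. f (?Y n \<omega>) \<partial>completion M)"
      proof (rule eventually_sequentiallyI[of 1])
        fix n :: nat assume n: "1 \<le> n"
        have "(\<integral>x. f (count_path \<sigma> n x) \<partial>completion S) = (\<integral>x. f (count_path \<sigma> n x) \<partial>distr M S J)"
          unfolding integral_completion[OF m] distr_J ..
        also have "\<dots> = (\<integral>\<omega>. f (count_path \<sigma> n (J \<omega>)) \<partial>M)" by (rule integral_distr[OF J m])
        also have "\<dots> = (\<integral>\<omega>. f (?Y n \<omega>) \<partial>M)" unfolding Y[OF n] ..
        finally show "(\<integral>x. f (count_path \<sigma> n x) \<partial>completion S) = (\<integral>\<omega>. f (?Y n \<omega>) \<partial>completion M)"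
          unfolding integral_completion[OF mY] .
      qed
      ultimately show "(\<lambda>n. \<integral>\<omega>. f (?Y n \<omega>) \<partial>completion M) \<longlonglongrightarrow> (\<integral>\<omega>. f (inverse_process D \<omega>) \<partial>completion N)"
        by (rule Lim_transform_eventually)
    qed
  qed
  show ?thesis
  proof (intro conjI allI impI)
    fix \<rho> assume \<rho>: "0 < \<rho> \<and> \<rho> < 1 \<and> pos_prob M X \<longlonglongrightarrow> \<rho>"
    then have prob_nonneg: "prob_nonneg \<longlonglongrightarrow> \<rho>" by (simp add: pos_fun)
    have ns: "\<not> summable (\<lambda>n. prob_nonneg n / real n)" using not_summable_over_nat[OF prob_nonneg] \<rho> by blast
    show "weak_conv_m (\<lambda>n. distr M borel (\<lambda>\<omega>. ladder_renewal M X \<sigma> * real (sigma_record_count \<sigma> X n \<omega>)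
                 / (spitzer_C M X \<rho> (1 - 1 / real n) * real n powr \<rho>))) (mittag_leffler \<rho>)"
      using weak_conv_record_count_mittag_leffler[OF c prob_nonneg ns] \<rho> by (intro wc) simp
    fix N :: "'b measure" and D assume "stable_subordinator \<rho> N D"
    then show "weak_conv_skorokhod M
             (\<lambda>n \<omega>. \<lambda>t\<in>{0..}. ladder_renewal M X \<sigma>
                 * real (sigma_record_count \<sigma> X (nat \<lfloor>real n * t\<rfloor>) \<omega>)
                 / (spitzer_C M X \<rho> (1 - 1 / real n) * real n powr \<rho>))
             N (inverse_process D)"
      using \<rho> prob_nonneg by (intro fun_lim) auto
  next
    assume a: "pos_prob M X \<longlonglongrightarrow> 0 \<and> \<not> summable (\<lambda>k. pos_prob M X (Suc k) / real (Suc k))"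
    then have prob_nonneg: "prob_nonneg \<longlonglongrightarrow> 0" and ns: "\<not> summable (\<lambda>n. prob_nonneg n / real n)"
      unfolding summable_iff by (simp_all add: pos_fun)
    have "weak_conv_m (\<lambda>n. distr M borel (\<lambda>\<omega>. ladder_renewal M X \<sigma> * real (sigma_record_count \<sigma> X n \<omega>)
                 / (spitzer_C M X 0 (1 - 1 / real n) * real n powr 0))) (mittag_leffler 0)"
      by (rule wc[OF weak_conv_record_count_exponential[OF c prob_nonneg ns]])
    moreover have "\<forall>\<^sub>F n in sequentially. distr M borel (\<lambda>\<omega>. ladder_renewal M X \<sigma> * real (sigma_record_count \<sigma> X n \<omega>)
                 / (spitzer_C M X 0 (1 - 1 / real n) * real n powr 0))
        = distr M borel (\<lambda>\<omega>. ladder_renewal M X \<sigma> * real (sigma_record_count \<sigma> X n \<omega>) / spitzer_C M X 0 (1 - 1 / real n))"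
      by (rule eventually_sequentiallyI[of 1]) simp
    ultimately show "weak_conv_m (\<lambda>n. distr M borel (\<lambda>\<omega>. ladder_renewal M X \<sigma> * real (sigma_record_count \<sigma> X n \<omega>)
                 / spitzer_C M X 0 (1 - 1 / real n))) (mittag_leffler 0)"
      by (rule weak_conv_m_cong_eventually[rotated])
  next
    assume "pos_prob M X \<longlonglongrightarrow> 1"
    then have prob_nonneg: "prob_nonneg \<longlonglongrightarrow> 1" by (simp add: pos_fun)
    have "weak_conv_m (\<lambda>n. distr M borel (\<lambda>\<omega>. ladder_renewal M X \<sigma> * real (sigma_record_count \<sigma> X n \<omega>)
                 / (spitzer_C M X 1 (1 - 1 / real n) * real n powr 1))) (return borel 1)"
      by (rule wc[OF weak_conv_record_count_degenerate[OF c prob_nonneg]])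
    then show "weak_conv_m (\<lambda>n. distr M borel (\<lambda>\<omega>. ladder_renewal M X \<sigma> * real (sigma_record_count \<sigma> X n \<omega>)
                 / (real n * spitzer_C M X 1 (1 - 1 / real n)))) (return borel 1)"
      by (simp add: mult.commute)
  next
    assume drift: "AE \<omega> in M. filterlim (\<lambda>n. walk X n \<omega>) at_bot sequentially"
    have "AE x in S. filterlim (psum x) at_bot sequentially"
      unfolding filterlim_at_bot_nat_iff
    proof (rule iffD1[OF AE_J])
      show "Measurable.pred S (\<lambda>x. \<forall>k::nat. \<exists>N. \<forall>n\<ge>N. psum x n \<le> - real k)" by measurable
      show "AE \<omega> in M. \<forall>k::nat. \<exists>N. \<forall>n\<ge>N. psum (J \<omega>) n \<le> - real k"
        using drift unfolding walk_J filterlim_at_bot_nat_iff .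
    qed
    note d = drift_to_minus_infinity[OF c this]
    let ?p = "ladder_renewal M X \<sigma> * exp (- (\<Sum>k. pos_prob M X (Suc k) / real (Suc k)))"
    have "(\<Sum>k. prob_nonneg (Suc k) / real (Suc k)) = (\<Sum>n. prob_nonneg n / real n)"
      using suminf_split_head[OF d(1)] by simp
    then have p: "?p = 1 - genfun (prob_hit \<sigma>) 1"
      unfolding d(2) lv(3) V pos by simp
    have "distr M (count_space UNIV) (total_sigma_record_count \<sigma> X) = distr M (count_space UNIV) (\<lambda>\<omega>. total_count \<sigma> (J \<omega>))"
      by (intro distr_cong) (simp_all add: total_sigma_record_count_eq J_def)
    also have "\<dots> = distr S (count_space UNIV) (total_count \<sigma>)"
      using distr_distr[OF measurable_total_count[of \<sigma>] J] unfolding distr_J by (simp add: comp_def)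
    also have "\<dots> = measure_pmf (map_pmf (\<lambda>j. enat (Suc j)) (geometric_pmf ?p))"
      by (rule distr_total_count[OF p]) (use d(3,4) p in simp_all)
    finally show "let p = ?p
         in 0 < p \<and> p \<le> 1 \<and>
            distr M (count_space UNIV) (total_sigma_record_count \<sigma> X)
              = measure_pmf (map_pmf (\<lambda>j. enat (Suc j)) (geometric_pmf p))"
      unfolding Let_def using d(3,4) p by simp
  qed
qed

end
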